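(* Let $N\ge1$ and let $F$ be a $C^1$, symmetric, concave function on $\Lambda=\{s\in\mathbb R^N:\min_{1\le j\le N}s_j>0\}$ with $\partial F/\partial s_j>0$ in $\Lambda$ for all $j=1,\dots,N$, and such that $G(s)=F(1/s_1,\dots,1/s_N)$ is convex in $\Lambda$. Let $f\in C(\mathbb R^N)$ be real-valued and let $\Omega=\{(x,x_{N+1})\in\mathbb R^{N+1}:x_{N+1}>f(x)\}$. Suppose that there exist real constants $R>0$ and $c$ such that $f$ satisfies, in the viscosity sense, $$F(1-R\kappa_1,\dots,1-R\kappa_N)=c\quad\text{in }\mathbb R^N,$$ where $\kappa_1,\dots,\kappa_N$ are the principal curvatures of the graph $\partial\Omega$ of $f$ with respect to the upward unit normal vector. Define $$g(x)=\sup_{|x-y|\le R}\left\{f(y)+\sqrt{R^2-|x-y|^2}\right\},\qquad f^*(x)=\inf_{|x-y|\le R}\left\{g(y)-\sqrt{R^2-|x-y|^2}\right\}\qquad(x\in\mathbb R^N),$$ and suppose moreover that $f(x)=f^*(x)$ for every $x\in\mathbb R^N$. If the set $\{|f(x)-f(y)|:x,y\in\mathbb R^N,\ |x-y|\le1\}$ is bounded, then $c=F(1,\dots,1)$ and $f$ is an affine function, that is, $\partial\Omega$ is a hyperplane.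
   Context: For a $C^2$ function $\psi$ near a point $x_0\in\mathbb R^N$, let $\kappa_1[\psi](x_0),\dots,\kappa_N[\psi](x_0)$ be the principal curvatures of the graph of $\psi$ at $(x_0,\psi(x_0))$ with respect to the upward unit normal, with the sign convention that they are nonnegative when $\psi$ is convex (so their sum is $\operatorname{div}\big(\nabla\psi/\sqrt{1+|\nabla\psi|^2}\big)(x_0)$). Viscosity sense: $f$ satisfies $F(1-R\kappa_1,\dots,1-R\kappa_N)=c$ in the viscosity sense if for every $x_0\in\mathbb R^N$ and every $C^2$ function $\psi$ near $x_0$ with $\big(1-R\kappa_1[\psi](x_0),\dots,1-R\kappa_N[\psi](x_0)\big)\in\Lambda$: (a) if $f-\psi$ has a local maximum at $x_0$, then $F(1-R\kappa_1[\psi](x_0),\dots,1-R\kappa_N[\psi](x_0))\le c$; (b) if $f-\psi$ has a local minimum at $x_0$, then $F(1-R\kappa_1[\psi](x_0),\dots,1-R\kappa_N[\psi](x_0))\ge c$. *)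

theory Defs
  imports "HOL-Analysis.Analysis"
begin

definition positive_cone :: "(real^'n) set" where
  "positive_cone = {s. \<forall>j. 0 < s $ j}"

definition symmetric_on :: "(real^'n) set \<Rightarrow> (real^'n \<Rightarrow> real) \<Rightarrow> bool" where
  "symmetric_on S F \<longleftrightarrow> (\<forall>p. p permutes UNIV \<longrightarrow> (\<forall>s\<in>S. F (\<chi> i. s $ p i) = F s))"

definition partial_deriv :: "'n \<Rightarrow> (real^'n \<Rightarrow> real) \<Rightarrow> real^'n \<Rightarrow> real" where
  "partial_deriv i f x = frechet_derivative f (at x) (axis i 1)"

text \<open>The next two notions are only meant for open sets, since derivatives are taken
  in full neighbourhoods.\<close>

definition C1_on :: "(real^'n) set \<Rightarrow> (real^'n \<Rightarrow> real) \<Rightarrow> bool" where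
  "C1_on U f \<longleftrightarrow>
     (\<forall>x\<in>U. f differentiable (at x)) \<and> (\<forall>i. continuous_on U (partial_deriv i f))"

definition C2_on :: "(real^'n) set \<Rightarrow> (real^'n \<Rightarrow> real) \<Rightarrow> bool" where
  "C2_on U f \<longleftrightarrow> C1_on U f \<and> (\<forall>i. C1_on U (partial_deriv i f))"

definition C2_near :: "real^'n \<Rightarrow> (real^'n \<Rightarrow> real) \<Rightarrow> bool" where
  "C2_near x0 f \<longleftrightarrow> (\<exists>U. open U \<and> x0 \<in> U \<and> C2_on U f)"

text \<open>Geometry of the graph of \<open>\<psi>\<close> in the chart \<open>x \<mapsto> (x, \<psi> x)\<close>: the coordinate tangent
  vectors \<open>(e\<^sub>i, \<partial>\<^sub>i\<psi>)\<close>, the upward unit normal \<open>(-\<nabla>\<psi>, 1) / sqrt (1 + |\<nabla>\<psi>|\<^sup>2)\<close>, and the two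
  fundamental forms. The second derivatives of the chart are \<open>(0, \<partial>\<^sub>i\<partial>\<^sub>j\<psi>)\<close>, so the second
  fundamental form is \<open>D\<^sup>2\<psi> / sqrt (1 + |\<nabla>\<psi>|\<^sup>2)\<close>, which is nonnegative for convex \<open>\<psi>\<close>.\<close>

definition graph_tangent :: "(real^'n \<Rightarrow> real) \<Rightarrow> real^'n \<Rightarrow> 'n \<Rightarrow> (real^'n) \<times> real" where
  "graph_tangent \<psi> x i = (axis i 1, partial_deriv i \<psi> x)"

definition upward_unit_normal :: "(real^'n \<Rightarrow> real) \<Rightarrow> real^'n \<Rightarrow> (real^'n) \<times> real" where
  "upward_unit_normal \<psi> x =
     (let p = (\<chi> i. partial_deriv i \<psi> x) in (1 / sqrt (1 + (norm p)\<^sup>2)) *\<^sub>R (- p, 1))"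

definition first_fundamental_form :: "(real^'n \<Rightarrow> real) \<Rightarrow> real^'n \<Rightarrow> real^'n^'n" where
  "first_fundamental_form \<psi> x = (\<chi> i j. graph_tangent \<psi> x i \<bullet> graph_tangent \<psi> x j)"

definition second_fundamental_form :: "(real^'n \<Rightarrow> real) \<Rightarrow> real^'n \<Rightarrow> real^'n^'n" where
  "second_fundamental_form \<psi> x =
     (\<chi> i j. (0, partial_deriv i (partial_deriv j \<psi>) x) \<bullet> upward_unit_normal \<psi> x)"

definition shape_operator :: "(real^'n \<Rightarrow> real) \<Rightarrow> real^'n \<Rightarrow> real^'n^'n" where
  "shape_operator \<psi> x =
     matrix_inv (first_fundamental_form \<psi> x) ** second_fundamental_form \<psi> x"

text \<open>\<open>\<kappa>\<close> lists the eigenvalues of the shape operator with multiplicity. It is determined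
  up to the order of its entries.\<close>

definition principal_curvatures ::
  "(real^'n \<Rightarrow> real) \<Rightarrow> real^'n \<Rightarrow> real^'n \<Rightarrow> bool" where
  "principal_curvatures \<psi> x \<kappa> \<longleftrightarrow>
     (\<forall>t. det (mat t - shape_operator \<psi> x) = (\<Prod>i\<in>UNIV. t - \<kappa> $ i))"

text \<open>For symmetric \<open>F\<close> the order of the entries of \<open>\<kappa>\<close> is immaterial.\<close>

definition viscosity_solution ::
  "(real^'n \<Rightarrow> real) \<Rightarrow> real \<Rightarrow> real \<Rightarrow> (real^'n \<Rightarrow> real) \<Rightarrow> bool" where
  "viscosity_solution F R c f \<longleftrightarrow>
     (\<forall>x0 \<psi> \<kappa>. C2_near x0 \<psi> \<longrightarrow> principal_curvatures \<psi> x0 \<kappa> \<longrightarrow>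
        (\<chi> i. 1 - R * \<kappa> $ i) \<in> positive_cone \<longrightarrow>
        ((\<forall>\<^sub>F x in nhds x0. f x - \<psi> x \<le> f x0 - \<psi> x0) \<longrightarrow> F (\<chi> i. 1 - R * \<kappa> $ i) \<le> c) \<and>
        ((\<forall>\<^sub>F x in nhds x0. f x - \<psi> x \<ge> f x0 - \<psi> x0) \<longrightarrow> F (\<chi> i. 1 - R * \<kappa> $ i) \<ge> c))"

text \<open>For continuous \<open>f\<close> and \<open>R > 0\<close> the supremum below, and the infimum with \<open>g\<close> the
  resulting upper envelope, are those of continuous functions on compact balls, hence finite.\<close>

definition upper_envelope :: "real \<Rightarrow> (real^'n \<Rightarrow> real) \<Rightarrow> real^'n \<Rightarrow> real" where
  "upper_envelope R f x = (SUP y\<in>{y. norm (x - y) \<le> R}. f y + sqrt (R\<^sup>2 - (norm (x - y))\<^sup>2))"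

definition lower_envelope :: "real \<Rightarrow> (real^'n \<Rightarrow> real) \<Rightarrow> real^'n \<Rightarrow> real" where
  "lower_envelope R g x = (INF y\<in>{y. norm (x - y) \<le> R}. g y - sqrt (R\<^sup>2 - (norm (x - y))\<^sup>2))"

definition strict_epigraph :: "(real^'n \<Rightarrow> real) \<Rightarrow> ((real^'n) \<times> real) set" where
  "strict_epigraph f = {(x, t). t > f x}"

end

theory Submission
 imports Defs "HOL-Probability.Probability"
begin

text \<open>Touching \<open>f\<close> by large hyperboloids, which have nearly zero curvature, gives \<open>c = F (1, \<dots>, 1)\<close>.
Concavity of \<open>F\<close> at \<open>(1, \<dots>, 1)\<close> then shows that \<open>f\<close> is a viscosity supersolution of the mean curvature
equation wherever it is touched from below by a graph of curvature less than \<open>1 / R\<close>. Let \<open>g\<close> be the upper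
envelope of \<open>f\<close>. Passing to the parallel graph \<open>g\<close> inverts the numbers \<open>1 - R \<kappa>\<^sub>i\<close>, so convexity
of \<open>G\<close> shows that \<open>- g\<close> is a supersolution as well.
Inf-convolution with hyperboloids turns \<open>f\<close> and \<open>- g\<close> into Lipschitz semiconcave supersolutions. The sum of
two of these is a supersolution of a uniformly elliptic divergence-form equation, so by the weak Harnack
inequality a nonnegative sum with infimum \<open>0\<close> is small on most of every large ball. Applied to translates, this makes
the increments of \<open>f\<close> additive up to a constant, hence \<open>f = \<ell> + O(1)\<close> with \<open>\<ell>\<close> linear.
Applied to \<open>f - \<ell>\<close> and \<open>\<ell> - g\<close>, it yields near-minimum points of \<open>f - \<ell>\<close> surrounded by near-maximum points
of \<open>g - \<ell>\<close>. Since \<open>f\<close> equals its double envelope, spherical caps at such points compare the two extreme values and force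
\<open>sup (f - \<ell>) \<le> inf (f - \<ell>)\<close>.\<close>

text \<open>Two obstacles shape the proof. The viscosity inequalities speak only where all numbers 1
  - R \<kappa> are positive, so nothing is known about \<open>f\<close> at contacts of large
  curvature. The hyperboloids of the inf-convolution have slope bound \<open>ka\<close> and width
  \<open>2 * R * ka\<close>, which bounds the Hessians of its subjets from above by 1 / (2 R) and
  keeps every test of \<open>f\<close> in the informative range. Secondly, a sum of two viscosity
  supersolutions cannot be tested by jets directly, since a contact of the sum gives no contact of
  the summands. The operator is therefore read in the sense of distributions with the gradient
  frozen: a heat flow with constant coefficients turns jet inequalities into integral ones. The
  Harnack inequality enters only through measure: finitely many near-minimum conditions, each
  failing on a small fraction of a large ball, hold at a common point.\<close>

notation scaleR (infixr "*R" 75)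

section \<open>A weak Harnack inequality for divergence-form supersolutions\<close>

lemma power2_integral_le:
 fixes g :: "real => real"
 assumes "continuous_on {0..1} g"
 shows "(integral {0..1} g)^2 \<le> integral {0..1} (\<lambda>t. (g t)^2)"
proof -
 define m where "m = integral {0..1} g"
 have ig: "g integrable_on {0..1}" "(\<lambda>t. (g t)^2) integrable_on {0..1}"
  using assms by (auto intro!: integrable_continuous_interval continuous_intros)
 have "0 \<le> integral {0..1} (\<lambda>t. (g t - m)^2)"
  by (intro integral_nonneg integrable_continuous_interval continuous_intros assms) auto
 also have "(\<lambda>t. (g t - m)^2) = (\<lambda>t. ((g t)^2 - 2 * m * g t) + m^2)"
  by (auto simp: power2_eq_square algebra_simps)
 also have "integral {0..1} \<dots> = integral {0..1} (\<lambda>t. (g t)^2) - 2 * m * m + m^2"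
 proof -
  have i1: "(\<lambda>t. 2 * m * g t) integrable_on {0..1}"
   using ig(1) integrable_on_mult_right by blast
  have i2: "(\<lambda>t. (g t)^2 - 2 * m * g t) integrable_on {0..1}"
   using i1 ig(2) by (rule integrable_diff[rotated])
  have "integral {0..1} (\<lambda>t. ((g t)^2 - 2 * m * g t) + m^2)
    = integral {0..1} (\<lambda>t. (g t)^2 - 2 * m * g t) + integral {0..1} (\<lambda>t::real. m^2)"
   by (rule integral_add[OF i2 integrable_const_ivl])
  also have "integral {0..1} (\<lambda>t. (g t)^2 - 2 * m * g t)
   = integral {0..1} (\<lambda>t. (g t)^2) - integral {0..1} (\<lambda>t. 2 * m * g t)"
   by (rule integral_diff[OF ig(2) i1])
  finally show ?thesis by (simp add: m_def)
 qed
 finally show ?thesis by (simp add: m_def power2_eq_square)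
qed

text \<open>The fundamental theorem of calculus along the segment from y to x, followed by
  Cauchy-Schwarz. The right side is an extended nonnegative integral so that Tonelli applies to it
  directly.\<close>

lemma diff_square_le_line_integral:
 fixes \<phi> :: "'a::euclidean_space => real" and ga :: "'a => 'a"
 assumes der: "\<And>x. (\<phi> has_derivative (\<lambda>h. ga x \<bullet> h)) (at x)"
  and cont: "continuous_on UNIV ga"
 shows "ennreal ((\<phi> x - \<phi> y)^2) \<le>
  ennreal ((norm (x - y))^2) * (\<integral>\<^sup>+t. ennreal ((norm (ga (y + t *R (x - y))))^2) * indicator {0..1} t \<partial>lborel)"
proof -
 define c where "c t = y + t *R (x - y)" for t
 have contc: "continuous_on {0..1} (\<lambda>t. ga (c t))"
  unfolding c_def by (intro continuous_on_compose2[OF cont] continuous_intros) auto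
 have d: "((\<lambda>t. \<phi> (c t)) has_vector_derivative (ga (c t) \<bullet> (x - y))) (at t within {0..1})" for t
 proof -
  have "(c has_derivative (\<lambda>h. h *R (x - y))) (at t within {0..1})"
   unfolding c_def by (auto intro!: derivative_eq_intros)
  then have "((\<lambda>t. \<phi> (c t)) has_derivative (\<lambda>h. ga (c t) \<bullet> (h *R (x - y)))) (at t within {0..1})"
   by (rule has_derivative_compose) (rule der)
  then show ?thesis by (simp add: has_vector_derivative_def)
 qed
 have "((\<lambda>t. ga (c t) \<bullet> (x - y)) has_integral (\<phi> (c 1) - \<phi> (c 0))) {0..1}"
  by (rule fundamental_theorem_of_calculus) (use d in auto)
 then have "\<phi> x - \<phi> y = integral {0..1} (\<lambda>t. ga (c t) \<bullet> (x - y))"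
  by (simp add: c_def integral_unique)
 then have "(\<phi> x - \<phi> y)^2 \<le> integral {0..1} (\<lambda>t. (ga (c t) \<bullet> (x - y))^2)"
  by (simp, intro power2_integral_le continuous_intros contc)
 also have "\<dots> \<le> integral {0..1} (\<lambda>t. (norm (x - y))^2 * (norm (ga (c t)))^2)"
 proof (intro integral_le integrable_continuous_interval continuous_intros contc)
  fix t show "(ga (c t) \<bullet> (x - y))^2 \<le> (norm (x - y))^2 * (norm (ga (c t)))^2"
   using Cauchy_Schwarz_ineq[of "ga (c t)" "x - y"]
   by (simp add: power2_norm_eq_inner mult.commute)
 qed
 also have "\<dots> = (norm (x - y))^2 * integral {0..1} (\<lambda>t. (norm (ga (c t)))^2)"
  by simp
 finally have 1: "(\<phi> x - \<phi> y)^2 \<le> (norm (x - y))^2 * integral {0..1} (\<lambda>t. (norm (ga (c t)))^2)" .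
 have contc': "continuous_on UNIV (\<lambda>t. ga (c t))"
  unfolding c_def by (intro continuous_on_compose2[OF cont] continuous_intros) auto
 have "(\<integral>\<^sup>+t. ennreal ((norm (ga (c t)))^2) * indicator {0..1} t \<partial>lborel)
  = ennreal (integral {0..1} (\<lambda>t. (norm (ga (c t)))^2))"
 proof -
  have "(\<integral>\<^sup>+t. ennreal (indicator {0..1} t * (norm (ga (c t)))^2) \<partial>lborel)
   = ennreal (integral {0..1} (\<lambda>t. (norm (ga (c t)))^2))"
  proof (rule nn_integral_has_integral_lborel)
   show "(\<lambda>t. (indicator {0..1} t * (norm (ga (c t)))^2)) \<in> borel_measurable borel"
    using contc' by (intro borel_measurable_times borel_measurable_indicator borel_measurable_continuous_onI continuous_intros) auto
   have "((\<lambda>t. (norm (ga (c t)))^2) has_integral integral {0..1} (\<lambda>t. (norm (ga (c t)))^2)) {0..1}"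
    by (intro integrable_integral integrable_continuous_interval continuous_intros contc)
   then have "((\<lambda>t. if t \<in> {0..1} then (norm (ga (c t)))\<^sup>2 else 0) has_integral integral {0..1} (\<lambda>t. (norm (ga (c t)))^2)) UNIV"
    by (simp only: has_integral_restrict_UNIV)
   then show "((\<lambda>t. indicator {0..1} t * (norm (ga (c t)))^2) has_integral integral {0..1} (\<lambda>t. (norm (ga (c t)))^2)) UNIV"
    by (rule has_integral_eq[rotated]) (auto simp: indicator_def)
  qed auto
  then show ?thesis by (simp add: ennreal_mult ennreal_indicator mult.commute)
 qed
 then show ?thesis using 1
  by (simp add: c_def ennreal_mult'[symmetric] ennreal_leI)
qed

lemma nn_integral_lborel_scale:
 fixes f :: "'a::euclidean_space => ennreal"
 assumes [measurable]: "f \<in> borel_measurable borel" and c: "c \<noteq> 0"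
 shows "(\<integral>\<^sup>+x. f x \<partial>lborel) = ennreal (\<bar>c\<bar> ^ DIM('a)) * (\<integral>\<^sup>+x. f (t + c *R x) \<partial>lborel)"
 by (subst lborel_affine[OF c, of t])
  (simp add: nn_integral_density nn_integral_distr nn_integral_cmult)

text \<open>Scaling by t changes Lebesgue measure by the power t^n, so for t \<ge> 1/2 the loss is
  at most 2^n. This is the origin of the factor \<open>2 ^ DIM('a)\<close> in the Poincare
  constants.\<close>

lemma nn_integral_half_scale_le:
 fixes h :: "'a::euclidean_space => ennreal"
 assumes [measurable]: "h \<in> borel_measurable borel" and t: "1/2 \<le> t" "t \<le> 1"
 shows "(\<integral>\<^sup>+x. h (c + t *R x) \<partial>lborel) \<le> ennreal (2 ^ DIM('a)) * (\<integral>\<^sup>+x. h x \<partial>lborel)"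
proof -
 have "ennreal (2 ^ DIM('a)) * (\<integral>\<^sup>+x. h x \<partial>lborel)
  = ennreal (2 ^ DIM('a)) * (ennreal (t ^ DIM('a)) * (\<integral>\<^sup>+x. h (c + t *R x) \<partial>lborel))"
  using nn_integral_lborel_scale[of h t c] t by simp
 also have "\<dots> = ennreal ((2 * t) ^ DIM('a)) * (\<integral>\<^sup>+x. h (c + t *R x) \<partial>lborel)"
  using t by (simp add: mult.assoc[symmetric] ennreal_mult'[symmetric] power_mult_distrib)
 also have "\<dots> \<ge> 1 * (\<integral>\<^sup>+x. h (c + t *R x) \<partial>lborel)"
 proof (intro mult_right_mono)
  have "1 \<le> (2 * t) ^ DIM('a)" using t by (intro one_le_power) auto
  then show "1 \<le> ennreal ((2 * t) ^ DIM('a))" by simp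
 qed auto
 finally show ?thesis by simp
qed

text \<open>For y in \<open>Z\<close> the value \<phi> x equals \<phi> x - \<phi> y, which is
  bounded by the gradient along the segment. Integrating over x and y and exchanging integrals
  leaves, for each t, the gradient at y + t (x - y). It can be substituted in x with factor t or in
  y with factor 1 - t, and one of the two factors is at least 1/2.\<close>

lemma poincare_zero_set:
 fixes \<phi> :: "'a::euclidean_space => real" and ga :: "'a => 'a"
 assumes der: "\<And>x. (\<phi> has_derivative (\<lambda>h. ga x \<bullet> h)) (at x)"
  and cont: "continuous_on UNIV ga"
  and K[measurable]: "K \<in> sets borel" and "convex K" and d: "\<And>x y. x \<in> K ==> y \<in> K ==> norm (x - y) \<le> d"
  and Z[measurable]: "Z \<in> sets borel" and ZK: "Z \<subseteq> K" and zero: "\<And>x. x \<in> Z ==> \<phi> x = 0"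
 shows "emeasure lborel Z * (\<integral>\<^sup>+x. ennreal ((\<phi> x)^2) * indicator K x \<partial>lborel)
  \<le> ennreal (d^2 * 2 ^ DIM('a)) * emeasure lborel K * (\<integral>\<^sup>+x. ennreal ((norm (ga x))^2) * indicator K x \<partial>lborel)"
proof -
 define h where "h x = ennreal ((norm (ga x))^2) * indicator K x" for x
 define D where "D = (\<integral>\<^sup>+x. h x \<partial>lborel)"
 define I :: "real => ennreal" where "I = indicator {0..1}"
 define ka :: "'a => ennreal" where "ka = indicator K"
 have contphi: "continuous_on UNIV \<phi>"
  using der by (meson continuous_at_imp_continuous_on has_derivative_continuous)
 have [measurable]: "ga \<in> borel_measurable borel" "\<phi> \<in> borel_measurable borel"
  using cont contphi by (auto intro: borel_measurable_continuous_onI)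
 have [measurable]: "h \<in> borel_measurable borel" "I \<in> borel_measurable borel" "ka \<in> borel_measurable borel"
  unfolding h_def I_def ka_def by measurable
 have point: "ennreal ((\<phi> x)^2) * ka x * indicator Z y
  \<le> ennreal (d^2) * (\<integral>\<^sup>+t. h (y + t *R (x - y)) * ka x * ka y * I t \<partial>lborel)" for x y
 proof (cases "x \<in> K \<and> y \<in> Z")
  case True
  then have xy: "x \<in> K" "y \<in> K" using ZK by auto
  have n: "(norm (x - y))^2 \<le> d^2" using d[OF xy] by (intro power_mono) auto
  have in_K: "y + t *R (x - y) \<in> K" if "0 \<le> t" "t \<le> 1" for t
  proof -
   have "(1 - t) *R y + t *R x \<in> K" using \<open>convex K\<close> xy that by (simp add: convex_alt)
   then show ?thesis by (simp add: algebra_simps)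
  qed
  have "ennreal ((\<phi> x)^2) = ennreal ((\<phi> x - \<phi> y)^2)" using zero True by auto
  also have "\<dots> \<le> ennreal ((norm (x - y))^2) * (\<integral>\<^sup>+t. ennreal ((norm (ga (y + t *R (x - y))))^2) * indicator {0..1} t \<partial>lborel)"
   by (rule diff_square_le_line_integral[OF der cont])
  also have "(\<integral>\<^sup>+t. ennreal ((norm (ga (y + t *R (x - y))))^2) * indicator {0..1} t \<partial>lborel)
    = (\<integral>\<^sup>+t. h (y + t *R (x - y)) * ka x * ka y * I t \<partial>lborel)"
   using xy in_K by (intro nn_integral_cong) (auto simp: h_def ka_def I_def indicator_def)
  also have "ennreal ((norm (x - y))^2) * \<dots> \<le> ennreal (d^2) * \<dots>"
   using n by (intro mult_right_mono ennreal_leI) auto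
  finally show ?thesis using True xy by (simp add: ka_def)
 qed (auto simp: ka_def)
 have "emeasure lborel Z * (\<integral>\<^sup>+x. ennreal ((\<phi> x)^2) * ka x \<partial>lborel)
  = (\<integral>\<^sup>+y. (\<integral>\<^sup>+x. ennreal ((\<phi> x)^2) * ka x \<partial>lborel) * indicator Z y \<partial>lborel)"
  by (subst nn_integral_cmult_indicator) (auto simp: mult.commute)
 also have "\<dots> = (\<integral>\<^sup>+y. (\<integral>\<^sup>+x. ennreal ((\<phi> x)^2) * ka x * indicator Z y \<partial>lborel) \<partial>lborel)"
  by (intro nn_integral_cong) (simp add: nn_integral_multc)
 also have "\<dots> \<le> (\<integral>\<^sup>+y. (\<integral>\<^sup>+x. ennreal (d^2) * (\<integral>\<^sup>+t. h (y + t *R (x - y)) * ka x * ka y * I t \<partial>lborel) \<partial>lborel) \<partial>lborel)"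
  by (intro nn_integral_mono point)
 also have "\<dots> = ennreal (d^2) * (\<integral>\<^sup>+y. (\<integral>\<^sup>+x. (\<integral>\<^sup>+t. h (y + t *R (x - y)) * ka x * ka y * I t \<partial>lborel) \<partial>lborel) \<partial>lborel)"
  by (simp add: nn_integral_cmult)
 also have "(\<integral>\<^sup>+y. (\<integral>\<^sup>+x. (\<integral>\<^sup>+t. h (y + t *R (x - y)) * ka x * ka y * I t \<partial>lborel) \<partial>lborel) \<partial>lborel)
  = (\<integral>\<^sup>+y. (\<integral>\<^sup>+t. (\<integral>\<^sup>+x. h (y + t *R (x - y)) * ka x * ka y * I t \<partial>lborel) \<partial>lborel) \<partial>lborel)"
  by (intro nn_integral_cong lborel_pair.Fubini') measurable
 also have "\<dots> = (\<integral>\<^sup>+t. (\<integral>\<^sup>+y. (\<integral>\<^sup>+x. h (y + t *R (x - y)) * ka x * ka y * I t \<partial>lborel) \<partial>lborel) \<partial>lborel)"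
  by (intro lborel_pair.Fubini') measurable
 also have "\<dots> \<le> (\<integral>\<^sup>+t. (ennreal (2 ^ DIM('a)) * emeasure lborel K * D) * indicator {0..1} t \<partial>(lborel :: real measure))"
 proof (intro nn_integral_mono)
  fix t :: real
  show "(\<integral>\<^sup>+y. (\<integral>\<^sup>+x. h (y + t *R (x - y)) * ka x * ka y * I t \<partial>lborel) \<partial>lborel)
   \<le> (ennreal (2 ^ DIM('a)) * emeasure lborel K * D) * indicator {0..1} t"
  proof (cases "t \<in> {0..1}")
   case True
   consider "1/2 \<le> t" | "t \<le> 1/2" by linarith
   then have "(\<integral>\<^sup>+y. (\<integral>\<^sup>+x. h (y + t *R (x - y)) * ka x * ka y * I t \<partial>lborel) \<partial>lborel)
    \<le> (\<integral>\<^sup>+z. (ennreal (2 ^ DIM('a)) * D) * ka z \<partial>lborel)"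
   proof cases
    case 1
    show ?thesis
    proof (intro nn_integral_mono)
     fix y
     have "(\<integral>\<^sup>+x. h (y + t *R (x - y)) * ka x * ka y * I t \<partial>lborel)
      \<le> (\<integral>\<^sup>+x. h ((1 - t) *R y + t *R x) * ka y \<partial>lborel)"
      by (intro nn_integral_mono) (auto simp: ka_def I_def indicator_def algebra_simps)
     also have "\<dots> = (\<integral>\<^sup>+x. h ((1 - t) *R y + t *R x) \<partial>lborel) * ka y"
      by (simp add: nn_integral_multc)
     also have "\<dots> \<le> (ennreal (2 ^ DIM('a)) * D) * ka y"
      unfolding D_def using 1 True
      by (intro mult_right_mono nn_integral_half_scale_le) auto
     finally show "(\<integral>\<^sup>+x. h (y + t *R (x - y)) * ka x * ka y * I t \<partial>lborel) \<le> (ennreal (2 ^ DIM('a)) * D) * ka y" .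
    qed
   next
    case 2
    have "(\<integral>\<^sup>+y. (\<integral>\<^sup>+x. h (y + t *R (x - y)) * ka x * ka y * I t \<partial>lborel) \<partial>lborel)
     = (\<integral>\<^sup>+x. (\<integral>\<^sup>+y. h (y + t *R (x - y)) * ka x * ka y * I t \<partial>lborel) \<partial>lborel)"
     by (intro lborel_pair.Fubini') measurable
    also have "\<dots> \<le> (\<integral>\<^sup>+x. (ennreal (2 ^ DIM('a)) * D) * ka x \<partial>lborel)"
    proof (intro nn_integral_mono)
     fix x
     have "(\<integral>\<^sup>+y. h (y + t *R (x - y)) * ka x * ka y * I t \<partial>lborel)
      \<le> (\<integral>\<^sup>+y. h (t *R x + (1 - t) *R y) * ka x \<partial>lborel)"
      by (intro nn_integral_mono) (auto simp: ka_def I_def indicator_def algebra_simps)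
     also have "\<dots> = (\<integral>\<^sup>+y. h (t *R x + (1 - t) *R y) \<partial>lborel) * ka x"
      by (simp add: nn_integral_multc)
     also have "\<dots> \<le> (ennreal (2 ^ DIM('a)) * D) * ka x"
      unfolding D_def using 2 True
      by (intro mult_right_mono nn_integral_half_scale_le) auto
     finally show "(\<integral>\<^sup>+y. h (y + t *R (x - y)) * ka x * ka y * I t \<partial>lborel) \<le> (ennreal (2 ^ DIM('a)) * D) * ka x" .
    qed
    finally show ?thesis .
   qed
   also have "\<dots> = ennreal (2 ^ DIM('a)) * emeasure lborel K * D"
    unfolding ka_def by (subst nn_integral_cmult_indicator) (auto simp: mult_ac)
   finally show ?thesis using True by simp
  qed (simp add: I_def)
 qed
 also have "\<dots> = ennreal (2 ^ DIM('a)) * emeasure lborel K * D"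
  by (subst nn_integral_cmult_indicator) auto
 finally have "emeasure lborel Z * (\<integral>\<^sup>+x. ennreal ((\<phi> x)^2) * ka x \<partial>lborel)
  \<le> ennreal (d^2) * (ennreal (2 ^ DIM('a)) * emeasure lborel K * D)"
  by (blast intro: mult_left_mono zero_le)
 then show ?thesis
  by (simp add: D_def h_def ka_def ennreal_mult' mult_ac)
qed

section \<open>Integration by parts without boundary terms\<close>

lemma integrable_continuous_compact_support:
 fixes f :: "'a::euclidean_space => 'b::euclidean_space"
 assumes "continuous_on UNIV f" and "\<And>x. norm x \<ge> r ==> f x = 0"
 shows "integrable lborel f"
proof -
 have "integrable lborel (\<lambda>x. indicator (cball 0 r) x *R f x)"
  by (intro borel_integrable_compact continuous_on_subset[OF assms(1)]) auto
 moreover have "(\<lambda>x. indicator (cball 0 r) x *R f x) = f"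
  using assms(2) by (auto simp: indicator_def fun_eq_iff)
 ultimately show ?thesis by simp
qed

lemma integrable_continuous_bounded_set:
 fixes f :: "'a::euclidean_space => real"
 assumes "continuous_on UNIV f" and S: "S \<in> sets borel" "bounded S"
 shows "integrable lborel (\<lambda>x. indicator S x * f x)"
proof -
 obtain r where r: "S \<subseteq> cball 0 r" using bounded_subset_ballD[OF S(2), of 0] ball_subset_cball by (meson subset_trans)
 have "integrable lborel (\<lambda>x. indicator (cball 0 r) x *R f x)"
  by (intro borel_integrable_compact continuous_on_subset[OF assms(1)]) auto
 then have "integrable lborel (\<lambda>x. indicator S x *R (indicator (cball 0 r) x *R f x))"
  by (rule integrable_mult_indicator[rotated]) (use S in auto)
 moreover have "(\<lambda>x. indicator S x *R (indicator (cball 0 r) x *R f x)) = (\<lambda>x. indicator S x * f x)"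
  using r by (auto simp: indicator_def fun_eq_iff)
 ultimately show ?thesis by simp
qed

lemma nn_integral_eq_integral_bounded_set:
 fixes f :: "'a::euclidean_space => real"
 assumes "continuous_on UNIV f" and "\<And>x. f x \<ge> 0" and S: "S \<in> sets borel" "bounded S"
 shows "(\<integral>\<^sup>+x. ennreal (f x) * indicator S x \<partial>lborel) = ennreal (LBINT x. indicator S x * f x)"
proof -
 have "(\<integral>\<^sup>+x. ennreal (f x) * indicator S x \<partial>lborel) = (\<integral>\<^sup>+x. ennreal (indicator S x * f x) \<partial>lborel)"
  by (intro nn_integral_cong) (auto simp: indicator_def)
 also have "\<dots> = ennreal (LBINT x. indicator S x * f x)"
  by (rule nn_integral_eq_integral[OF integrable_continuous_bounded_set[OF assms(1) S]])
   (use assms(2) in \<open>auto simp: indicator_def\<close>)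
 finally show ?thesis .
qed

lemma lborel_integral_translate:
 fixes f :: "'a::euclidean_space => 'b::{banach, second_countable_topology}"
 assumes [measurable]: "f \<in> borel_measurable borel"
 shows "(LBINT x. f (x + t)) = (LBINT x. f x)"
proof -
 have "(LBINT x. f x) = (\<integral>x. f x \<partial>distr lborel borel ((+) t))"
  by (simp add: lborel_distr_plus)
 also have "\<dots> = (LBINT x. f (t + x))" by (simp add: integral_distr)
 finally show ?thesis by (simp add: add.commute)
qed

lemma integral_cbox_eq_lborel:
 fixes f :: "'a::euclidean_space => 'b::euclidean_space"
 assumes "continuous_on UNIV f" and "\<And>x. x \<notin> cbox a b ==> f x = 0"
 shows "integral (cbox a b) f = (LBINT x. f x)"
proof -
 obtain r where r: "cbox a b \<subseteq> ball 0 r" using bounded_cbox bounded_subset_ballD by blast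
 have "f x = 0" if "norm x \<ge> r" for x using r that assms(2)[of x] by (metis in_mono dist_0_norm mem_ball not_le)
 then have int: "integrable lborel f"
  by (rule integrable_continuous_compact_support[OF assms(1)])
 have "integral (cbox a b) f = integral UNIV (\<lambda>x. if x \<in> cbox a b then f x else 0)"
  by (simp add: integral_restrict_UNIV)
 also have "(\<lambda>x. if x \<in> cbox a b then f x else 0) = f" using assms(2) by auto
 finally show ?thesis using integral_lborel[OF int] by simp
qed

text \<open>By translation invariance the integral of f (x + t e) does not depend on t;
  differentiating under the integral at t = 0 gives the claim. The radius \<open>R\<close> has the
  margin \<open>norm e\<close> so that one box contains the supports of all translates with |t|
  \<le> 1.\<close>

lemma integral_directional_derivative_eq_0:
 fixes f :: "'a::euclidean_space => real"
 assumes der: "\<And>x. (f has_derivative D x) (at x)" and cont: "continuous_on UNIV (\<lambda>x. D x e)"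
  and supp: "\<And>x. norm x \<ge> r ==> f x = 0"
 shows "(LBINT x. D x e) = 0"
proof -
 define R where "R = \<bar>r\<bar> + norm e + 1"
 define a :: 'a where "a = (- R) *R One"
 define b :: 'a where "b = R *R One"
 have Kball: "cball 0 R \<subseteq> cbox a b"
 proof
  fix x :: 'a assume "x \<in> cball 0 R"
  then have "\<And>i. i \<in> Basis ==> \<bar>x \<bullet> i\<bar> \<le> R"
   using Basis_le_norm order_trans by (metis dist_0_norm mem_cball)
  then show "x \<in> cbox a b" by (auto simp: mem_box a_def b_def abs_le_iff minus_le_iff)
 qed
 have contf: "continuous_on UNIV f"
  using der by (meson continuous_at_imp_continuous_on has_derivative_continuous)
 have D0: "D x e = 0" if "norm x > r" for x
 proof -
  have "open {x::'a. norm x > r}" by (intro open_Collect_less continuous_intros)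
  then have "(f has_derivative (\<lambda>h. 0)) (at x)"
   using has_derivative_transform_within_open[of "\<lambda>_. 0" "\<lambda>h. 0" x UNIV "{x. norm x > r}" f] supp that
   by (auto intro: less_imp_le)
  then have "D x = (\<lambda>h. 0)" using der has_derivative_unique by blast
  then show ?thesis by simp
 qed
 have outside: "norm x \<ge> \<bar>r\<bar> + norm e + 1" if "x \<notin> cbox a b" for x
 proof (rule ccontr)
  assume "\<not> ?thesis"
  then have "x \<in> cball 0 R" by (auto simp: R_def)
  then show False using Kball that by blast
 qed
 define F where "F t = integral (cbox a b) (\<lambda>x. f (x + t *R e))" for t :: real
 have Fconst: "F t = (LBINT x. f x)" if "t \<in> {-1..1}" for t
 proof -
  have "F t = (LBINT x. f (x + t *R e))" unfolding F_def
  proof (rule integral_cbox_eq_lborel)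
   show "continuous_on UNIV (\<lambda>x. f (x + t *R e))"
    by (intro continuous_on_compose2[OF contf] continuous_intros) auto
   fix x assume "x \<notin> cbox a b"
   then have "norm x \<ge> \<bar>r\<bar> + norm e + 1" by (rule outside)
   moreover have "norm (t *R e) \<le> norm e" using that by (auto simp: mult_left_le_one_le)
   moreover have "norm x \<le> norm (x + t *R e) + norm (t *R e)"
    using norm_triangle_ineq4[of "x + t *R e" "t *R e"] by simp
   ultimately show "f (x + t *R e) = 0" by (intro supp) auto
  qed
  then show ?thesis
   using lborel_integral_translate[of f "t *R e"] borel_measurable_continuous_onI[OF contf] by simp
 qed
 have dF: "(F has_field_derivative integral (cbox a b) (\<lambda>x. D (x + 0 *R e) e)) (at 0 within {-1..1})"
  unfolding F_def
 proof (rule leibniz_rule_field_derivative)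
  fix t :: real and x
  have "((\<lambda>t. x + t *R e) has_derivative (\<lambda>h. h *R e)) (at t within {-1..1})"
   by (auto intro!: derivative_eq_intros)
  then have "((\<lambda>t. f (x + t *R e)) has_derivative (\<lambda>h. D (x + t *R e) (h *R e))) (at t within {-1..1})"
   by (rule has_derivative_compose) (rule der)
  moreover have "(\<lambda>h. D (x + t *R e) (h *R e)) = (*) (D (x + t *R e) e)"
   using has_derivative_bounded_linear[OF der[of "x + t *R e"]]
   by (auto simp: fun_eq_iff linear_simps bounded_linear.linear mult.commute linear_scale)
  ultimately show "((\<lambda>t. f (x + t *R e)) has_field_derivative D (x + t *R e) e) (at t within {-1..1})"
   by (simp add: has_field_derivative_def)
 next
  fix t :: real
  show "(\<lambda>x. f (x + t *R e)) integrable_on cbox a b"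
   by (intro integrable_continuous continuous_on_compose2[OF contf] continuous_intros) auto
 next
  show "continuous_on ({-1..1} \<times> cbox a b) (\<lambda>(t, x). D (x + t *R e) e)"
   unfolding split_beta by (intro continuous_on_compose2[OF cont] continuous_intros) auto
 qed auto
 moreover have "(F has_field_derivative 0) (at 0 within {-1..1})"
  by (rule has_field_derivative_transform_within[OF DERIV_const[of "(LBINT x. f x)"] zero_less_one])
   (simp_all add: Fconst)
 moreover have "at 0 within {-1..1::real} = at 0"
  by (rule at_within_interior) auto
 ultimately have "integral (cbox a b) (\<lambda>x. D x e) = 0"
  by (simp add: DERIV_unique)
 moreover have "integral (cbox a b) (\<lambda>x. D x e) = (LBINT x. D x e)"
 proof (rule integral_cbox_eq_lborel[OF cont])
  fix x assume "x \<notin> cbox a b"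
  then have "norm x > r" using outside[of x] norm_ge_zero[of e] by linarith
  then show "D x e = 0" by (rule D0)
 qed
 ultimately show ?thesis by simp
qed

lemma integral_divergence_eq_0:
 fixes X :: "'a::euclidean_space => 'a"
 assumes der: "\<And>x. (X has_derivative X' x) (at x)"
  and cont: "\<And>i. i \<in> Basis ==> continuous_on UNIV (\<lambda>x. X' x i \<bullet> i)"
  and supp: "\<And>x. norm x \<ge> r ==> X x = 0"
 shows "(LBINT x. (\<Sum>i\<in>Basis. X' x i \<bullet> i)) = 0"
proof -
 have derc: "((\<lambda>x. X x \<bullet> i) has_derivative (\<lambda>h. X' x h \<bullet> i)) (at x)" for i x
  by (intro has_derivative_inner_left der)
 have z: "(LBINT x. X' x i \<bullet> i) = 0" if "i \<in> Basis" for i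
  using integral_directional_derivative_eq_0[of "\<lambda>x. X x \<bullet> i" "\<lambda>x h. X' x h \<bullet> i" i r] derc cont[OF that] supp
  by auto
 have X'0: "X' x i = 0" if "norm x > r" for x i
 proof -
  have "open {x::'a. norm x > r}" by (intro open_Collect_less continuous_intros)
  then have "(X has_derivative (\<lambda>h. 0)) (at x)"
   using has_derivative_transform_within_open[of "\<lambda>_. 0" "\<lambda>h. 0" x UNIV "{x. norm x > r}" X] supp that
   by (auto intro: less_imp_le)
  then have "X' x = (\<lambda>h. 0)" using der has_derivative_unique by blast
  then show ?thesis by simp
 qed
 have "integrable lborel (\<lambda>x. X' x i \<bullet> i)" if "i \<in> Basis" for i
  by (rule integrable_continuous_compact_support[OF cont[OF that], of "r + 1"]) (simp add: X'0)
 then show ?thesis using z by simp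
qed

lemma measurable_indicator_ball_pair:
 "(\<lambda>(y, x). indicator (ball y s) x :: ennreal) \<in> borel_measurable ((lborel :: 'a::euclidean_space measure) \<Otimes>\<^sub>M lborel)"
proof -
 have "(\<lambda>z. indicator {z::'a \<times> 'a. dist (fst z) (snd z) < s} z :: ennreal) \<in> borel_measurable borel"
  by (intro borel_measurable_indicator borel_open open_Collect_less continuous_intros)
 moreover have "(\<lambda>z. indicator {z::'a \<times> 'a. dist (fst z) (snd z) < s} z :: ennreal) = (\<lambda>(y, x). indicator (ball y s) x)"
  by (auto simp: indicator_def fun_eq_iff)
 moreover have "sets ((lborel :: 'a measure) \<Otimes>\<^sub>M (lborel :: 'a measure)) = sets (borel :: ('a \<times> 'a) measure)"
  unfolding borel_prod[symmetric] by (rule sets_pair_measure_cong) simp_all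
 ultimately show ?thesis by (simp cong: measurable_cong_sets)
qed

text \<open>In each ball of radius s at least half of the volume lies outside \<open>S\<close>,
  where \<phi> vanishes, so the Poincare inequality holds there with twice its constant; 8 s^2 is
  twice the square of the diameter 2 s. Integrating over all centres counts every point with the
  same weight, the volume of a ball, which cancels.\<close>

lemma faber_krahn_balls:
 fixes \<phi> :: "'a::euclidean_space => real" and ga :: "'a => 'a"
 assumes der: "\<And>x. (\<phi> has_derivative (\<lambda>h. ga x \<bullet> h)) (at x)"
  and cont: "continuous_on UNIV ga"
  and S[measurable]: "S \<in> sets borel" and zero: "\<And>x. x \<notin> S ==> \<phi> x = 0"
  and s: "s > 0" "2 * emeasure lborel S \<le> emeasure lborel (ball (0::'a) s)"
 shows "(\<integral>\<^sup>+x. ennreal ((\<phi> x)^2) \<partial>lborel)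
  \<le> ennreal (8 * s^2 * 2 ^ DIM('a)) * (\<integral>\<^sup>+x. ennreal ((norm (ga x))^2) \<partial>lborel)"
proof -
 define B where "B = emeasure lborel (ball (0::'a) s)"
 have Bt: "emeasure lborel (ball y s) = B" for y :: 'a
  unfolding B_def using s by (simp add: emeasure_ball)
 have "unit_ball_vol (real DIM('a)) \<noteq> 0" by (metis less_irrefl unit_ball_vol_pos of_nat_0_le_iff)
 then have B0: "B \<noteq> 0" "B \<noteq> \<infinity>"
  unfolding B_def using s by (auto simp: emeasure_ball ennreal_mult_eq_top_iff)
 have contphi: "continuous_on UNIV \<phi>"
  using der by (meson continuous_at_imp_continuous_on has_derivative_continuous)
 have [measurable]: "ga \<in> borel_measurable borel" "\<phi> \<in> borel_measurable borel"
  using cont contphi by (auto intro: borel_measurable_continuous_onI)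
 have local: "(\<integral>\<^sup>+x. ennreal ((\<phi> x)^2) * indicator (ball y s) x \<partial>lborel)
  \<le> ennreal (8 * s^2 * 2 ^ DIM('a)) * (\<integral>\<^sup>+x. ennreal ((norm (ga x))^2) * indicator (ball y s) x \<partial>lborel)" (is "?L \<le> ?C * ?R") for y
 proof -
  define Z where "Z = ball y s - S"
  have [measurable]: "Z \<in> sets borel" unfolding Z_def by measurable
  have "B \<le> emeasure lborel Z + emeasure lborel S"
  proof -
   have "B = emeasure lborel (ball y s)" by (simp add: Bt)
   also have "\<dots> \<le> emeasure lborel (Z \<union> S)" by (intro emeasure_mono) (auto simp: Z_def)
   also have "\<dots> \<le> emeasure lborel Z + emeasure lborel S" by (intro emeasure_subadditive) auto
   finally show ?thesis .
  qed
  then have "2 * B \<le> 2 * emeasure lborel Z + 2 * emeasure lborel S"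
   by (metis distrib_left mult_left_mono zero_le)
  also have "\<dots> \<le> 2 * emeasure lborel Z + B" using s(2) by (simp add: B_def add_left_mono)
  finally have "B + B \<le> 2 * emeasure lborel Z + B" by (simp add: mult_2)
  then have BZ: "B \<le> 2 * emeasure lborel Z" using B0
   by (simp add: ennreal_add_left_cancel_le add.commute)
  have "B * ?L \<le> 2 * (emeasure lborel Z * ?L)"
   using mult_right_mono[OF BZ, of ?L] by (simp add: mult.assoc)
  also have "\<dots> \<le> 2 * (ennreal ((2 * s)^2 * 2 ^ DIM('a)) * emeasure lborel (ball y s) * ?R)"
  proof (intro mult_left_mono poincare_zero_set[OF der cont])
   fix u v assume "u \<in> ball y s" "v \<in> ball y s"
   then show "norm (u - v) \<le> 2 * s"
    using dist_triangle[of u v y] by (simp add: dist_norm norm_minus_commute)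
  qed (auto simp: Z_def intro: zero)
  also have "\<dots> = B * (?C * ?R)"
  proof -
   have "ennreal (8 * s^2 * 2 ^ DIM('a)) = 2 * ennreal ((2 * s)^2 * 2 ^ DIM('a))"
    by (subst ennreal_numeral[symmetric], subst ennreal_mult[symmetric]) (auto simp: power_mult_distrib)
   then show ?thesis by (simp add: Bt mult_ac)
  qed
  finally show ?thesis using B0 by (simp add: ennreal_mult_le_mult_iff)
 qed
 have swap: "(\<integral>\<^sup>+y. (\<integral>\<^sup>+x. h x * indicator (ball y s) x \<partial>lborel) \<partial>lborel) = B * (\<integral>\<^sup>+x. h x \<partial>lborel)"
  if [measurable]: "h \<in> borel_measurable borel" for h :: "'a => ennreal"
 proof -
  note measurable_indicator_ball_pair[measurable]
  have "(\<integral>\<^sup>+y. (\<integral>\<^sup>+x. h x * indicator (ball y s) x \<partial>lborel) \<partial>lborel)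
    = (\<integral>\<^sup>+x. (\<integral>\<^sup>+y. h x * indicator (ball y s) x \<partial>lborel) \<partial>lborel)"
   by (intro lborel_pair.Fubini') measurable
  also have "\<dots> = (\<integral>\<^sup>+x. h x * B \<partial>lborel)"
  proof (intro nn_integral_cong)
   fix x :: 'a
   have "(\<integral>\<^sup>+y. h x * indicator (ball y s) x \<partial>lborel) = (\<integral>\<^sup>+y. h x * indicator (ball x s) y \<partial>lborel)"
    by (intro nn_integral_cong) (auto simp: indicator_def dist_commute)
   then show "(\<integral>\<^sup>+y. h x * indicator (ball y s) x \<partial>lborel) = h x * B"
    by (simp add: nn_integral_cmult_indicator Bt)
  qed
  finally show ?thesis by (simp add: nn_integral_cmult mult.commute[of _ B])
 qed
 have "B * (\<integral>\<^sup>+x. ennreal ((\<phi> x)^2) \<partial>lborel)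
  = (\<integral>\<^sup>+y. (\<integral>\<^sup>+x. ennreal ((\<phi> x)^2) * indicator (ball y s) x \<partial>lborel) \<partial>lborel)"
  by (rule swap[symmetric]) measurable
 also have "\<dots> \<le> (\<integral>\<^sup>+y. ennreal (8 * s^2 * 2 ^ DIM('a)) * (\<integral>\<^sup>+x. ennreal ((norm (ga x))^2) * indicator (ball y s) x \<partial>lborel) \<partial>lborel)"
  by (intro nn_integral_mono local)
 also have "\<dots> = ennreal (8 * s^2 * 2 ^ DIM('a)) * (\<integral>\<^sup>+y. (\<integral>\<^sup>+x. ennreal ((norm (ga x))^2) * indicator (ball y s) x \<partial>lborel) \<partial>lborel)"
 proof (rule nn_integral_cmult)
  note measurable_indicator_ball_pair[measurable]
  show "(\<lambda>y. \<integral>\<^sup>+x. ennreal ((norm (ga x))^2) * indicator (ball y s) x \<partial>lborel) \<in> borel_measurable lborel"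
   by measurable
 qed
 also have "(\<integral>\<^sup>+y. (\<integral>\<^sup>+x. ennreal ((norm (ga x))^2) * indicator (ball y s) x \<partial>lborel) \<partial>lborel)
  = B * (\<integral>\<^sup>+x. ennreal ((norm (ga x))^2) \<partial>lborel)"
  by (rule swap) measurable
 finally show ?thesis using B0
  by (simp add: mult.left_commute[of _ B] ennreal_mult_le_mult_iff)
qed

section \<open>Differentiable positive parts and cut-off functions\<close>

lemma DERIV_pos_part_comp:
 fixes F F' :: "real => real"
 assumes der: "\<And>t. t \<ge> 0 ==> (F has_real_derivative F' t) (at t)" and z: "F 0 = 0" "F' 0 = 0"
 shows "((\<lambda>s. F (max 0 s)) has_real_derivative F' (max 0 s)) (at s)"
proof -
 consider "s > 0" | "s < 0" | "s = 0" by linarith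
 then show ?thesis
 proof cases
  case 1
  then have "((\<lambda>s. F s) has_real_derivative F' s) (at s)" using der by auto
  then have "((\<lambda>s. F (max 0 s)) has_real_derivative F' s) (at s)"
   by (rule DERIV_cong_ev[THEN iffD1, rotated -1])
    (use 1 in \<open>auto intro!: eventually_mono[OF eventually_nhds_in_open[of "{0<..}" s]]\<close>)
  then show ?thesis using 1 by (simp add: max_def)
 next
  case 2
  have "((\<lambda>s. 0) has_real_derivative 0) (at s)" by simp
  then have "((\<lambda>s. F (max 0 s)) has_real_derivative 0) (at s)"
   by (rule DERIV_cong_ev[THEN iffD1, rotated -1])
    (use 2 z in \<open>auto intro!: eventually_mono[OF eventually_nhds_in_open[of "{..<0}" s]]\<close>)
  then show ?thesis using 2 z by (simp add: max_def)
 next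
  case 3
  have "((\<lambda>h. (F (0 + h) - F 0) / h) \<longlongrightarrow> F' 0) (at 0)"
   using der[of 0] by (simp add: DERIV_def)
  then have l: "((\<lambda>h. F h / h) \<longlongrightarrow> 0) (at 0)" using z by simp
  have "((\<lambda>h. F (max 0 h) / h) \<longlongrightarrow> 0) (at 0)"
  proof (rule tendstoI)
   fix e :: real assume "e > 0"
   then have "\<forall>\<^sub>F h in at 0. dist (F h / h) 0 < e" using l tendstoD by blast
   then show "\<forall>\<^sub>F h in at 0. dist (F (max 0 h) / h) 0 < e"
    by eventually_elim (use \<open>e > 0\<close> z in \<open>auto simp: max_def\<close>)
  qed
  then show ?thesis using 3 z by (simp add: DERIV_def)
 qed
qed

text \<open>A continuously differentiable substitute for the positive part, at most
  \<open>de\<close> below it. The energy estimates need test functions that are differentiable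
  everywhere.\<close>

definition soft_pos :: "real => real => real" where
 "soft_pos de s = (max 0 s)^2 / (max 0 s + de)"

definition soft_pos' :: "real => real => real" where
 "soft_pos' de s = ((max 0 s)^2 + 2 * max 0 s * de) / (max 0 s + de)^2"

lemma soft_pos_deriv_aux:
 assumes "t + de > (0::real)"
 shows "((\<lambda>t. t^2 / (t + de)) has_real_derivative (t^2 + 2 * t * de) / (t + de)^2) (at t)"
  "((\<lambda>t. (t^2 + 2 * t * de) / (t + de)^2) has_real_derivative 2 * de^2 / (t + de) ^ 3) (at t)"
proof -
 have d: "((\<lambda>t. t^2) has_real_derivative 2 * t) (at t)" "((\<lambda>t. t + de) has_real_derivative 1) (at t)"
  "((\<lambda>t. t^2 + 2 * t * de) has_real_derivative 2 * t + 2 * de) (at t)"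
  "((\<lambda>t. (t + de)^2) has_real_derivative 2 * (t + de)) (at t)"
  by (auto intro!: derivative_eq_intros)
 have n: "t + de \<noteq> 0" "(t + de)^2 \<noteq> 0" using assms by auto
 have "(2 * t * (t + de) - t\<^sup>2 * 1) / ((t + de) * (t + de)) = (t^2 + 2 * t * de) / (t + de)^2"
  by (simp add: power2_eq_square algebra_simps)
 then show "((\<lambda>t. t^2 / (t + de)) has_real_derivative (t^2 + 2 * t * de) / (t + de)^2) (at t)"
  using DERIV_divide[OF d(1,2) n(1)] by simp
 define y where "y = t + de"
 have "((2 * t + 2 * de) * (t + de)^2 - (t^2 + 2 * t * de) * (2 * (t + de))) = y * (2 * de^2)"
  unfolding y_def by (simp add: power2_eq_square algebra_simps)
 moreover have "(t + de)^2 * (t + de)^2 = y * y ^ 3"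
  unfolding y_def[symmetric] by (simp add: power2_eq_square power3_eq_cube)
 moreover have "y \<noteq> 0" using n by (simp add: y_def)
 ultimately have "((2 * t + 2 * de) * (t + de)^2 - (t^2 + 2 * t * de) * (2 * (t + de))) / ((t + de)^2 * (t + de)^2)
   = 2 * de^2 / (t + de) ^ 3"
  unfolding y_def[symmetric] by simp
 then show "((\<lambda>t. (t^2 + 2 * t * de) / (t + de)^2) has_real_derivative 2 * de^2 / (t + de) ^ 3) (at t)"
  using DERIV_divide[OF d(3,4) n(2)] by simp
qed

lemma soft_pos_deriv:
 assumes "de > 0"
 shows "(soft_pos de has_real_derivative soft_pos' de s) (at s)"
proof -
 have "((\<lambda>t. t^2 / (t + de)) has_real_derivative (t^2 + 2 * t * de) / (t + de)^2) (at t)" if "t \<ge> 0" for t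
  by (rule soft_pos_deriv_aux) (use that assms in auto)
 from DERIV_pos_part_comp[OF this] show ?thesis
  using assms by (simp add: soft_pos_def[abs_def] soft_pos'_def)
qed

lemma soft_pos_cont [continuous_intros]:
 assumes "de > 0" "continuous_on A f"
 shows "continuous_on A (\<lambda>x. soft_pos de (f x))" "continuous_on A (\<lambda>x. soft_pos' de (f x))"
proof -
 have n: "max 0 s + de \<noteq> 0" for s using assms by (simp add: max_def)
 show "continuous_on A (\<lambda>x. soft_pos de (f x))" "continuous_on A (\<lambda>x. soft_pos' de (f x))"
  unfolding soft_pos_def soft_pos'_def using n by (auto intro!: continuous_intros assms)
qed

lemma soft_pos_bounds:
 assumes "de > 0"
 shows "0 \<le> soft_pos de s" "soft_pos de s \<le> max 0 s" "max 0 s - de \<le> soft_pos de s"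
  "0 \<le> soft_pos' de s" "soft_pos' de s \<le> 1" "s \<le> 0 ==> soft_pos de s = 0"
proof -
 define t where "t = max 0 s"
 have t: "t \<ge> 0" "t + de > 0" using assms by (auto simp: t_def)
 show "0 \<le> soft_pos de s" "0 \<le> soft_pos' de s"
  using t assms unfolding soft_pos_def soft_pos'_def t_def[symmetric] by auto
 show "soft_pos de s \<le> max 0 s"
  using t assms unfolding soft_pos_def t_def[symmetric] by (simp add: pos_divide_le_eq power2_eq_square algebra_simps)
 have "(t - de) * (t + de) \<le> t^2" by (simp add: power2_eq_square algebra_simps)
 then show "max 0 s - de \<le> soft_pos de s"
  unfolding soft_pos_def t_def[symmetric] pos_le_divide_eq[OF t(2)] .
 show "soft_pos' de s \<le> 1"
 proof -
  have "t^2 + 2 * t * de \<le> 1 * (t + de)^2" by (simp add: power2_eq_square algebra_simps)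
  moreover have "(t + de)^2 > 0" using t by simp
  ultimately show ?thesis
   unfolding soft_pos'_def t_def[symmetric] using pos_divide_le_eq by blast
 qed
 show "s \<le> 0 ==> soft_pos de s = 0" by (simp add: soft_pos_def)
qed

text \<open>Half the derivative of the square of \<open>soft_pos de\<close>. As a weight in the
  energy inequality its square is the product of the squares of \<open>soft_pos de\<close> and
  \<open>soft_pos' de\<close>, and its derivative dominates the square of
  \<open>soft_pos' de\<close>; this combination produces a Caccioppoli estimate.\<close>

definition soft_pos_sq :: "real => real => real" where
 "soft_pos_sq de s = soft_pos de s * soft_pos' de s"

definition soft_pos_sq' :: "real => real => real" where
 "soft_pos_sq' de s = (soft_pos' de s)^2 + 2 * de^2 * (max 0 s)^2 / (max 0 s + de) ^ 4"

lemma soft_pos_sq_deriv: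
 assumes "de > 0"
 shows "(soft_pos_sq de has_real_derivative soft_pos_sq' de s) (at s)"
proof -
 have "((\<lambda>t. t^2 / (t + de) * ((t^2 + 2 * t * de) / (t + de)^2)) has_real_derivative
   ((t^2 + 2 * t * de) / (t + de)^2)\<^sup>2 + 2 * de^2 * t^2 / (t + de) ^ 4) (at t)" if "t \<ge> 0" for t
 proof -
  have "((\<lambda>t. t^2 / (t + de)) has_real_derivative (t^2 + 2 * t * de) / (t + de)^2) (at t)"
   by (rule soft_pos_deriv_aux) (use that assms in auto)
  moreover have "((\<lambda>t. (t^2 + 2 * t * de) / (t + de)^2) has_real_derivative 2 * de^2 / (t + de) ^ 3) (at t)"
   by (rule soft_pos_deriv_aux) (use that assms in auto)
  ultimately have "((\<lambda>t. t^2 / (t + de) * ((t^2 + 2 * t * de) / (t + de)^2)) has_real_derivative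
   (t^2 + 2 * t * de) / (t + de)^2 * ((t^2 + 2 * t * de) / (t + de)^2) + 2 * de^2 / (t + de) ^ 3 * (t^2 / (t + de))) (at t)"
   by (rule DERIV_mult)
  moreover have "(t^2 + 2 * t * de) / (t + de)^2 * ((t^2 + 2 * t * de) / (t + de)^2) = ((t^2 + 2 * t * de) / (t + de)^2)^2"
   by (simp only: power2_eq_square)
  moreover have "2 * de^2 / (t + de) ^ 3 * (t^2 / (t + de)) = 2 * de^2 * t^2 / (t + de) ^ 4"
  proof -
   have "(t + de) ^ 3 * (t + de) = (t + de) ^ 4" by (simp add: power_Suc2[symmetric] del: power_Suc)
   then show ?thesis by simp
  qed
  ultimately show ?thesis by (simp only:)
 qed
 from DERIV_pos_part_comp[OF this] show ?thesis
  using assms by (simp add: soft_pos_def[abs_def] soft_pos'_def soft_pos_sq_def[abs_def] soft_pos_sq'_def)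
qed

lemma soft_pos_sq_cont:
 assumes "de > 0" "continuous_on A f"
 shows "continuous_on A (\<lambda>x. soft_pos_sq' de (f x))"
proof -
 have n: "max 0 s + de \<noteq> 0" for s using assms by (simp add: max_def)
 show ?thesis
  unfolding soft_pos_sq'_def using n by (auto intro!: continuous_intros assms)
qed

text \<open>Composing two quadratic switches \<open>q\<close> makes the profile differentiable at
  both radii. In the transition zone |k| \<le> 4 and |x| \<le> b, while m = (b - a) (b + a); this
  gives the gradient bound 8 / (b - a).\<close>

lemma radial_cutoff:
 fixes a b :: real
 assumes "0 < a" "a < b"
 obtains \<zeta> :: "'a::euclidean_space => real" and d :: "'a => 'a"
 where "\<And>x. (\<zeta> has_derivative (\<lambda>h. d x \<bullet> h)) (at x)" "continuous_on UNIV d"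
  "\<And>x. norm x \<le> a ==> \<zeta> x = 1" "\<And>x. norm x \<ge> b ==> \<zeta> x = 0" "\<And>x. norm x \<ge> b ==> d x = 0"
  "\<And>x. 0 \<le> \<zeta> x" "\<And>x. \<zeta> x \<le> 1" "\<And>x. norm (d x) \<le> 8 / (b - a)"
proof
 define q where "q s = (max 0 s)^2" for s :: real
 have dq: "(q has_real_derivative 2 * max 0 s) (at s)" for s
  unfolding q_def[abs_def] by (rule DERIV_pos_part_comp) (auto intro!: derivative_eq_intros)
 define m where "m = b^2 - a\<^sup>2"
 have m: "m > 0" using assms by (auto simp: m_def power_strict_mono)
 define s where "s x = (x \<bullet> x - a\<^sup>2) / m" for x :: 'a
 define \<zeta> where "\<zeta> x = q (1 - q (s x))" for x :: 'a
 define k where "k x = 2 * max 0 (1 - q (s x)) * (- (2 * max 0 (s x)))" for x :: 'a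
 define d where "d x = (k x * (2 / m)) *R x" for x :: 'a
 have xx: "x \<bullet> x = (norm x)^2" for x :: 'a by (simp add: power2_norm_eq_inner)
 show "(\<zeta> has_derivative (\<lambda>h. d x \<bullet> h)) (at x)" for x
 proof -
  have ds: "(s has_derivative (\<lambda>h. (2 / m) * (x \<bullet> h))) (at x)"
   unfolding s_def[abs_def] using m
   by (auto intro!: derivative_eq_intros simp: inner_commute field_simps)
  have "((\<lambda>t. q (1 - q t)) has_real_derivative 2 * max 0 (1 - q t) * (0 - 2 * max 0 t)) (at t)" for t
   by (rule DERIV_chain2[OF dq]) (intro derivative_intros dq)
  then have "((\<lambda>t. q (1 - q t)) has_derivative (\<lambda>h. 2 * max 0 (1 - q t) * (0 - 2 * max 0 t) * h)) (at t)" for t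
   unfolding has_field_derivative_def .
  from has_derivative_compose[OF ds this]
  show ?thesis by (simp add: \<zeta>_def[abs_def] d_def k_def mult_ac)
 qed
 have contq: "continuous_on A q" for A unfolding q_def by (intro continuous_intros)
 have conts: "continuous_on UNIV s" unfolding s_def using m by (intro continuous_intros) auto
 show "continuous_on UNIV d"
  unfolding d_def k_def
  by (intro continuous_intros continuous_on_compose2[OF contq[of UNIV]] conts) auto
 show "\<zeta> x = 1" if "norm x \<le> a" for x
 proof -
  have "x \<bullet> x \<le> a^2" unfolding xx using that assms by (intro power_mono) auto
  then have "s x \<le> 0" using m by (simp add: s_def divide_le_0_iff)
  then show ?thesis by (simp add: \<zeta>_def q_def)
 qed
 have s1: "s x \<ge> 1" if "norm x \<ge> b" for x
 proof -
  have "x \<bullet> x \<ge> b^2" unfolding xx using that assms by (intro power_mono) auto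
  then show ?thesis using m by (simp add: s_def m_def pos_le_divide_eq)
 qed
 have q1: "q t \<ge> 1" if "t \<ge> 1" for t using that by (simp add: q_def)
 show "\<zeta> x = 0" "d x = 0" if "norm x \<ge> b" for x
  using q1[OF s1[OF that]] by (simp_all add: \<zeta>_def d_def k_def q_def[of "1 - _"])
 show "0 \<le> \<zeta> x" for x by (simp add: \<zeta>_def q_def)
 have q0: "q t \<ge> 0" for t by (simp add: q_def)
 show "\<zeta> x \<le> 1" for x
  using q0[of "s x"] by (auto simp: \<zeta>_def q_def[of "1 - _"] intro!: power_le_one)
 show "norm (d x) \<le> 8 / (b - a)" for x
 proof (cases "norm x \<ge> b")
  case True
  then have "d x = 0" using q1[OF s1[OF True]] by (simp add: d_def k_def)
  then show ?thesis using assms by simp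
 next
  case False
  then have "x \<bullet> x \<le> b^2" unfolding xx using assms by (intro power_mono) auto
  then have "s x \<le> 1" using m by (simp add: s_def m_def pos_divide_le_eq)
  then have "\<bar>max 0 (s x)\<bar> \<le> 1" by auto
  moreover have "\<bar>max 0 (1 - q (s x))\<bar> \<le> 1" using q0[of "s x"] by auto
  ultimately have "\<bar>max 0 (1 - q (s x))\<bar> * \<bar>max 0 (s x)\<bar> \<le> 1 * 1" by (intro mult_mono) auto
  then have "\<bar>k x\<bar> \<le> 4" by (simp add: k_def abs_mult)
  then have "norm (d x) \<le> 4 * (2 / m) * b"
  proof -
   have "\<bar>k x\<bar> * (2 / m) * norm x \<le> 4 * (2 / m) * b"
    using \<open>\<bar>k x\<bar> \<le> 4\<close> m False by (intro mult_mono) auto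
   then show ?thesis unfolding d_def using m by (simp add: abs_mult)
  qed
  also have "\<dots> = 8 * b / m" by simp
  also have "\<dots> \<le> 8 / (b - a)"
  proof -
   have "m = (b - a) * (b + a)" by (simp add: m_def power2_eq_square algebra_simps)
   then have "8 * b / m = (8 / (b - a)) * (b / (b + a))" by simp
   also have "\<dots> \<le> (8 / (b - a)) * 1" using assms by (intro mult_left_mono) auto
   finally show ?thesis by simp
  qed
  finally show ?thesis .
 qed
qed

text \<open>The divergence inequality is tested with
  \<open>\<zeta>\<^sup>2 * G (- ln v) / v\<close>. Differentiating 1 / v contributes
  \<open>G\<close> and differentiating the argument of \<open>G\<close> contributes
  \<open>G'\<close>, with the same sign, so the dissipation carries the weight G + G' \<ge> P. The
  condition G^2 \<le> P Q lets Young's inequality absorb the cross term with the gradient of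
  \<zeta>. Constant \<open>G\<close> yields the logarithmic estimate, \<open>soft_pos_sq\<close> the
  Caccioppoli estimate.\<close>

lemma energy_inequality:
 fixes v :: "'a::euclidean_space => real" and g \<beta> :: "'a => 'a"
 assumes v: "\<And>x. (v has_derivative (\<lambda>h. g x \<bullet> h)) (at x)" "continuous_on UNIV g" "\<And>x. v x > 0"
  and b: "\<And>x. (\<beta> has_derivative \<beta>' x) (at x)" "\<And>i. i \<in> Basis ==> continuous_on UNIV (\<lambda>x. \<beta>' x i)"
  and nb: "\<And>x. norm (\<beta> x) \<le> norm (g x)" and mono: "\<And>x. c * (norm (g x))^2 \<le> \<beta> x \<bullet> g x" and c: "c > 0"
  and e: "\<And>x. (\<Sum>i\<in>Basis. \<beta>' x i \<bullet> i) \<le> e x" "continuous_on UNIV e"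
  and z: "\<And>x. (\<zeta> has_derivative (\<lambda>h. d x \<bullet> h)) (at x)" "continuous_on UNIV d"
   "\<And>x. norm x \<ge> b ==> \<zeta> x = 0" "\<And>x. norm x \<ge> b ==> d x = 0"
  and G: "\<And>s. (G has_real_derivative G' s) (at s)" "continuous_on UNIV G'" "\<And>s. G s \<ge> 0"
  and P: "continuous_on UNIV P" "\<And>s. P s \<ge> 0" "\<And>s. P s \<le> G s + G' s"
  and Q: "continuous_on UNIV Q" "\<And>s. Q s \<ge> 0" "\<And>s. (G s)^2 \<le> P s * Q s"
 shows "(c / 2) * (LBINT x. (\<zeta> x)^2 * P (- ln (v x)) * (norm (g x))^2 / (v x)^2)
  \<le> (2 / c) * (LBINT x. (norm (d x))^2 * Q (- ln (v x)))
   + (LBINT x. e x * (\<zeta> x)^2 * G (- ln (v x)) / v x)"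
proof -
 define w where "w x = - ln (v x)" for x
 have contv: "continuous_on UNIV v" and contb: "continuous_on UNIV \<beta>" and contz: "continuous_on UNIV \<zeta>"
  using v(1) b(1) z(1) by (meson continuous_at_imp_continuous_on has_derivative_continuous)+
 have v0: "v x \<noteq> 0" for x using v(3)[of x] by simp
 have contG: "continuous_on UNIV G" using G(1) by (meson DERIV_continuous continuous_at_imp_continuous_on)
 have contw: "continuous_on UNIV w" unfolding w_def using v0 by (intro continuous_intros contv) auto
 have cc: "continuous_on UNIV (\<lambda>x. F (w x))" if "continuous_on UNIV F" for F :: "real => real"
  using continuous_on_compose2[OF that contw] by auto
 define \<theta> where "\<theta> x = (\<zeta> x)^2 * G (w x) / v x" for x
 define \<theta>' where "\<theta>' x = (2 * \<zeta> x * G (w x) / v x) *R d x - ((\<zeta> x)^2 * (G (w x) + G' (w x)) / (v x)^2) *R g x" for x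
 have dth: "(\<theta> has_derivative (\<lambda>h. \<theta>' x \<bullet> h)) (at x)" for x
 proof -
  have dw: "(w has_derivative (\<lambda>h. - (g x \<bullet> h) / v x)) (at x)"
   unfolding w_def[abs_def] using v(3)[of x]
   by (auto intro!: derivative_eq_intros v(1) simp: field_simps)
  have dG: "((\<lambda>x. G (w x)) has_derivative (\<lambda>h. G' (w x) * (- (g x \<bullet> h) / v x))) (at x)"
   using has_derivative_compose[OF dw, of G "(*) (G' (w x))"] G(1) by (simp add: has_field_derivative_def)
  have "(\<theta> has_derivative (\<lambda>h. ((\<zeta> x)^2 * (G' (w x) * (- (g x \<bullet> h) / v x)) + (2 * (d x \<bullet> h) * \<zeta> x) * G (w x)) / v x
    - (\<zeta> x)\<^sup>2 * G (w x) * (g x \<bullet> h) / (v x)^2)) (at x)"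
   unfolding \<theta>_def[abs_def] using v0[of x]
   by (auto intro!: derivative_eq_intros z(1) dG v(1) simp: power2_eq_square)
    (simp add: fun_eq_iff field_simps)
  moreover have "(\<lambda>h. ((\<zeta> x)^2 * (G' (w x) * (- (g x \<bullet> h) / v x)) + (2 * (d x \<bullet> h) * \<zeta> x) * G (w x)) / v x
    - (\<zeta> x)\<^sup>2 * G (w x) * (g x \<bullet> h) / (v x)^2) = (\<lambda>h. \<theta>' x \<bullet> h)"
   using v0[of x] by (auto simp: \<theta>'_def fun_eq_iff inner_diff_left field_simps power2_eq_square)
  ultimately show ?thesis by simp
 qed
 have contth: "continuous_on UNIV \<theta>" and contth': "continuous_on UNIV \<theta>'"
  unfolding \<theta>_def \<theta>'_def using v0
  by (auto intro!: continuous_intros contz contv z(2) v(2) cc contG G(2))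
 define X where "X x = \<theta> x *R \<beta> x" for x
 define X' where "X' x h = \<theta> x *R \<beta>' x h + (\<theta>' x \<bullet> h) *R \<beta> x" for x h
 have dX: "(X has_derivative X' x) (at x)" for x
  unfolding X_def[abs_def] X'_def[abs_def] by (rule has_derivative_scaleR[OF dth b(1)])
 have "(LBINT x. (\<Sum>i\<in>Basis. X' x i \<bullet> i)) = 0"
 proof (rule integral_divergence_eq_0[OF dX])
  fix i :: 'a assume "i \<in> Basis"
  then show "continuous_on UNIV (\<lambda>x. X' x i \<bullet> i)"
   unfolding X'_def by (intro continuous_intros contth contth' contb b(2))
 next
  fix x :: 'a assume "norm x \<ge> b"
  then show "X x = 0" by (simp add: X_def \<theta>_def z(3))
 qed
 moreover have sumX: "(\<Sum>i\<in>Basis. X' x i \<bullet> i) = \<theta> x * (\<Sum>i\<in>Basis. \<beta>' x i \<bullet> i) + \<theta>' x \<bullet> \<beta> x" for x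
 proof -
  have "(\<Sum>i\<in>Basis. (\<theta>' x \<bullet> i) * (\<beta> x \<bullet> i)) = \<theta>' x \<bullet> \<beta> x" by (rule euclidean_inner[symmetric])
  then show ?thesis by (simp add: X'_def inner_add_left sum.distrib sum_distrib_left[symmetric]) 
 qed
 ultimately have zero: "(LBINT x. \<theta> x * (\<Sum>i\<in>Basis. \<beta>' x i \<bullet> i) + \<theta>' x \<bullet> \<beta> x) = 0" by simp
 define A where "A x = (\<zeta> x)^2 * P (w x) * (norm (g x))^2 / (v x)^2" for x
 define B where "B x = (norm (d x))^2 * Q (w x)" for x
 define E where "E x = e x * (\<zeta> x)^2 * G (w x) / v x" for x
 have point: "\<theta> x * (\<Sum>i\<in>Basis. \<beta>' x i \<bullet> i) + \<theta>' x \<bullet> \<beta> x \<le> - (c / 2) * A x + (2 / c) * B x + E x" for x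
 proof -
  have th0: "\<theta> x \<ge> 0" using v(3)[of x] G(3) by (simp add: \<theta>_def)
  have 1: "\<theta> x * (\<Sum>i\<in>Basis. \<beta>' x i \<bullet> i) \<le> E x"
   using mult_left_mono[OF e(1)[of x] th0] by (simp add: \<theta>_def E_def mult_ac)
  define N where "N = norm (g x) / v x"
  have N: "N \<ge> 0" using v(3)[of x] by (simp add: N_def)
  have "\<theta>' x \<bullet> \<beta> x = (2 * \<zeta> x * G (w x) / v x) * (d x \<bullet> \<beta> x) - ((\<zeta> x)^2 * (G (w x) + G' (w x)) / (v x)^2) * (\<beta> x \<bullet> g x)"
   by (simp add: \<theta>'_def inner_diff_left inner_commute[of "\<beta> x" "g x"])
  also have "\<dots> \<le> 2 * \<bar>\<zeta> x\<bar> * G (w x) * norm (d x) * N - ((\<zeta> x)^2 * P (w x) / (v x)^2) * (c * (norm (g x))^2)"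
  proof (rule diff_mono)
   have "(2 * \<zeta> x * G (w x) / v x) * (d x \<bullet> \<beta> x) \<le> \<bar>(2 * \<zeta> x * G (w x) / v x) * (d x \<bullet> \<beta> x)\<bar>" by (rule abs_ge_self)
   also have "\<dots> = 2 * \<bar>\<zeta> x\<bar> * G (w x) / v x * \<bar>d x \<bullet> \<beta> x\<bar>"
    using v(3)[of x] G(3) by (simp add: abs_mult)
   also have "\<dots> \<le> 2 * \<bar>\<zeta> x\<bar> * G (w x) / v x * (norm (d x) * norm (g x))"
    using v(3)[of x] G(3)
    by (intro mult_left_mono order_trans[OF Cauchy_Schwarz_ineq2] mult_left_mono nb) auto
   finally show "(2 * \<zeta> x * G (w x) / v x) * (d x \<bullet> \<beta> x) \<le> 2 * \<bar>\<zeta> x\<bar> * G (w x) * norm (d x) * N"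
    by (simp add: N_def mult_ac)
   have "c * (norm (g x))^2 \<ge> 0" using c by simp
   then show "((\<zeta> x)^2 * P (w x) / (v x)^2) * (c * (norm (g x))^2) \<le> ((\<zeta> x)^2 * (G (w x) + G' (w x)) / (v x)^2) * (\<beta> x \<bullet> g x)"
    using mono[of x] P(2,3)[of "w x"]
    by (intro mult_mono divide_right_mono mult_left_mono) auto
  qed
  also have "((\<zeta> x)^2 * P (w x) / (v x)^2) * (c * (norm (g x))^2) = c * A x"
   by (simp add: A_def mult_ac)
  also have "2 * \<bar>\<zeta> x\<bar> * G (w x) * norm (d x) * N \<le> (c / 2) * A x + (2 / c) * B x"
  proof -
   have Gs: "G (w x) \<le> sqrt (P (w x)) * sqrt (Q (w x))"
    using Q(3)[of "w x"] real_le_rsqrt by (simp add: real_sqrt_mult[symmetric])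
   define a where "a = \<bar>\<zeta> x\<bar> * sqrt (P (w x)) * N"
   define b where "b = norm (d x) * sqrt (Q (w x))"
   have "2 * \<bar>\<zeta> x\<bar> * G (w x) * norm (d x) * N \<le> 2 * \<bar>\<zeta> x\<bar> * (sqrt (P (w x)) * sqrt (Q (w x))) * norm (d x) * N"
    using N Gs by (intro mult_right_mono mult_left_mono) auto
   also have "\<dots> = 2 * a * b" by (simp add: a_def b_def)
   also have "\<dots> \<le> (c / 2) * a^2 + (2 / c) * b^2"
   proof -
    have "0 \<le> (sqrt (c / 2) * a - sqrt (2 / c) * b)^2" by simp
    also have "\<dots> = (c / 2) * a^2 + (2 / c) * b^2 - 2 * (sqrt (c / 2) * sqrt (2 / c)) * a * b"
     using c by (simp add: power2_diff power_mult_distrib)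
    also have "sqrt (c / 2) * sqrt (2 / c) = 1" using c by (simp add: real_sqrt_mult[symmetric])
    finally show ?thesis by simp
   qed
   also have "a^2 = A x" using P(2) by (simp add: a_def A_def N_def power_mult_distrib power_divide)
   also have "b^2 = B x" using Q(2) by (simp add: b_def B_def power_mult_distrib)
   finally show ?thesis .
  qed
  finally have "\<theta>' x \<bullet> \<beta> x \<le> (c / 2) * A x + (2 / c) * B x - c * A x" by simp
  with 1 show ?thesis by (simp add: field_simps)
 qed
 have contA: "continuous_on UNIV A" and contB: "continuous_on UNIV B" and contE: "continuous_on UNIV E"
  unfolding A_def B_def E_def using v0
  by (auto intro!: continuous_intros contz contv z(2) v(2) cc P Q contG e(2))
 have iA: "integrable lborel A" and iB: "integrable lborel B" and iE: "integrable lborel E"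
  by (rule integrable_continuous_compact_support[OF contA, of b] integrable_continuous_compact_support[OF contB, of b]
     integrable_continuous_compact_support[OF contE, of b]; simp add: A_def B_def E_def z)+
 have contdiv: "continuous_on UNIV (\<lambda>x. \<Sum>i\<in>Basis. \<beta>' x i \<bullet> i)"
  by (intro continuous_intros b(2))
 have "0 \<le> (LBINT x. - (c / 2) * A x + (2 / c) * B x + E x)"
  unfolding zero[symmetric]
 proof (intro integral_mono point)
  show "integrable lborel (\<lambda>x. \<theta> x * (\<Sum>i\<in>Basis. \<beta>' x i \<bullet> i) + \<theta>' x \<bullet> \<beta> x)"
  proof (rule integrable_continuous_compact_support[of _ b])
   show "continuous_on UNIV (\<lambda>x. \<theta> x * (\<Sum>i\<in>Basis. \<beta>' x i \<bullet> i) + \<theta>' x \<bullet> \<beta> x)"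
    by (intro continuous_on_add continuous_on_mult contdiv contth continuous_on_inner contth' contb)
  qed (simp add: \<theta>_def \<theta>'_def z)
  show "integrable lborel (\<lambda>x. - (c / 2) * A x + (2 / c) * B x + E x)"
   using iA iB iE by (intro Bochner_Integration.integrable_add integrable_mult_right) auto
 qed
 also have "\<dots> = - (c / 2) * (LBINT x. A x) + (2 / c) * (LBINT x. B x) + (LBINT x. E x)"
  using iA iB iE by simp
 finally show ?thesis by (simp add: A_def B_def E_def w_def)
qed

section \<open>Approximate supersolutions and estimates for their logarithms\<close>

lemma integrable_indicator_ball [simp]: "integrable lborel (\<lambda>x. indicator (ball c r) x :: real)"
 using integrable_continuous_bounded_set[of "\<lambda>_. 1" "ball c r"] by simp

lemma poincare_ball:
 fixes \<phi> :: "'a::euclidean_space => real" and ga :: "'a => 'a"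
 assumes der: "\<And>x. (\<phi> has_derivative (\<lambda>h. ga x \<bullet> h)) (at x)" and cont: "continuous_on UNIV ga"
  and Z: "Z \<in> sets borel" "Z \<subseteq> ball 0 r" "\<And>x. x \<in> Z ==> \<phi> x = 0"
 shows "measure lborel Z * (LBINT x. indicator (ball 0 r) x * (\<phi> x)^2)
  \<le> (2 * r)^2 * 2 ^ DIM('a) * measure lborel (ball (0::'a) r) * (LBINT x. indicator (ball 0 r) x * (norm (ga x))^2)"
proof -
 have contphi: "continuous_on UNIV \<phi>"
  using der by (meson continuous_at_imp_continuous_on has_derivative_continuous)
 have fin: "emeasure lborel Z = ennreal (measure lborel Z)"
 proof (rule emeasure_eq_ennreal_measure)
  have "emeasure lborel Z \<le> emeasure lborel (ball (0::'a) r)" using Z by (intro emeasure_mono) auto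
  then show "emeasure lborel Z \<noteq> top" using emeasure_lborel_ball_finite[of "0::'a" r] by (auto simp: top_unique)
 qed
 have finB: "emeasure lborel (ball (0::'a) r) = ennreal (measure lborel (ball (0::'a) r))"
  by (rule emeasure_eq_ennreal_measure) (use emeasure_lborel_ball_finite[of "0::'a" r] in auto)
 have "emeasure lborel Z * (\<integral>\<^sup>+x. ennreal ((\<phi> x)^2) * indicator (ball 0 r) x \<partial>lborel)
  \<le> ennreal ((2 * r)^2 * 2 ^ DIM('a)) * emeasure lborel (ball (0::'a) r) * (\<integral>\<^sup>+x. ennreal ((norm (ga x))^2) * indicator (ball 0 r) x \<partial>lborel)"
 proof (rule poincare_zero_set[OF der cont])
  fix x y :: 'a assume "x \<in> ball 0 r" "y \<in> ball 0 r"
  then show "norm (x - y) \<le> 2 * r" using norm_triangle_ineq4[of x y] by simp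
 qed (use Z in auto)
 moreover have "(\<integral>\<^sup>+x. ennreal ((\<phi> x)^2) * indicator (ball 0 r) x \<partial>lborel) = ennreal (LBINT x. indicator (ball 0 r) x * (\<phi> x)^2)"
  by (rule nn_integral_eq_integral_bounded_set) (auto intro!: continuous_intros contphi)
 moreover have "(\<integral>\<^sup>+x. ennreal ((norm (ga x))^2) * indicator (ball 0 r) x \<partial>lborel) = ennreal (LBINT x. indicator (ball 0 r) x * (norm (ga x))^2)"
  by (rule nn_integral_eq_integral_bounded_set) (auto intro!: continuous_intros cont)
 ultimately show ?thesis
  unfolding fin finB by (simp add: ennreal_mult'[symmetric] ennreal_le_iff)
qed

lemma faber_krahn_compact_support:
 fixes \<phi> :: "'a::euclidean_space => real" and ga :: "'a => 'a"
 assumes der: "\<And>x. (\<phi> has_derivative (\<lambda>h. ga x \<bullet> h)) (at x)" and cont: "continuous_on UNIV ga"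
  and b: "\<And>x. norm x \<ge> b ==> \<phi> x = 0" "\<And>x. norm x \<ge> b ==> ga x = 0"
  and S: "S \<in> sets borel" "bounded S" "\<And>x. x \<notin> S ==> \<phi> x = 0"
  and s: "s > 0" "2 * measure lborel S \<le> measure lborel (ball (0::'a) s)"
 shows "(LBINT x. (\<phi> x)^2) \<le> 8 * s^2 * 2 ^ DIM('a) * (LBINT x. (norm (ga x))^2)"
proof -
 have contphi: "continuous_on UNIV \<phi>"
  using der by (meson continuous_at_imp_continuous_on has_derivative_continuous)
 have fin: "emeasure lborel S = ennreal (measure lborel S)"
  by (rule emeasure_eq_ennreal_measure) (use emeasure_bounded_finite[OF S(2)] in auto)
 have finB: "emeasure lborel (ball (0::'a) s) = ennreal (measure lborel (ball (0::'a) s))"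
  by (rule emeasure_eq_ennreal_measure) (use emeasure_lborel_ball_finite[of "0::'a" s] in auto)
 have "(\<integral>\<^sup>+x. ennreal ((\<phi> x)^2) \<partial>lborel)
  \<le> ennreal (8 * s^2 * 2 ^ DIM('a)) * (\<integral>\<^sup>+x. ennreal ((norm (ga x))^2) \<partial>lborel)"
 proof (rule faber_krahn_balls[OF der cont S(1) S(3) s(1)])
  have "2 * emeasure lborel S = ennreal (2 * measure lborel S)"
   unfolding fin by (simp add: ennreal_mult')
  then show "2 * emeasure lborel S \<le> emeasure lborel (ball (0::'a) s)"
   unfolding finB using s(2) by (simp add: ennreal_leI)
 qed
 moreover have "(\<integral>\<^sup>+x. ennreal ((\<phi> x)^2) \<partial>lborel) = ennreal (LBINT x. (\<phi> x)^2)"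
  by (rule nn_integral_eq_integral, rule integrable_continuous_compact_support[of _ b])
   (auto intro!: continuous_intros contphi simp: b)
 moreover have "(\<integral>\<^sup>+x. ennreal ((norm (ga x))^2) \<partial>lborel) = ennreal (LBINT x. (norm (ga x))^2)"
  by (rule nn_integral_eq_integral, rule integrable_continuous_compact_support[of _ b])
   (auto intro!: continuous_intros cont simp: b)
 ultimately show ?thesis
  by (simp add: ennreal_mult'[symmetric] ennreal_le_iff)
qed

text \<open>Divergence-form supersolutions without weak derivatives: v is a uniform limit of
  differentiable \<open>w\<close>, each with a field \<beta> that is bounded by the gradient of
  \<open>w\<close>, is coercive against it with constant \<open>c\<close>, and has divergence at
  most a nonnegative \<open>e\<close> of small integral over a given ball. No formula for \<beta> in
  terms of the gradient is imposed, so nonlinear equations and sums of solutions fit.\<close>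

definition supersol_approx :: "real => ('a::euclidean_space => real) => bool" where
 "supersol_approx c v \<longleftrightarrow> (\<forall>r>0. \<forall>ep>0. \<exists>w g \<beta> \<beta>' e.
  (\<forall>x. (w has_derivative (\<lambda>h. g x \<bullet> h)) (at x)) \<and> continuous_on UNIV g \<and>
  (\<forall>x. (\<beta> has_derivative \<beta>' x) (at x)) \<and> (\<forall>i\<in>Basis. continuous_on UNIV (\<lambda>x. \<beta>' x i)) \<and>
  (\<forall>x. norm (\<beta> x) \<le> norm (g x)) \<and> (\<forall>x. c * (norm (g x))^2 \<le> \<beta> x \<bullet> g x) \<and>
  (\<forall>x. (\<Sum>i\<in>Basis. \<beta>' x i \<bullet> i) \<le> e x) \<and> continuous_on UNIV e \<and> (\<forall>x. 0 \<le> e x) \<and>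
  (\<forall>x. \<bar>w x - v x\<bar> \<le> ep) \<and> (LBINT x. indicator (ball 0 r) x * e x) \<le> ep)"

lemma abs_ln_diff_le:
 assumes "a \<ge> m" "b \<ge> m" "m > (0::real)"
 shows "\<bar>ln a - ln b\<bar> \<le> \<bar>a - b\<bar> / m"
proof -
 have *: "ln a - ln b \<le> \<bar>a - b\<bar> / m" if "a \<ge> m" "b \<ge> m" for a b
 proof -
  have "ln a - ln b = ln (a / b)" using that assms by (simp add: ln_div)
  also have "\<dots> \<le> a / b - 1" using that assms by (intro ln_le_minus_one) auto
  also have "\<dots> = (a - b) / b" using that assms by (simp add: field_simps)
  also have "\<dots> \<le> \<bar>a - b\<bar> / m" using that assms by (intro frac_le) auto
  finally show ?thesis .
 qed
 show ?thesis using *[of a b] *[of b a] assms by (simp add: abs_le_iff abs_minus_commute)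
qed

text \<open>The energy inequality for all admissible weights at once, after the error density
  \<open>e\<close> has been absorbed: it contributes \<open>ka\<close> times an upper bound
  \<open>Gm\<close> of \<open>G\<close> along - ln V.\<close>

definition log_energy_bound :: "real => real => real => ('a::euclidean_space => real) => ('a => 'a) => bool" where
 "log_energy_bound c r ka V g \<longleftrightarrow> (\<forall>\<zeta> d G G' P Q Gm.
   (\<forall>x. (\<zeta> has_derivative (\<lambda>h. d x \<bullet> h)) (at x)) --> continuous_on UNIV d -->
   (\<forall>x. norm x \<ge> r --> \<zeta> x = 0) --> (\<forall>x. norm x \<ge> r --> d x = 0) -->
   (\<forall>x. 0 \<le> \<zeta> x) --> (\<forall>x. \<zeta> x \<le> 1) -->
   (\<forall>s. (G has_real_derivative G' s) (at s)) --> continuous_on UNIV G' --> (\<forall>s. G s \<ge> 0) -->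
   continuous_on UNIV P --> (\<forall>s. P s \<ge> 0) --> (\<forall>s. P s \<le> G s + G' s) -->
   continuous_on UNIV Q --> (\<forall>s. Q s \<ge> 0) --> (\<forall>s. (G s)^2 \<le> P s * Q s) --> (\<forall>x. G (- ln (V x)) \<le> Gm) -->
   (c / 2) * (LBINT x. (\<zeta> x)^2 * P (- ln (V x)) * (norm (g x))^2 / (V x)^2)
    \<le> (2 / c) * (LBINT x. (norm (d x))^2 * Q (- ln (V x))) + ka * Gm)"

lemmas log_energy_boundD = log_energy_bound_def[THEN iffD1, rule_format]

text \<open>Adding \<tau> keeps the approximation above \<tau> / 2 as soon as ep \<le> \<tau> / 2.
  So its logarithm is controlled, and the error term, which carries a factor 1 / V, costs at most 2
  ep / \<tau> times the bound on \<open>G\<close>.\<close>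

lemma supersol_approx_log:
 fixes v :: "'a::euclidean_space => real"
 assumes sa: "supersol_approx c v" and c: "c > 0" and v0: "\<And>x. v x \<ge> 0"
  and tau: "\<tau> > 0" and r: "r > 0" and eps: "0 < ep" "ep \<le> \<tau> / 2"
 obtains V g where "\<And>x. (V has_derivative (\<lambda>h. g x \<bullet> h)) (at x)" "continuous_on UNIV g" "\<And>x. V x \<ge> \<tau> / 2"
  "\<And>x. \<bar>V x - (v x + \<tau>)\<bar> \<le> ep" "\<And>x. \<bar>ln (V x) - ln (v x + \<tau>)\<bar> \<le> 2 * ep / \<tau>"
  "log_energy_bound c r (2 * ep / \<tau>) V g"
proof -
 obtain w g \<beta> \<beta>' e where w: "\<And>x. (w has_derivative (\<lambda>h. g x \<bullet> h)) (at x)" "continuous_on UNIV g"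
  "\<And>x. (\<beta> has_derivative \<beta>' x) (at x)" "\<And>i. i\<in>Basis ==> continuous_on UNIV (\<lambda>x. \<beta>' x i)"
  "\<And>x. norm (\<beta> x) \<le> norm (g x)" "\<And>x. c * (norm (g x))^2 \<le> \<beta> x \<bullet> g x"
  "\<And>x. (\<Sum>i\<in>Basis. \<beta>' x i \<bullet> i) \<le> e x" "continuous_on UNIV e" "\<And>x. 0 \<le> e x"
  "\<And>x. \<bar>w x - v x\<bar> \<le> ep" "(LBINT x. indicator (ball 0 r) x * e x) \<le> ep"
  using sa[unfolded supersol_approx_def, rule_format, OF r eps(1)] by blast
 define V where "V x = w x + \<tau>" for x
 have V: "V x \<ge> \<tau> / 2" for x using w(10)[of x] v0[of x] eps by (simp add: V_def)
 have Vpos: "V x > 0" for x using V[of x] tau by simp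
 have dV: "(V has_derivative (\<lambda>h. g x \<bullet> h)) (at x)" for x
  unfolding V_def[abs_def] by (auto intro!: derivative_eq_intros w(1))
 have contV: "continuous_on UNIV V"
  using dV by (meson continuous_at_imp_continuous_on has_derivative_continuous)
 show ?thesis
 proof (rule that[of V g])
  show "(V has_derivative (\<lambda>h. g x \<bullet> h)) (at x)" for x by (rule dV)
  show "continuous_on UNIV g" by (rule w)
  show "V x \<ge> \<tau> / 2" for x by (rule V)
  show near: "\<bar>V x - (v x + \<tau>)\<bar> \<le> ep" for x using w(10)[of x] by (simp add: V_def)
  show "\<bar>ln (V x) - ln (v x + \<tau>)\<bar> \<le> 2 * ep / \<tau>" for x
  proof -
   have "\<bar>ln (V x) - ln (v x + \<tau>)\<bar> \<le> \<bar>V x - (v x + \<tau>)\<bar> / (\<tau> / 2)"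
    using V[of x] v0[of x] tau by (intro abs_ln_diff_le) auto
   also have "\<dots> \<le> ep / (\<tau> / 2)" using near[of x] tau by (intro divide_right_mono) auto
   finally show ?thesis by (simp add: mult.commute)
  qed
 show "log_energy_bound c r (2 * ep / \<tau>) V g"
  unfolding log_energy_bound_def
 proof (intro allI impI)
  fix \<zeta> :: "'a => real" and d and G G' P Q and Gm :: real
  assume z0: "\<forall>x. (\<zeta> has_derivative (\<lambda>h. d x \<bullet> h)) (at x)" "continuous_on UNIV d"
   "\<forall>x. norm x \<ge> r --> \<zeta> x = 0" "\<forall>x. norm x \<ge> r --> d x = 0"
   and z010: "\<forall>x. 0 \<le> \<zeta> x" "\<forall>x. \<zeta> x \<le> 1"
   and G0: "\<forall>s. (G has_real_derivative G' s) (at s)" "continuous_on UNIV G'" "\<forall>s. G s \<ge> 0"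
   and P0: "continuous_on UNIV P" "\<forall>s. P s \<ge> 0" "\<forall>s. P s \<le> G s + G' s"
   and Q0: "continuous_on UNIV Q" "\<forall>s. Q s \<ge> 0" "\<forall>s. (G s)^2 \<le> P s * Q s"
   and Gm0: "\<forall>x. G (- ln (V x)) \<le> Gm"
  note z = z0[rule_format] and z01 = z010[rule_format] and G = G0[rule_format] and P = P0[rule_format]
   and Q = Q0[rule_format] and Gm = Gm0[rule_format]
  have E1: "(c / 2) * (LBINT x. (\<zeta> x)^2 * P (- ln (V x)) * (norm (g x))^2 / (V x)^2)
    \<le> (2 / c) * (LBINT x. (norm (d x))^2 * Q (- ln (V x))) + (LBINT x. e x * (\<zeta> x)^2 * G (- ln (V x)) / V x)"
   by (rule energy_inequality[OF dV w(2) Vpos w(3,4,5,6) c w(7,8) z G P Q])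
  have E2: "(LBINT x. e x * (\<zeta> x)^2 * G (- ln (V x)) / V x) \<le> (LBINT x. (2 * Gm / \<tau>) * (indicator (ball 0 r) x * e x))"
  proof (rule integral_mono)
   have contG: "continuous_on UNIV G"
    using G(1) by (meson DERIV_isCont continuous_at_imp_continuous_on)
   have contz: "continuous_on UNIV \<zeta>"
    using z(1) by (meson continuous_at_imp_continuous_on has_derivative_continuous)
   have V0: "V x \<noteq> 0" for x using Vpos[of x] by simp
   have "continuous_on UNIV (\<lambda>x. - ln (V x))"
    by (intro continuous_intros contV) (simp add: V0)
   then have "continuous_on UNIV (\<lambda>x. G (- ln (V x)))"
    by (intro continuous_on_compose2[OF contG]) auto
   then show "integrable lborel (\<lambda>x. e x * (\<zeta> x)^2 * G (- ln (V x)) / V x)"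
    by (intro integrable_continuous_compact_support[of _ r] continuous_intros contV w(8) contz) (auto simp: V0 z(3))
   show "integrable lborel (\<lambda>x. (2 * Gm / \<tau>) * (indicator (ball 0 r) x * e x))"
    by (intro integrable_mult_right integrable_continuous_bounded_set w(8)) auto
   fix x
   show "e x * (\<zeta> x)^2 * G (- ln (V x)) / V x \<le> (2 * Gm / \<tau>) * (indicator (ball 0 r) x * e x)"
   proof (cases "norm x < r")
    case True
    have "Gm \<ge> 0" using Gm[of x] G(3)[of "- ln (V x)"] by simp
    then have "e x * (\<zeta> x)^2 * G (- ln (V x)) / V x \<le> e x * 1 * Gm / (\<tau> / 2)"
     using V[of x] tau w(9)[of x] z01[of x] Gm[of x] G(3)[of "- ln (V x)"]
     by (intro frac_le mult_mono power_le_one mult_nonneg_nonneg) auto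
    also have "\<dots> = (2 * Gm / \<tau>) * (indicator (ball 0 r) x * e x)"
     using True by (simp add: field_simps)
    finally show ?thesis .
   next
    case False
    then have "\<zeta> x = 0" using z(3) by auto
    then show ?thesis using False by simp
   qed
  qed
  have E3: "(LBINT x. (2 * Gm / \<tau>) * (indicator (ball 0 r) x * e x)) \<le> (2 * Gm / \<tau>) * ep"
  proof -
   have "Gm \<ge> 0" using Gm[of 0] G(3)[of "- ln (V 0)"] by simp
   then show ?thesis using tau w(11) by (simp add: mult_left_mono divide_right_mono)
  qed
  show "(c / 2) * (LBINT x. (\<zeta> x)^2 * P (- ln (V x)) * (norm (g x))^2 / (V x)^2)
    \<le> (2 / c) * (LBINT x. (norm (d x))^2 * Q (- ln (V x))) + 2 * ep / \<tau> * Gm"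
  proof -
   have "(2 * Gm / \<tau>) * ep = 2 * ep / \<tau> * Gm" by simp
   then show ?thesis using E1 E2 E3 by linarith
  qed
 qed
 qed
qed

lemma integral_double_add:
 fixes f g :: "'a => real"
 assumes "integrable M f" "integrable M g"
 shows "(\<integral>x. 2 * f x + 2 * g x \<partial>M) = 2 * (\<integral>x. f x \<partial>M) + 2 * (\<integral>x. g x \<partial>M)"
 using assms by simp

lemma power2_add_le: "((a::real) + b)^2 \<le> 2 * a^2 + 2 * b^2"
 using sum_squares_bound[of a b] by (simp add: power2_sum)

lemma power2_norm_add_le:
 fixes x y :: "'a::real_normed_vector"
 shows "(norm (x + y))^2 \<le> 2 * (norm x)^2 + 2 * (norm y)^2"
 by (rule order_trans[OF power_mono[OF norm_triangle_ineq] power2_add_le]) simp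

lemma pos_part_sq_le:
 fixes a b :: real
 assumes "max 0 a \<le> b + \<sigma>" "0 \<le> b" "0 \<le> \<sigma>"
 shows "(max 0 a)^2 \<le> 2 * b^2 + 2 * \<sigma>^2"
 by (rule order_trans[OF power_mono[OF assms(1)] power2_add_le]) simp

text \<open>The weight G = 1 bounds the mean square of the gradient of ln V by a multiple of 1 /
  r^2, whatever the size of v. The positive part of ln \<eta> - ln V vanishes on a fraction \<theta>
  of the ball, so the Poincare inequality gives a mean square bound that depends neither on r nor on
  \<tau>; both can therefore be chosen later.\<close>

lemma log_L2_bound:
 fixes v :: "'a::euclidean_space => real"
 assumes sa: "supersol_approx c v" and c: "c > 0" and contv: "continuous_on UNIV v" and v0: "\<And>x. v x \<ge> 0"
  and eta: "\<eta> > 0" and tau: "\<tau> > 0" and r: "r > 0" and theta: "\<theta> > 0"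
  and Z: "\<theta> * measure lborel (ball (0::'a) r) \<le> measure lborel {x \<in> ball 0 r. v x > \<eta>}"
 shows "(LBINT x. indicator (ball 0 r) x * (max 0 (- ln (v x + \<tau>) + ln \<eta>))^2)
  \<le> (32 * 2 ^ DIM('a) / (\<theta> * c^2) * (64 * 2 ^ DIM('a) + 1) + 2) * measure lborel (ball (0::'a) r)"
proof -
 define M where "M = measure lborel (ball (0::'a) r)"
 have M: "M > 0" using r by (simp add: M_def content_ball_pos)
 define N :: real where "N = 2 ^ DIM('a)"
 have N: "N > 0" by (simp add: N_def)
 \<comment> \<open>The second entry makes the error 2 ep / \<tau> comparable with the cut-off term,
   of order M / r^2; the first keeps the error of the logarithm at most 1/2.\<close>
 define ep where "ep = min (\<tau> / 4) (\<tau> * M / (c * r^2))"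
 have eps: "ep > 0" "ep \<le> \<tau> / 2" "2 * ep / \<tau> \<le> 1 / 2"
  using tau M c r by (auto simp: ep_def field_simps)
 have "ep \<le> \<tau> * M / (c * r^2)" by (simp add: ep_def)
 then have "2 * ep / \<tau> \<le> 2 * (\<tau> * M / (c * r^2)) / \<tau>" using tau by (intro divide_right_mono) auto
 then have r2: "2 * r > 0" and eps2: "2 * ep / \<tau> \<le> 2 / c * (M / r^2)" using tau r by simp_all
 obtain V g where V: "\<And>x. (V has_derivative (\<lambda>h. g x \<bullet> h)) (at x)" "continuous_on UNIV g" "\<And>x. V x \<ge> \<tau> / 2"
  "\<And>x. \<bar>V x - (v x + \<tau>)\<bar> \<le> ep" "\<And>x. \<bar>ln (V x) - ln (v x + \<tau>)\<bar> \<le> 2 * ep / \<tau>"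
  and en: "log_energy_bound c (2 * r) (2 * ep / \<tau>) V g"
  by (rule supersol_approx_log[OF sa c v0 tau r2 eps(1,2)]) (rule that)
 have Vpos: "V x > 0" and V0: "V x \<noteq> 0" for x using V(3)[of x] tau by auto
 have contV: "continuous_on UNIV V"
  using V(1) by (meson continuous_at_imp_continuous_on has_derivative_continuous)
 obtain \<zeta> :: "'a => real" and d where z: "\<And>x. (\<zeta> has_derivative (\<lambda>h. d x \<bullet> h)) (at x)" "continuous_on UNIV d"
  "\<And>x. norm x \<le> r ==> \<zeta> x = 1" "\<And>x. norm x \<ge> 2 * r ==> \<zeta> x = 0" "\<And>x. norm x \<ge> 2 * r ==> d x = 0"
  "\<And>x. 0 \<le> \<zeta> x" "\<And>x. \<zeta> x \<le> 1" "\<And>x. norm (d x) \<le> 8 / (2 * r - r)"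
  using radial_cutoff[of r "2 * r", where 'a = 'a] r by (metis mult_2 less_add_same_cancel1)
 have contz: "continuous_on UNIV \<zeta>"
  using z(1) by (meson continuous_at_imp_continuous_on has_derivative_continuous)
 define A where "A = (LBINT x. (\<zeta> x)^2 * (norm (g x))^2 / (V x)^2)"
 have iA: "integrable lborel (\<lambda>x. (\<zeta> x)^2 * (norm (g x))^2 / (V x)^2)"
  by (rule integrable_continuous_compact_support[of _ "2 * r"])
   (auto intro!: continuous_intros contz contV V(2) simp: V0 z(4))
 have D: "(LBINT x. (norm (d x))^2) \<le> 64 * N * M / r^2"
 proof -
  have "(LBINT x. (norm (d x))^2) \<le> (LBINT x. 64 / r^2 * indicator (ball (0::'a) (2 * r)) x)"
  proof (rule integral_mono)
   show "integrable lborel (\<lambda>x. (norm (d x))^2)"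
    by (rule integrable_continuous_compact_support[of _ "2 * r"]) (auto intro!: continuous_intros z(2) simp: z(5))
   show "integrable lborel (\<lambda>x::'a. 64 / r^2 * indicator (ball 0 (2 * r)) x :: real)"
    by (intro integrable_mult_right integrable_indicator_ball)
   fix x
   have "(norm (d x))^2 \<le> (8 / r)^2" using z(8)[of x] by (intro power_mono) auto
   then show "(norm (d x))^2 \<le> 64 / r^2 * indicator (ball 0 (2 * r)) x"
    using z(5)[of x] by (auto simp: indicator_def power_divide)
  qed
  also have "\<dots> = 64 / r^2 * measure lborel (ball (0::'a) (2 * r))" by simp
  also have "measure lborel (ball (0::'a) (2 * r)) = N * M"
   using r by (simp add: content_ball M_def N_def power_mult_distrib)
  finally show ?thesis by simp
 qed
 have "(c / 2) * A \<le> (2 / c) * (LBINT x. (norm (d x))^2) + 2 * ep / \<tau>"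
  using log_energy_boundD[OF en, OF z(1,2,4,5,6,7), of "\<lambda>_. 1" "\<lambda>_. 0" "\<lambda>_. 1" "\<lambda>_. 1" 1] by (simp add: A_def)
 also have "\<dots> \<le> (2 / c) * (64 * N * M / r^2) + 2 / c * (M / r^2)"
  using D eps2 c by (intro add_mono mult_left_mono) auto
 also have "\<dots> = (c / 2) * ((4 / c^2) * (64 * N + 1) * M / r^2)"
  using c r by (simp add: field_simps power2_eq_square)
 finally have A: "A \<le> (4 / c^2) * (64 * N + 1) * M / r^2"
  by (rule mult_left_le_imp_le) (use c in simp)
 \<comment> \<open>The smoothing error 1/2 and the error 1/2 of the logarithm add up to 1, which
   produces the summand 2 of the constant.\<close>
 define de :: real where "de = 1 / 2"
 have delta: "de > 0" by (simp add: de_def)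
 define \<phi> where "\<phi> x = soft_pos de (- ln (V x) + ln \<eta>)" for x
 define ga where "ga x = (soft_pos' de (- ln (V x) + ln \<eta>) * (- 1 / V x)) *R g x" for x
 have dphi: "(\<phi> has_derivative (\<lambda>h. ga x \<bullet> h)) (at x)" for x
 proof -
  have "((\<lambda>x. - ln (V x) + ln \<eta>) has_derivative (\<lambda>h. (- 1 / V x) * (g x \<bullet> h))) (at x)"
   using Vpos[of x] by (auto intro!: derivative_eq_intros V(1) simp: field_simps)
  from has_derivative_compose[OF this soft_pos_deriv[OF delta, unfolded has_field_derivative_def]]
  show ?thesis by (simp add: \<phi>_def[abs_def] ga_def mult_ac)
 qed
 have contln: "continuous_on UNIV (\<lambda>x. - ln (V x) + ln \<eta>)"
  by (intro continuous_intros contV) (simp add: V0)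
 have contg: "continuous_on UNIV ga"
  unfolding ga_def by (intro continuous_intros contV V(2) soft_pos_cont contln delta) (simp add: V0)
 have contphi: "continuous_on UNIV \<phi>"
  using dphi by (meson continuous_at_imp_continuous_on has_derivative_continuous)
 define S where "S = {x \<in> ball 0 r. v x > \<eta>}"
 have Sb: "S \<in> sets borel"
 proof -
  have "S = ball 0 r \<inter> {x. \<eta> < v x}" by (auto simp: S_def)
  then show ?thesis using contv by (auto intro!: borel_open open_Int open_Collect_less continuous_intros)
 qed
 have zero: "\<phi> x = 0" if "x \<in> S" for x
 proof -
  have "V x \<ge> \<eta>" using V(4)[of x] that eps tau unfolding S_def by auto
  then have "- ln (V x) + ln \<eta> \<le> 0" using eta by simp
  then show ?thesis unfolding \<phi>_def by (rule soft_pos_bounds(6)[OF delta])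
 qed
 have gle: "indicator (ball 0 r) x * (norm (ga x))^2 \<le> (\<zeta> x)^2 * (norm (g x))^2 / (V x)^2" for x
 proof (cases "norm x < r")
  case True
  have "\<bar>soft_pos' de (- ln (V x) + ln \<eta>)\<bar> \<le> 1" using soft_pos_bounds(4,5)[OF delta] by (simp add: abs_le_iff)
  then have "(soft_pos' de (- ln (V x) + ln \<eta>))^2 \<le> 1" by (simp add: abs_square_le_1)
  then have "(soft_pos' de (- ln (V x) + ln \<eta>))^2 * ((norm (g x))^2 / (V x)^2) \<le> 1 * ((norm (g x))^2 / (V x)^2)"
   by (intro mult_right_mono) auto
  then show ?thesis using True z(3)[of x] by (simp add: ga_def power_mult_distrib power_divide)
 qed auto
 have Gam: "(LBINT x. indicator (ball 0 r) x * (norm (ga x))^2) \<le> A"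
  unfolding A_def
  by (intro integral_mono iA gle integrable_continuous_bounded_set continuous_intros contg) auto
 have iphi: "integrable lborel (\<lambda>x. indicator (ball 0 r) x * (\<phi> x)^2)"
  by (intro integrable_continuous_bounded_set continuous_intros contphi) auto
 define I where "I = (LBINT x. indicator (ball 0 r) x * (\<phi> x)^2)"
 have I0: "I \<ge> 0" unfolding I_def by (intro Bochner_Integration.integral_nonneg) auto
 have "\<theta> * M * I \<le> measure lborel S * I" using Z I0 by (intro mult_right_mono) (auto simp: M_def S_def)
 also have "\<dots> \<le> (2 * r)^2 * N * M * (LBINT x. indicator (ball 0 r) x * (norm (ga x))^2)"
  unfolding I_def N_def M_def by (rule poincare_ball[OF dphi contg Sb]) (auto simp: S_def intro!: zero)
 also have "\<dots> \<le> (2 * r)^2 * N * M * A"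
  using Gam N M by (intro mult_left_mono) auto
 also have "\<dots> \<le> (2 * r)^2 * N * M * ((4 / c^2) * (64 * N + 1) * M / r^2)"
  using A N M by (intro mult_left_mono) auto
 also have "\<dots> = \<theta> * M * (16 * N / (\<theta> * c^2) * (64 * N + 1) * M)"
  using r theta c by (simp add: field_simps power2_eq_square)
 finally have I: "I \<le> 16 * N / (\<theta> * c^2) * (64 * N + 1) * M"
  by (rule mult_left_le_imp_le) (use theta M in simp)
 have "(LBINT x. indicator (ball 0 r) x * (max 0 (- ln (v x + \<tau>) + ln \<eta>))^2)
   \<le> (LBINT x. 2 * (indicator (ball 0 r) x * (\<phi> x)^2) + 2 * indicator (ball 0 r) x)"
 proof (rule integral_mono)
  have vt: "v x + \<tau> \<noteq> 0" for x using v0[of x] tau by simp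
  show "integrable lborel (\<lambda>x. indicator (ball 0 r) x * (max 0 (- ln (v x + \<tau>) + ln \<eta>))^2)"
   by (intro integrable_continuous_bounded_set continuous_intros contv) (auto simp: vt)
  show "integrable lborel (\<lambda>x. 2 * (indicator (ball 0 r) x * (\<phi> x)^2) + 2 * indicator (ball 0 r) x)"
   by (intro Bochner_Integration.integrable_add integrable_mult_right iphi integrable_indicator_ball)
  fix x
  have "max 0 (- ln (V x) + ln \<eta>) - 1 / 2 \<le> \<phi> x"
   using soft_pos_bounds(3)[OF delta, of "- ln (V x) + ln \<eta>"] by (simp add: \<phi>_def de_def)
  moreover have "\<bar>ln (V x) - ln (v x + \<tau>)\<bar> \<le> 1 / 2" using V(5)[of x] eps(3) by linarith
  ultimately have "max 0 (- ln (v x + \<tau>) + ln \<eta>) \<le> \<phi> x + 1" by linarith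
  then have "(max 0 (- ln (v x + \<tau>) + ln \<eta>))^2 \<le> 2 * (\<phi> x)^2 + 2 * 1^2"
   by (rule pos_part_sq_le) (auto simp: \<phi>_def soft_pos_bounds delta)
  then show "indicator (ball 0 r) x * (max 0 (- ln (v x + \<tau>) + ln \<eta>))^2
    \<le> 2 * (indicator (ball 0 r) x * (\<phi> x)^2) + 2 * indicator (ball 0 r) x"
   by (auto simp: indicator_def)
 qed
 also have "\<dots> = 2 * I + 2 * M"
  using iphi by (subst Bochner_Integration.integral_add)
   (auto intro!: integrable_mult_right integrable_real_indicator emeasure_lborel_ball_finite simp: I_def M_def)
 also have "\<dots> \<le> 2 * (16 * N / (\<theta> * c^2) * (64 * N + 1) * M) + 2 * M" using I by simp
 finally show ?thesis by (simp add: M_def[symmetric] N_def[symmetric] algebra_simps)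
qed

text \<open>The weight \<open>soft_pos_sq\<close> gives a Caccioppoli estimate for the truncation of
  - ln (v + \<tau>) at level k'. The truncation lives on a set of small measure, so Faber-Krahn
  turns the gradient bound into the factor s^2 / (rh - rh')^2. The gap k < k' absorbs the error of
  the approximation, which afterwards tends to 0.\<close>

lemma log_caccioppoli:
 fixes v :: "'a::euclidean_space => real"
 assumes sa: "supersol_approx c v" and c: "c > 0" and contv: "continuous_on UNIV v" and v0: "\<And>x. v x \<ge> 0"
  and tau: "\<tau> > 0" and kk: "k < k'" and rho: "0 < rh'" "rh' < rh" and s: "s > 0"
  and S: "2 * measure lborel {x \<in> ball (0::'a) rh. - ln (v x + \<tau>) > k} \<le> measure lborel (ball (0::'a) s)"
 shows "(LBINT x. indicator (ball 0 rh') x * (max 0 (- ln (v x + \<tau>) - k'))^2)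
  \<le> 2048 * 2 ^ DIM('a) * (8 / c^2 + 2) * s^2 / (rh - rh')^2 *
   (LBINT x. indicator (ball 0 rh) x * (max 0 (- ln (v x + \<tau>) - k'))^2)"
proof -
 define z where "z x = - ln (v x + \<tau>)" for x
 have contz: "continuous_on UNIV z"
 proof -
  have "v x + \<tau> \<noteq> 0" for x using v0[of x] tau by simp
  then show ?thesis unfolding z_def by (intro continuous_intros contv) auto
 qed
 define M where "M = measure lborel (ball (0::'a) rh)"
 define N :: real where "N = 2 ^ DIM('a)"
 have N: "N > 0" by (simp add: N_def)
 define I where "I = (LBINT x. indicator (ball 0 rh) x * (max 0 (z x - k'))^2)"
 define L where "L = (LBINT x. indicator (ball 0 rh') x * (max 0 (z x - k'))^2)"
 define Gm where "Gm = max 0 (- ln (\<tau> / 2) - k')"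
 \<comment> \<open>The bound obtained at accuracy \<open>ep\<close>; it is continuous at 0 and
   \<open>h 0\<close> is the claim.\<close>
 define h where "h ep = 2 * (8 * s^2 * N * ((8 / c^2 + 2) * (64 / (rh - rh')^2 *
   (2 * I + 2 * (ep + 2 * ep / \<tau>)^2 * M)) + 8 * ep * Gm / (c * \<tau>))) + 2 * (ep + 2 * ep / \<tau>)^2 * M" for ep
 \<comment> \<open>Below \<open>ep0\<close> the approximation stays above \<tau> / 2 and its
   logarithm is off by at most k' - k, so truncating at k' gives 0 wherever the exact function is at
   most k.\<close>
 define ep0 where "ep0 = min (\<tau> / 2) (\<tau> * (k' - k) / 2)"
 have e0: "ep0 > 0" using tau kk by (simp add: ep0_def)
 obtain \<zeta> :: "'a => real" and d where zz: "\<And>x. (\<zeta> has_derivative (\<lambda>h. d x \<bullet> h)) (at x)" "continuous_on UNIV d"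
  "\<And>x. norm x \<le> rh' ==> \<zeta> x = 1" "\<And>x. norm x \<ge> rh ==> \<zeta> x = 0" "\<And>x. norm x \<ge> rh ==> d x = 0"
  "\<And>x. 0 \<le> \<zeta> x" "\<And>x. \<zeta> x \<le> 1" "\<And>x. norm (d x) \<le> 8 / (rh - rh')"
  using radial_cutoff[OF rho, where 'a = 'a] by metis
 have contzeta: "continuous_on UNIV \<zeta>"
  using zz(1) by (meson continuous_at_imp_continuous_on has_derivative_continuous)
 have main: "L \<le> h ep" if eps: "0 < ep" "ep < ep0" for ep
 proof -
  have eps2: "ep \<le> \<tau> / 2" "2 * ep / \<tau> \<le> k' - k"
   using eps tau by (auto simp: ep0_def field_simps)
  obtain V g where V: "\<And>x. (V has_derivative (\<lambda>h. g x \<bullet> h)) (at x)" "continuous_on UNIV g" "\<And>x. V x \<ge> \<tau> / 2"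
   "\<And>x. \<bar>V x - (v x + \<tau>)\<bar> \<le> ep" "\<And>x. \<bar>ln (V x) - ln (v x + \<tau>)\<bar> \<le> 2 * ep / \<tau>"
   and en: "log_energy_bound c rh (2 * ep / \<tau>) V g"
   by (rule supersol_approx_log[OF sa c v0 tau _ eps(1) eps2(1), of rh]) (use rho in simp, rule that)
  define \<sigma> where "\<sigma> = ep + 2 * ep / \<tau>"
  have sig: "\<sigma> \<ge> 0" using eps tau by (simp add: \<sigma>_def)
  have Vpos: "V x > 0" and V0: "V x \<noteq> 0" for x using V(3)[of x] tau by auto
  have contV: "continuous_on UNIV V"
   using V(1) by (meson continuous_at_imp_continuous_on has_derivative_continuous)
  have near: "\<bar>- ln (V x) - z x\<bar> \<le> 2 * ep / \<tau>" for x using V(5)[of x] by (simp add: z_def)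
  have top: "- ln (V x) \<le> - ln (\<tau> / 2)" for x using V(3)[of x] tau by simp
  define sp where "sp s = soft_pos ep (s - k')" for s
  define sp' where "sp' s = soft_pos' ep (s - k')" for s
  have dsh: "((\<lambda>s. s - k') has_real_derivative 1) (at s)" for s
   by (auto intro!: derivative_eq_intros)
  have dsp: "(sp has_real_derivative sp' s) (at s)" for s
   using DERIV_chain2[OF soft_pos_deriv[OF eps(1)] dsh[of s]]
   by (simp add: sp_def[abs_def] sp'_def)
  have csp: "continuous_on UNIV sp" "continuous_on UNIV sp'"
   unfolding sp_def sp'_def by (intro soft_pos_cont eps continuous_intros)+
  define Q where "Q x = (sp (- ln (V x)))^2" for x
  define D where "D = (LBINT x. (norm (d x))^2 * Q x)"
  define A where "A = (LBINT x. (\<zeta> x)^2 * (sp' (- ln (V x)))^2 * (norm (g x))^2 / (V x)^2)"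
  have contln: "continuous_on UNIV (\<lambda>x. - ln (V x))"
   by (intro continuous_intros contV) (simp add: V0)
  have cspV: "continuous_on UNIV (\<lambda>x. sp (- ln (V x)))" "continuous_on UNIV (\<lambda>x. sp' (- ln (V x)))"
   by (intro continuous_on_compose2[OF csp(1)] continuous_on_compose2[OF csp(2)] contln; simp)+
  have "(c / 2) * A \<le> (2 / c) * D + 2 * ep / \<tau> * Gm"
   unfolding A_def D_def Q_def
  proof (rule log_energy_boundD[OF en zz(1,2,4,5,6,7)])
   fix s
   show "((\<lambda>s. soft_pos_sq ep (s - k')) has_real_derivative soft_pos_sq' ep (s - k')) (at s)"
    using DERIV_chain2[OF soft_pos_sq_deriv[OF eps(1)] dsh[of s]] by simp
   show "continuous_on UNIV (\<lambda>s. soft_pos_sq' ep (s - k'))"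
    by (intro soft_pos_sq_cont eps continuous_intros)
   show "0 \<le> soft_pos_sq ep (s - k')" using soft_pos_bounds[OF eps(1)] by (simp add: soft_pos_sq_def)
   show "continuous_on UNIV (\<lambda>s. (sp' s)^2)" "continuous_on UNIV (\<lambda>s. (sp s)^2)"
    by (intro continuous_intros csp)+
   have "0 \<le> 2 * ep^2 * (max 0 (s - k'))^2 / (max 0 (s - k') + ep) ^ 4" using eps by (intro divide_nonneg_nonneg) auto
   then show "(sp' s)^2 \<le> soft_pos_sq ep (s - k') + soft_pos_sq' ep (s - k')"
    using soft_pos_bounds[OF eps(1)] by (simp add: soft_pos_sq_def soft_pos_sq'_def sp'_def)
   show "(soft_pos_sq ep (s - k'))^2 \<le> (sp' s)^2 * (sp s)^2"
    by (simp add: soft_pos_sq_def sp_def sp'_def power_mult_distrib)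
  next
   fix x
   have "soft_pos_sq ep (- ln (V x) - k') \<le> max 0 (- ln (V x) - k') * 1"
    unfolding soft_pos_sq_def by (intro mult_mono soft_pos_bounds eps) auto
   also have "\<dots> \<le> Gm" using top[of x] by (simp add: Gm_def)
   finally show "soft_pos_sq ep (- ln (V x) - k') \<le> Gm" .
  qed auto
  then have A: "A \<le> 4 / c^2 * D + 4 * ep * Gm / (c * \<tau>)"
  proof -
   assume "(c / 2) * A \<le> (2 / c) * D + 2 * ep / \<tau> * Gm"
   then have "(2 / c) * ((c / 2) * A) \<le> (2 / c) * ((2 / c) * D + 2 * ep / \<tau> * Gm)"
    using c by (intro mult_left_mono) auto
   then show ?thesis using c by (simp add: algebra_simps power2_eq_square)
  qed
  have sp_le: "sp (- ln (V x)) \<le> max 0 (z x - k') + \<sigma>" for x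
   using soft_pos_bounds(2)[OF eps(1), of "- ln (V x) - k'"] near[of x] eps divide_nonneg_pos[of "2 * ep" \<tau>] tau
   unfolding sp_def \<sigma>_def abs_le_iff max_def by (auto split: if_splits)
  have sp0: "sp s \<ge> 0" for s by (simp add: sp_def soft_pos_bounds eps)
  have M0: "M \<ge> 0" by (simp add: M_def)
  have iz: "integrable lborel (\<lambda>x. indicator (ball 0 rh) x * (max 0 (z x - k'))^2)"
   by (intro integrable_continuous_bounded_set continuous_intros contz) auto
  have iM: "integrable lborel (\<lambda>x::'a. indicator (ball 0 rh) x :: real)"
   by simp
  have D: "D \<le> 64 / (rh - rh')^2 * (2 * I + 2 * \<sigma>^2 * M)"
  proof -
   have "D \<le> (LBINT x. 64 / (rh - rh')^2 * (2 * (indicator (ball 0 rh) x * (max 0 (z x - k'))^2) + 2 * \<sigma>^2 * indicator (ball 0 rh) x))"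
    unfolding D_def
   proof (rule integral_mono)
    show "integrable lborel (\<lambda>x. (norm (d x))^2 * Q x)"
     unfolding Q_def
     by (rule integrable_continuous_compact_support[of _ rh]) (auto intro!: continuous_intros zz(2) cspV simp: zz(5))
    show "integrable lborel (\<lambda>x. 64 / (rh - rh')^2 * (2 * (indicator (ball 0 rh) x * (max 0 (z x - k'))^2) + 2 * \<sigma>^2 * indicator (ball 0 rh) x))"
     by (intro integrable_mult_right Bochner_Integration.integrable_add iz iM)
    fix x
    show "(norm (d x))^2 * Q x \<le> 64 / (rh - rh')^2 * (2 * (indicator (ball 0 rh) x * (max 0 (z x - k'))^2) + 2 * \<sigma>^2 * indicator (ball 0 rh) x)"
    proof (cases "norm x < rh")
     case True
     have 1: "(norm (d x))^2 \<le> (8 / (rh - rh'))^2" using zz(8)[of x] by (intro power_mono) auto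
     have "Q x \<le> (max 0 (z x - k') + \<sigma>)^2" unfolding Q_def by (intro power_mono sp_le sp0)
     also have "\<dots> \<le> 2 * (max 0 (z x - k'))^2 + 2 * \<sigma>^2" by (rule power2_add_le)
     finally have "(norm (d x))^2 * Q x \<le> (8 / (rh - rh'))^2 * (2 * (max 0 (z x - k'))^2 + 2 * \<sigma>^2)"
      using 1 by (intro mult_mono) (auto simp: Q_def)
     then show ?thesis using True by (simp add: power_divide)
    next
     case False
     then show ?thesis using zz(5)[of x] by simp
    qed
   qed
   also have "\<dots> = 64 / (rh - rh')^2 * (2 * I + 2 * \<sigma>^2 * M)"
    using iz iM by (simp add: I_def M_def)
   finally show ?thesis .
  qed
  define \<phi> where "\<phi> x = \<zeta> x * sp (- ln (V x))" for x
  define ga where "ga x = (\<zeta> x * sp' (- ln (V x)) * (- 1 / V x)) *R g x + sp (- ln (V x)) *R d x" for x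
  have dphi: "(\<phi> has_derivative (\<lambda>h. ga x \<bullet> h)) (at x)" for x
  proof -
   have "((\<lambda>x. - ln (V x)) has_derivative (\<lambda>h. (- 1 / V x) * (g x \<bullet> h))) (at x)"
    using Vpos[of x] by (auto intro!: derivative_eq_intros V(1) simp: field_simps)
   from has_derivative_mult[OF zz(1) has_derivative_compose[OF this dsp[unfolded has_field_derivative_def]]]
   show ?thesis unfolding \<phi>_def[abs_def]
    by (rule has_derivative_eq_rhs) (simp add: fun_eq_iff ga_def inner_diff_left mult_ac)
  qed
  have contphi: "continuous_on UNIV \<phi>"
   using dphi by (meson continuous_at_imp_continuous_on has_derivative_continuous)
  have contg: "continuous_on UNIV ga"
   unfolding ga_def by (intro continuous_intros contV V(2) cspV contzeta zz(2)) (simp add: V0)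
  define F where "F = (LBINT x. (\<phi> x)^2)"
  define S where "S = {x \<in> ball (0::'a) rh. z x > k}"
  have Sb: "S \<in> sets borel"
  proof -
   have "S = ball 0 rh \<inter> {x. k < z x}" by (auto simp: S_def)
   then show ?thesis using contz by (auto intro!: borel_open open_Int open_Collect_less continuous_intros)
  qed
  have "F \<le> 8 * s^2 * N * (LBINT x. (norm (ga x))^2)"
   unfolding F_def N_def
  proof (rule faber_krahn_compact_support[where b = rh, OF dphi contg _ _ Sb _ _ s])
   show "bounded S" by (rule bounded_subset[of "ball 0 rh"]) (auto simp: S_def)
   show "2 * measure lborel S \<le> measure lborel (ball (0::'a) s)" using assms(10) by (simp add: S_def z_def)
   fix x assume "x \<notin> S"
   show "\<phi> x = 0"
   proof (cases "norm x < rh")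
    case True
    then have "z x \<le> k" using \<open>x \<notin> S\<close> by (auto simp: S_def)
    then have "- ln (V x) - k' \<le> 0" using near[of x] eps2 by simp
    then show ?thesis using soft_pos_bounds(6)[OF eps(1)] by (simp add: \<phi>_def sp_def)
   qed (simp add: \<phi>_def zz(4))
  qed (auto simp: \<phi>_def ga_def zz)
  moreover have "(LBINT x. (norm (ga x))^2) \<le> 2 * A + 2 * D"
  proof -
   have iA: "integrable lborel (\<lambda>x. (\<zeta> x)^2 * (sp' (- ln (V x)))^2 * (norm (g x))^2 / (V x)^2)"
    by (rule integrable_continuous_compact_support[of _ rh])
     (auto intro!: continuous_intros contzeta contV V(2) cspV simp: V0 zz(4))
   have iD: "integrable lborel (\<lambda>x. (norm (d x))^2 * Q x)"
     unfolding Q_def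
     by (rule integrable_continuous_compact_support[of _ rh]) (auto intro!: continuous_intros zz(2) cspV simp: zz(5))
   have "(LBINT x. (norm (ga x))^2) \<le> (LBINT x. 2 * ((\<zeta> x)^2 * (sp' (- ln (V x)))^2 * (norm (g x))^2 / (V x)^2) + 2 * ((norm (d x))^2 * Q x))"
   proof (rule integral_mono)
    show "integrable lborel (\<lambda>x. (norm (ga x))^2)"
    proof (rule integrable_continuous_compact_support[of _ rh])
     show "continuous_on UNIV (\<lambda>x. (norm (ga x))^2)" by (intro continuous_intros contg)
    qed (simp add: ga_def zz)
    show "integrable lborel (\<lambda>x. 2 * ((\<zeta> x)^2 * (sp' (- ln (V x)))^2 * (norm (g x))^2 / (V x)^2) + 2 * ((norm (d x))^2 * Q x))"
     by (intro integrable_mult_right Bochner_Integration.integrable_add iA iD)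
    fix x
    have "(norm (ga x))^2 \<le> 2 * (norm ((\<zeta> x * sp' (- ln (V x)) * (- 1 / V x)) *R g x))^2 + 2 * (norm (sp (- ln (V x)) *R d x))^2"
     unfolding ga_def by (rule power2_norm_add_le)
    also have "\<dots> = 2 * ((\<zeta> x)^2 * (sp' (- ln (V x)))^2 * (norm (g x))^2 / (V x)^2) + 2 * ((norm (d x))^2 * Q x)"
     by (simp add: power_mult_distrib power_divide Q_def)
    finally show "(norm (ga x))^2 \<le> 2 * ((\<zeta> x)^2 * (sp' (- ln (V x)))^2 * (norm (g x))^2 / (V x)^2) + 2 * ((norm (d x))^2 * Q x)" .
   qed
   also have "\<dots> = 2 * A + 2 * D" unfolding A_def D_def by (rule integral_double_add[OF iA iD])
   finally show ?thesis .
  qed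
  ultimately have F: "F \<le> 8 * s^2 * N * (2 * A + 2 * D)"
   using N by (meson mult_left_mono order_trans zero_le_mult_iff zero_le_power2 less_imp_le zero_le_numeral)
  also have "2 * A + 2 * D \<le> (8 / c^2 + 2) * D + 8 * ep * Gm / (c * \<tau>)"
  proof -
   have "2 * (4 / c^2 * D + 4 * ep * Gm / (c * \<tau>)) = 8 / c^2 * D + 8 * ep * Gm / (c * \<tau>)" by (simp add: distrib_left)
   then show ?thesis using A unfolding distrib_right by linarith
  qed
  also have "(8 / c^2 + 2) * D \<le> (8 / c^2 + 2) * (64 / (rh - rh')^2 * (2 * I + 2 * \<sigma>^2 * M))"
   by (intro mult_left_mono D) auto
  finally have F: "F \<le> 8 * s^2 * N * ((8 / c^2 + 2) * (64 / (rh - rh')^2 * (2 * I + 2 * \<sigma>^2 * M)) + 8 * ep * Gm / (c * \<tau>))"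
   using N by (simp add: mult_left_mono)
  have "L \<le> (LBINT x. 2 * (\<phi> x)^2 + 2 * \<sigma>^2 * indicator (ball 0 rh) x)"
   unfolding L_def
  proof (rule integral_mono)
   have ip: "integrable lborel (\<lambda>x. (\<phi> x)^2)"
    
   proof (rule integrable_continuous_compact_support[of _ rh])
    show "continuous_on UNIV (\<lambda>x. (\<phi> x)^2)" by (intro continuous_intros contphi)
   qed (simp add: \<phi>_def zz)
   show "integrable lborel (\<lambda>x. 2 * (\<phi> x)^2 + 2 * \<sigma>^2 * indicator (ball 0 rh) x)"
    by (intro integrable_mult_right Bochner_Integration.integrable_add ip iM)
   show "integrable lborel (\<lambda>x. indicator (ball 0 rh') x * (max 0 (z x - k'))^2)"
    by (intro integrable_continuous_bounded_set continuous_intros contz) auto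
   fix x
   show "indicator (ball 0 rh') x * (max 0 (z x - k'))^2 \<le> 2 * (\<phi> x)^2 + 2 * \<sigma>^2 * indicator (ball 0 rh) x"
   proof (cases "norm x < rh'")
    case True
    then have 1: "\<phi> x = sp (- ln (V x))" using zz(3) by (simp add: \<phi>_def)
    have "max 0 (z x - k') \<le> \<phi> x + \<sigma>"
    proof -
     have "max 0 (- ln (V x) - k') - ep \<le> \<phi> x"
      unfolding 1 sp_def by (rule soft_pos_bounds(3)[OF eps(1)])
     then show ?thesis using near[of x] unfolding \<sigma>_def by linarith
    qed
    then have "(max 0 (z x - k'))^2 \<le> 2 * (\<phi> x)^2 + 2 * \<sigma>^2"
     by (rule pos_part_sq_le) (use sig sp0 in \<open>simp_all add: 1\<close>)
    then show ?thesis using True rho by simp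
   qed (auto simp: indicator_def)
  qed
  also have "\<dots> = 2 * F + 2 * \<sigma>^2 * M"
  proof -
   have ip: "integrable lborel (\<lambda>x. (\<phi> x)^2)"
    
   proof (rule integrable_continuous_compact_support[of _ rh])
    show "continuous_on UNIV (\<lambda>x. (\<phi> x)^2)" by (intro continuous_intros contphi)
   qed (simp add: \<phi>_def zz)
   show ?thesis using ip iM by (simp add: F_def M_def)
  qed
  also have "\<dots> \<le> 2 * (8 * s^2 * N * ((8 / c^2 + 2) * (64 / (rh - rh')^2 * (2 * I + 2 * \<sigma>^2 * M)) + 8 * ep * Gm / (c * \<tau>))) + 2 * \<sigma>^2 * M"
   by (intro add_mono mult_left_mono F) auto
  also have "\<dots> = h ep" by (simp only: h_def \<sigma>_def)
  finally show ?thesis .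
 qed
 have "(h \<longlongrightarrow> h 0) (at_right 0)"
  unfolding h_def using tau c rho by (auto intro!: tendsto_eq_intros)
 moreover have "\<forall>\<^sub>F ep in at_right 0. L \<le> h ep"
  using eventually_at_right_less eventually_at_right_real[OF e0]
  by eventually_elim (use main in auto)
 ultimately have "L \<le> h 0" by (intro tendsto_lowerbound) auto
 also have "h 0 = 2048 * N * (8 / c^2 + 2) * s^2 / (rh - rh')^2 * I"
  by (simp add: h_def)
 finally show ?thesis by (simp add: L_def I_def N_def z_def)
qed

text \<open>Radii decrease geometrically from r to r / 2 while levels increase from k0 to k0 + K. By
  Chebyshev the superlevel set of step j has relative volume of order 2^(-n j), at most half that of
  a ball of radius s = r S 2^(-j). This is the scale of the gap between consecutive radii, so the
  factor of \<open>log_caccioppoli\<close> is a constant multiple of S^2. First \<open>S\<close> is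
  small enough to contract, then \<open>K\<close> is large enough for the volume condition.\<close>

lemma de_giorgi_iteration:
 fixes v :: "'a::euclidean_space => real"
 assumes sa: "supersol_approx c v" and c: "c > 0" and contv: "continuous_on UNIV v" and v0: "\<And>x. v x \<ge> 0"
  and C: "C1 > 0" "S > 0" "16 * (2048 * 2 ^ DIM('a) * (8 / c^2 + 2)) * S^2 \<le> 1 / 2 ^ (DIM('a) + 2)"
  and K: "K > 0" "64 * C1 \<le> K^2 * S ^ DIM('a)"
  and tau: "\<tau> > 0" and r: "r > 0"
  and L2: "(LBINT x. indicator (ball 0 r) x * (max 0 (- ln (v x + \<tau>) - k0))^2) \<le> C1 * measure lborel (ball (0::'a) r)"
  and x: "norm x < r / 2"
 shows "- ln (v x + \<tau>) \<le> k0 + K"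
proof -
 define n where "n = DIM('a)"
 define z where "z x = - ln (v x + \<tau>)" for x
 have contz: "continuous_on UNIV z"
 proof -
  have "v x + \<tau> \<noteq> 0" for x using v0[of x] tau by simp
  then show ?thesis unfolding z_def by (intro continuous_intros contv) auto
 qed
 define rh where "rh j = r / 2 * (1 + (1/2) ^ j)" for j :: nat
 define k where "k j = k0 + K * (1 - (1/2) ^ j)" for j :: nat
 define Y where "Y j = (LBINT x. indicator (ball 0 (rh j)) x * (max 0 (z x - k j))^2)" for j
 define M where "M = measure lborel (ball (0::'a) r)"
 have iY: "integrable lborel (\<lambda>x. indicator (ball 0 a) x * (max 0 (z x - b))^2)" for a b
  by (intro integrable_continuous_bounded_set continuous_intros contz) auto
 \<comment> \<open>The exponent n + 2 pays for the volume 2^(-n j) of the comparison ball and for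
   the factor 4^(-j) of the squared level gaps.\<close>
 define q :: real where "q = 1 / 2 ^ (n + 2)"
 have "(1::real) < 2 ^ (n + 2)" by (rule one_less_power) auto
 then have q: "0 < q" "q < 1" unfolding q_def by (auto simp del: power_add_numeral power_add power_add_numeral2)
 have Ybound: "Y j \<le> C1 * M * q ^ j" for j
 proof (induction j)
  case 0
  then show ?case using L2 by (simp add: Y_def rh_def k_def z_def M_def)
 next
  case (Suc j)
  define s where "s = r * S * (1/2) ^ j"
  have s: "s > 0" using r C by (simp add: s_def)
  have dk: "k (Suc j) - k j = K * (1/2) ^ Suc j" by (simp add: k_def algebra_simps)
  have drho: "rh j - rh (Suc j) = r / 4 * (1/2) ^ j" by (simp add: rh_def algebra_simps)
  \<comment> \<open>The midpoint supplies the strict gap below k (Suc j) that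
    \<open>log_caccioppoli\<close> requires.\<close>
  define km where "km = (k j + k (Suc j)) / 2"
  have dkm: "km - k j = K / 4 * (1/2) ^ j" using dk by (simp add: km_def)
  have "k (Suc j) - k j > 0" unfolding dk using K by simp
  then have km: "k j < km" "km < k (Suc j)" unfolding km_def by simp_all
  define U where "U = {x \<in> ball (0::'a) (rh j). z x > km}"
  have Ub: "U \<in> sets borel"
  proof -
   have "U = ball 0 (rh j) \<inter> {x. km < z x}" by (auto simp: U_def)
   then show ?thesis using contz by (auto intro!: borel_open open_Int open_Collect_less continuous_intros)
  qed
  have iU: "integrable lborel (\<lambda>x. indicator U x * (km - k j)^2 :: real)"
  proof (rule integrable_continuous_bounded_set[OF continuous_on_const Ub])
   show "bounded U" by (rule bounded_subset[of "ball 0 (rh j)"]) (auto simp: U_def)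
  qed
  have "measure lborel U * (km - k j)^2 = (LBINT x. indicator U x * (km - k j)^2)" using Ub by simp
  also have "\<dots> \<le> Y j"
   unfolding Y_def
  proof (intro integral_mono iU iY)
   fix x show "indicator U x * (km - k j)^2 \<le> indicator (ball 0 (rh j)) x * (max 0 (z x - k j))^2"
    using km by (auto simp: U_def indicator_def intro!: power_mono)
  qed
  also have "\<dots> \<le> C1 * M * q ^ j" by (rule Suc)
  finally have U: "measure lborel U * (km - k j)^2 \<le> C1 * M * q ^ j" .
  have ball_s: "measure lborel (ball (0::'a) s) = M * S ^ n * (1 / 2 ^ n) ^ j"
  proof -
   have "((1/2::real) ^ j) ^ n = (1 / 2 ^ n) ^ j"
    by (simp add: power_mult[symmetric] mult.commute power_one_over)
   then show ?thesis using s r by (simp add: content_ball M_def s_def power_mult_distrib n_def)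
  qed
  have M0: "M > 0" using r by (simp add: M_def content_ball_pos)
  have qj: "q ^ j = (1 / 2 ^ n) ^ j * ((1/2) ^ j)^2"
  proof -
   have "q = 1 / 2 ^ n * (1/2)^2" by (simp add: q_def power_add power2_eq_square)
   then show ?thesis by (simp only: power_mult_distrib power_mult[symmetric] mult.commute)
  qed
  have "2 * measure lborel U \<le> measure lborel (ball (0::'a) s)"
  proof -
   have "measure lborel U * (K^2 / 16) * ((1/2) ^ j)^2 \<le> (C1 * M * (1 / 2 ^ n) ^ j) * ((1/2) ^ j)^2"
    using U unfolding dkm qj by (simp add: power_mult_distrib power_divide mult_ac)
   then have "measure lborel U * (K^2 / 16) \<le> C1 * M * (1 / 2 ^ n) ^ j"
    by (rule mult_right_le_imp_le) simp
   then have "K^2 * (2 * measure lborel U) \<le> (64 * C1) * (M * (1 / 2 ^ n) ^ j)"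
   proof -
    assume *: "measure lborel U * (K^2 / 16) \<le> C1 * M * (1 / 2 ^ n) ^ j"
    have "0 \<le> C1 * M * (1 / 2 ^ n) ^ j" using C M0 by simp
    moreover have "K^2 * (2 * measure lborel U) = 32 * (measure lborel U * (K^2 / 16))" by simp
    moreover have "(64 * C1) * (M * (1 / 2 ^ n) ^ j) = 64 * (C1 * M * (1 / 2 ^ n) ^ j)" by simp
    ultimately show ?thesis using * by linarith
   qed
   also have "\<dots> \<le> (K^2 * S ^ n) * (M * (1 / 2 ^ n) ^ j)"
    using K M0 by (intro mult_right_mono) (auto simp: n_def)
   also have "\<dots> = K^2 * measure lborel (ball (0::'a) s)" by (simp add: ball_s)
   finally show ?thesis using K by simp
  qed
  then have "Y (Suc j) \<le> 2048 * 2 ^ n * (8 / c^2 + 2) * s^2 / (rh j - rh (Suc j))^2 *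
    (LBINT x. indicator (ball 0 (rh j)) x * (max 0 (z x - k (Suc j)))^2)"
   unfolding Y_def z_def n_def
  proof (intro log_caccioppoli[OF sa c contv v0 tau km(2) _ _ s])
   show "0 < rh (Suc j)" using r by (simp add: rh_def add_pos_pos)
   have "rh j - rh (Suc j) > 0" unfolding drho using r by simp
   then show "rh (Suc j) < rh j" by simp
  qed (simp add: U_def z_def)
  also have "s^2 / (rh j - rh (Suc j))^2 = 16 * S^2"
   unfolding drho s_def using r by (simp add: power_mult_distrib power_divide)
  then have "2048 * 2 ^ n * (8 / c^2 + 2) * s^2 / (rh j - rh (Suc j))^2 = 16 * (2048 * 2 ^ n * (8 / c^2 + 2)) * S^2"
   unfolding times_divide_eq_right[symmetric] by (simp only: mult_ac)
  also have "16 * (2048 * 2 ^ n * (8 / c^2 + 2)) * S^2 * (LBINT x. indicator (ball 0 (rh j)) x * (max 0 (z x - k (Suc j)))^2) \<le> q * Y j"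
  proof (intro mult_mono)
   show "16 * (2048 * 2 ^ n * (8 / c^2 + 2)) * S^2 \<le> q" using C(3) by (simp add: q_def n_def)
   show "(LBINT x. indicator (ball 0 (rh j)) x * (max 0 (z x - k (Suc j)))^2) \<le> Y j"
    unfolding Y_def
    using km by (intro integral_mono iY mult_left_mono power_mono) auto
   show "0 \<le> (LBINT x. indicator (ball 0 (rh j)) x * (max 0 (z x - k (Suc j)))^2)"
    by (intro Bochner_Integration.integral_nonneg) auto
  qed (use q in auto)
  also have "\<dots> \<le> q * (C1 * M * q ^ j)" using Suc q by (intro mult_left_mono) auto
  finally show ?case by (simp add: mult_ac)
 qed
 define J where "J = (LBINT x. indicator (ball 0 (r / 2)) x * (max 0 (z x - (k0 + K)))^2)"
 have "J \<le> C1 * M * q ^ j" for j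
 proof -
  have "J \<le> Y j"
   unfolding J_def Y_def
  proof (intro integral_mono iY mult_mono power_mono)
   fix x :: 'a
   have "r / 2 \<le> rh j" using r by (simp add: rh_def)
   then show "indicator (ball 0 (r / 2)) x \<le> (indicator (ball 0 (rh j)) x :: real)" by (auto simp: indicator_def)
   have "k j \<le> k0 + K" using K by (simp add: k_def algebra_simps)
   then show "max 0 (z x - (k0 + K)) \<le> max 0 (z x - k j)" by auto
  qed auto
  then show ?thesis using Ybound[of j] by linarith
 qed
 moreover have "(\<lambda>j. C1 * M * q ^ j) \<longlonglongrightarrow> C1 * M * 0"
  using q by (intro tendsto_intros LIMSEQ_power_zero) auto
 ultimately have "J \<le> 0" by (intro tendsto_lowerbound[where F = sequentially]) auto
 moreover have "J \<ge> 0" unfolding J_def by (intro Bochner_Integration.integral_nonneg) auto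
 ultimately have J0: "J = 0" by simp
 show ?thesis
 proof (rule ccontr)
  assume "\<not> ?thesis"
  then have zx: "z x > k0 + K" by (simp add: z_def)
  define O' where "O' = ball 0 (r / 2) \<inter> {y. k0 + K < z y}"
  have "open O'" unfolding O'_def by (intro open_Int open_ball open_Collect_less continuous_intros contz)
  moreover have "x \<in> O'" using x zx by (simp add: O'_def)
  ultimately obtain e where e: "e > 0" "ball x e \<subseteq> O'" using open_contains_ball by blast
  have "0 < emeasure lborel (ball x e)"
   using e(1) content_ball_pos[of e x] emeasure_lborel_ball_finite[of x e]
   by (simp add: emeasure_eq_ennreal_measure less_top)
  then have "emeasure lborel O' \<noteq> 0"
   using emeasure_mono[OF e(2), of lborel] \<open>open O'\<close> by (auto simp: not_le[symmetric] borel_open)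
  moreover have "AE x in lborel. indicator (ball 0 (r / 2)) x * (max 0 (z x - (k0 + K)))^2 = 0"
   using J0 unfolding J_def by (subst (asm) integral_nonneg_eq_0_iff_AE[OF iY]) auto
  then have "AE x in lborel. x \<notin> O'"
   by eventually_elim (auto simp: O'_def indicator_def split: if_splits)
  then have "emeasure lborel O' = 0"
   using \<open>open O'\<close> by (subst (asm) AE_iff_measurable[where N = O']) auto
  ultimately show False by simp
 qed
qed

text \<open>If v exceeded \<eta> on a fraction \<theta> of the ball, the two preceding estimates
  would bound - ln (v + \<tau>) by - ln \<eta> + K on the half ball, with \<open>K\<close> depending
  only on \<theta>, c and the dimension. Since the infimum is 0 there is a point x0 with v x0 <
  \<eta> exp (- K), and this is a contradiction once the half ball contains x0.\<close>

theorem weak_harnack: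
 fixes v :: "'a::euclidean_space => real"
 assumes sa: "supersol_approx c v" and c: "c > 0" and contv: "continuous_on UNIV v" and v0: "\<And>x. v x \<ge> 0"
  and inf0: "\<And>m. m > 0 ==> \<exists>x. v x < m" and eta: "\<eta> > 0" and theta: "\<theta> > 0"
 obtains r0 where "r0 > 0"
  "\<And>r. r \<ge> r0 ==> measure lborel {x \<in> ball 0 r. v x > \<eta>} < \<theta> * measure lborel (ball (0::'a) r)"
proof -
 define n where "n = DIM('a)"
 define C1 :: real where "C1 = 32 * 2 ^ n / (\<theta> * c^2) * (64 * 2 ^ n + 1) + 2"
 have C1: "C1 > 0" using theta c by (simp add: C1_def add_pos_pos)
 define C2 :: real where "C2 = 16 * (2048 * 2 ^ n * (8 / c^2 + 2))"
 have C2: "C2 > 0" using c by (simp add: C2_def add_pos_pos)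
 define S where "S = sqrt (1 / 2 ^ (n + 2) / C2)"
 have S: "S > 0" "C2 * S^2 \<le> 1 / 2 ^ (n + 2)" using C2 by (auto simp: S_def)
 define K where "K = sqrt (64 * C1 / S ^ n)"
 have K: "K > 0" "64 * C1 \<le> K^2 * S ^ n" using C1 S by (auto simp: K_def)
 define m where "m = \<eta> * exp (- K)"
 have m: "m > 0" using eta by (simp add: m_def)
 obtain x0 where x0: "v x0 < m" using inf0[OF m] by blast
 show ?thesis
 proof (rule that[of "2 * norm x0 + 1"])
  show "2 * norm x0 + 1 > 0" using norm_ge_zero[of x0] by linarith
  fix r assume r: "r \<ge> 2 * norm x0 + 1"
  have r0: "r > 0" using r norm_ge_zero[of x0] by linarith
  have xr: "norm x0 < r / 2" using r by simp
  show "measure lborel {x \<in> ball 0 r. v x > \<eta>} < \<theta> * measure lborel (ball (0::'a) r)"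
  proof (rule ccontr)
   assume "\<not> ?thesis"
   then have Z: "\<theta> * measure lborel (ball (0::'a) r) \<le> measure lborel {x \<in> ball 0 r. v x > \<eta>}" by simp
   \<comment> \<open>Half of the gap, so that v x0 + \<tau> is still below m.\<close>
   define \<tau> where "\<tau> = (m - v x0) / 2"
   have tau: "\<tau> > 0" using x0 by (simp add: \<tau>_def)
   have "- ln (v x0 + \<tau>) \<le> - ln \<eta> + K"
   proof (rule de_giorgi_iteration[OF sa c contv v0 C1 S(1) _ K(1) _ tau r0 _ xr])
    show "16 * (2048 * 2 ^ DIM('a) * (8 / c^2 + 2)) * S^2 \<le> 1 / 2 ^ (DIM('a) + 2)"
     using S(2) by (simp add: C2_def n_def)
    show "64 * C1 \<le> K^2 * S ^ DIM('a)" using K(2) by (simp add: n_def)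
    show "(LBINT x. indicator (ball 0 r) x * (max 0 (- ln (v x + \<tau>) - - ln \<eta>))^2) \<le> C1 * measure lborel (ball (0::'a) r)"
     using log_L2_bound[OF sa c contv v0 eta tau r0 theta Z] by (simp add: C1_def n_def)
   qed
   then have "ln m \<le> ln (v x0 + \<tau>)" using eta by (simp add: m_def ln_mult)
   then have "m \<le> v x0 + \<tau>" using m v0[of x0] tau by simp
   then show False using x0 by (simp add: \<tau>_def field_simps)
  qed
 qed
qed

section \<open>Jets and the mean curvature operator\<close>

definition trace_map :: "('a::euclidean_space => 'a) => real" where
 "trace_map B = (\<Sum>i\<in>Basis. B i \<bullet> i)"

text \<open>The trace of \<open>B\<close> against the inverse of the first fundamental form I + p
  p^T: for a graph with gradient p and Hessian B it is sqrt (1 + p \<bullet> p) times the sum of the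
  principal curvatures.\<close>

definition mcurv :: "'a::euclidean_space => ('a => 'a) => real" where
 "mcurv p B = trace_map B - (p \<bullet> B p) / (1 + p \<bullet> p)"

definition selfadjoint :: "('a::euclidean_space => 'a) => bool" where
 "selfadjoint B \<longleftrightarrow> linear B \<and> (\<forall>h k. B h \<bullet> k = h \<bullet> B k)"

definition subjet :: "('a::euclidean_space => real) => 'a => 'a => ('a => 'a) => bool" where
 "subjet u x p B \<longleftrightarrow> selfadjoint B \<and>
  (\<exists>de>0. \<forall>h. norm h < de --> u x + p \<bullet> h + (h \<bullet> B h) / 2 \<le> u (x + h))"

definition semiconcave :: "real => ('a::euclidean_space => real) => bool" where
 "semiconcave C u \<longleftrightarrow> (\<forall>x h t. 0 \<le> t --> t \<le> 1 -->
  u x + t * (u (x + h) - u x) \<le> u (x + t *R h) + C / 2 * t * (1 - t) * (norm h)^2)"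

text \<open>The inequality is required for all \<open>h\<close>, not only small ones: for a
  semiconcave function the local condition extends globally with the same constant.\<close>

definition supergrad :: "real => ('a::euclidean_space => real) => 'a => 'a => bool" where
 "supergrad C u x q \<longleftrightarrow> (\<forall>h. u (x + h) \<le> u x + q \<bullet> h + C / 2 * (norm h)^2)"

lemma selfadjointD: "selfadjoint B ==> linear B" "selfadjoint B ==> B h \<bullet> k = h \<bullet> B k"
 by (auto simp: selfadjoint_def)

lemma mcurv_add: "mcurv p (\<lambda>h. A h + B h) = mcurv p A + mcurv p B"
 by (simp add: mcurv_def trace_map_def inner_add_left inner_add_right sum.distrib add_divide_distrib)

lemma mcurv_scale: "mcurv p (\<lambda>h. c *R A h) = c * mcurv p A"
 by (simp add: mcurv_def trace_map_def sum_distrib_left right_diff_distrib)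

lemma mcurv_diff: "mcurv p (\<lambda>h. A h - B h) = mcurv p A - mcurv p B"
 using mcurv_add[of p A "\<lambda>h. (- 1) *R B h"] mcurv_scale[of p "- 1" B] by simp

lemma mcurv_id: "mcurv (p::'a::euclidean_space) (\<lambda>h. h) = DIM('a) - (p \<bullet> p) / (1 + p \<bullet> p)"
 by (simp add: mcurv_def trace_map_def)

lemma mcurv_rank_one: "mcurv p (\<lambda>h. (v \<bullet> h) *R v) = v \<bullet> v - (p \<bullet> v)\<^sup>2 / (1 + p \<bullet> p)"
proof -
 have "v \<bullet> v = (\<Sum>i\<in>Basis. (v \<bullet> i) * (v \<bullet> i))" by (rule euclidean_inner)
 then show ?thesis
  by (simp add: mcurv_def trace_map_def power2_eq_square inner_commute)
qed

section \<open>Positive semidefinite forms\<close>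

lemma quadratic_nonneg_discriminant:
 fixes \<alpha> \<beta> ga :: real
 assumes "\<And>t. 0 \<le> \<alpha> + 2 * \<beta> * t + ga * t^2"
 shows "\<beta>^2 \<le> \<alpha> * ga"
proof (cases "ga = 0")
 case True
 have "\<beta> = 0"
 proof (rule ccontr)
  assume b: "\<beta> \<noteq> 0"
  have "0 \<le> \<alpha> + 2 * \<beta> * (- (\<alpha> + 1) / (2 * \<beta>)) + ga * (- (\<alpha> + 1) / (2 * \<beta>))^2" by (rule assms)
  also have "\<dots> = - 1" using b True by simp
  finally show False by simp
 qed
 then show ?thesis using True by simp
next
 case False
 obtain A B where A: "\<alpha> \<le> A" "0 \<le> A" and B: "\<beta> \<le> B" "0 \<le> B" by (metis abs_ge_self abs_ge_zero)
 have "ga > 0"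
 proof (rule ccontr)
  assume "\<not> ga > 0"
  then have g: "ga < 0" using False by simp
  define t where "t = (1 + A + 2 * B) / (- ga) + 1"
  have t1: "t \<ge> 1" using g A B by (simp add: t_def divide_nonneg_neg divide_nonpos_neg)
  have "- ga * t = 1 + A + 2 * B - ga" using g by (simp add: t_def field_simps)
  then have "- ga * t \<ge> 1 + A + 2 * B" using g by simp
  then have 1: "(1 + A + 2 * B) * t \<le> (- ga * t) * t" using t1 by (intro mult_right_mono) auto
  define X P Y where "X = (- ga * t) * t" and "P = \<beta> * t" and "Y = B * t"
  have "Y + Y + (1 + A) \<le> X"
  proof -
   have a: "1 + A \<le> (1 + A) * t" using mult_left_mono[OF t1, of "1 + A"] A by simp
   have "Y + Y + (1 + A) \<le> Y + Y + (1 + A) * t" using a by (rule add_left_mono)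
   also have "\<dots> = (1 + A + 2 * B) * t" by (simp add: Y_def algebra_simps)
   also have "\<dots> \<le> X" using 1 by (simp only: X_def)
   finally show ?thesis .
  qed
  moreover have "P \<le> Y" unfolding P_def Y_def using t1 B by (intro mult_right_mono) auto
  moreover have "0 \<le> \<alpha> + (P + P) - X" using assms[of t] by (simp add: X_def P_def power2_eq_square)
  ultimately show False using A by linarith
 qed
 moreover have "0 \<le> \<alpha> + 2 * \<beta> * (- \<beta> / ga) + ga * (- \<beta> / ga)^2" by (rule assms)
 ultimately have "0 \<le> \<alpha> - \<beta>\<^sup>2 / ga" by (simp add: power2_eq_square field_simps)
 then show ?thesis using \<open>ga > 0\<close> by (simp add: field_simps)
qed

lemma psd_cauchy_schwarz:
 assumes D: "selfadjoint D" and psd: "\<And>h. 0 \<le> h \<bullet> D h"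
 shows "(a \<bullet> D b)^2 \<le> (a \<bullet> D a) * (b \<bullet> D b)"
proof (rule quadratic_nonneg_discriminant)
 fix t
 have "0 \<le> (a + t *R b) \<bullet> D (a + t *R b)" by (rule psd)
 also have "\<dots> = a \<bullet> D a + t * (a \<bullet> D b) + t * (b \<bullet> D a) + t^2 * (b \<bullet> D b)"
  using selfadjointD(1)[OF D]
  by (simp add: linear_add linear_scale inner_add_left inner_add_right power2_eq_square algebra_simps)
 also have "b \<bullet> D a = a \<bullet> D b" using selfadjointD(2)[OF D, of a b] by (simp add: inner_commute)
 finally show "0 \<le> a \<bullet> D a + 2 * (a \<bullet> D b) * t + b \<bullet> D b * t^2" by (simp add: algebra_simps)
qed

text \<open>The entries of a positive semidefinite form satisfy |D_ij|^2 \<le> D_ii D_jj, so the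
  double sum is at most the square of a single sum, to which Cauchy-Schwarz applies.\<close>

lemma psd_diag_le_trace:
 assumes D: "selfadjoint D" and psd: "\<And>h. 0 \<le> h \<bullet> D h"
 shows "a \<bullet> D a \<le> trace_map D * (norm a)^2"
proof -
 define s where "s i = sqrt (D i \<bullet> i)" for i
 have dn: "0 \<le> D i \<bullet> i" for i using psd[of i] by (simp add: inner_commute)
 have ent: "\<bar>i \<bullet> D j\<bar> \<le> s i * s j" for i j
 proof -
  have "(i \<bullet> D j)^2 \<le> (s i * s j)^2"
   using psd_cauchy_schwarz[OF D psd, of i j] dn by (simp add: s_def power_mult_distrib inner_commute)
  then have "\<bar>i \<bullet> D j\<bar> \<le> \<bar>s i * s j\<bar>" by (simp only: abs_le_square_iff)
  then show ?thesis using dn by (simp add: s_def abs_mult)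
 qed
 have lin: "linear D" by (rule selfadjointD(1)[OF D])
 have Da: "D a = (\<Sum>j\<in>Basis. (a \<bullet> j) *R D j)"
  by (subst euclidean_representation[symmetric, of a]) (simp add: linear_sum[OF lin] linear_scale[OF lin])
 have "a \<bullet> D a = (\<Sum>i\<in>Basis. (a \<bullet> i) * (D a \<bullet> i))" by (rule euclidean_inner)
 also have "\<dots> = (\<Sum>i\<in>Basis. \<Sum>j\<in>Basis. (a \<bullet> i) * ((a \<bullet> j) * (i \<bullet> D j)))"
  unfolding Da by (simp add: inner_sum_left sum_distrib_left inner_commute[of "D _"])
 also have "\<dots> \<le> (\<Sum>i\<in>Basis. \<Sum>j\<in>Basis. (\<bar>a \<bullet> i\<bar> * s i) * (\<bar>a \<bullet> j\<bar> * s j))"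
 proof (intro sum_mono)
  fix i j :: 'a
  have "(a \<bullet> i) * ((a \<bullet> j) * (i \<bullet> D j)) \<le> \<bar>a \<bullet> i\<bar> * (\<bar>a \<bullet> j\<bar> * \<bar>i \<bullet> D j\<bar>)"
   by (metis abs_ge_self abs_mult)
  also have "\<dots> \<le> \<bar>a \<bullet> i\<bar> * (\<bar>a \<bullet> j\<bar> * (s i * s j))" by (intro mult_left_mono ent) auto
  finally show "(a \<bullet> i) * ((a \<bullet> j) * (i \<bullet> D j)) \<le> (\<bar>a \<bullet> i\<bar> * s i) * (\<bar>a \<bullet> j\<bar> * s j)" by (simp add: mult_ac)
 qed
 also have "\<dots> = (\<Sum>i\<in>Basis. \<bar>a \<bullet> i\<bar> * s i)^2"
  by (simp add: power2_eq_square sum_product)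
 also have "\<dots> \<le> (\<Sum>i\<in>Basis. \<bar>a \<bullet> i\<bar>^2) * (\<Sum>i\<in>Basis. (s i)^2)" by (rule Cauchy_Schwarz_ineq_sum)
 also have "(\<Sum>i\<in>Basis. \<bar>a \<bullet> i\<bar>^2) = (norm a)^2"
  unfolding power2_norm_eq_inner by (simp add: power2_eq_square euclidean_inner[of a a])
 also have "(\<Sum>i\<in>Basis. (s i)^2) = trace_map D" using dn by (simp add: s_def trace_map_def)
 finally show ?thesis by (simp add: mult.commute)
qed

lemma psd_trace_nonneg: "(\<And>h. 0 \<le> h \<bullet> D h) ==> 0 \<le> trace_map D"
 unfolding trace_map_def by (intro sum_nonneg) (simp add: inner_commute)

lemma psd_bilinear_le_trace:
 assumes D: "selfadjoint D" and psd: "\<And>h. 0 \<le> h \<bullet> D h"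
 shows "\<bar>a \<bullet> D b\<bar> \<le> trace_map D * norm a * norm b"
proof -
 have "(a \<bullet> D b)^2 \<le> (a \<bullet> D a) * (b \<bullet> D b)" by (rule psd_cauchy_schwarz[OF D psd])
 also have "\<dots> \<le> (trace_map D * (norm a)^2) * (trace_map D * (norm b)^2)"
  by (intro mult_mono psd_diag_le_trace[OF D psd] psd mult_nonneg_nonneg psd_trace_nonneg) auto
 also have "\<dots> = (trace_map D * norm a * norm b)^2" by (simp add: power_mult_distrib power2_eq_square)
 finally have "\<bar>a \<bullet> D b\<bar> \<le> \<bar>trace_map D * norm a * norm b\<bar>" by (simp add: abs_le_square_iff)
 then show ?thesis using psd_trace_nonneg[OF psd] by (simp add: abs_mult)
qed

text \<open>The flux of the mean curvature equation: evaluated at the gradient of a function, its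
  divergence is the mean curvature of the graph.\<close>

definition unit_slope :: "'a::euclidean_space => 'a" where
 "unit_slope p = (1 / sqrt (1 + p \<bullet> p)) *R p"

lemma one_plus_inner_pos: "0 < 1 + p \<bullet> (p::'a::euclidean_space)" "1 \<le> 1 + p \<bullet> p"
 using inner_ge_zero[of p] by linarith+

lemma sqrt_one_plus_inner: "1 \<le> sqrt (1 + p \<bullet> (p::'a::euclidean_space))"
 "sqrt (1 + p \<bullet> p) * sqrt (1 + p \<bullet> p) = 1 + p \<bullet> p"
 using one_plus_inner_pos[of p] by auto

lemma mcurv_eq_unit_slope: "linear B ==> mcurv p B = trace_map B - unit_slope p \<bullet> B (unit_slope p)"
 using one_plus_inner_pos(1)[of p] by (simp add: mcurv_def unit_slope_def linear_scale)

lemma norm_unit_slope_less_1: "norm (unit_slope p) < 1"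
proof -
 have "norm p < sqrt (1 + p \<bullet> p)" by (simp add: norm_eq_sqrt_inner)
 moreover have "norm (unit_slope p) = norm p / sqrt (1 + p \<bullet> p)"
  using sqrt_one_plus_inner(1)[of p] by (simp add: unit_slope_def)
 moreover have "sqrt (1 + p \<bullet> p) > 0" using sqrt_one_plus_inner(1)[of p] by linarith
 ultimately show ?thesis by simp
qed

text \<open>The quotient (1 + p \<bullet> q) / (a b) is the cosine of the angle between the unit
  normals (- p, 1) / a and (- q, 1) / b, and the left side of the first identity is the squared
  distance of these normals.\<close>

lemma unit_slope_dist_identities:
 fixes p q :: "'a::euclidean_space"
 defines "a \<equiv> sqrt (1 + p \<bullet> p)" and "b \<equiv> sqrt (1 + q \<bullet> q)"
 shows "(norm (unit_slope p - unit_slope q))^2 + (1 / a - 1 / b)^2 = 2 * (1 - (1 + p \<bullet> q) / (a * b))"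
  "(unit_slope p - unit_slope q) \<bullet> (p - q) = (a + b) * (1 - (1 + p \<bullet> q) / (a * b))"
proof -
 have a: "a \<ge> 1" "a * a = 1 + p \<bullet> p" and b: "b \<ge> 1" "b * b = 1 + q \<bullet> q"
  unfolding a_def b_def using sqrt_one_plus_inner by auto
 have u: "unit_slope p = (1 / a) *R p" "unit_slope q = (1 / b) *R q" by (auto simp: unit_slope_def a_def b_def)
 have pp: "p \<bullet> p = a * a - 1" "q \<bullet> q = b * b - 1" using a b by auto
 show "(norm (unit_slope p - unit_slope q))^2 + (1 / a - 1 / b)^2 = 2 * (1 - (1 + p \<bullet> q) / (a * b))"
  unfolding u power2_norm_eq_inner using a(1) b(1)
  by (simp add: inner_diff_left inner_diff_right inner_commute[of q p] pp power2_eq_square field_simps)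
 show "(unit_slope p - unit_slope q) \<bullet> (p - q) = (a + b) * (1 - (1 + p \<bullet> q) / (a * b))"
  unfolding u using a(1) b(1)
  by (simp add: inner_diff_left inner_diff_right inner_commute[of q p] pp power2_eq_square field_simps)
qed

text \<open>Everything reduces to d = a b - (1 + p \<bullet> q). It is at most |p - q|^2 / 2 because
  (a - b)^2 \<ge> 0, and it is bounded below because (a b)^2 - (1 + p \<bullet> q)^2 is |p - q|^2
  plus a nonnegative Cauchy-Schwarz defect. The two conclusions are the boundedness and coercivity
  that \<open>supersol_approx\<close> asks of its field.\<close>

lemma unit_slope_dist:
 fixes p q :: "'a::euclidean_space"
 shows "norm (unit_slope p - unit_slope q) \<le> norm (p - q)"
  "norm p \<le> La ==> norm q \<le> La ==> (norm (p - q))^2 / (1 + La^2)^2 \<le> (unit_slope p - unit_slope q) \<bullet> (p - q)"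
proof -
 define a where "a = sqrt (1 + p \<bullet> p)"
 define b where "b = sqrt (1 + q \<bullet> q)"
 define d where "d = a * b - (1 + p \<bullet> q)"
 have a: "a \<ge> 1" "a * a = 1 + p \<bullet> p" and b: "b \<ge> 1" "b * b = 1 + q \<bullet> q"
  unfolding a_def b_def using sqrt_one_plus_inner by auto
 have ab: "a * b \<ge> 1" using mult_mono[of 1 a 1 b] a b by simp
 have frac: "1 - (1 + p \<bullet> q) / (a * b) = d / (a * b)" using a b by (simp add: d_def field_simps)
 note ids = unit_slope_dist_identities[of p q, folded a_def b_def, unfolded frac]
 have npq: "(norm (p - q))^2 = a * a + b * b - 2 - 2 * (p \<bullet> q)"
  unfolding power2_norm_eq_inner using a b by (simp add: inner_diff_left inner_diff_right inner_commute[of q p])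
 have d2: "2 * d \<le> (norm (p - q))^2"
 proof -
  have "0 \<le> (a - b)^2" by simp
  then show ?thesis unfolding npq d_def by (simp add: power2_eq_square algebra_simps)
 qed
 have key: "(norm (p - q))^2 \<le> (a * b)^2 - (1 + p \<bullet> q)\<^sup>2"
 proof -
  have "(a * b)^2 = (a * a) * (b * b)" by (simp add: power2_eq_square)
  also have "\<dots> = (1 + p \<bullet> p) * (1 + q \<bullet> q)" by (simp add: a b)
  finally have "(a * b)^2 - (1 + p \<bullet> q)\<^sup>2 = (norm (p - q))^2 + ((p \<bullet> p) * (q \<bullet> q) - (p \<bullet> q)\<^sup>2)"
   unfolding npq a b by (simp add: power2_eq_square algebra_simps)
  then show ?thesis using Cauchy_Schwarz_ineq[of p q] by simp
 qed
 have abs_pq: "\<bar>1 + p \<bullet> q\<bar> \<le> a * b"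
 proof -
  have "(1 + p \<bullet> q)^2 \<le> (a * b)^2" using key zero_le_power2[of "norm (p - q)"] by linarith
  then have "\<bar>1 + p \<bullet> q\<bar> \<le> \<bar>a * b\<bar>" by (simp only: abs_le_square_iff)
  then show ?thesis using ab by simp
 qed
 have d0: "d \<ge> 0" using abs_pq by (simp add: d_def)
 have keyd: "(norm (p - q))^2 \<le> d * (2 * (a * b))"
 proof -
  have "(a * b)^2 - (1 + p \<bullet> q)\<^sup>2 = d * (a * b + (1 + p \<bullet> q))" by (simp add: d_def power2_eq_square algebra_simps)
  also have "\<dots> \<le> d * (2 * (a * b))" using abs_pq d0 by (intro mult_left_mono) auto
  finally show ?thesis using key by simp
 qed
 have "(norm (unit_slope p - unit_slope q))^2 \<le> 2 * (d / (a * b))"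
  using ids(1) zero_le_power2[of "1 / a - 1 / b"] by linarith
 also have "\<dots> \<le> 2 * d" using d0 ab mult_left_mono[OF ab d0] by (simp add: divide_le_eq)
 also have "\<dots> \<le> (norm (p - q))^2" by (rule d2)
 finally show "norm (unit_slope p - unit_slope q) \<le> norm (p - q)" by (simp add: power2_le_iff_abs_le)
 assume L: "norm p \<le> La" "norm q \<le> La"
 have pL: "1 + p \<bullet> p \<le> 1 + La^2" "1 + q \<bullet> q \<le> 1 + La^2"
  using L power_mono[of "norm p" La 2] power_mono[of "norm q" La 2] by (auto simp: power2_norm_eq_inner)
 have ab2: "(a * b)^2 \<le> (1 + La^2)^2"
 proof -
  have "(a * b)^2 = (1 + p \<bullet> p) * (1 + q \<bullet> q)" using a b by (metis mult.commute mult.left_commute power2_eq_square)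
  also have "\<dots> \<le> (1 + La^2) * (1 + La^2)" using pL one_plus_inner_pos(1)[of q] by (intro mult_mono) (auto simp: add_nonneg_nonneg)
  finally show ?thesis by (simp add: power2_eq_square)
 qed
 have "(norm (p - q))^2 / (1 + La^2)^2 \<le> (norm (p - q))^2 / (a * b)^2"
  using ab2 ab by (intro divide_left_mono mult_pos_pos) (auto simp: add_pos_nonneg)
 also have "\<dots> \<le> d * (2 * (a * b)) / (a * b)^2" using keyd by (intro divide_right_mono) auto
 also have "\<dots> = 2 * (d / (a * b))" using ab by (simp add: power2_eq_square)
 also have "\<dots> \<le> (a + b) * (d / (a * b))" using a b d0 ab by (intro mult_right_mono) auto
 finally show "(norm (p - q))^2 / (1 + La^2)^2 \<le> (unit_slope p - unit_slope q) \<bullet> (p - q)" using ids(2) by simp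
qed

lemma selfadjoint_shift:
 assumes "selfadjoint B" shows "selfadjoint (\<lambda>h. C *R h - B h)"
 using assms by (auto simp: selfadjoint_def inner_diff_left inner_diff_right intro!: linear_compose_sub linear_scaleR)

text \<open>Ellipticity from below: the subtracted term p \<bullet> D p is at most the trace times p
  \<bullet> p.\<close>

lemma mcurv_psd_lower:
 fixes D :: "'a::euclidean_space => 'a"
 assumes D: "selfadjoint D" and psd: "\<And>h. 0 \<le> h \<bullet> D h"
 shows "trace_map D \<le> (1 + p \<bullet> p) * mcurv p D"
proof -
 have "p \<bullet> D p \<le> trace_map D * (p \<bullet> p)" using psd_diag_le_trace[OF D psd, of p] by (simp add: power2_norm_eq_inner)
 moreover have "(1 + p \<bullet> p) * mcurv p D = (1 + p \<bullet> p) * trace_map D - p \<bullet> D p"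
  using one_plus_inner_pos(1)[of p] by (simp add: mcurv_def right_diff_distrib)
 ultimately show ?thesis by (simp add: algebra_simps)
qed

lemma mcurv_psd_nonneg:
 fixes D :: "'a::euclidean_space => 'a"
 assumes D: "selfadjoint D" and psd: "\<And>h. 0 \<le> h \<bullet> D h"
 shows "0 \<le> mcurv p D"
proof -
 have "0 \<le> (1 + p \<bullet> p) * mcurv p D"
  using mcurv_psd_lower[OF D psd, of p] psd_trace_nonneg[OF psd] by (rule order_trans[rotated])
 then show ?thesis using one_plus_inner_pos(1)[of p] by (simp add: zero_le_mult_iff)
qed

lemma mcurv_le_bound:
 fixes B :: "'a::euclidean_space => 'a"
 assumes B: "selfadjoint B" "\<And>h. h \<bullet> B h \<le> C * (norm h)^2" and C: "C \<ge> 0"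
 shows "mcurv p B \<le> C * DIM('a)"
proof -
 define D where "D h = C *R h - B h" for h
 have D: "selfadjoint D" "\<And>h. 0 \<le> h \<bullet> D h"
  unfolding D_def using B selfadjoint_shift by (auto simp: inner_diff_right power2_norm_eq_inner)
 have "0 \<le> mcurv p D" by (rule mcurv_psd_nonneg[OF D])
 then have "mcurv p B \<le> C * mcurv p (\<lambda>h. h)"
  unfolding D_def mcurv_diff mcurv_scale by simp
 also have "\<dots> \<le> C * DIM('a)" using C by (intro mult_left_mono) (auto simp: mcurv_id)
 finally show ?thesis .
qed

text \<open>\<open>B\<close> is bounded only from above, so a change of slope cannot be estimated by
  the norm of \<open>B\<close>. With B = C I - D and D \<ge> 0, the trace of D is controlled by
  \<open>mcurv p D\<close>, and the change is at most the fraction \<open>ka\<close> of it. The part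
  of this error proportional to - \<open>mcurv p B\<close> is absorbed by \<open>mcurv p B\<close>
  itself because ka \<le> 1.\<close>

lemma mcurv_perturb:
 fixes B :: "'a::euclidean_space => 'a"
 assumes B: "selfadjoint B" "\<And>h. h \<bullet> B h \<le> C * (norm h)^2" and C: "C \<ge> 0"
  and p: "norm p \<le> La" and ka: "2 * (1 + La^2) * norm (p - q) \<le> ka" "ka \<le> 1"
  and s: "mcurv p B \<le> s" "0 \<le> s"
 shows "mcurv q B \<le> s + C * ka * (DIM('a) + 1)"
proof -
 define D where "D h = C *R h - B h" for h
 have D: "selfadjoint D" "\<And>h. 0 \<le> h \<bullet> D h"
  unfolding D_def using B selfadjoint_shift by (auto simp: inner_diff_right power2_norm_eq_inner)
 have lin: "linear D" by (rule selfadjointD(1)[OF D(1)])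
 define a b where "a = unit_slope p" and "b = unit_slope q"
 have ab: "norm (a - b) \<le> norm (p - q)" "norm (a + b) \<le> 2"
  using unit_slope_dist(1)[of p q] norm_unit_slope_less_1[of p] norm_unit_slope_less_1[of q] norm_triangle_ineq[of a b]
  unfolding a_def b_def by linarith+
 have k0: "0 \<le> ka" using ka(1) by (rule order_trans[rotated]) simp
 have pq: "2 * norm (p - q) \<le> ka"
 proof -
  have "norm (p - q) * 1 \<le> norm (p - q) * (1 + La^2)" by (intro mult_left_mono) auto
  moreover have "2 * (1 + La^2) * norm (p - q) = 2 * (norm (p - q) * (1 + La^2))" by simp
  ultimately show ?thesis using ka(1) by linarith
 qed
 have trD: "0 \<le> trace_map D" by (rule psd_trace_nonneg[OF D(2)])
 have diffD: "mcurv p D - mcurv q D \<le> ka * mcurv p D"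
 proof -
  have "mcurv p D - mcurv q D = b \<bullet> D b - a \<bullet> D a"
   using lin by (simp add: mcurv_eq_unit_slope a_def b_def)
  also have "\<dots> = - ((a - b) \<bullet> D (a + b))"
  proof -
   have "b \<bullet> D a = a \<bullet> D b" using selfadjointD(2)[OF D(1), of a b] by (simp add: inner_commute)
   then show ?thesis by (simp add: linear_add[OF lin] inner_diff_left inner_add_right)
  qed
  also have "\<dots> \<le> trace_map D * norm (a - b) * norm (a + b)"
   using psd_bilinear_le_trace[OF D, of "a - b" "a + b"] by linarith
  also have "\<dots> \<le> trace_map D * norm (p - q) * 2" using ab trD by (intro mult_mono) auto
  also have "\<dots> \<le> ((1 + La^2) * mcurv p D) * norm (p - q) * 2"
  proof -
   have "0 \<le> mcurv p D" by (rule mcurv_psd_nonneg[OF D])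
   moreover have "1 + p \<bullet> p \<le> 1 + La^2" using p power_mono[of "norm p" La 2] by (auto simp: power2_norm_eq_inner)
   ultimately have "trace_map D \<le> (1 + La^2) * mcurv p D"
    using mcurv_psd_lower[OF D, of p] mult_right_mono by (meson order_trans)
   then show ?thesis by (intro mult_right_mono) auto
  qed
  also have "\<dots> = (2 * (1 + La^2) * norm (p - q)) * mcurv p D" by simp
  also have "\<dots> \<le> ka * mcurv p D"
  proof (intro mult_right_mono ka)
   show "0 \<le> mcurv p D" by (rule mcurv_psd_nonneg[OF D])
  qed
  finally show ?thesis .
 qed
 have I: "mcurv q (\<lambda>h::'a. h) - mcurv p (\<lambda>h. h) \<le> ka"
 proof -
  have "mcurv q (\<lambda>h::'a. h) - mcurv p (\<lambda>h. h) = a \<bullet> a - b \<bullet> b"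
   by (simp add: mcurv_eq_unit_slope[OF linear_id[unfolded id_def]] a_def b_def)
  also have "\<dots> = (a - b) \<bullet> (a + b)" by (simp add: inner_diff_left inner_add_right inner_commute[of b a])
  also have "\<dots> \<le> norm (a - b) * norm (a + b)" by (rule norm_cauchy_schwarz)
  also have "\<dots> \<le> norm (p - q) * 2" using ab by (intro mult_mono) auto
  finally show ?thesis using pq by simp
 qed
 have Ip: "mcurv p (\<lambda>h::'a. h) \<le> DIM('a)" by (simp add: mcurv_id)
 have eqs: "mcurv p D = C * mcurv p (\<lambda>h. h) - mcurv p B" "mcurv q D = C * mcurv q (\<lambda>h. h) - mcurv q B"
  unfolding D_def mcurv_diff mcurv_scale by auto
 have "mcurv q B = C * (mcurv q (\<lambda>h. h) - mcurv p (\<lambda>h. h)) + (mcurv p D - mcurv q D) + mcurv p B"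
  unfolding eqs by (simp add: algebra_simps)
 also have "\<dots> \<le> C * ka + ka * (C * mcurv p (\<lambda>h. h) - mcurv p B) + mcurv p B"
  using mult_left_mono[OF I C] diffD unfolding eqs by linarith
 also have "\<dots> = C * ka + ka * (C * mcurv p (\<lambda>h. h)) + (1 - ka) * mcurv p B" by (simp add: algebra_simps)
 also have "(1 - ka) * mcurv p B \<le> 1 * s"
 proof -
  have "(1 - ka) * mcurv p B \<le> (1 - ka) * s" using s ka by (intro mult_left_mono) auto
  also have "\<dots> \<le> 1 * s" using s k0 by (intro mult_right_mono) auto
  finally show ?thesis .
 qed
 also have "ka * (C * mcurv p (\<lambda>h. h)) \<le> ka * (C * DIM('a))" by (intro mult_left_mono Ip k0 C)
 finally show ?thesis by (simp add: algebra_simps)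
qed

lemma taylor_second_order:
 fixes g :: "'a::euclidean_space => real" and dg H :: "'a => 'a"
 assumes g: "\<And>y. (g has_derivative (\<lambda>h. dg y \<bullet> h)) (at y)" and H: "(dg has_derivative H) (at x)" and eta: "\<eta> > 0"
 obtains de where "de > 0" "\<And>h::'a. norm h < de ==> \<bar>g (x + h) - g x - dg x \<bullet> h - (h \<bullet> H h) / 2\<bar> \<le> \<eta> * (norm h)^2"
proof -
 have lin: "linear H" using H by (simp add: has_derivative_linear)
 obtain de where d: "de > 0" "\<And>y. norm (y - x) < de ==> norm (dg y - dg x - H (y - x)) \<le> \<eta> * norm (y - x)"
  using H[unfolded has_derivative_at_alt] eta by blast
 show ?thesis
 proof (rule that[OF d(1)])
  fix h :: 'a assume h: "norm h < de"
  define r where "r t = g (x + t *R h) - t * (dg x \<bullet> h) - t\<^sup>2 / 2 * (h \<bullet> H h)" for t :: real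
  have dr: "(r has_real_derivative (dg (x + t *R h) - dg x - H (t *R h)) \<bullet> h) (at t)" for t
  proof -
   have "((\<lambda>t. x + t *R h) has_derivative (\<lambda>s. s *R h)) (at t)" by (auto intro!: derivative_eq_intros)
   from has_derivative_compose[OF this g]
   have "((\<lambda>t. g (x + t *R h)) has_real_derivative dg (x + t *R h) \<bullet> h) (at t)"
    by (simp add: has_field_derivative_def mult_commute_abs)
   then show ?thesis unfolding r_def[abs_def]
    by (auto intro!: derivative_eq_intros simp: inner_diff_left linear_scale[OF lin] inner_commute[of "H h" h])
  qed
  obtain \<xi> where xi: "0 < \<xi>" "\<xi> < 1" "r 1 - r 0 = (1 - 0) * ((dg (x + \<xi> *R h) - dg x - H (\<xi> *R h)) \<bullet> h)"
   using MVT2[of 0 1 r, OF _ dr] by auto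
  have "norm (\<xi> *R h) \<le> norm h" using xi by (simp add: mult_left_le_one_le)
  then have "norm (dg (x + \<xi> *R h) - dg x - H (\<xi> *R h)) \<le> \<eta> * norm (\<xi> *R h)"
   using d(2)[of "x + \<xi> *R h"] h by simp
  also have "\<dots> \<le> \<eta> * norm h" using \<open>norm (\<xi> *R h) \<le> norm h\<close> eta by simp
  finally have n: "norm (dg (x + \<xi> *R h) - dg x - H (\<xi> *R h)) \<le> \<eta> * norm h" .
  have "\<bar>r 1 - r 0\<bar> \<le> norm (dg (x + \<xi> *R h) - dg x - H (\<xi> *R h)) * norm h"
   unfolding xi(3) by (simp add: Cauchy_Schwarz_ineq2)
  also have "\<dots> \<le> \<eta> * norm h * norm h" using n by (intro mult_right_mono) auto
  finally show "\<bar>g (x + h) - g x - dg x \<bullet> h - (h \<bullet> H h) / 2\<bar> \<le> \<eta> * (norm h)^2"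
   by (simp add: r_def power2_eq_square algebra_simps)
 qed
qed

section \<open>Semiconcave functions, subjets and supergradients\<close>

lemma semiconcave_second_difference:
 assumes "semiconcave C u"
 shows "u (x + h) + u (x - h) - 2 * u x \<le> C * (norm h)^2"
proof -
 have "u (x - h) + (1/2) * (u (x - h + 2 *R h) - u (x - h)) \<le> u (x - h + (1/2) *R (2 *R h)) + C / 2 * (1/2) * (1 - 1/2) * (norm (2 *R h))^2"
  by (rule assms[unfolded semiconcave_def, rule_format]) auto
 moreover have "x - h + 2 *R h = x + h" "x - h + (1/2) *R (2 *R h) = x" by (auto simp: scaleR_2)
 ultimately show ?thesis by (simp add: power_mult_distrib) argo
qed

lemma subjet_hessian_le:
 assumes sc: "semiconcave C u" and j: "subjet u x q B"
 shows "h \<bullet> B h \<le> C * (norm h)^2"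
proof (cases "h = 0")
 case False
 obtain de where d: "de > 0" "\<And>h. norm h < de ==> u x + q \<bullet> h + (h \<bullet> B h) / 2 \<le> u (x + h)"
  using j by (auto simp: subjet_def)
 have lin: "linear B" using j by (simp add: subjet_def selfadjoint_def)
 define t where "t = de / (2 * norm h)"
 have t: "t > 0" "norm (t *R h) < de" using d(1) False by (auto simp: t_def)
 have "2 * u x + t^2 * (h \<bullet> B h) \<le> u (x + t *R h) + u (x - t *R h)"
  using d(2)[OF t(2)] d(2)[of "- (t *R h)"] t(2)
  by (simp add: linear_scale[OF lin] linear_neg[OF lin] power2_eq_square)
 also have "\<dots> \<le> 2 * u x + C * (norm (t *R h))^2"
  using semiconcave_second_difference[OF sc, of x "t *R h"] by simp
 finally have "t^2 * (h \<bullet> B h) \<le> t^2 * (C * (norm h)^2)" by (simp add: power_mult_distrib mult_ac)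
 then show ?thesis using t by simp
qed auto

text \<open>Semiconcavity compares the value at x + h with the value at x + t h, so a first-order
  upper bound along small t becomes a global one as t tends to 0.\<close>

lemma supergrad_of_upper:
 assumes sc: "semiconcave C u" and M: "de > 0"
  "\<And>t. 0 < t ==> t < de ==> u (x + t *R h) \<le> u x + t * (q \<bullet> h) + M * t^2"
 shows "u (x + h) \<le> u x + q \<bullet> h + C / 2 * (norm h)^2"
proof -
 have "u (x + h) - u x \<le> q \<bullet> h + M * t + C / 2 * (1 - t) * (norm h)^2" if t: "0 < t" "t < min 1 de" for t
 proof -
  have "t * (u (x + h) - u x) \<le> t * (q \<bullet> h) + M * t^2 + C / 2 * t * (1 - t) * (norm h)^2"
   using M(2)[of t] t sc[unfolded semiconcave_def, rule_format, of t x h] by simp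
  also have "\<dots> = t * (q \<bullet> h + M * t + C / 2 * (1 - t) * (norm h)^2)" by (simp add: power2_eq_square algebra_simps)
  finally show ?thesis using t by simp
 qed
 then have "\<forall>\<^sub>F t in at_right 0. u (x + h) - u x \<le> q \<bullet> h + M * t + C / 2 * (1 - t) * (norm h)^2"
  using eventually_at_right_less[of 0] eventually_at_right_real[of 0 "min 1 de"] M(1) by (auto elim!: eventually_mono)
 moreover have "((\<lambda>t. q \<bullet> h + M * t + C / 2 * (1 - t) * (norm h)^2) \<longlongrightarrow> q \<bullet> h + M * 0 + C / 2 * (1 - 0) * (norm h)^2) (at_right 0)"
  by (intro tendsto_intros)
 ultimately have "u (x + h) - u x \<le> q \<bullet> h + M * 0 + C / 2 * (1 - 0) * (norm h)^2"
  by (intro tendsto_lowerbound) auto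
 then show ?thesis by simp
qed

text \<open>A paraboloid below u bounds u (x - t h) from below, and the bound on second differences
  then bounds u (x + t h) from above. In effect a semiconcave function is differentiable wherever it
  has a subjet.\<close>

lemma subjet_imp_supergrad:
 assumes sc: "semiconcave C u" and j: "subjet u x q B"
 shows "supergrad C u x q"
 unfolding supergrad_def
proof
 fix h
 obtain de where d: "de > 0" "\<And>h. norm h < de ==> u x + q \<bullet> h + (h \<bullet> B h) / 2 \<le> u (x + h)"
  using j by (auto simp: subjet_def)
 have lin: "linear B" using j by (simp add: subjet_def selfadjoint_def)
 show "u (x + h) \<le> u x + q \<bullet> h + C / 2 * (norm h)^2"
 proof (rule supergrad_of_upper[OF sc, of "de / (norm h + 1)" x h q "C * (norm h)^2 - (h \<bullet> B h) / 2"])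
  show "0 < de / (norm h + 1)" using d(1) by (simp add: add_nonneg_pos)
  fix t assume t: "0 < t" "t < de / (norm h + 1)"
  then have "t * norm h + t < de" using pos_less_divide_eq[of "norm h + 1" t de] norm_ge_zero[of h] by (simp add: algebra_simps)
  then have "norm (- (t *R h)) < de" using t by simp
  from d(2)[OF this] semiconcave_second_difference[OF sc, of x "t *R h"]
  show "u (x + t *R h) \<le> u x + t * (q \<bullet> h) + (C * (norm h)^2 - (h \<bullet> B h) / 2) * t^2"
   by (simp add: linear_scale[OF lin] linear_neg[OF lin] power2_eq_square algebra_simps)
 qed
qed

lemma differentiable_imp_supergrad:
 assumes sc: "semiconcave C u" and d: "(u has_derivative (\<lambda>h. q \<bullet> h)) (at x)"
 shows "supergrad C u x q"
 unfolding supergrad_def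
proof
 fix h
 have "((\<lambda>t. x + t *R h) has_derivative (\<lambda>s. s *R h)) (at 0)" by (auto intro!: derivative_eq_intros)
 from has_derivative_compose[OF this, of u "\<lambda>h. q \<bullet> h"] d
 have "((\<lambda>t. u (x + t *R h)) has_real_derivative q \<bullet> h) (at 0)"
  by (simp add: has_field_derivative_def mult_commute_abs)
 then have "((\<lambda>t. (u (x + t *R h) - u x) / t) \<longlongrightarrow> q \<bullet> h) (at_right 0)"
  unfolding DERIV_def by (auto intro: tendsto_mono[OF at_le])
 moreover have "((\<lambda>t. C / 2 * (1 - t) * (norm h)^2) \<longlongrightarrow> C / 2 * (1 - 0) * (norm h)^2) (at_right 0)"
  by (intro tendsto_intros)
 ultimately have "((\<lambda>t. (u (x + t *R h) - u x) / t + C / 2 * (1 - t) * (norm h)^2) \<longlongrightarrow> q \<bullet> h + C / 2 * (1 - 0) * (norm h)^2) (at_right 0)"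
  by (rule tendsto_add)
 moreover have "\<forall>\<^sub>F t in at_right 0. u (x + h) - u x \<le> (u (x + t *R h) - u x) / t + C / 2 * (1 - t) * (norm h)^2"
  using eventually_at_right_real[OF zero_less_one]
 proof eventually_elim
  case (elim t)
  then have "t * (u (x + h) - u x) \<le> (u (x + t *R h) - u x) + C / 2 * t * (1 - t) * (norm h)^2"
   using sc[unfolded semiconcave_def, rule_format, of t x h] by simp
  also have "\<dots> = t * ((u (x + t *R h) - u x) / t + C / 2 * (1 - t) * (norm h)^2)"
  proof -
   have "t \<noteq> 0" using elim by auto
   then show ?thesis by (simp add: distrib_left)
  qed
  finally show ?case using elim by simp
 qed
 ultimately have "u (x + h) - u x \<le> q \<bullet> h + C / 2 * (1 - 0) * (norm h)^2"
  by (intro tendsto_lowerbound) auto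
 then show "u (x + h) \<le> u x + q \<bullet> h + C / 2 * (norm h)^2" by simp
qed

section \<open>From jets to distributions by Gaussian regularization\<close>

lemma continuous_box_convolution:
 fixes u :: "'a::euclidean_space => real" and K :: "'a => 'b::euclidean_space"
 assumes "continuous_on UNIV K" "continuous_on (cbox a b) u"
 shows "continuous_on UNIV (\<lambda>x. integral (cbox a b) (\<lambda>y. u y *R K (x - y)))"
proof (rule integral_continuous_on_param)
 show "continuous_on (UNIV \<times> cbox a b) (\<lambda>(x, y). u y *R K (x - y))"
  unfolding split_beta
  by (intro continuous_intros continuous_on_compose2[OF assms(1)] continuous_on_compose2[OF assms(2)]) auto
qed

text \<open>Leibniz' rule works with derivatives as bounded linear functions, so \<open>K'\<close>
  is packaged by \<open>Blinfun\<close>; continuity of the package follows from that of the basis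
  components.\<close>

lemma box_convolution_derivative:
 fixes u :: "'a::euclidean_space => real" and K :: "'a => 'b::euclidean_space"
 assumes K: "\<And>x. (K has_derivative K' x) (at x)" "\<And>i. i \<in> Basis ==> continuous_on UNIV (\<lambda>x. K' x i)"
  and u: "continuous_on (cbox a b) u"
 shows "((\<lambda>x. integral (cbox a b) (\<lambda>y. u y *R K (x - y))) has_derivative
  (\<lambda>h. integral (cbox a b) (\<lambda>y. u y *R K' (x - y) h))) (at x)"
proof -
 have bl: "bounded_linear (K' x)" for x using K(1) by (rule has_derivative_bounded_linear)
 have contK: "continuous_on UNIV K"
  using K(1) by (meson continuous_at_imp_continuous_on has_derivative_continuous)
 have cB: "continuous_on UNIV (\<lambda>x. Blinfun (K' x))"
 proof (rule continuous_on_blinfun_componentwise)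
  fix i :: 'a assume "i \<in> Basis"
  then show "continuous_on UNIV (\<lambda>x. blinfun_apply (Blinfun (K' x)) i)"
   using K(2) by (simp add: bounded_linear_Blinfun_apply bl)
 qed
 define D where "D x y = u y *R Blinfun (K' (x - y))" for x y
 have Dapp: "blinfun_apply (D x y) h = u y *R K' (x - y) h" for x y h
  by (simp add: D_def scaleR_blinfun.rep_eq bounded_linear_Blinfun_apply bl)
 have cD: "continuous_on (UNIV \<times> cbox a b) (\<lambda>(x, y). D x y)"
  unfolding split_beta D_def
  by (intro continuous_intros continuous_on_compose2[OF cB] continuous_on_compose2[OF u]) auto
 have "((\<lambda>x. integral (cbox a b) (\<lambda>y. u y *R K (x - y))) has_derivative blinfun_apply (integral (cbox a b) (D x))) (at x within UNIV)"
 proof (rule leibniz_rule[OF _ _ cD])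
  fix x y :: 'a
  have "((\<lambda>x. x - y) has_derivative (\<lambda>h. h)) (at x within UNIV)" by (auto intro!: derivative_eq_intros)
  from has_derivative_compose[OF this K(1)[of "x - y"]]
  have "((\<lambda>x. u y *R K (x - y)) has_derivative (\<lambda>h. u y *R K' (x - y) h)) (at x within UNIV)"
   by (intro has_derivative_scaleR_right)
  then show "((\<lambda>x. u y *R K (x - y)) has_derivative blinfun_apply (D x y)) (at x within UNIV)"
   by (simp add: Dapp[abs_def])
  show "(\<lambda>y. u y *R K (x - y)) integrable_on cbox a b"
   by (intro integrable_continuous continuous_intros u continuous_on_compose2[OF contK]) auto
 qed auto
 moreover have "blinfun_apply (integral (cbox a b) (D x)) = (\<lambda>h. integral (cbox a b) (\<lambda>y. u y *R K' (x - y) h))"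
 proof (rule ext)
  fix h
  have "continuous_on (cbox a b) (D x)"
   unfolding D_def by (intro continuous_intros u continuous_on_compose2[OF cB]) auto
  then show "blinfun_apply (integral (cbox a b) (D x)) h = integral (cbox a b) (\<lambda>y. u y *R K' (x - y) h)"
   by (simp add: blinfun_apply_integral[OF integrable_continuous] Dapp)
 qed
 ultimately show ?thesis by (simp only:)
qed

text \<open>The first fundamental form I + p p^T of a graph of slope p; \<open>mcurv p\<close> is
  the trace against its inverse.\<close>

definition tilt :: "'a::euclidean_space => 'a => 'a" where
 "tilt p z = z + (p \<bullet> z) *R p"

lemma tilt_simps: "linear (tilt p)" "tilt p z \<bullet> w = z \<bullet> tilt p w" "tilt p z \<bullet> z = z \<bullet> z + (p \<bullet> z)^2"
 by (auto simp: tilt_def linear_iff inner_add_left inner_add_right inner_commute power2_eq_square algebra_simps)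

lemma mcurv_tilt: "mcurv (p::'a::euclidean_space) (tilt p) = DIM('a)"
proof -
 have "mcurv p (\<lambda>h. h + (p \<bullet> h) *R p) = DIM('a) - (p \<bullet> p) / (1 + p \<bullet> p) + (p \<bullet> p - (p \<bullet> p)\<^sup>2 / (1 + p \<bullet> p))"
  unfolding mcurv_add mcurv_id mcurv_rank_one ..
 also have "\<dots> = DIM('a)" 
 proof -
  have "(1 + p \<bullet> p) * (p \<bullet> p) / (1 + p \<bullet> p) = p \<bullet> p" using one_plus_inner_pos(1)[of p] by simp
  then have "(p \<bullet> p) / (1 + p \<bullet> p) + (p \<bullet> p)^2 / (1 + p \<bullet> p) = p \<bullet> p"
   by (simp only: add_divide_distrib[symmetric] power2_eq_square distrib_right mult_1_left)
  then show ?thesis by simp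
 qed
 finally show ?thesis by (simp add: tilt_def[abs_def])
qed

lemma mcurv_tilt_rank_one: "mcurv p (\<lambda>h. (tilt p z \<bullet> h) *R tilt p z) = tilt p z \<bullet> z"
proof -
 have "p \<bullet> tilt p z = (1 + p \<bullet> p) * (p \<bullet> z)" by (simp add: tilt_def inner_add_right algebra_simps)
 then have "(p \<bullet> tilt p z)^2 / (1 + p \<bullet> p) = (1 + p \<bullet> p) * (p \<bullet> z)^2"
  using one_plus_inner_pos(1)[of p] by (simp add: power2_eq_square)
 moreover have "tilt p z \<bullet> tilt p z = z \<bullet> z + 2 * (p \<bullet> z)^2 + (p \<bullet> p) * (p \<bullet> z)^2"
  by (simp add: tilt_def inner_add_left inner_add_right inner_commute power2_eq_square algebra_simps)
 ultimately show ?thesis unfolding mcurv_rank_one by (simp add: tilt_simps(3) algebra_simps)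
qed

text \<open>The fundamental solution of the heat equation for the constant-coefficient operator
  \<open>mcurv p\<close>, up to normalisation. Its total mass is kept as a positive constant, called
  \<open>Z\<close> in the later proofs, instead of being computed.\<close>

definition heat :: "'a::euclidean_space => real => 'a => real" where
 "heat p t z = t powr (- (DIM('a) / 2)) * exp (- (tilt p z \<bullet> z) / (4 * t))"

definition dheat :: "'a::euclidean_space => real => 'a => 'a" where
 "dheat p t z = (- heat p t z / (2 * t)) *R tilt p z"

definition Hheat :: "'a::euclidean_space => real => 'a => 'a => 'a" where
 "Hheat p t z h = (heat p t z / (4 * t^2)) *R ((tilt p z \<bullet> h) *R tilt p z) - (heat p t z / (2 * t)) *R tilt p h"

definition Lheat :: "'a::euclidean_space => real => 'a => real" where
 "Lheat p t z = heat p t z * ((tilt p z \<bullet> z) / (4 * t^2) - DIM('a) / (2 * t))"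

lemma tilt_derivative: "(tilt p has_derivative tilt p) (at z)"
 by (rule linear_imp_has_derivative[OF tilt_simps(1)])

lemma heat_derivative:
 assumes "t > 0"
 shows "(heat p t has_derivative (\<lambda>h. dheat p t z \<bullet> h)) (at z)"
proof -
 have "((\<lambda>z. tilt p z \<bullet> z) has_derivative (\<lambda>h. tilt p z \<bullet> h + tilt p h \<bullet> z)) (at z)"
  by (rule has_derivative_inner[OF tilt_derivative has_derivative_ident])
 then have "((\<lambda>z. tilt p z \<bullet> z) has_derivative (\<lambda>h. 2 * (tilt p z \<bullet> h))) (at z)"
  by (rule has_derivative_eq_rhs) (simp add: fun_eq_iff tilt_simps(2) inner_commute[of z])
 from has_derivative_mult_right[OF has_derivative_compose[OF has_derivative_mult_right[OF this, of "- 1 / (4 * t)"]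
   DERIV_exp[unfolded has_field_derivative_def]], of "t powr (- (DIM('a) / 2))"]
 have "((\<lambda>z. t powr (- (DIM('a) / 2)) * exp (- 1 / (4 * t) * (tilt p z \<bullet> z))) has_derivative
  (\<lambda>h. dheat p t z \<bullet> h)) (at z)"
  by (rule has_derivative_eq_rhs) (use assms in \<open>simp add: fun_eq_iff dheat_def heat_def\<close>)
 then show ?thesis by (simp add: heat_def[abs_def])
qed

lemma dheat_derivative:
 assumes "t > 0"
 shows "(dheat p t has_derivative Hheat p t z) (at z)"
proof -
 have "((\<lambda>z. - heat p t z / (2 * t)) has_derivative (\<lambda>h. - (dheat p t z \<bullet> h) / (2 * t))) (at z)"
  using assms by (auto intro!: derivative_eq_intros heat_derivative)
 from has_derivative_scaleR[OF this tilt_derivative]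
 have "((\<lambda>z. (- heat p t z / (2 * t)) *R tilt p z) has_derivative
  (\<lambda>h. (- heat p t z / (2 * t)) *R tilt p h + (- (dheat p t z \<bullet> h) / (2 * t)) *R tilt p z)) (at z)" .
 then show ?thesis
  unfolding dheat_def[abs_def]
  by (rule has_derivative_eq_rhs)
   (simp add: fun_eq_iff Hheat_def power2_eq_square)
qed

lemma heat_time_derivative:
 fixes z :: "'a::euclidean_space"
 assumes "t > 0"
 shows "((\<lambda>t. heat p t z) has_real_derivative Lheat p t z) (at t)"
proof -
 define Q where "Q = tilt p z \<bullet> z"
 define n where "n = DIM('a) / 2"
 have "((\<lambda>t. t powr (- n)) has_real_derivative (- n) * t powr (- n - 1)) (at t)"
  using has_real_derivative_powr[OF assms, of "- n"] by simp
 moreover have "((\<lambda>t. - Q / (4 * t)) has_real_derivative Q / (4 * t^2)) (at t)"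
  using assms by (auto intro!: derivative_eq_intros simp: power2_eq_square field_simps)
 from DERIV_fun_exp[OF this]
 have "((\<lambda>t. exp (- Q / (4 * t))) has_real_derivative exp (- Q / (4 * t)) * (Q / (4 * t^2))) (at t)" .
 ultimately have "((\<lambda>t. t powr (- n) * exp (- Q / (4 * t))) has_real_derivative
   (- n) * t powr (- n - 1) * exp (- Q / (4 * t)) + exp (- Q / (4 * t)) * (Q / (4 * t^2)) * t powr (- n)) (at t)"
  by (rule DERIV_mult)
 moreover have "t powr (- n - 1) = t powr (- n) / t" using assms by (simp add: powr_diff)
 ultimately show ?thesis
  unfolding heat_def Lheat_def Q_def[symmetric] n_def[symmetric]
  by (simp add: n_def algebra_simps)
qed

text \<open>Together with \<open>heat_time_derivative\<close> this is the heat equation for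
  \<open>heat p\<close>.\<close>

lemma mcurv_Hheat: "mcurv p (Hheat p t z) = Lheat p t z"
 unfolding Hheat_def[abs_def] mcurv_diff mcurv_scale mcurv_tilt_rank_one
 using mcurv_tilt[of p] by (simp add: Lheat_def algebra_simps)

lemma selfadjoint_Hheat: "selfadjoint (Hheat p t z)"
 unfolding selfadjoint_def
proof (intro conjI allI)
 show "linear (Hheat p t z)"
  unfolding Hheat_def linear_iff
  by (auto simp: inner_add_right linear_add[OF tilt_simps(1)] linear_scale[OF tilt_simps(1)] algebra_simps)
 show "Hheat p t z h \<bullet> k = h \<bullet> Hheat p t z k" for h k
  unfolding Hheat_def
  by (simp add: inner_diff_left inner_diff_right tilt_simps(2)[of p h k] inner_commute[of h "tilt p z"])
qed

lemma continuous_tilt [continuous_intros]: "continuous_on S f ==> continuous_on S (\<lambda>x. tilt p (f x))"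
 unfolding tilt_def by (intro continuous_intros)

lemma continuous_heat:
 assumes "continuous_on S f" "continuous_on S g" "\<And>x. x \<in> S ==> f x > 0"
 shows "continuous_on S (\<lambda>x. heat p (f x) (g x))" "continuous_on S (\<lambda>x. Lheat p (f x) (g x))"
  "continuous_on S (\<lambda>x. dheat p (f x) (g x))" "continuous_on S (\<lambda>x. Hheat p (f x) (g x) i)"
proof -
 have n: "f x \<noteq> 0" if "x \<in> S" for x using assms(3)[OF that] by simp
 show h: "continuous_on S (\<lambda>x. heat p (f x) (g x))"
  unfolding heat_def using n by (intro continuous_intros assms) auto
 show "continuous_on S (\<lambda>x. Lheat p (f x) (g x))" "continuous_on S (\<lambda>x. dheat p (f x) (g x))"
  "continuous_on S (\<lambda>x. Hheat p (f x) (g x) i)"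
  unfolding Lheat_def dheat_def Hheat_def using n by (intro continuous_intros assms h; simp)+
qed

lemma lborel_integral_affine:
 fixes f :: "'a::euclidean_space => real"
 assumes [measurable]: "f \<in> borel_measurable borel" and c: "c \<noteq> 0"
 shows "(LBINT x. f x) = \<bar>c\<bar> ^ DIM('a) * (LBINT x. f (t + c *R x))"
  "integrable lborel f \<longleftrightarrow> integrable lborel (\<lambda>x. f (t + c *R x))"
proof -
 show "(LBINT x. f x) = \<bar>c\<bar> ^ DIM('a) * (LBINT x. f (t + c *R x))"
  by (subst lborel_affine[OF c, of t]) (simp add: integral_density integral_distr)
 show "integrable lborel f \<longleftrightarrow> integrable lborel (\<lambda>x. f (t + c *R x))"
  by (subst lborel_affine[OF c, of t]) (use c in \<open>simp add: integrable_density integrable_distr_eq\<close>)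
qed

lemma integrable_gaussian: "integrable lborel (\<lambda>z::'a::euclidean_space. exp (- (norm z)\<^sup>2 / 8))"
proof (rule integrableI_nonneg)
 have one: "(\<integral>\<^sup>+x. ennreal (exp (- x\<^sup>2 / 8)) \<partial>lborel) = ennreal (\<integral>x. exp (- x\<^sup>2 / 8) \<partial>(lborel :: real measure))"
 proof -
  have "integrable lborel (\<lambda>x. sqrt (8 * pi) * normal_density 0 2 x)" by simp
  moreover have "(\<lambda>x. sqrt (8 * pi) * normal_density 0 2 x) = (\<lambda>x. exp (- x\<^sup>2 / 8))"
   by (simp add: normal_density_def fun_eq_iff mult.commute)
  ultimately have "integrable lborel (\<lambda>x::real. exp (- x\<^sup>2 / 8))" by simp
  then show ?thesis by (simp add: nn_integral_eq_integral)
 qed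
 have "exp (- (norm z)\<^sup>2 / 8) = (\<Prod>b\<in>Basis. exp (- (z \<bullet> b)\<^sup>2 / 8))" for z :: 'a
 proof -
  have "(norm z)^2 = (\<Sum>b\<in>Basis. (z \<bullet> b)^2)"
   unfolding power2_norm_eq_inner by (simp add: euclidean_inner[of z z] power2_eq_square)
  then have "- (norm z)\<^sup>2 / 8 = (\<Sum>b\<in>Basis. - (z \<bullet> b)\<^sup>2 / 8)"
   by (simp add: sum_negf sum_divide_distrib)
  then show ?thesis by (simp only: exp_sum finite_Basis)
 qed
 then have "(\<integral>\<^sup>+z. ennreal (exp (- (norm z)\<^sup>2 / 8)) \<partial>(lborel :: 'a measure))
   = (\<integral>\<^sup>+z. (\<Prod>b\<in>Basis. ennreal (exp (- (z \<bullet> b)\<^sup>2 / 8))) \<partial>(lborel :: 'a measure))"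
  by (simp add: prod_ennreal)
 also have "\<dots> = (\<Prod>b\<in>(Basis::'a set). (\<integral>\<^sup>+x. ennreal (exp (- x\<^sup>2 / 8)) \<partial>lborel))"
  by (rule nn_integral_lborel_prod) auto
 also have "\<dots> < \<infinity>" unfolding one by (simp add: ennreal_power)
 finally show "(\<integral>\<^sup>+z. ennreal (exp (- (norm z)\<^sup>2 / 8)) \<partial>(lborel :: 'a measure)) < \<infinity>" .
qed auto

text \<open>The kernel at time 1 is at most exp (- |z|^2 / 4); giving up half of the exponent pays
  for the factor \<open>norm z\<close>.\<close>

lemma heat_one_bounds:
 fixes z :: "'a::euclidean_space"
 shows "0 < heat p 1 z" "heat p 1 z \<le> exp (- (norm z)\<^sup>2 / 8)" "norm z * heat p 1 z \<le> 2 * exp (- (norm z)\<^sup>2 / 8)"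
proof -
 show "0 < heat p 1 z" by (simp add: heat_def)
 have 1: "heat p 1 z \<le> exp (- (norm z)\<^sup>2 / 4)" by (simp add: heat_def tilt_simps(3) power2_norm_eq_inner)
 also have "\<dots> \<le> exp (- (norm z)\<^sup>2 / 8)" by simp
 finally show "heat p 1 z \<le> exp (- (norm z)\<^sup>2 / 8)" .
 have "norm z \<le> 2 * (1 + (norm z)^2 / 8)"
 proof -
  have "0 \<le> (norm z / 2 - 1)^2" by simp
  also have "\<dots> = (norm z)^2 / 4 - norm z + 1" by (simp add: power2_diff power_divide)
  finally show ?thesis by simp
 qed
 also have "\<dots> \<le> 2 * exp ((norm z)^2 / 8)" by (intro mult_left_mono exp_ge_add_one_self) auto
 finally have "norm z * heat p 1 z \<le> (2 * exp ((norm z)^2 / 8)) * exp (- (norm z)\<^sup>2 / 4)"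
  using 1 \<open>0 < heat p 1 z\<close> by (intro mult_mono) auto
 also have "\<dots> = 2 * exp (- (norm z)\<^sup>2 / 8)" by (simp add: exp_add[symmetric] mult.assoc)
 finally show "norm z * heat p 1 z \<le> 2 * exp (- (norm z)\<^sup>2 / 8)" .
qed

lemma heat_scaling:
 fixes z :: "'a::euclidean_space"
 assumes "t > 0"
 shows "sqrt t ^ DIM('a) * heat p t (sqrt t *R z) = heat p 1 z"
proof -
 have "sqrt t ^ DIM('a) = t powr (DIM('a) / 2)"
  using assms by (simp add: powr_half_sqrt[symmetric] powr_realpow[symmetric] powr_powr)
 moreover have "t powr (DIM('a) / 2) * t powr (- (DIM('a) / 2)) = 1"
  using assms by (simp add: powr_add[symmetric])
 moreover have "tilt p (sqrt t *R z) \<bullet> (sqrt t *R z) / (4 * t) = (tilt p z \<bullet> z) / 4"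
  using assms by (simp add: linear_scale[OF tilt_simps(1)] mult.assoc[symmetric])
 ultimately show ?thesis
  unfolding heat_def by (simp add: mult.assoc[symmetric])
qed

lemma heat_integrals:
 fixes x :: "'a::euclidean_space"
 assumes t: "t > 0"
 shows "integrable lborel (\<lambda>y. heat p t (x - y))" "(LBINT y. heat p t (x - y)) = (LBINT z. heat p 1 z)"
  "integrable lborel (\<lambda>y. norm (x - y) * heat p t (x - y))"
  "(LBINT y. norm (x - y) * heat p t (x - y)) = sqrt t * (LBINT z. norm z * heat p 1 z)"
proof -
 have cont: "continuous_on UNIV (heat p t)" if "t > 0" for t
  using continuous_heat(1)[of UNIV "\<lambda>_. t" "\<lambda>x. x"] that by simp
 have m: "(\<lambda>y. heat p t (x - y)) \<in> borel_measurable borel" "(\<lambda>y. norm (x - y) * heat p t (x - y)) \<in> borel_measurable borel"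
  by (intro borel_measurable_continuous_onI continuous_intros continuous_on_compose2[OF cont[OF t]]; simp)+
 have i1: "integrable lborel (heat p 1)"
  by (rule Bochner_Integration.integrable_bound[OF integrable_gaussian])
   (use heat_one_bounds[of p] cont[of 1] in \<open>auto intro!: borel_measurable_continuous_onI simp: abs_of_pos\<close>)
 have i2: "integrable lborel (\<lambda>z. norm z * heat p 1 z)"
 proof (rule Bochner_Integration.integrable_bound[OF integrable_mult_right[OF integrable_gaussian, of 2]])
  show "(\<lambda>z. norm z * heat p 1 z) \<in> borel_measurable lborel"
   using cont[of 1] by (auto intro!: borel_measurable_continuous_onI continuous_intros)
  show "AE z in lborel. norm (norm z * heat p 1 z) \<le> norm (2 * exp (- (norm z)\<^sup>2 / 8))"
  proof (intro AE_I2)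
   fix z :: 'a
   show "norm (norm z * heat p 1 z) \<le> norm (2 * exp (- (norm z)\<^sup>2 / 8))"
    using heat_one_bounds(1)[where p = p and z = z] heat_one_bounds(3)[where p = p and z = z] by (simp add: abs_mult)
  qed
 qed
 have c: "- sqrt t \<noteq> 0" using t by simp
 have h: "heat p t (x - (x + (- sqrt t) *R z)) = heat p 1 z / sqrt t ^ DIM('a)" for z
  using heat_scaling[OF t, of p z] t by (simp add: field_simps)
 show "integrable lborel (\<lambda>y. heat p t (x - y))"
  using lborel_integral_affine(2)[OF m(1) c, of x] i1 unfolding h by simp
 show "(LBINT y. heat p t (x - y)) = (LBINT z. heat p 1 z)"
  using lborel_integral_affine(1)[OF m(1) c, of x] t unfolding h by simp
 have n: "norm (x - (x + (- sqrt t) *R z)) * (heat p 1 z / sqrt t ^ DIM('a)) = (sqrt t / sqrt t ^ DIM('a)) * (norm z * heat p 1 z)" for z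
  using t by simp
 show "integrable lborel (\<lambda>y. norm (x - y) * heat p t (x - y))"
  using lborel_integral_affine(2)[OF m(2) c, of x] i2 unfolding h n by simp
 show "(LBINT y. norm (x - y) * heat p t (x - y)) = sqrt t * (LBINT z. norm z * heat p 1 z)"
  using lborel_integral_affine(1)[OF m(2) c, of x] t unfolding h n by simp
qed

lemma integral_cbox_indicator:
 fixes f :: "'a::euclidean_space => real"
 assumes "continuous_on (cbox a b) f"
 shows "integrable lborel (\<lambda>y. indicator (cbox a b) y * f y)"
  "integral (cbox a b) f = (LBINT y. indicator (cbox a b) y * f y)"
proof -
 have *: "set_integrable lborel (cbox a b) f"
  unfolding set_integrable_def using borel_integrable_compact[OF compact_cbox assms] .
 then show "integrable lborel (\<lambda>y. indicator (cbox a b) y * f y)" by (simp add: set_integrable_def)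
 show "integral (cbox a b) f = (LBINT y. indicator (cbox a b) y * f y)"
  using set_borel_integral_eq_integral(2)[OF *] by (simp add: set_lebesgue_integral_def)
qed

text \<open>The convolution is cut off to a box. Inside the box the Lipschitz bound gives La |x -
  y|; outside, |x - y| > rh, so the missing value, at most U, is bounded by U / rh times |x - y|.
  The first moment of the kernel is of order sqrt t.\<close>

lemma heat_approximation:
 fixes x :: "'a::euclidean_space"
 assumes t: "t > 0" and Lip: "\<And>x y. \<bar>u x - u y\<bar> \<le> La * norm (x - y)" and rh: "rh > 0" "cball x rh \<subseteq> cbox a b"
  and U: "\<bar>u x\<bar> \<le> U"
 shows "\<bar>integral (cbox a b) (\<lambda>y. u y * heat p t (x - y)) - (LBINT z. heat p 1 z) * u x\<bar>
  \<le> (La + U / rh) * (LBINT z. norm z * heat p 1 z) * sqrt t"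
proof -
 have Lam: "La \<ge> 0"
 proof -
  obtain b :: 'a where "b \<in> Basis" using nonempty_Basis by blast
  then show ?thesis using order_trans[OF abs_ge_zero Lip[of b 0]] by simp
 qed
 have contu: "continuous_on S u" for S
  by (rule lipschitz_on_continuous_on[where L = La]) (use Lip in \<open>auto simp: dist_norm lipschitz_on_def Lam\<close>)
 have cont: "continuous_on UNIV (heat p t)"
  using continuous_heat(1)[of UNIV "\<lambda>_. t" "\<lambda>x. x"] t by simp
 have pos: "heat p t z \<ge> 0" for z by (simp add: heat_def)
 have c1: "continuous_on (cbox a b) (\<lambda>y. u y * heat p t (x - y))"
  by (intro continuous_intros contu continuous_on_compose2[OF cont]) auto
 note I = integral_cbox_indicator[OF c1]
 have J: "integrable lborel (\<lambda>y. u x * heat p t (x - y))" by (intro integrable_mult_right heat_integrals(1)[OF t])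
 have eq: "integral (cbox a b) (\<lambda>y. u y * heat p t (x - y)) - (LBINT z. heat p 1 z) * u x
  = (LBINT y. indicator (cbox a b) y * (u y * heat p t (x - y)) - u x * heat p t (x - y))"
  unfolding I(2) Bochner_Integration.integral_diff[OF I(1) J] using heat_integrals(2)[OF t, of p x] by (simp add: mult.commute)
 have "\<bar>integral (cbox a b) (\<lambda>y. u y * heat p t (x - y)) - (LBINT z. heat p 1 z) * u x\<bar>
   \<le> (LBINT y. \<bar>indicator (cbox a b) y * (u y * heat p t (x - y)) - u x * heat p t (x - y)\<bar>)"
  unfolding eq by (rule integral_abs_bound)
 also have "\<dots> \<le> (LBINT y. (La + U / rh) * (norm (x - y) * heat p t (x - y)))"
 proof (rule integral_mono)
  show "integrable lborel (\<lambda>y. \<bar>indicator (cbox a b) y * (u y * heat p t (x - y)) - u x * heat p t (x - y)\<bar>)"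
   by (rule integrable_abs[OF Bochner_Integration.integrable_diff[OF I(1) J]])
  show "integrable lborel (\<lambda>y. (La + U / rh) * (norm (x - y) * heat p t (x - y)))"
   by (rule integrable_mult_right[OF heat_integrals(3)[OF t]])
  fix y
  have "\<bar>indicator (cbox a b) y * u y - u x\<bar> \<le> (La + U / rh) * norm (x - y)"
  proof (cases "y \<in> cbox a b")
   case True
   have "La * norm (x - y) \<le> (La + U / rh) * norm (x - y)" using U rh by (intro mult_right_mono) auto
   then show ?thesis using Lip[of y x] True by (simp add: norm_minus_commute)
  next
   case False
   then have "norm (x - y) > rh" using rh by (metis dist_norm in_mono linorder_not_less mem_cball)
   then have "U * 1 \<le> U * (norm (x - y) / rh)" using U rh by (intro mult_left_mono) auto
   moreover have "0 \<le> La * norm (x - y)" using Lam by simp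
   ultimately show ?thesis using False U by (simp add: distrib_right)
  qed
  then have "\<bar>indicator (cbox a b) y * u y - u x\<bar> * heat p t (x - y) \<le> (La + U / rh) * norm (x - y) * heat p t (x - y)"
   by (intro mult_right_mono pos)
  moreover have "indicator (cbox a b) y * (u y * heat p t (x - y)) - u x * heat p t (x - y)
    = (indicator (cbox a b) y * u y - u x) * heat p t (x - y)" by (simp add: algebra_simps)
  ultimately show "\<bar>indicator (cbox a b) y * (u y * heat p t (x - y)) - u x * heat p t (x - y)\<bar>
    \<le> (La + U / rh) * (norm (x - y) * heat p t (x - y))"
   using pos[of "x - y"] by (simp add: abs_mult mult.assoc)
 qed
 also have "\<dots> = (La + U / rh) * (LBINT z. norm z * heat p 1 z) * sqrt t"
  using heat_integrals(4)[OF t, of x p] by simp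
 finally show ?thesis .
qed

text \<open>The third power makes the truncated paraboloid twice continuously differentiable. The
  sign \<sigma> = 1 gives a bump supported in the ball of radius ep, and \<sigma> = -1 gives a
  barrier that vanishes in this ball.\<close>

lemma cubic_bump_derivative:
 fixes z :: "'a::euclidean_space" and \<sigma> ep :: real
 defines "m \<equiv> \<lambda>z::'a. max 0 (\<sigma> * (ep^2 - z \<bullet> z))"
 shows "((\<lambda>z. (m z) ^ 3) has_derivative (\<lambda>h. ((- 6 * \<sigma> * (m z)^2) *R z) \<bullet> h)) (at z)"
  "((\<lambda>z. (- 6 * \<sigma> * (m z)^2) *R z) has_derivative
   (\<lambda>h. (24 * \<sigma>^2 * m z) *R ((z \<bullet> h) *R z) - (6 * \<sigma> * (m z)^2) *R h)) (at z)"
proof -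
 have ds: "((\<lambda>z. \<sigma> * (ep^2 - z \<bullet> z)) has_derivative (\<lambda>h. - 2 * \<sigma> * (z \<bullet> h))) (at z)"
  by (auto intro!: derivative_eq_intros simp: fun_eq_iff inner_commute)
 have p3: "((\<lambda>s. (max 0 s) ^ 3) has_real_derivative 3 * (max 0 s)^2) (at s)" for s :: real
  by (rule DERIV_pos_part_comp) (auto intro!: derivative_eq_intros)
 have p2: "((\<lambda>s. (max 0 s)^2) has_real_derivative 2 * max 0 s) (at s)" for s :: real
  by (rule DERIV_pos_part_comp) (auto intro!: derivative_eq_intros)
 show "((\<lambda>z. (m z) ^ 3) has_derivative (\<lambda>h. ((- 6 * \<sigma> * (m z)^2) *R z) \<bullet> h)) (at z)"
  unfolding m_def
  by (rule has_derivative_eq_rhs[OF has_derivative_compose[OF ds p3[unfolded has_field_derivative_def]]])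
   (simp add: fun_eq_iff)
 have "((\<lambda>z. (m z)^2) has_derivative (\<lambda>h. - 4 * \<sigma> * m z * (z \<bullet> h))) (at z)"
  unfolding m_def
  by (rule has_derivative_eq_rhs[OF has_derivative_compose[OF ds p2[unfolded has_field_derivative_def]]])
   (simp add: fun_eq_iff)
 then have "((\<lambda>z. - 6 * \<sigma> * (m z)^2) has_derivative (\<lambda>h. - 6 * \<sigma> * (- 4 * \<sigma> * m z * (z \<bullet> h)))) (at z)"
  by (intro has_derivative_mult_right)
 from has_derivative_scaleR[OF this has_derivative_ident]
 show "((\<lambda>z. (- 6 * \<sigma> * (m z)^2) *R z) has_derivative
   (\<lambda>h. (24 * \<sigma>^2 * m z) *R ((z \<bullet> h) *R z) - (6 * \<sigma> * (m z)^2) *R h)) (at z)"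
  by (rule has_derivative_eq_rhs) (simp add: fun_eq_iff power2_eq_square)
qed

lemma selfadjoint_bump_hessian: "selfadjoint (\<lambda>h. c *R ((z \<bullet> h) *R z) - d *R h)"
 unfolding selfadjoint_def linear_iff
 by (auto simp: inner_diff_left inner_diff_right inner_add_right algebra_simps inner_commute)

section \<open>Heat flow of a continuous function cut off to a box\<close>

definition heat_conv :: "'a::euclidean_space => 'a => ('a => real) => 'a => real => 'a => real" where
 "heat_conv a b u p t x = integral (cbox a b) (\<lambda>y. u y * heat p t (x - y))"

definition dheat_conv :: "'a::euclidean_space => 'a => ('a => real) => 'a => real => 'a => 'a" where
 "dheat_conv a b u p t x = integral (cbox a b) (\<lambda>y. u y *R dheat p t (x - y))"

definition Hheat_conv :: "'a::euclidean_space => 'a => ('a => real) => 'a => real => 'a => 'a => 'a" where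
 "Hheat_conv a b u p t x h = integral (cbox a b) (\<lambda>y. u y *R Hheat p t (x - y) h)"

context
 fixes a b p :: "'a::euclidean_space" and u :: "'a => real"
 assumes contu: "continuous_on UNIV u"
begin

lemma heat_conv_derivs:
 assumes t: "t > 0"
 shows "(heat_conv a b u p t has_derivative (\<lambda>h. dheat_conv a b u p t x \<bullet> h)) (at x)"
  "(dheat_conv a b u p t has_derivative Hheat_conv a b u p t x) (at x)"
  "selfadjoint (Hheat_conv a b u p t x)"
  "mcurv p (Hheat_conv a b u p t x) = integral (cbox a b) (\<lambda>y. u y * Lheat p t (x - y))"
  "continuous_on UNIV (dheat_conv a b u p t)" "continuous_on UNIV (\<lambda>x. Hheat_conv a b u p t x i)"
proof -
 note cc = continuous_heat[of UNIV "\<lambda>_. t" "\<lambda>x. x", OF continuous_on_const continuous_on_id t, of p]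
 have cu: "continuous_on S u" for S using contu continuous_on_subset by blast
 have cdot: "continuous_on UNIV (\<lambda>x. dheat p t x \<bullet> i)" for i by (intro continuous_intros cc)
 have io: "(\<lambda>y. u y *R dheat p t (x - y)) integrable_on cbox a b" for x
  by (intro integrable_continuous continuous_intros cu continuous_on_compose2[OF cc(3)]) auto
 have iH: "(\<lambda>y. u y *R Hheat p t (x - y) h) integrable_on cbox a b" for x h
  by (intro integrable_continuous continuous_intros cu continuous_on_compose2[OF cc(4)]) auto
 have "((\<lambda>x. integral (cbox a b) (\<lambda>y. u y *R heat p t (x - y))) has_derivative
  (\<lambda>h. integral (cbox a b) (\<lambda>y. u y *R (dheat p t (x - y) \<bullet> h)))) (at x)"
  by (rule box_convolution_derivative[OF heat_derivative[OF t] cdot cu])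
 moreover have "integral (cbox a b) (\<lambda>y. u y *R (dheat p t (x - y) \<bullet> h)) = dheat_conv a b u p t x \<bullet> h" for h
  using integral_linear[OF io bounded_linear_inner_left[of h], of x] by (simp add: o_def dheat_conv_def)
 ultimately show "(heat_conv a b u p t has_derivative (\<lambda>h. dheat_conv a b u p t x \<bullet> h)) (at x)"
  by (simp add: heat_conv_def[abs_def])
 have H: "((\<lambda>x. integral (cbox a b) (\<lambda>y. u y *R dheat p t (x - y))) has_derivative
  (\<lambda>h. integral (cbox a b) (\<lambda>y. u y *R Hheat p t (x - y) h))) (at x)"
  by (rule box_convolution_derivative[OF dheat_derivative[OF t] cc(4) cu])
 then show D: "(dheat_conv a b u p t has_derivative Hheat_conv a b u p t x) (at x)"
  by (simp add: dheat_conv_def[abs_def] Hheat_conv_def[abs_def])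
 have inn: "Hheat_conv a b u p t x h \<bullet> k = integral (cbox a b) (\<lambda>y. u y * (Hheat p t (x - y) h \<bullet> k))" for h k
  using integral_linear[OF iH bounded_linear_inner_left[of k], of x h] by (simp add: o_def Hheat_conv_def)
 show "selfadjoint (Hheat_conv a b u p t x)"
  unfolding selfadjoint_def
 proof (intro conjI allI)
  show "linear (Hheat_conv a b u p t x)" using D by (rule has_derivative_linear)
  show "Hheat_conv a b u p t x h \<bullet> k = h \<bullet> Hheat_conv a b u p t x k" for h k
   unfolding inn inner_commute[of h] using selfadjointD(2)[OF selfadjoint_Hheat, of p t _ h k] by (simp add: inner_commute)
 qed
 have ir: "(\<lambda>y. u y * (Hheat p t (x - y) h \<bullet> k)) integrable_on cbox a b" for h k
  by (intro integrable_continuous continuous_intros cu continuous_on_compose2[OF cc(4)]) auto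
 have "mcurv p (Hheat_conv a b u p t x) = (\<Sum>i\<in>Basis. integral (cbox a b) (\<lambda>y. u y * (Hheat p t (x - y) i \<bullet> i)))
  - integral (cbox a b) (\<lambda>y. u y * (Hheat p t (x - y) p \<bullet> p)) / (1 + p \<bullet> p)"
  unfolding mcurv_def trace_map_def inner_commute[of p "Hheat_conv a b u p t x p"] inn ..
 also have "\<dots> = integral (cbox a b) (\<lambda>y. (\<Sum>i\<in>Basis. u y * (Hheat p t (x - y) i \<bullet> i)) - u y * (Hheat p t (x - y) p \<bullet> p) / (1 + p \<bullet> p))"
 proof -
  have "(\<Sum>i\<in>Basis. integral (cbox a b) (\<lambda>y. u y * (Hheat p t (x - y) i \<bullet> i)))
   = integral (cbox a b) (\<lambda>y. \<Sum>i\<in>Basis. u y * (Hheat p t (x - y) i \<bullet> i))"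
   by (rule Henstock_Kurzweil_Integration.integral_sum[symmetric, OF finite_Basis ir])
  moreover have "integral (cbox a b) (\<lambda>y. u y * (Hheat p t (x - y) p \<bullet> p)) / (1 + p \<bullet> p)
   = integral (cbox a b) (\<lambda>y. u y * (Hheat p t (x - y) p \<bullet> p) / (1 + p \<bullet> p))"
   by (rule integral_divide[symmetric])
  moreover have is_int: "(\<lambda>y. \<Sum>i\<in>Basis. u y * (Hheat p t (x - y) i \<bullet> i)) integrable_on cbox a b"
   by (rule integrable_sum[OF finite_Basis ir])
  ultimately show ?thesis
   using Henstock_Kurzweil_Integration.integral_diff[OF is_int integrable_on_divide[OF ir, of p p "1 + p \<bullet> p"]] by (simp only:)
 qed
 also have "(\<lambda>y. (\<Sum>i\<in>Basis. u y * (Hheat p t (x - y) i \<bullet> i)) - u y * (Hheat p t (x - y) p \<bullet> p) / (1 + p \<bullet> p))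
  = (\<lambda>y. u y * Lheat p t (x - y))"
 proof (rule ext)
  fix y
  have "p \<bullet> Hheat p t (x - y) p = Hheat p t (x - y) p \<bullet> p" by (rule inner_commute)
  then show "(\<Sum>i\<in>Basis. u y * (Hheat p t (x - y) i \<bullet> i)) - u y * (Hheat p t (x - y) p \<bullet> p) / (1 + p \<bullet> p) = u y * Lheat p t (x - y)"
   unfolding mcurv_Hheat[symmetric] mcurv_def trace_map_def
   by (simp add: sum_distrib_left right_diff_distrib)
 qed
 finally show "mcurv p (Hheat_conv a b u p t x) = integral (cbox a b) (\<lambda>y. u y * Lheat p t (x - y))" .
 show "continuous_on UNIV (dheat_conv a b u p t)" "continuous_on UNIV (\<lambda>x. Hheat_conv a b u p t x i)"
  unfolding dheat_conv_def Hheat_conv_def by (intro continuous_box_convolution cc cu)+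
qed

lemma heat_conv_time_derivative:
 assumes t: "t > 0"
 shows "((\<lambda>t. heat_conv a b u p t x) has_real_derivative mcurv p (Hheat_conv a b u p t x)) (at t)"
proof -
 have cu: "continuous_on S u" for S using contu continuous_on_subset by blast
 have "((\<lambda>t. integral (cbox a b) (\<lambda>y. u y * heat p t (x - y))) has_field_derivative
   integral (cbox a b) (\<lambda>y. u y * Lheat p t (x - y))) (at t within {0<..})"
 proof (rule leibniz_rule_field_derivative)
  fix s y assume "s \<in> {0::real<..}"
  then show "((\<lambda>t. u y * heat p t (x - y)) has_field_derivative u y * Lheat p s (x - y)) (at s within {0<..})"
   by (intro DERIV_cmult heat_time_derivative[THEN DERIV_subset]) auto
 next
  fix s assume s: "s \<in> {0::real<..}"
  show "(\<lambda>y. u y * heat p s (x - y)) integrable_on cbox a b"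
   using s by (intro integrable_continuous continuous_intros cu continuous_heat) auto
 next
  show "continuous_on ({0<..} \<times> cbox a b) (\<lambda>(t, y). u y * Lheat p t (x - y))"
   unfolding split_beta by (intro continuous_intros continuous_heat continuous_on_compose2[OF contu]) auto
 qed (use t in auto)
 moreover have "at t within {0<..} = at t" using t by (intro at_within_open) auto
 ultimately show ?thesis by (simp add: heat_conv_derivs(4)[OF t] heat_conv_def[abs_def])
qed

lemma heat_conv_joint_continuous:
 assumes "continuous_on S f" "continuous_on S g" "\<And>z. z \<in> S ==> f z > 0"
 shows "continuous_on S (\<lambda>z. heat_conv a b u p (f z) (g z))"
  "continuous_on S (\<lambda>z. mcurv p (Hheat_conv a b u p (f z) (g z)))"
proof -
 have "continuous_on S (\<lambda>z. integral (cbox a b) (\<lambda>y. u y * Lheat p (f z) (g z - y)))"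
 proof (rule integral_continuous_on_param)
  show "continuous_on (S \<times> cbox a b) (\<lambda>(z, y). u y * Lheat p (f z) (g z - y))"
   unfolding split_beta
   by (intro continuous_intros continuous_heat continuous_on_compose2[OF contu] continuous_on_compose2[OF assms(1)]
     continuous_on_compose2[OF assms(2)]) (use assms in auto)
 qed
 then show "continuous_on S (\<lambda>z. mcurv p (Hheat_conv a b u p (f z) (g z)))"
  by (rule continuous_on_eq) (use assms in \<open>simp add: heat_conv_derivs(4)\<close>)
 show "continuous_on S (\<lambda>z. heat_conv a b u p (f z) (g z))"
  unfolding heat_conv_def
 proof (rule integral_continuous_on_param)
  show "continuous_on (S \<times> cbox a b) (\<lambda>(z, y). u y * heat p (f z) (g z - y))"
   unfolding split_beta
   by (intro continuous_intros continuous_heat continuous_on_compose2[OF contu] continuous_on_compose2[OF assms(1)]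
     continuous_on_compose2[OF assms(2)]) (use assms in auto)
 qed
qed

end

text \<open>A parabolic comparison. If the bound failed, \<open>\<Phi>\<close> would have a minimum
  away from the initial time and the lateral boundary. There the time derivative forces
  \<open>Lw\<close> \<ge> \<open>de\<close>, while the spatial Taylor expansion gives a subjet of u
  and forces \<open>Lw\<close> < \<open>de\<close>. The barrier \<open>\<Psi>\<close> vanishes on
  the inner ball and excludes the lateral boundary; its curvature is paid for by the term of order
  sqrt \<tau> in \<open>de\<close>.\<close>

lemma heat_comparison:
 fixes u :: "'a::euclidean_space => real"
 assumes contu: "continuous_on UNIV u"
  and jets: "\<And>y q B. y \<in> ball x0 (2 * ep) ==> subjet u y q B ==> mcurv p B \<le> s"
  and eps: "ep > 0" and Z: "Z > 0" and M: "M \<ge> 0" and s: "s \<ge> 0"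
  and approx: "\<And>t x. t > 0 ==> x \<in> cball x0 (2 * ep) ==> \<bar>heat_conv a b u p t x - Z * u x\<bar> \<le> M * sqrt t"
 obtains K where "K \<ge> 0"
  "\<And>\<tau> x. 0 < \<tau> ==> x \<in> cball x0 ep ==> heat_conv a b u p \<tau> x \<le> Z * u x + (Z * s + K * sqrt \<tau>) * \<tau>"
proof -
 define m where "m z = max 0 (- 1 * (ep^2 - z \<bullet> z))" for z :: 'a
 define \<Psi> where "\<Psi> x = (m (x - x0)) ^ 3" for x
 define d\<Psi> where "d\<Psi> x = (- 6 * (- 1) * (m (x - x0))^2) *R (x - x0)" for x
 define H\<Psi> where "H\<Psi> x h = (24 * (- 1)^2 * m (x - x0)) *R (((x - x0) \<bullet> h) *R (x - x0)) - (6 * (- 1) * (m (x - x0))^2) *R h" for x h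
 have sh: "((\<lambda>x. x - x0) has_derivative (\<lambda>h. h)) (at x)" for x by (auto intro!: derivative_eq_intros)
 note bump = cubic_bump_derivative[where \<sigma> = "-1" and ep = ep, folded m_def]
 have dPsi: "(\<Psi> has_derivative (\<lambda>h. d\<Psi> x \<bullet> h)) (at x)" for x
  unfolding \<Psi>_def[abs_def] d\<Psi>_def using has_derivative_compose[OF sh[of x] bump(1)[of "x - x0"]] by (simp add: m_def)
 have HPsi: "(d\<Psi> has_derivative H\<Psi> x) (at x)" for x
  unfolding d\<Psi>_def[abs_def] H\<Psi>_def using has_derivative_compose[OF sh[of x] bump(2)[of "x - x0"]] by (simp add: m_def)
 have saPsi: "selfadjoint (H\<Psi> x)" for x unfolding H\<Psi>_def by (rule selfadjoint_bump_hessian)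
 have contm: "continuous_on UNIV (\<lambda>x. m (x - x0))" unfolding m_def by (intro continuous_intros)
 have contPsi: "continuous_on S \<Psi>" for S
  using dPsi by (meson continuous_at_imp_continuous_on has_derivative_continuous continuous_on_subset subset_UNIV)
 have "continuous_on (cball x0 (2 * ep)) (\<lambda>x. mcurv p (H\<Psi> x))"
  unfolding mcurv_def trace_map_def H\<Psi>_def using one_plus_inner_pos(1)[of p]
  by (intro continuous_intros continuous_on_subset[OF contm]) auto
 then have "bounded ((\<lambda>x. mcurv p (H\<Psi> x)) ` cball x0 (2 * ep))"
  by (intro compact_imp_bounded compact_continuous_image) auto
 then obtain C where "\<forall>v\<in>(\<lambda>x. mcurv p (H\<Psi> x)) ` cball x0 (2 * ep). norm v \<le> C"
  unfolding bounded_iff by blast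
 then have C: "\<And>x. x \<in> cball x0 (2 * ep) ==> \<bar>mcurv p (H\<Psi> x)\<bar> \<le> C" by auto
 have C0: "C \<ge> 0" using C[of x0] eps by force
 have Psi0: "\<Psi> x \<ge> 0" for x by (simp add: \<Psi>_def m_def)
 \<comment> \<open>The value of the barrier on the outer sphere, where (2 ep)^2 - ep^2 = 3
   ep^2.\<close>
 define E where "E = (3 * ep^2) ^ 3"
 have E: "E > 0" using eps by (simp add: E_def)
 have PsiE: "\<Psi> x = E" if "norm (x - x0) = 2 * ep" for x
 proof -
  have "(x - x0) \<bullet> (x - x0) = (2 * ep)^2" using that by (simp add: power2_norm_eq_inner[symmetric])
  then show ?thesis by (simp add: \<Psi>_def m_def E_def power_mult_distrib)
 qed
 have Psi_in: "\<Psi> x = 0" if "x \<in> cball x0 ep" for x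
 proof -
  have "(norm (x - x0))^2 \<le> ep^2" using that by (intro power_mono) (auto simp: dist_norm norm_minus_commute)
  then show ?thesis by (simp add: \<Psi>_def m_def power2_norm_eq_inner)
 qed
 define K where "K = M / E * C"
 have K: "K \<ge> 0" using M E C0 by (simp add: K_def)
 \<comment> \<open>The kernel is singular at time 0, so times start at t0 > 0; t0 and \<eta> tend to
   0 together at the end.\<close>
 have main: "- M * sqrt t0 \<le> Z * u x - heat_conv a b u p \<tau> x + (Z * s + K * sqrt \<tau> + \<eta>) * \<tau>"
  if t0: "0 < t0" "t0 < \<tau>" and eta: "\<eta> > 0" and x: "x \<in> cball x0 ep" for t0 \<tau> \<eta> x
 proof (rule ccontr)
  assume neg: "\<not> ?thesis"
  \<comment> \<open>With this weight the barrier equals M sqrt \<tau> on the outer sphere, which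
    outweighs the approximation error there at all times up to \<tau>.\<close>
  define ka where "ka = M * sqrt \<tau> / E"
  have kap: "ka \<ge> 0" using M E t0 by (simp add: ka_def)
  have Kk: "K * sqrt \<tau> = ka * C" by (simp add: K_def ka_def)
  define de where "de = Z * s + K * sqrt \<tau> + \<eta>"
  have delta: "de > 0" using Z s K t0 eta by (simp add: de_def add_nonneg_pos)
  define \<Phi> where "\<Phi> z = Z * u (snd z) - heat_conv a b u p (fst z) (snd z) + ka * \<Psi> (snd z) + de * fst z" for z
  define S where "S = {t0..\<tau>} \<times> cball x0 (2 * ep)"
  have "continuous_on S \<Phi>"
   unfolding \<Phi>_def S_def using t0
   by (intro continuous_intros heat_conv_joint_continuous[OF contu] continuous_on_compose2[OF contu]
     continuous_on_compose2[OF contPsi[of UNIV]]) auto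
  moreover have "compact S" unfolding S_def by (intro compact_Times compact_Icc compact_cball)
  moreover have xS: "(\<tau>, x) \<in> S" using t0 x eps by (auto simp: S_def)
  ultimately obtain z where z: "z \<in> S" "\<And>w. w \<in> S ==> \<Phi> z \<le> \<Phi> w"
   using continuous_attains_inf[of S \<Phi>] by blast
  obtain t y where ty: "z = (t, y)" by (cases z)
  have t: "t0 \<le> t" "t \<le> \<tau>" and y: "y \<in> cball x0 (2 * ep)" using z(1) by (auto simp: S_def ty)
  have tpos: "t > 0" using t t0 by simp
  have low: "\<Phi> z < - M * sqrt t0"
   using z(2)[OF xS] neg Psi_in[OF x] by (simp add: \<Phi>_def de_def)
  have lowM: "\<Phi> z \<ge> - M * sqrt t + ka * \<Psi> y"
   using approx[OF tpos y] mult_pos_pos[OF delta tpos] unfolding \<Phi>_def ty fst_conv snd_conv by linarith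
  have "t \<noteq> t0"
  proof
   assume "t = t0"
   moreover have "ka * \<Psi> y \<ge> 0" using kap Psi0 by simp
   ultimately show False using low lowM by simp
  qed
  then have tt: "t0 < t" using t by simp
  have yin: "norm (y - x0) < 2 * ep"
  proof (rule ccontr)
   assume "\<not> ?thesis"
   then have "norm (y - x0) = 2 * ep" using y by (simp add: dist_norm norm_minus_commute)
   then have "ka * \<Psi> y = M * sqrt \<tau>" using PsiE E by (simp add: ka_def)
   moreover have "M * sqrt t \<le> M * sqrt \<tau>" using t M by (intro mult_left_mono) auto
   moreover have "M * sqrt t0 \<ge> 0" using M t0 by simp
   ultimately show False using low lowM by linarith
  qed
  define Lw where "Lw = mcurv p (Hheat_conv a b u p t y)"
  \<comment> \<open>Only earlier times are compared, since the minimum may lie at the final time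
    \<tau>.\<close>
  have time: "de \<le> Lw"
  proof (rule ccontr)
   assume "\<not> de \<le> Lw"
   then have "0 < de - Lw" by simp
   moreover have "((\<lambda>t'. de * t' - heat_conv a b u p t' y) has_real_derivative de - Lw) (at t)"
    unfolding Lw_def by (auto intro!: derivative_eq_intros heat_conv_time_derivative[OF contu tpos])
   ultimately obtain d where d: "d > 0" "\<And>h. 0 < h ==> h < d ==> de * (t - h) - heat_conv a b u p (t - h) y < de * t - heat_conv a b u p t y"
    using DERIV_pos_inc_left by blast
   define h where "h = min (d / 2) (t - t0)"
   have h: "0 < h" "h < d" "h \<le> t - t0" using d(1) tt by (auto simp: h_def)
   then have "(t - h, y) \<in> S" using t y by (auto simp: S_def)
   then have "\<Phi> z \<le> \<Phi> (t - h, y)" by (rule z(2))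
   then show False using d(2)[OF h(1,2)] by (simp add: \<Phi>_def ty)
  qed
  define N :: real where "N = DIM('a)"
  have N: "N \<ge> 1" by (simp add: N_def Suc_le_eq)
  \<comment> \<open>Small enough that the Taylor error changes \<open>mcurv\<close> by at most
    \<eta> / 2.\<close>
  define \<eta>' where "\<eta>' = \<eta> / (4 * N)"
  have eta': "\<eta>' > 0" using eta N by (simp add: \<eta>'_def)
  define dg where "dg x = dheat_conv a b u p t x - ka *R d\<Psi> x" for x
  define Hg where "Hg h = Hheat_conv a b u p t y h - ka *R H\<Psi> y h" for h
  have dg: "((\<lambda>x. heat_conv a b u p t x - ka * \<Psi> x) has_derivative (\<lambda>h. dg x \<bullet> h)) (at x)" for x
   unfolding dg_def
   by (rule has_derivative_eq_rhs[OF has_derivative_diff[OF heat_conv_derivs(1)[OF contu tpos] has_derivative_mult_right[OF dPsi]]])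
    (simp add: inner_diff_left)
  have Hg: "(dg has_derivative Hg) (at y)"
   unfolding dg_def[abs_def] Hg_def[abs_def]
   by (intro has_derivative_diff heat_conv_derivs(2)[OF contu tpos] has_derivative_scaleR_right HPsi)
  have linHg: "linear Hg" using Hg by (rule has_derivative_linear)
  obtain d where d: "d > 0" "\<And>h::'a. norm h < d ==> \<bar>(heat_conv a b u p t (y + h) - ka * \<Psi> (y + h)) - (heat_conv a b u p t y - ka * \<Psi> y)
    - dg y \<bullet> h - (h \<bullet> Hg h) / 2\<bar> \<le> \<eta>' * (norm h)^2"
   using taylor_second_order[OF dg Hg eta'] by blast
  define B where "B h = (1 / Z) *R (Hg h - (2 * \<eta>') *R h)" for h
  have "selfadjoint Hg"
   unfolding selfadjoint_def
  proof (intro conjI allI linHg)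
   show "Hg h \<bullet> k = h \<bullet> Hg k" for h k
    unfolding Hg_def using selfadjointD(2)[OF heat_conv_derivs(3)[OF contu tpos], of a b p y h k] selfadjointD(2)[OF saPsi, of y h k]
    by (simp add: inner_diff_left inner_diff_right)
  qed
  then have saB: "selfadjoint B"
   unfolding selfadjoint_def B_def
   by (auto simp: inner_diff_left inner_diff_right linear_iff scaleR_add_right algebra_simps)
  have "subjet u y ((1 / Z) *R dg y) B"
   unfolding subjet_def
  proof (intro conjI saB exI allI impI)
   show "0 < min d (2 * ep - norm (y - x0))" using d(1) yin by simp
   fix h :: 'a assume h: "norm h < min d (2 * ep - norm (y - x0))"
   have "norm (y + h - x0) \<le> norm (y - x0) + norm h" using norm_triangle_ineq[of "y - x0" h] by (simp add: algebra_simps)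
   then have "(t, y + h) \<in> S" using h t by (auto simp: S_def dist_norm norm_minus_commute[of x0])
   then have 1: "\<Phi> z \<le> \<Phi> (t, y + h)" by (rule z(2))
   define G where "G = (heat_conv a b u p t (y + h) - ka * \<Psi> (y + h)) - (heat_conv a b u p t y - ka * \<Psi> y)"
   have "\<bar>G - dg y \<bullet> h - (h \<bullet> Hg h) / 2\<bar> \<le> \<eta>' * (norm h)^2" unfolding G_def by (rule d(2)) (use h in simp)
   then have "dg y \<bullet> h + (h \<bullet> Hg h) / 2 - \<eta>' * (norm h)^2 \<le> G" by linarith
   also have "G \<le> Z * (u (y + h) - u y)" using 1 by (simp add: G_def \<Phi>_def ty algebra_simps)
   finally have 2: "(1 / Z) * (dg y \<bullet> h + (h \<bullet> Hg h) / 2 - \<eta>' * (norm h)^2) \<le> u (y + h) - u y"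
    using Z by (simp add: field_simps)
   have "(1 / Z) * (dg y \<bullet> h + (h \<bullet> Hg h) / 2 - \<eta>' * (norm h)^2) = (1 / Z) *R dg y \<bullet> h + (h \<bullet> B h) / 2"
   proof -
    have "h \<bullet> B h = (1 / Z) * (h \<bullet> Hg h - 2 * \<eta>' * (norm h)^2)"
     by (simp add: B_def inner_diff_right power2_norm_eq_inner)
    then show ?thesis by (simp add: diff_divide_distrib add_divide_distrib)
   qed
   then show "u y + (1 / Z) *R dg y \<bullet> h + (h \<bullet> B h) / 2 \<le> u (y + h)" using 2 by linarith
  qed
  then have "mcurv p B \<le> s" using yin by (intro jets) (auto simp: dist_norm norm_minus_commute)
  moreover have "mcurv p B = (1 / Z) * (Lw - ka * mcurv p (H\<Psi> y) - 2 * \<eta>' * mcurv p (\<lambda>h. h))"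
   unfolding B_def Hg_def mcurv_scale mcurv_diff Lw_def ..
  ultimately have "Lw - ka * mcurv p (H\<Psi> y) - 2 * \<eta>' * mcurv p (\<lambda>h::'a. h) \<le> Z * s"
   using Z by (simp add: field_simps)
  moreover have "ka * mcurv p (H\<Psi> y) \<le> ka * C" using C[OF y] kap by (intro mult_left_mono) auto
  moreover have "2 * \<eta>' * mcurv p (\<lambda>h::'a. h) \<le> 2 * \<eta>' * N"
   using eta' by (intro mult_left_mono) (auto simp: mcurv_id N_def)
  moreover have "2 * \<eta>' * N = \<eta> / 2" using N by (simp add: \<eta>'_def)
  ultimately have "Lw \<le> Z * s + ka * C + \<eta> / 2" by linarith
  then show False using time eta Kk by (simp add: de_def)
 qed
 show ?thesis
 proof (rule that[OF K])
  fix \<tau> :: real and x assume tau: "0 < \<tau>" and x: "x \<in> cball x0 ep"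
  have "- M * sqrt t \<le> Z * u x - heat_conv a b u p \<tau> x + (Z * s + K * sqrt \<tau> + t) * \<tau>" if "t \<in> {0<..<\<tau>}" for t
   using main[of t \<tau> t x] that x by simp
  then have "\<forall>\<^sub>F t in at_right 0. - M * sqrt t \<le> Z * u x - heat_conv a b u p \<tau> x + (Z * s + K * sqrt \<tau> + t) * \<tau>"
   using eventually_at_right_real[OF tau] by (rule eventually_mono[rotated])
  moreover have "((\<lambda>t. - M * sqrt t) \<longlongrightarrow> - M * sqrt 0) (at_right 0)" by (intro tendsto_intros)
  moreover have "((\<lambda>t. Z * u x - heat_conv a b u p \<tau> x + (Z * s + K * sqrt \<tau> + t) * \<tau>) \<longlongrightarrow>
    Z * u x - heat_conv a b u p \<tau> x + (Z * s + K * sqrt \<tau> + 0) * \<tau>) (at_right 0)" by (intro tendsto_intros)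
  ultimately have "- M * sqrt 0 \<le> Z * u x - heat_conv a b u p \<tau> x + (Z * s + K * sqrt \<tau> + 0) * \<tau>"
   by (intro tendsto_le[of "at_right 0"]) auto
  then show "heat_conv a b u p \<tau> x \<le> Z * u x + (Z * s + K * sqrt \<tau>) * \<tau>" by simp
 qed
qed

text \<open>Green's second identity for the constant-coefficient operator \<open>mcurv p\<close>;
  its coefficient matrix is the symmetric map \<open>Q\<close>.\<close>

lemma green_identity_mcurv:
 fixes \<phi> w :: "'a::euclidean_space => real"
 assumes phi: "\<And>x. (\<phi> has_derivative (\<lambda>h. d\<phi> x \<bullet> h)) (at x)" "\<And>x. (d\<phi> has_derivative H\<phi> x) (at x)"
   "\<And>i. continuous_on UNIV (\<lambda>x. H\<phi> x i)"
  and w: "\<And>x. (w has_derivative (\<lambda>h. dw x \<bullet> h)) (at x)" "\<And>x. (dw has_derivative Hw x) (at x)"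
   "\<And>i. continuous_on UNIV (\<lambda>x. Hw x i)"
  and supp: "\<And>x. norm x \<ge> r ==> \<phi> x = 0"  "\<And>x. norm x \<ge> r ==> d\<phi> x = 0"
 shows "(LBINT x. \<phi> x * mcurv p (Hw x) - w x * mcurv p (H\<phi> x)) = 0"
proof -
 define Q where "Q v = v - ((p \<bullet> v) / (1 + p \<bullet> p)) *R p" for v
 have dQ: "(Q has_derivative Q) (at v)" for v
 proof (rule linear_imp_has_derivative)
  show "linear Q" unfolding Q_def linear_iff by (auto simp: inner_add_right add_divide_distrib algebra_simps)
 qed
 have Qsym: "Q v \<bullet> k = v \<bullet> Q k" for v k by (simp add: Q_def inner_diff_left inner_diff_right inner_commute)
 have contQ: "continuous_on S (\<lambda>x. Q (f x))" if "continuous_on S f" for S and f :: "'a => 'a"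
  unfolding Q_def using one_plus_inner_pos(1)[of p] by (intro continuous_intros that) auto
 have ip: "(\<Sum>i\<in>Basis. (v \<bullet> i) * (k \<bullet> i)) = v \<bullet> k" for v k :: 'a by (rule euclidean_inner[symmetric])
 have trQ: "(\<Sum>i\<in>Basis. Q (B i) \<bullet> i) = mcurv p B" if B: "linear B" for B
 proof -
  have "(\<Sum>i\<in>Basis. (p \<bullet> B i) * (p \<bullet> i)) = p \<bullet> B (\<Sum>i\<in>Basis. (p \<bullet> i) *R i)"
   by (simp add: linear_sum[OF B] linear_scale[OF B] inner_sum_right mult.commute)
  also have "\<dots> = p \<bullet> B p" by (simp add: euclidean_representation)
  finally show ?thesis
   by (simp add: Q_def inner_diff_left sum_subtractf mcurv_def trace_map_def sum_divide_distrib[symmetric])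
 qed
 define X where "X x = \<phi> x *R Q (dw x) - w x *R Q (d\<phi> x)" for x
 define X' where "X' x h = (\<phi> x *R Q (Hw x h) + (d\<phi> x \<bullet> h) *R Q (dw x)) - (w x *R Q (H\<phi> x h) + (dw x \<bullet> h) *R Q (d\<phi> x))" for x h
 have cphi: "continuous_on UNIV \<phi>" "continuous_on UNIV d\<phi>" "continuous_on UNIV w" "continuous_on UNIV dw"
  using phi(1,2) w(1,2) by (meson continuous_at_imp_continuous_on has_derivative_continuous)+
 have "(LBINT x. (\<Sum>i\<in>Basis. X' x i \<bullet> i)) = 0"
 proof (rule integral_divergence_eq_0)
  show "(X has_derivative X' x) (at x)" for x
   unfolding X_def[abs_def] X'_def
   by (intro has_derivative_diff has_derivative_scaleR phi w has_derivative_compose[OF w(2) dQ] has_derivative_compose[OF phi(2) dQ])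
  show "continuous_on UNIV (\<lambda>x. X' x i \<bullet> i)" for i
   unfolding X'_def by (intro continuous_intros contQ cphi phi(3) w(3))
  show "X x = 0" if "norm x \<ge> r" for x using supp[OF that] by (simp add: X_def Q_def)
 qed
 moreover have "(\<Sum>i\<in>Basis. X' x i \<bullet> i) = \<phi> x * mcurv p (Hw x) - w x * mcurv p (H\<phi> x)" for x
 proof -
  have lin: "linear (Hw x)" "linear (H\<phi> x)" using w(2) phi(2) by (auto intro: has_derivative_linear)
  have "(\<Sum>i\<in>Basis. X' x i \<bullet> i) = \<phi> x * (\<Sum>i\<in>Basis. Q (Hw x i) \<bullet> i) + (\<Sum>i\<in>Basis. (d\<phi> x \<bullet> i) * (Q (dw x) \<bullet> i))
    - (w x * (\<Sum>i\<in>Basis. Q (H\<phi> x i) \<bullet> i) + (\<Sum>i\<in>Basis. (dw x \<bullet> i) * (Q (d\<phi> x) \<bullet> i)))"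
   unfolding X'_def inner_diff_left inner_add_left inner_scaleR_left sum.distrib sum_subtractf sum_distrib_left ..
  then show ?thesis unfolding ip trQ[OF lin(1)] trQ[OF lin(2)] using Qsym[of "dw x" "d\<phi> x"] by (simp add: inner_commute[of "d\<phi> x"])
 qed
 ultimately show ?thesis by simp
qed

text \<open>Let I(t) be the integral of \<phi> against the heat flow of u. The comparison gives I(t)
  \<le> I(0) + Z s t \<Phi> + o(t), where I(0) stands for Z times the integral of u \<phi>. By
  Green's identity I'(t) is the integral of the flow against \<open>mcurv p\<close> of the Hessian
  of \<phi>, which tends to Z times the left side. Comparing the two rates as t tends to 0 gives the
  inequality.\<close>

lemma jets_imp_distributional:
 fixes u :: "'a::euclidean_space => real"
 assumes Lip: "\<And>x y. \<bar>u x - u y\<bar> \<le> La * norm (x - y)"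
  and jets: "\<And>y q B. y \<in> ball x0 (2 * ep) ==> subjet u y q B ==> mcurv p B \<le> s"
  and eps: "ep > 0" and s: "s \<ge> 0"
  and phi: "\<And>x. (\<phi> has_derivative (\<lambda>h. d\<phi> x \<bullet> h)) (at x)" "\<And>x. (d\<phi> has_derivative H\<phi> x) (at x)"
   "\<And>i. continuous_on UNIV (\<lambda>x. H\<phi> x i)"
  and phi0: "\<And>x. \<phi> x \<ge> 0"
  and supp: "\<And>x. norm (x - x0) \<ge> ep ==> \<phi> x = 0" "\<And>x. norm (x - x0) \<ge> ep ==> d\<phi> x = 0"
   "\<And>x i. norm (x - x0) \<ge> ep ==> H\<phi> x i = 0"
 shows "(LBINT x. u x * mcurv p (H\<phi> x)) \<le> s * (LBINT x. \<phi> x)"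
proof -
 have Lam: "La \<ge> 0"
 proof -
  obtain b :: 'a where "b \<in> Basis" using nonempty_Basis by blast
  then show ?thesis using order_trans[OF abs_ge_zero Lip[of b 0]] by simp
 qed
 have contu: "continuous_on UNIV u"
  by (rule lipschitz_on_continuous_on[where L = La]) (use Lip in \<open>auto simp: dist_norm lipschitz_on_def Lam\<close>)
 obtain a b :: 'a where ab: "cball x0 (2 * ep + 1) \<subseteq> cbox a b"
  using bounded_subset_cbox_symmetric[OF bounded_cball] by metis
 define Z where "Z = (LBINT z. heat p 1 z)"
 define M1 where "M1 = (LBINT z. norm z * heat p 1 z)"
 have Zpos: "Z > 0"
 proof -
  have i: "integrable lborel (heat p 1)"
  proof -
   have "heat p 1 (0 - y) = heat p 1 y" for y
    by (simp add: heat_def linear_neg[OF tilt_simps(1)])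
   then show ?thesis using heat_integrals(1)[of 1 p 0] by simp
  qed
  have "Z \<ge> 0" unfolding Z_def by (intro Bochner_Integration.integral_nonneg) (simp add: less_imp_le heat_one_bounds)
  moreover have "Z \<noteq> 0"
  proof
   assume "Z = 0"
   then have "AE z in lborel. heat p 1 z = 0"
    unfolding Z_def using integral_nonneg_eq_0_iff_AE[OF i] by (simp add: less_imp_le heat_one_bounds)
   then have "AE z in (lborel :: 'a measure). False"
    by eventually_elim (use heat_one_bounds(1) in \<open>metis less_irrefl\<close>)
   then show False using AE_iff_measurable[of UNIV "lborel :: 'a measure" "\<lambda>_. False"] by (simp add: emeasure_lborel_UNIV)
  qed
  ultimately show ?thesis by simp
 qed
 have M1: "M1 \<ge> 0" unfolding M1_def by (intro Bochner_Integration.integral_nonneg) (simp add: less_imp_le heat_one_bounds)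
 define U where "U = \<bar>u x0\<bar> + La * (2 * ep)"
 have U0: "U \<ge> 0" using Lam eps by (simp add: U_def)
 have U: "\<bar>u x\<bar> \<le> U" if "x \<in> cball x0 (2 * ep)" for x
 proof -
  have "La * norm (x - x0) \<le> La * (2 * ep)" using that Lam by (intro mult_left_mono) (auto simp: dist_norm norm_minus_commute)
  then show ?thesis using Lip[of x x0] unfolding U_def by linarith
 qed
 define M where "M = (La + U / 1) * M1"
 have M: "M \<ge> 0" using Lam U0 M1 by (simp add: M_def)
 have approx: "\<bar>heat_conv a b u p t x - Z * u x\<bar> \<le> M * sqrt t" if "t > 0" "x \<in> cball x0 (2 * ep)" for t x
  unfolding heat_conv_def Z_def M_def M1_def
 proof (rule heat_approximation[OF that(1) Lip zero_less_one _ U[OF that(2)]])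
  have "cball x 1 \<subseteq> cball x0 (2 * ep + 1)"
  proof
   fix y assume "y \<in> cball x 1"
   then show "y \<in> cball x0 (2 * ep + 1)" using that(2) dist_triangle[of x0 y x] by (simp add: dist_commute)
  qed
  then show "cball x 1 \<subseteq> cbox a b" using ab by blast
 qed
 obtain K where K: "K \<ge> 0" "\<And>\<tau> x. 0 < \<tau> ==> x \<in> cball x0 ep ==> heat_conv a b u p \<tau> x \<le> Z * u x + (Z * s + K * sqrt \<tau>) * \<tau>"
  by (rule heat_comparison[OF contu jets eps Zpos M s approx]) (auto intro: that)
 define w where "w t x = heat_conv a b u p t x" for t x
 have near: "\<bar>w t x - Z * u x\<bar> \<le> M * sqrt t" if "t > 0" "norm (x - x0) \<le> ep" for t x
  unfolding w_def using that eps by (intro approx) (auto simp: dist_norm norm_minus_commute)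
 have cphi: "continuous_on S \<phi>" "continuous_on UNIV d\<phi>" for S
  using phi(1,2) by (meson continuous_at_imp_continuous_on has_derivative_continuous continuous_on_subset subset_UNIV)+
 define L where "L x = mcurv p (H\<phi> x)" for x
 have cL: "continuous_on S L" for S
  unfolding L_def mcurv_def trace_map_def using one_plus_inner_pos(1)[of p]
  by (intro continuous_intros continuous_on_subset[OF phi(3)]) auto
 have suppL: "L x = 0" if "norm (x - x0) \<ge> ep" for x using supp(3)[OF that] by (simp add: L_def mcurv_def trace_map_def)
 define r where "r = norm x0 + ep"
 have far: "norm (x - x0) \<ge> ep" if "norm x \<ge> r" for x
  using that norm_triangle_ineq2[of x x0] by (simp add: r_def)
 have notin: "norm (x - x0) \<ge> ep" if "x \<notin> cbox a b" for x
 proof (rule ccontr)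
  assume "\<not> ?thesis"
  then have "x \<in> cball x0 (2 * ep + 1)" using eps by (simp add: dist_norm norm_minus_commute)
  then show False using ab that by blast
 qed
 have cw: "continuous_on UNIV (w t)" if "t > 0" for t
  using heat_conv_joint_continuous(1)[OF contu, of UNIV "\<lambda>_. t" "\<lambda>x. x"] that by (simp add: w_def[abs_def])
 have int: "integrable lborel f" if "continuous_on UNIV f" "\<And>x. norm (x - x0) \<ge> ep ==> f x = 0" for f :: "'a => real"
  by (rule integrable_continuous_compact_support[OF that(1), of r]) (use that(2) far in auto)
 define I where "I t = (LBINT x. \<phi> x * w t x)" for t
 define J where "J t = (LBINT x. w t x * L x)" for t
 define \<Phi> where "\<Phi> = (LBINT x. \<phi> x)"
 define U\<phi> where "U\<phi> = (LBINT x. u x * \<phi> x)"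
 define UL where "UL = (LBINT x. u x * L x)"
 define AL where "AL = (LBINT x. \<bar>L x\<bar>)"
 have ip: "integrable lborel \<phi>" "integrable lborel (\<lambda>x. u x * \<phi> x)" "integrable lborel (\<lambda>x. u x * L x)" "integrable lborel (\<lambda>x. \<bar>L x\<bar>)"
  by (intro int continuous_intros cphi contu cL; simp add: supp suppL)+
 have iw: "integrable lborel (\<lambda>x. \<phi> x * w t x)" "integrable lborel (\<lambda>x. w t x * L x)" if "t > 0" for t
  by (intro int continuous_intros cphi cw[OF that] cL; simp add: supp suppL)+
 have Phi0: "\<Phi> \<ge> 0" unfolding \<Phi>_def by (intro Bochner_Integration.integral_nonneg phi0)
 have AL0: "AL \<ge> 0" unfolding AL_def by (intro Bochner_Integration.integral_nonneg) auto
 have dI: "(I has_real_derivative J t) (at t)" if t: "t > 0" for t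
 proof -
  have "((\<lambda>t. integral (cbox a b) (\<lambda>x. \<phi> x * w t x)) has_field_derivative
    integral (cbox a b) (\<lambda>x. \<phi> x * mcurv p (Hheat_conv a b u p t x))) (at t within {0<..})"
  proof (rule leibniz_rule_field_derivative)
   fix s y assume "s \<in> {0::real<..}"
   then show "((\<lambda>t. \<phi> y * w t y) has_field_derivative \<phi> y * mcurv p (Hheat_conv a b u p s y)) (at s within {0<..})"
    unfolding w_def by (intro DERIV_cmult heat_conv_time_derivative[OF contu, THEN DERIV_subset]) auto
  next
   fix s assume s: "s \<in> {0::real<..}"
   then show "(\<lambda>y. \<phi> y * w s y) integrable_on cbox a b"
    by (intro integrable_continuous continuous_intros cphi continuous_on_subset[OF cw]) auto
  next
   show "continuous_on ({0<..} \<times> cbox a b) (\<lambda>(t, x). \<phi> x * mcurv p (Hheat_conv a b u p t x))"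
    unfolding split_beta
    by (intro continuous_intros heat_conv_joint_continuous[OF contu] continuous_on_compose2[OF cphi(1)[of UNIV]]) auto
  qed (use t in auto)
  moreover have "at t within {0<..} = at t" using t by (intro at_within_open) auto
  moreover have "integral (cbox a b) (\<lambda>x. \<phi> x * mcurv p (Hheat_conv a b u p t x)) = J t"
  proof -
   have c: "continuous_on UNIV (\<lambda>x. \<phi> x * mcurv p (Hheat_conv a b u p t x))"
    using t by (intro continuous_intros cphi heat_conv_joint_continuous[OF contu]) auto
   have "integral (cbox a b) (\<lambda>x. \<phi> x * mcurv p (Hheat_conv a b u p t x)) = (LBINT x. \<phi> x * mcurv p (Hheat_conv a b u p t x))"
    by (rule integral_cbox_eq_lborel[OF c]) (use supp notin in auto)
   moreover have "(LBINT x. \<phi> x * mcurv p (Hheat_conv a b u p t x) - w t x * L x) = 0"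
    unfolding w_def L_def
    by (rule green_identity_mcurv[OF phi heat_conv_derivs(1,2,6)[OF contu t], of r]) (use supp far in auto)
   moreover have "integrable lborel (\<lambda>x. \<phi> x * mcurv p (Hheat_conv a b u p t x))"
    by (rule int[OF c]) (simp add: supp)
   ultimately show ?thesis using iw(2)[OF t] by (simp add: J_def)
  qed
  moreover have "((\<lambda>t. integral (cbox a b) (\<lambda>x. \<phi> x * w t x)) has_field_derivative J t) (at t) ==> ?thesis"
  proof (erule has_field_derivative_transform_within_open[where S = "{0<..}"])
   fix s assume "s \<in> {0::real<..}"
   then show "integral (cbox a b) (\<lambda>x. \<phi> x * w s x) = I s"
    unfolding I_def
    by (intro integral_cbox_eq_lborel continuous_intros cphi cw) (use supp notin in auto)
  qed (use t in auto)
  ultimately show ?thesis by simp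
 qed
 have I_up: "I t \<le> Z * U\<phi> + (Z * s + K * sqrt t) * t * \<Phi>" if t: "t > 0" for t
 proof -
  have "I t \<le> (LBINT x. Z * (u x * \<phi> x) + (Z * s + K * sqrt t) * t * \<phi> x)"
   unfolding I_def
  proof (rule integral_mono[OF iw(1)[OF t]])
   show "integrable lborel (\<lambda>x. Z * (u x * \<phi> x) + (Z * s + K * sqrt t) * t * \<phi> x)" using ip by simp
   fix x
   show "\<phi> x * w t x \<le> Z * (u x * \<phi> x) + (Z * s + K * sqrt t) * t * \<phi> x"
   proof (cases "norm (x - x0) \<ge> ep")
    case False
    then have "w t x \<le> Z * u x + (Z * s + K * sqrt t) * t"
     unfolding w_def using t by (intro K(2)) (auto simp: dist_norm norm_minus_commute)
    then have "\<phi> x * w t x \<le> \<phi> x * (Z * u x + (Z * s + K * sqrt t) * t)" using phi0 by (intro mult_left_mono)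
    then show ?thesis by (simp add: algebra_simps)
   qed (simp add: supp)
  qed
  also have "\<dots> = Z * U\<phi> + (Z * s + K * sqrt t) * t * \<Phi>" using ip by (simp add: U\<phi>_def \<Phi>_def)
  finally show ?thesis .
 qed
 have I_low: "I t \<ge> Z * U\<phi> - M * sqrt t * \<Phi>" if t: "t > 0" for t
 proof -
  have "(LBINT x. Z * (u x * \<phi> x) - M * sqrt t * \<phi> x) \<le> I t"
   unfolding I_def
  proof (rule integral_mono[OF _ iw(1)[OF t]])
   show "integrable lborel (\<lambda>x. Z * (u x * \<phi> x) - M * sqrt t * \<phi> x)" using ip by simp
   fix x
   show "Z * (u x * \<phi> x) - M * sqrt t * \<phi> x \<le> \<phi> x * w t x"
   proof (cases "norm (x - x0) \<ge> ep")
    case False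
    then have "Z * u x - M * sqrt t \<le> w t x" using near[OF t, of x] by (simp add: abs_le_iff)
    then have "\<phi> x * (Z * u x - M * sqrt t) \<le> \<phi> x * w t x" using phi0 by (intro mult_left_mono)
    then show ?thesis by (simp add: algebra_simps)
   qed (simp add: supp)
  qed
  moreover have "(LBINT x. Z * (u x * \<phi> x) - M * sqrt t * \<phi> x) = Z * U\<phi> - M * sqrt t * \<Phi>"
   using ip by (simp add: U\<phi>_def \<Phi>_def)
  ultimately show ?thesis by simp
 qed
 have J_low: "J t \<ge> Z * UL - M * sqrt t * AL" if t: "t > 0" for t
 proof -
  have "(LBINT x. Z * (u x * L x) - M * sqrt t * \<bar>L x\<bar>) \<le> J t"
   unfolding J_def
  proof (rule integral_mono[OF _ iw(2)[OF t]])
   show "integrable lborel (\<lambda>x. Z * (u x * L x) - M * sqrt t * \<bar>L x\<bar>)" using ip by simp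
   fix x
   show "Z * (u x * L x) - M * sqrt t * \<bar>L x\<bar> \<le> w t x * L x"
   proof (cases "norm (x - x0) \<ge> ep")
    case False
    then have "\<bar>w t x - Z * u x\<bar> * \<bar>L x\<bar> \<le> M * sqrt t * \<bar>L x\<bar>" using near[OF t, of x] by (intro mult_right_mono) auto
    then have "\<bar>(w t x - Z * u x) * L x\<bar> \<le> M * sqrt t * \<bar>L x\<bar>" by (simp add: abs_mult)
    then show ?thesis by (simp add: abs_le_iff algebra_simps)
   qed (simp add: suppL)
  qed
  moreover have "(LBINT x. Z * (u x * L x) - M * sqrt t * \<bar>L x\<bar>) = Z * UL - M * sqrt t * AL"
   using ip by (simp add: UL_def AL_def)
  ultimately show ?thesis by simp
 qed
 have step: "(1 - t ^ 3) * (Z * UL - M * sqrt t * AL) \<le> (Z * s + K * sqrt t) * \<Phi> + M * t * \<Phi>" if t: "0 < t" "t < 1" for t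
 proof -
  \<comment> \<open>The lower bound for I (t0) has an error of order sqrt t0, which must be small
    compared with t; the fourth power makes it of order t^2.\<close>
  define t0 where "t0 = t ^ 4"
  have t0: "0 < t0" "t0 < t"
   using t power_strict_decreasing[of 1 4 t] by (auto simp: t0_def)
  have sq: "sqrt t0 = t^2"
  proof -
   have "t0 = (t^2)^2" by (simp add: t0_def)
   then have "sqrt t0 = \<bar>t^2\<bar>" by (simp only: real_sqrt_abs)
   then show ?thesis by simp
  qed
  obtain \<xi> where xi: "t0 < \<xi>" "\<xi> < t" "I t - I t0 = (t - t0) * J \<xi>"
   using MVT2[OF t0(2), of I J] dI t0 by (meson less_le_trans)
  have "M * sqrt \<xi> * AL \<le> M * sqrt t * AL" using xi M AL0 by (intro mult_right_mono mult_left_mono) auto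
  then have "Z * UL - M * sqrt t * AL \<le> J \<xi>" using J_low[of \<xi>] xi t0 by simp
  then have "(t - t0) * (Z * UL - M * sqrt t * AL) \<le> I t - I t0"
   unfolding xi(3) using t0 by (intro mult_left_mono) auto
  also have "\<dots> \<le> (Z * s + K * sqrt t) * t * \<Phi> + M * t^2 * \<Phi>"
   using I_up[OF t(1)] I_low[OF t0(1)] unfolding sq by linarith
  finally have "t * ((1 - t ^ 3) * (Z * UL - M * sqrt t * AL)) \<le> t * ((Z * s + K * sqrt t) * \<Phi> + M * t * \<Phi>)"
   by (simp add: t0_def algebra_simps power2_eq_square power4_eq_xxxx power3_eq_cube)
  then show ?thesis by (rule mult_left_le_imp_le) (rule t(1))
 qed
 have "\<forall>\<^sub>F t in at_right 0. (1 - t ^ 3) * (Z * UL - M * sqrt t * AL) \<le> (Z * s + K * sqrt t) * \<Phi> + M * t * \<Phi>"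
  using eventually_at_right_real[OF zero_less_one] by eventually_elim (use step in auto)
 moreover have "((\<lambda>t. (1 - t ^ 3) * (Z * UL - M * sqrt t * AL)) \<longlongrightarrow> (1 - 0 ^ 3) * (Z * UL - M * sqrt 0 * AL)) (at_right 0)"
  by (intro tendsto_intros)
 moreover have "((\<lambda>t. (Z * s + K * sqrt t) * \<Phi> + M * t * \<Phi>) \<longlongrightarrow> (Z * s + K * sqrt 0) * \<Phi> + M * 0 * \<Phi>) (at_right 0)"
  by (intro tendsto_intros)
 ultimately have "(1 - 0 ^ 3) * (Z * UL - M * sqrt 0 * AL) \<le> (Z * s + K * sqrt 0) * \<Phi> + M * 0 * \<Phi>"
  by (intro tendsto_le[of "at_right 0"]) auto
 then have "Z * UL \<le> Z * (s * \<Phi>)" by simp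
 then have "UL \<le> s * \<Phi>" using Zpos by simp
 then show ?thesis by (simp add: UL_def L_def \<Phi>_def)
qed

section \<open>Supersolutions of the mean curvature equation\<close>

text \<open>For points near x the support of the kernel confines the integral to one fixed box,
  where \<open>box_convolution_derivative\<close> applies.\<close>

lemma convolution_derivative:
 fixes u :: "'a::euclidean_space => real" and K :: "'a => 'b::euclidean_space"
 assumes K: "\<And>x. (K has_derivative K' x) (at x)" "\<And>i. continuous_on UNIV (\<lambda>x. K' x i)"
  and supp: "\<And>z. norm z \<ge> ep ==> K z = 0" "\<And>z i. norm z \<ge> ep ==> K' z i = 0"
  and contu: "continuous_on UNIV u"
 shows "((\<lambda>x. (LBINT y. u y *R K (x - y))) has_derivative (\<lambda>h. (LBINT y. u y *R K' (x - y) h))) (at x)"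
  "integrable lborel (\<lambda>y. u y *R K (x - y))"
proof -
 have contK: "continuous_on UNIV K"
  using K(1) by (meson continuous_at_imp_continuous_on has_derivative_continuous)
 obtain a b :: 'a where ab: "cball x (1 + \<bar>ep\<bar>) \<subseteq> cbox a b"
  using bounded_subset_cbox_symmetric[OF bounded_cball] by metis
 have out: "norm (x' - y) \<ge> ep" if "x' \<in> ball x 1" "y \<notin> cbox a b" for x' y
 proof -
  have "norm (x - y) > 1 + \<bar>ep\<bar>" using ab that(2) by (metis dist_norm in_mono linorder_not_less mem_cball)
  then show ?thesis using that(1) norm_triangle_ineq[of "x - x'" "x' - y"] by (simp add: dist_norm)
 qed
 have cu: "continuous_on S u" for S using contu continuous_on_subset by blast
 have eq: "integral (cbox a b) (\<lambda>y. u y *R K (x' - y)) = (LBINT y. u y *R K (x' - y))" if "x' \<in> ball x 1" for x'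
  by (rule integral_cbox_eq_lborel)
   (use out[OF that] supp in \<open>auto intro!: continuous_intros contu continuous_on_compose2[OF contK]\<close>)
 have eq': "integral (cbox a b) (\<lambda>y. u y *R K' (x - y) h) = (LBINT y. u y *R K' (x - y) h)" for h
  by (rule integral_cbox_eq_lborel)
   (use out[of x] supp in \<open>auto intro!: continuous_intros contu continuous_on_compose2[OF K(2)]\<close>)
 have "((\<lambda>x. integral (cbox a b) (\<lambda>y. u y *R K (x - y))) has_derivative
   (\<lambda>h. (LBINT y. u y *R K' (x - y) h))) (at x)"
  using box_convolution_derivative[OF K(1) K(2) cu, of a b x] unfolding eq' .
 then show "((\<lambda>x. (LBINT y. u y *R K (x - y))) has_derivative (\<lambda>h. (LBINT y. u y *R K' (x - y) h))) (at x)"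
  by (rule has_derivative_transform_within_open[of _ _ _ _ "ball x 1"]) (use eq in auto)
 show "integrable lborel (\<lambda>y. u y *R K (x - y))"
 proof (rule integrable_continuous_compact_support[of _ "norm x + ep"])
  show "continuous_on UNIV (\<lambda>y. u y *R K (x - y))" by (intro continuous_intros contu continuous_on_compose2[OF contK]) auto
  fix y :: 'a assume "norm x + ep \<le> norm y"
  then have "norm (x - y) \<ge> ep" using norm_triangle_ineq2[of y x] by (simp add: norm_minus_commute)
  then show "u y *R K (x - y) = 0" using supp by simp
 qed
qed

section \<open>Mollification by a compactly supported bump\<close>

definition bump :: "real => 'a::euclidean_space => real" where
 "bump ep z = (max 0 (1 * (ep^2 - z \<bullet> z))) ^ 3"

text \<open>The factors 1 here and in \<open>Hbump\<close> keep the literal form of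
  \<open>cubic_bump_derivative\<close> at \<sigma> = 1.\<close>

definition dbump :: "real => 'a::euclidean_space => 'a" where
 "dbump ep z = (- 6 * 1 * (max 0 (1 * (ep^2 - z \<bullet> z)))^2) *R z"

definition Hbump :: "real => 'a::euclidean_space => 'a => 'a" where
 "Hbump ep z h = (24 * 1^2 * max 0 (1 * (ep^2 - z \<bullet> z))) *R ((z \<bullet> h) *R z) - (6 * 1 * (max 0 (1 * (ep^2 - z \<bullet> z)))^2) *R h"

lemma bump_derivs:
 "(bump ep has_derivative (\<lambda>h. dbump ep z \<bullet> h)) (at z)"
 "(dbump ep has_derivative Hbump ep z) (at z)"
 "selfadjoint (Hbump ep z)"
 using cubic_bump_derivative[of 1 ep z] selfadjoint_bump_hessian
 unfolding bump_def[abs_def] dbump_def[abs_def] Hbump_def[abs_def] by blast+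

lemma bump_cont: "continuous_on UNIV (bump ep)" "continuous_on UNIV (dbump ep)" "continuous_on UNIV (\<lambda>z. Hbump ep z h)"
 unfolding bump_def dbump_def Hbump_def by (intro continuous_intros)+

lemma bump_supp:
 assumes "norm z \<ge> ep" "ep > 0"
 shows "bump ep z = 0" "dbump ep z = 0" "Hbump ep z h = 0"
proof -
 have "ep^2 \<le> (norm z)^2" using assms by (intro power_mono) auto
 then have "max 0 (1 * (ep^2 - z \<bullet> z)) = 0" by (simp add: power2_norm_eq_inner)
 then show "bump ep z = 0" "dbump ep z = 0" "Hbump ep z h = 0" by (simp_all add: bump_def dbump_def Hbump_def)
qed

lemma bump_nonneg: "bump ep z \<ge> 0" by (simp add: bump_def)

lemma bump_pos: "norm z < ep ==> bump ep z > 0"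
proof -
 assume "norm z < ep"
 then have "(norm z)^2 < ep\<^sup>2" by (intro power_strict_mono) auto
 then show ?thesis by (simp add: bump_def power2_norm_eq_inner)
qed

lemma bump_integrable: "ep > 0 ==> integrable lborel (bump ep)"
 by (rule integrable_continuous_compact_support[OF bump_cont(1), of ep]) (rule bump_supp)

lemma bump_integral_pos:
 assumes "ep > 0" shows "(\<integral>z. bump ep z \<partial>(lborel :: 'a::euclidean_space measure)) > 0"
proof -
 have "(\<integral>z. bump ep z \<partial>(lborel :: 'a measure)) \<noteq> 0"
 proof
  assume "(\<integral>z. bump ep z \<partial>(lborel :: 'a measure)) = 0"
  then have "AE z in (lborel :: 'a measure). bump ep z = 0"
   using integral_nonneg_eq_0_iff_AE[OF bump_integrable[OF assms, where 'a = 'a]] by (simp add: bump_nonneg)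
  then have "AE z in (lborel :: 'a measure). z \<notin> ball 0 ep"
   by eventually_elim (use bump_pos in force)
  then have "emeasure lborel (ball (0::'a) ep) = 0"
   by (subst (asm) AE_iff_measurable[where N = "ball 0 ep"]) auto
  then have "measure lborel (ball (0::'a) ep) = 0" by (simp add: measure_def)
  then show False using assms content_ball_pos[of ep "0::'a"] by simp
 qed
 moreover have "(\<integral>z. bump ep z \<partial>(lborel :: 'a measure)) \<ge> 0" by (intro Bochner_Integration.integral_nonneg bump_nonneg)
 ultimately show ?thesis by simp
qed

definition nrm :: "'a::euclidean_space itself => real => real" where
 "nrm _ ep = 1 / (\<integral>z. bump ep z \<partial>(lborel :: 'a measure))"

definition moll :: "real => ('a::euclidean_space => real) => 'a => real" where
 "moll ep u x = (LBINT y. u y *R (nrm TYPE('a) ep *R bump ep (x - y)))"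

definition dmoll :: "real => ('a::euclidean_space => real) => 'a => 'a" where
 "dmoll ep u x = (LBINT y. u y *R (nrm TYPE('a) ep *R dbump ep (x - y)))"

definition Hmoll :: "real => ('a::euclidean_space => real) => 'a => 'a => 'a" where
 "Hmoll ep u x h = (LBINT y. u y *R (nrm TYPE('a) ep *R Hbump ep (x - y) h))"

text \<open>The class that inf-convolution with hyperboloids produces: Lipschitz, semiconcave
  viscosity supersolutions of the mean curvature equation.\<close>

definition superclass :: "real => real => ('a::euclidean_space => real) => bool" where
 "superclass La C u \<longleftrightarrow> 0 \<le> La \<and> 0 \<le> C \<and> (\<forall>x y. \<bar>u x - u y\<bar> \<le> La * norm (x - y)) \<and> semiconcave C u \<and>
  (\<forall>x p B. subjet u x p B --> mcurv p B \<le> 0)"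

lemma superclassD:
 assumes "superclass La C u"
 shows "0 \<le> La" "0 \<le> C" "\<bar>u x - u y\<bar> \<le> La * norm (x - y)" "semiconcave C u" "subjet u x p B ==> mcurv p B \<le> 0"
 using assms unfolding superclass_def by auto

lemma superclass_continuous: "superclass La C u ==> continuous_on S u"
 by (rule lipschitz_on_continuous_on[where L = La]) (auto simp: dist_norm lipschitz_on_def superclass_def)

lemma derivative_norm_le_Lipschitz:
 fixes u :: "'a::euclidean_space => real"
 assumes Lip: "\<And>x y. \<bar>u x - u y\<bar> \<le> La * norm (x - y)" and d: "(u has_derivative (\<lambda>h. q \<bullet> h)) (at x)"
 shows "norm q \<le> La"
proof -
 have "((\<lambda>t. x + t *R q) has_derivative (\<lambda>s. s *R q)) (at 0)" by (auto intro!: derivative_eq_intros)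
 from has_derivative_compose[OF this, of u "\<lambda>h. q \<bullet> h"] d
 have "((\<lambda>t. u (x + t *R q)) has_real_derivative q \<bullet> q) (at 0)"
  by (simp add: has_field_derivative_def mult_commute_abs)
 then have "((\<lambda>t. (u (x + t *R q) - u x) / t) \<longlongrightarrow> q \<bullet> q) (at_right 0)"
  unfolding DERIV_def by (auto intro: tendsto_mono[OF at_le])
 moreover have "\<forall>\<^sub>F t in at_right 0. (u (x + t *R q) - u x) / t \<le> La * norm q"
  using eventually_at_right_less[of "0::real"]
 proof eventually_elim
  case (elim t)
  then show ?case using Lip[of "x + t *R q" x] by (simp add: divide_le_eq abs_le_iff mult_ac)
 qed
 ultimately have "q \<bullet> q \<le> La * norm q" by (intro tendsto_upperbound) auto
 then have "norm q * norm q \<le> La * norm q" by (simp add: power2_norm_eq_inner[symmetric] power2_eq_square)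
 moreover have "0 \<le> La"
 proof -
  obtain b :: 'a where "b \<in> Basis" using nonempty_Basis by blast
  then show ?thesis using order_trans[OF abs_ge_zero Lip[of b 0]] by simp
 qed
 ultimately show ?thesis by (cases "q = 0") auto
qed

text \<open>A small step t against q lowers u by almost t |q|^2, while the Lipschitz bound allows
  only La t |q|.\<close>

lemma supergrad_norm_le:
 fixes u :: "'a::euclidean_space => real"
 assumes Lip: "\<And>x y. \<bar>u x - u y\<bar> \<le> La * norm (x - y)" and q: "supergrad C u x q"
 shows "norm q \<le> La"
proof (cases "q = 0")
 case True
 obtain b :: 'a where "b \<in> Basis" using nonempty_Basis by blast
 then show ?thesis using order_trans[OF abs_ge_zero Lip[of b 0]] True by simp
next
 case False
 have "norm q \<le> La + C / 2 * t * norm q" if t: "t > 0" for t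
 proof -
  have "u (x + (- t) *R q) \<le> u x + q \<bullet> ((- t) *R q) + C / 2 * (norm ((- t) *R q))^2"
   using q unfolding supergrad_def by blast
  moreover have "u x - u (x + (- t) *R q) \<le> La * (t * norm q)"
   using Lip[of x "x + (- t) *R q"] t by simp
  ultimately have "t * (norm q)^2 \<le> La * (t * norm q) + C / 2 * (t * norm q)^2"
   using t by (simp add: power2_norm_eq_inner)
  then have "(t * norm q) * norm q \<le> (t * norm q) * (La + C / 2 * t * norm q)"
   by (simp add: power2_eq_square algebra_simps)
  then show ?thesis using t False by simp
 qed
 then have "\<forall>\<^sub>F t in at_right 0. norm q \<le> La + C / 2 * t * norm q"
  using eventually_at_right_less[of "0::real"] by (auto elim: eventually_mono)
 moreover have "((\<lambda>t. La + C / 2 * t * norm q) \<longlongrightarrow> La + C / 2 * 0 * norm q) (at_right 0)" by (intro tendsto_intros)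
 ultimately have "norm q \<le> La + C / 2 * 0 * norm q" by (intro tendsto_lowerbound) auto
 then show ?thesis by simp
qed

context
 fixes La C ep :: real and u :: "'a::euclidean_space => real"
 assumes u: "superclass La C u" and eps: "ep > 0"
begin

definition ker :: "'a => real" where "ker z = nrm TYPE('a) ep * bump ep z"

lemma ker_facts: "ker z \<ge> 0" "norm z \<ge> ep ==> ker z = 0" "integrable lborel ker" "(LBINT z. ker z) = 1" "continuous_on UNIV ker"
proof -
 have n: "nrm TYPE('a) ep > 0" using bump_integral_pos[OF eps, where 'a = 'a] by (simp add: nrm_def)
 show "ker z \<ge> 0" unfolding ker_def by (rule mult_nonneg_nonneg[OF less_imp_le[OF n] bump_nonneg])
 show "norm z \<ge> ep ==> ker z = 0" using bump_supp(1)[of ep z, OF _ eps] by (simp add: ker_def)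
 show "integrable lborel ker" unfolding ker_def[abs_def] by (intro integrable_mult_right bump_integrable eps)
 show "(LBINT z. ker z) = 1" using bump_integral_pos[OF eps, where 'a = 'a] by (simp add: ker_def nrm_def)
 show "continuous_on UNIV ker" unfolding ker_def[abs_def] by (intro continuous_intros bump_cont)
qed

lemma moll_alt: "moll ep u x = (LBINT z. u (x - z) * ker z)" "integrable lborel (\<lambda>z. u (x - z) * ker z)"
proof -
 have c: "continuous_on UNIV (\<lambda>y. u y * ker (x - y))"
  by (intro continuous_intros superclass_continuous[OF u] continuous_on_compose2[OF ker_facts(5)]) auto
 have "moll ep u x = (LBINT y. u y * ker (x - y))" by (simp add: moll_def ker_def)
 also have "\<dots> = (LBINT z. u (x - z) * ker z)"
  using lborel_integral_affine(1)[OF borel_measurable_continuous_onI[OF c], of "-1" x] by simp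
 finally show "moll ep u x = (LBINT z. u (x - z) * ker z)" .
 show "integrable lborel (\<lambda>z. u (x - z) * ker z)"
  by (rule integrable_continuous_compact_support[of _ ep])
   (auto intro!: continuous_intros superclass_continuous[OF u] continuous_on_compose2[OF superclass_continuous[OF u]] ker_facts simp: ker_facts)
qed

text \<open>The kernel is a probability density on the ball of radius ep. Applied to differences of
  translates, this transfers pointwise inequalities from u to its mollification.\<close>

lemma moll_mono_const:
 assumes "\<And>z. norm z < ep ==> f z \<le> c" "integrable lborel (\<lambda>z. f z * ker z)"
 shows "(LBINT z. f z * ker z) \<le> c"
proof -
 have "(LBINT z. f z * ker z) \<le> (LBINT z. c * ker z)"
 proof (rule integral_mono)
  show "integrable lborel (\<lambda>z. f z * ker z)" by (rule assms)
  show "integrable lborel (\<lambda>z. c * ker z)" by (intro integrable_mult_right ker_facts)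
  show "f z * ker z \<le> c * ker z" for z
   using assms(1)[of z] ker_facts(1,2)[of z] by (cases "norm z < ep") (auto intro!: mult_right_mono)
 qed
 then show ?thesis by (simp add: ker_facts)
qed

lemma moll_near: "\<bar>moll ep u x - u x\<bar> \<le> La * ep"
proof -
 have L: "\<bar>u (x - z) - u x\<bar> \<le> La * ep" if "norm z < ep" for z
 proof -
  have "La * norm z \<le> La * ep" using that superclassD(1)[OF u] by (intro mult_left_mono) auto
  then show ?thesis using superclassD(3)[OF u, of "x - z" x] by simp
 qed
 have "moll ep u x \<le> u x + La * ep"
  unfolding moll_alt(1) by (rule moll_mono_const[OF _ moll_alt(2)]) (use L in \<open>auto simp: abs_le_iff dest!: L\<close>)
 moreover have "(LBINT z. (- u (x - z)) * ker z) \<le> - u x + La * ep"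
 proof (rule moll_mono_const)
  show "integrable lborel (\<lambda>z. - u (x - z) * ker z)" using moll_alt(2)[of x] by simp
  show "- u (x - z) \<le> - u x + La * ep" if "norm z < ep" for z using L[OF that] by linarith
 qed
 ultimately show ?thesis using moll_alt(1)[of x] by (simp add: abs_le_iff)
qed

lemma moll_Lipschitz: "\<bar>moll ep u x - moll ep u y\<bar> \<le> La * norm (x - y)"
proof -
 have *: "moll ep u x - moll ep u y \<le> La * norm (x - y)" for x y
 proof -
  have "moll ep u x - moll ep u y = (LBINT z. (u (x - z) - u (y - z)) * ker z)"
   unfolding moll_alt(1) left_diff_distrib using moll_alt(2) by simp
  also have "\<dots> \<le> La * norm (x - y)"
  proof (rule moll_mono_const)
   show "integrable lborel (\<lambda>z. (u (x - z) - u (y - z)) * ker z)"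
    unfolding left_diff_distrib using moll_alt(2) by simp
   show "u (x - z) - u (y - z) \<le> La * norm (x - y)" for z
    using superclassD(3)[OF u, of "x - z" "y - z"] by (simp add: abs_le_iff)
  qed
  finally show ?thesis .
 qed
 show ?thesis using *[of x y] *[of y x] by (simp add: abs_le_iff norm_minus_commute)
qed

lemma moll_semiconcave: "semiconcave C (moll ep u)"
 unfolding semiconcave_def
proof (intro allI impI)
 fix x h t assume t: "0 \<le> t" "t \<le> (1::real)"
 define f where "f z = u (x - z) + t * (u (x + h - z) - u (x - z)) - u (x + t *R h - z)" for z
 have eq: "f z * ker z = u (x - z) * ker z + (t * (u (x + h - z) * ker z) - t * (u (x - z) * ker z)) - u (x + t *R h - z) * ker z" for z
  by (simp add: f_def algebra_simps)
 have "(LBINT z. f z * ker z) \<le> C / 2 * t * (1 - t) * (norm h)^2"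
 proof (rule moll_mono_const)
  show "integrable lborel (\<lambda>z. f z * ker z)" unfolding eq using moll_alt(2) by simp
  show "f z \<le> C / 2 * t * (1 - t) * (norm h)^2" for z
  proof -
   have "u (x - z) + t * (u (x - z + h) - u (x - z)) \<le> u (x - z + t *R h) + C / 2 * t * (1 - t) * (norm h)^2"
    using superclassD(4)[OF u] t unfolding semiconcave_def by blast
   moreover have "x - z + h = x + h - z" "x - z + t *R h = x + t *R h - z" by auto
   ultimately show ?thesis by (simp add: f_def)
  qed
 qed
 moreover have "(LBINT z. f z * ker z) = moll ep u x + (t * moll ep u (x + h) - t * moll ep u x) - moll ep u (x + t *R h)"
  unfolding eq moll_alt(1) using moll_alt(2) by simp
 ultimately show "moll ep u x + t * (moll ep u (x + h) - moll ep u x) \<le> moll ep u (x + t *R h) + C / 2 * t * (1 - t) * (norm h)^2"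
  unfolding right_diff_distrib[of t] by linarith
qed

lemma moll_derivs:
 "(moll ep u has_derivative (\<lambda>h. dmoll ep u x \<bullet> h)) (at x)"
 "(dmoll ep u has_derivative Hmoll ep u x) (at x)"
 "selfadjoint (Hmoll ep u x)"
 "mcurv p (Hmoll ep u x) = (LBINT y. u y * mcurv p (\<lambda>h. nrm TYPE('a) ep *R Hbump ep (x - y) h))"
 "continuous_on UNIV (dmoll ep u)" "continuous_on UNIV (\<lambda>x. Hmoll ep u x i)"
proof -
 define n where "n = nrm TYPE('a) ep"
 have cu: "continuous_on UNIV u" by (rule superclass_continuous[OF u])
 have d1: "((\<lambda>z. n *R bump ep z) has_derivative (\<lambda>h. n *R (dbump ep z \<bullet> h))) (at z)" for z :: 'a
  by (intro has_derivative_scaleR_right bump_derivs)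
 have d2: "((\<lambda>z. n *R dbump ep z) has_derivative (\<lambda>h. n *R Hbump ep z h)) (at z)" for z :: 'a
  by (intro has_derivative_scaleR_right bump_derivs)
 have cH: "continuous_on UNIV (\<lambda>z. n *R Hbump ep z i)" for i :: 'a by (intro continuous_intros bump_cont)
 note s = bump_supp[OF _ eps]
 have C1: "((\<lambda>x. (LBINT y. u y *R (n *R bump ep (x - y)))) has_derivative (\<lambda>h. (LBINT y. u y *R (n *R (dbump ep (x - y) \<bullet> h))))) (at x)" for x
  by (rule convolution_derivative(1)[OF d1, of ep]) (auto intro!: continuous_intros bump_cont cu simp: s)
 have C2: "((\<lambda>x. (LBINT y. u y *R (n *R dbump ep (x - y)))) has_derivative (\<lambda>h. (LBINT y. u y *R (n *R Hbump ep (x - y) h)))) (at x)" for x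
  by (rule convolution_derivative(1)[OF d2 cH, of ep]) (auto intro!: cu simp: s)
 have I1: "integrable lborel (\<lambda>y. u y *R (n *R dbump ep (x - y)))" for x
  by (rule convolution_derivative(2)[OF d2 cH, of ep]) (auto intro!: cu simp: s)
 have I2: "integrable lborel (\<lambda>y. u y *R (n *R Hbump ep (x - y) h))" for x h :: 'a
 proof (rule integrable_continuous_compact_support[of _ "norm x + ep"])
  show "continuous_on UNIV (\<lambda>y. u y *R (n *R Hbump ep (x - y) h))"
   by (intro continuous_intros cu continuous_on_compose2[OF bump_cont(3)]) auto
  fix y :: 'a assume "norm x + ep \<le> norm y"
  then have "norm (x - y) \<ge> ep" using norm_triangle_ineq2[of y x] by (simp add: norm_minus_commute)
  then show "u y *R (n *R Hbump ep (x - y) h) = 0" by (simp add: s)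
 qed
 show D1: "(moll ep u has_derivative (\<lambda>h. dmoll ep u x \<bullet> h)) (at x)"
 proof -
  have "dmoll ep u x \<bullet> h = (LBINT y. u y *R (n *R (dbump ep (x - y) \<bullet> h)))" for h
   using integral_inner_left[OF I1[of x], of h] by (simp add: dmoll_def n_def mult.assoc)
  then show ?thesis using C1[of x] by (simp add: moll_def[abs_def] n_def)
 qed
 show D2: "(dmoll ep u has_derivative Hmoll ep u x) (at x)"
  using C2[of x] by (simp add: dmoll_def[abs_def] Hmoll_def[abs_def] n_def)
 have inn: "Hmoll ep u x h \<bullet> k = (LBINT y. u y * (n *R Hbump ep (x - y) h \<bullet> k))" for h k
  using integral_inner_left[OF I2[of x h], of k] by (simp add: Hmoll_def n_def mult.assoc)
 have I3: "integrable lborel (\<lambda>y. u y * (n *R Hbump ep (x - y) h \<bullet> k))" for h k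
  using integrable_inner_left[OF I2[of x h], of k] by (simp add: mult.assoc)
 show "selfadjoint (Hmoll ep u x)"
  unfolding selfadjoint_def
 proof (intro conjI allI)
  show "linear (Hmoll ep u x)" using D2 by (rule has_derivative_linear)
  fix h k
  have "Hmoll ep u x h \<bullet> k = Hmoll ep u x k \<bullet> h"
   unfolding inn using selfadjointD(2)[OF bump_derivs(3), of ep _ h k] by (simp add: inner_commute)
  then show "Hmoll ep u x h \<bullet> k = h \<bullet> Hmoll ep u x k" by (simp add: inner_commute)
 qed
 have "mcurv p (Hmoll ep u x) = (\<Sum>i\<in>Basis. (LBINT y. u y * (n *R Hbump ep (x - y) i \<bullet> i)))
   - (LBINT y. u y * (n *R Hbump ep (x - y) p \<bullet> p)) / (1 + p \<bullet> p)"
  unfolding mcurv_def trace_map_def inner_commute[of p "Hmoll ep u x p"] inn ..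
 also have "\<dots> = (LBINT y. (\<Sum>i\<in>Basis. u y * (n *R Hbump ep (x - y) i \<bullet> i)) - u y * (n *R Hbump ep (x - y) p \<bullet> p) / (1 + p \<bullet> p))"
 proof -
  have "(\<Sum>i\<in>Basis. (LBINT y. u y * (n *R Hbump ep (x - y) i \<bullet> i))) = (LBINT y. (\<Sum>i\<in>Basis. u y * (n *R Hbump ep (x - y) i \<bullet> i)))"
   by (rule Bochner_Integration.integral_sum[symmetric]) (rule I3)
  moreover have "(LBINT y. u y * (n *R Hbump ep (x - y) p \<bullet> p)) / (1 + p \<bullet> p) = (LBINT y. u y * (n *R Hbump ep (x - y) p \<bullet> p) / (1 + p \<bullet> p))"
   by (rule integral_divide_zero[symmetric])
  moreover have Is: "integrable lborel (\<lambda>y. \<Sum>i\<in>Basis. u y * (n *R Hbump ep (x - y) i \<bullet> i))"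
   by (rule Bochner_Integration.integrable_sum) (rule I3)
  ultimately show ?thesis
   using Bochner_Integration.integral_diff[OF Is integrable_divide_zero[OF I3[of p p], of "1 + p \<bullet> p"]]
   by (simp only:)
 qed
 also have "(\<lambda>y. (\<Sum>i\<in>Basis. u y * (n *R Hbump ep (x - y) i \<bullet> i)) - u y * (n *R Hbump ep (x - y) p \<bullet> p) / (1 + p \<bullet> p))
  = (\<lambda>y. u y * mcurv p (\<lambda>h. n *R Hbump ep (x - y) h))"
 proof (rule ext)
  fix y :: 'a
  have "p \<bullet> Hbump ep (x - y) p = Hbump ep (x - y) p \<bullet> p" by (rule inner_commute)
  then show "(\<Sum>i\<in>Basis. u y * (n *R Hbump ep (x - y) i \<bullet> i)) - u y * (n *R Hbump ep (x - y) p \<bullet> p) / (1 + p \<bullet> p)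
   = u y * mcurv p (\<lambda>h. n *R Hbump ep (x - y) h)"
   unfolding mcurv_def trace_map_def by (simp add: sum_distrib_left right_diff_distrib)
 qed
 finally show "mcurv p (Hmoll ep u x) = (LBINT y. u y * mcurv p (\<lambda>h. nrm TYPE('a) ep *R Hbump ep (x - y) h))"
  by (simp add: n_def)
 show "continuous_on UNIV (dmoll ep u)"
 proof -
  have "(dmoll ep u has_derivative Hmoll ep u x) (at x)" for x
   using C2[of x] by (simp add: dmoll_def[abs_def] Hmoll_def[abs_def] n_def)
  then show ?thesis by (meson continuous_at_imp_continuous_on has_derivative_continuous)
 qed
 show "continuous_on UNIV (\<lambda>x. Hmoll ep u x i)"
 proof (rule continuous_at_imp_continuous_on, rule ballI)
  fix x :: 'a
  obtain a b :: 'a where ab: "cball x (1 + ep) \<subseteq> cbox a b"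
   using bounded_subset_cbox_symmetric[OF bounded_cball] by metis
  have "continuous_on (ball x 1) (\<lambda>x. integral (cbox a b) (\<lambda>y. u y *R (n *R Hbump ep (x - y) i)))"
   by (rule continuous_on_subset[OF continuous_box_convolution[OF cH superclass_continuous[OF u]]]) auto
  moreover have "integral (cbox a b) (\<lambda>y. u y *R (n *R Hbump ep (x' - y) i)) = Hmoll ep u x' i" if x': "x' \<in> ball x 1" for x'
   unfolding Hmoll_def n_def[symmetric]
  proof (rule integral_cbox_eq_lborel)
   show "continuous_on UNIV (\<lambda>y. u y *R (n *R Hbump ep (x' - y) i))"
    by (intro continuous_intros cu continuous_on_compose2[OF bump_cont(3)]) auto
   fix y :: 'a assume "y \<notin> cbox a b"
   then have "norm (x - y) > 1 + ep" using ab by (metis dist_norm in_mono linorder_not_less mem_cball)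
   then have "norm (x' - y) \<ge> ep" using x' norm_triangle_ineq[of "x - x'" "x' - y"] by (simp add: dist_norm)
   then show "u y *R (n *R Hbump ep (x' - y) i) = 0" by (simp add: s)
  qed
  ultimately have "continuous_on (ball x 1) (\<lambda>x. Hmoll ep u x i)" by (metis (no_types, lifting) continuous_on_cong)
  then show "isCont (\<lambda>x. Hmoll ep u x i) x" by (simp add: continuous_on_eq_continuous_at)
 qed
qed

lemma dmoll_norm_le: "norm (dmoll ep u x) \<le> La"
 by (rule derivative_norm_le_Lipschitz[OF moll_Lipschitz moll_derivs(1)])

lemma dmoll_supergrad: "supergrad C (moll ep u) x (dmoll ep u x)"
 by (rule differentiable_imp_supergrad[OF moll_semiconcave moll_derivs(1)])

text \<open>The Taylor polynomial lowered by \<eta> |h|^2 is a subjet of the mollification, so the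
  Hessian bound for subjets applies; then \<eta> tends to 0.\<close>

lemma Hmoll_le: "h \<bullet> Hmoll ep u x h \<le> C * (norm h)^2"
proof -
 have "h \<bullet> Hmoll ep u x h - 2 * \<eta> * (norm h)^2 \<le> C * (norm h)^2" if eta: "\<eta> > 0" for \<eta>
 proof -
  obtain d where d: "d > 0" "\<And>h::'a. norm h < d ==> \<bar>moll ep u (x + h) - moll ep u x - dmoll ep u x \<bullet> h - (h \<bullet> Hmoll ep u x h) / 2\<bar> \<le> \<eta> * (norm h)^2"
   using taylor_second_order[OF moll_derivs(1,2) eta] by blast
  define B where "B h = Hmoll ep u x h - (2 * \<eta>) *R h" for h
  have saB: "selfadjoint B"
   using moll_derivs(3)[of x] unfolding selfadjoint_def B_def
   by (auto simp: inner_diff_left inner_diff_right linear_iff scaleR_add_right algebra_simps)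
  have hB: "h \<bullet> B h = h \<bullet> Hmoll ep u x h - 2 * \<eta> * (norm h)^2" for h
   by (simp add: B_def inner_diff_right power2_norm_eq_inner)
  have "subjet (moll ep u) x (dmoll ep u x) B"
   unfolding subjet_def
  proof (intro conjI saB exI[of _ d] allI impI d(1))
   fix h :: 'a assume "norm h < d"
   from d(2)[OF this] show "moll ep u x + dmoll ep u x \<bullet> h + (h \<bullet> B h) / 2 \<le> moll ep u (x + h)"
    unfolding hB abs_le_iff by (simp add: diff_divide_distrib)
  qed
  from subjet_hessian_le[OF moll_semiconcave this, of h] show ?thesis unfolding hB .
 qed
 then have "\<forall>\<^sub>F \<eta> in at_right 0. h \<bullet> Hmoll ep u x h - 2 * \<eta> * (norm h)^2 \<le> C * (norm h)^2"
  using eventually_at_right_less[of "0::real"] by (auto elim: eventually_mono)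
 moreover have "((\<lambda>\<eta>. h \<bullet> Hmoll ep u x h - 2 * \<eta> * (norm h)^2) \<longlongrightarrow> h \<bullet> Hmoll ep u x h - 2 * 0 * (norm h)^2) (at_right 0)"
  by (intro tendsto_intros)
 ultimately have "h \<bullet> Hmoll ep u x h - 2 * 0 * (norm h)^2 \<le> C * (norm h)^2" by (intro tendsto_upperbound) auto
 then show ?thesis by simp
qed

text \<open>The Hessian of the mollification is u integrated against the Hessian of a nonnegative
  bump, so this is the distributional inequality with that bump as test function. The operator there
  has constant coefficients, which is why the jets are tested with one frozen slope
  \<open>p\<close>.\<close>

lemma mcurv_Hmoll_le:
 assumes jets: "\<And>y q B. y \<in> ball x (2 * ep) ==> subjet u y q B ==> mcurv p B \<le> s" and s: "s \<ge> 0"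
 shows "mcurv p (Hmoll ep u x) \<le> s"
proof -
 define n where "n = nrm TYPE('a) ep"
 have n0: "n > 0" using bump_integral_pos[OF eps, where 'a = 'a] by (simp add: n_def nrm_def)
 note supp = bump_supp[OF _ eps]
 have sh: "((\<lambda>y. x - y) has_derivative (\<lambda>h. - h)) (at y)" for y by (auto intro!: derivative_eq_intros)
 have lin: "linear (Hbump ep z)" for z :: 'a by (rule selfadjointD(1)[OF bump_derivs(3)])
 have "(LBINT y. u y * mcurv p (\<lambda>h. n *R Hbump ep (x - y) h)) \<le> s * (LBINT y. n * bump ep (x - y))"
 proof (rule jets_imp_distributional[OF superclassD(3)[OF u] jets eps s])
  show "((\<lambda>y. n * bump ep (x - y)) has_derivative (\<lambda>h. (- n *R dbump ep (x - y)) \<bullet> h)) (at y)" for y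
   by (rule has_derivative_eq_rhs[OF has_derivative_mult_right[OF has_derivative_compose[OF sh bump_derivs(1)]]]) (simp add: fun_eq_iff)
  show "((\<lambda>y. - n *R dbump ep (x - y)) has_derivative (\<lambda>h. n *R Hbump ep (x - y) h)) (at y)" for y
   by (rule has_derivative_eq_rhs[OF has_derivative_scaleR_right[OF has_derivative_compose[OF sh bump_derivs(2)]]])
    (simp add: fun_eq_iff linear_neg[OF lin])
  show "continuous_on UNIV (\<lambda>y. n *R Hbump ep (x - y) i)" for i
   by (intro continuous_intros continuous_on_compose2[OF bump_cont(3)]) auto
  show "0 \<le> n * bump ep (x - y)" for y using n0 bump_nonneg[of ep "x - y"] by simp
 qed (auto simp: supp norm_minus_commute)
 moreover have "(LBINT y. n * bump ep (x - y)) = 1"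
 proof -
  have c: "continuous_on UNIV (\<lambda>y. n * bump ep (x - y))"
   by (intro continuous_intros continuous_on_compose2[OF bump_cont(1)]) auto
  have "(LBINT y. n * bump ep (x - y)) = (LBINT z. ker z)"
   using lborel_integral_affine(1)[OF borel_measurable_continuous_onI[OF c], of "-1" x] by (simp add: ker_def n_def)
  then show ?thesis by (simp add: ker_facts)
 qed
 ultimately show ?thesis unfolding moll_derivs(4) n_def by simp
qed

end

section \<open>Supergradients: limits, and uniqueness almost everywhere\<close>

lemma supergrad_limit:
 assumes q: "\<And>n. supergrad C (w n) (y n) (q n)" and w: "\<And>n z. \<bar>w n z - u z\<bar> \<le> e n" and e: "e \<longlonglongrightarrow> 0"
  and y: "y \<longlonglongrightarrow> x" and lim: "q \<longlonglongrightarrow> p" and contu: "continuous_on UNIV u"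
 shows "supergrad C u x p"
 unfolding supergrad_def
proof
 fix h
 have cu: "(\<lambda>n. u (y n + k)) \<longlonglongrightarrow> u (x + k)" for k
  by (rule continuous_on_tendsto_compose[OF contu]) (auto intro!: tendsto_intros y)
 have "u (y n + h) - e n \<le> u (y n + 0) + e n + q n \<bullet> h + C / 2 * (norm h)^2" for n
 proof -
  have "w n (y n + h) \<le> w n (y n) + q n \<bullet> h + C / 2 * (norm h)^2" using q[of n] by (simp add: supergrad_def)
  moreover have "u (y n + h) - e n \<le> w n (y n + h)" "w n (y n) \<le> u (y n) + e n"
   using w[of n "y n + h"] w[of n "y n"] by (auto simp: abs_le_iff)
  ultimately show ?thesis by simp
 qed
 moreover have "(\<lambda>n. u (y n + h) - e n) \<longlonglongrightarrow> u (x + h) - 0" by (intro tendsto_intros cu e)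
 moreover have "(\<lambda>n. u (y n + 0) + e n + q n \<bullet> h + C / 2 * (norm h)^2) \<longlonglongrightarrow> u (x + 0) + 0 + p \<bullet> h + C / 2 * (norm h)^2"
  by (intro tendsto_intros cu e lim)
 ultimately have "u (x + h) - 0 \<le> u (x + 0) + 0 + p \<bullet> h + C / 2 * (norm h)^2"
  by (intro LIMSEQ_le) auto
 then show "u (x + h) \<le> u x + p \<bullet> h + C / 2 * (norm h)^2" by simp
qed

lemma supergrad_subsequence:
 fixes u :: "'a::euclidean_space => real"
 assumes q: "\<And>n. supergrad C (w n) (y n) (q n)" and w: "\<And>n z. \<bar>w n z - u z\<bar> \<le> e n" and e: "e \<longlonglongrightarrow> 0"
  and y: "y \<longlonglongrightarrow> x" and qL: "\<And>n. norm (q n) \<le> La" and contu: "continuous_on UNIV u"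
 obtains r p where "strict_mono r" "(q \<circ> r) \<longlonglongrightarrow> p" "supergrad C u x p"
proof -
 have "seq_compact (cball 0 La :: 'a set)" by (simp add: compact_imp_seq_compact)
 moreover have "\<forall>n. q n \<in> cball 0 La" using qL by simp
 ultimately obtain p r where r: "strict_mono (r :: nat => nat)" "(q \<circ> r) \<longlonglongrightarrow> p" unfolding seq_compact_def by blast
 have "supergrad C u x p"
 proof (rule supergrad_limit[where w = "w \<circ> r" and y = "y \<circ> r" and e = "e \<circ> r"])
  show "(e \<circ> r) \<longlonglongrightarrow> 0" "(y \<circ> r) \<longlonglongrightarrow> x" using e y r(1) LIMSEQ_subseq_LIMSEQ by blast+
 qed (use q w r contu in auto)
 with r show ?thesis by (rule that)
qed

text \<open>Every subsequence of the bounded sequence q has a further subsequence converging to a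
  supergradient at x, and there is only one such limit.\<close>

lemma unique_supergrad_convergence:
 fixes u :: "'a::euclidean_space => real"
 assumes uniq: "\<And>q. supergrad C u x q ==> q = p"
  and q: "\<And>n. supergrad C (w n) (y n) (q n)" and w: "\<And>n z. \<bar>w n z - u z\<bar> \<le> e n" and e: "e \<longlonglongrightarrow> 0"
  and y: "y \<longlonglongrightarrow> x" and qL: "\<And>n. norm (q n) \<le> La" and contu: "continuous_on UNIV u"
 shows "q \<longlonglongrightarrow> p"
proof (rule ccontr)
 assume "\<not> q \<longlonglongrightarrow> p"
 then obtain \<omega> where om: "\<omega> > 0" "\<not> (\<forall>\<^sub>F n in sequentially. dist (q n) p < \<omega>)" by (auto simp: tendsto_iff)
 then obtain r :: "nat => nat" where r: "strict_mono r" "\<And>n. \<not> dist (q (r n)) p < \<omega>"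
  using not_eventually_sequentiallyD by blast
 have er: "(e \<circ> r) \<longlonglongrightarrow> 0" and yr: "(y \<circ> r) \<longlonglongrightarrow> x" using e y r(1) LIMSEQ_subseq_LIMSEQ by blast+
 obtain r' p' where r': "strict_mono r'" "((q \<circ> r) \<circ> r') \<longlonglongrightarrow> p'" "supergrad C u x p'"
 proof (rule supergrad_subsequence[where w = "w \<circ> r" and y = "y \<circ> r" and q = "q \<circ> r" and e = "e \<circ> r" and u = u and x = x and C = C and La = La])
  show "\<And>n. supergrad C ((w \<circ> r) n) ((y \<circ> r) n) ((q \<circ> r) n)" using q by simp
  show "\<And>n z. \<bar>(w \<circ> r) n z - u z\<bar> \<le> (e \<circ> r) n" using w by simp
  show "\<And>n. norm ((q \<circ> r) n) \<le> La" using qL by simp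
 qed (use er yr contu in auto)
 have "p' = p" using uniq r'(3) by blast
 then have "\<forall>\<^sub>F n in sequentially. dist (((q \<circ> r) \<circ> r') n) p < \<omega>" using r'(2) om(1) by (auto simp: tendsto_iff)
 then show False using r(2) by (auto simp: eventually_sequentially)
qed

text \<open>The Hessian of the bump is bounded by (24 + 6) ep^4, and the two gradients that occur
  are taken at points 2 \<xi> |h| apart with \<xi> < 1.\<close>

lemma second_difference_bump:
 fixes x h :: "'a::euclidean_space"
 shows "\<bar>2 * bump ep x - bump ep (x + h) - bump ep (x - h)\<bar> \<le> 60 * ep ^ 4 * (norm h)^2"
proof -
 have Hb: "norm (Hbump ep z h) \<le> 30 * ep ^ 4 * norm h" for z h :: 'a
 proof -
  define m where "m = max 0 (1 * (ep^2 - z \<bullet> z))"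
  have m0: "0 \<le> m" and m1: "m \<le> ep^2" by (auto simp: m_def)
  have mz: "m * (norm z)^2 \<le> ep^2 * ep^2"
  proof (cases "m = 0")
   case False
   then have "(norm z)^2 \<le> ep^2" by (auto simp: m_def power2_norm_eq_inner max_def split: if_splits)
   then show ?thesis using m0 m1 by (intro mult_mono) auto
  qed simp
  have "norm (Hbump ep z h) \<le> norm ((24 * m) *R ((z \<bullet> h) *R z)) + norm ((6 * m^2) *R h)"
   unfolding Hbump_def m_def[symmetric] by (rule order_trans[OF norm_triangle_ineq4]) simp
  also have "\<dots> = 24 * m * (\<bar>z \<bullet> h\<bar> * norm z) + 6 * m^2 * norm h" using m0 by (simp add: abs_mult)
  also have "\<dots> \<le> 24 * m * ((norm z * norm h) * norm z) + 6 * m^2 * norm h"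
   using m0 by (intro add_mono mult_left_mono mult_right_mono Cauchy_Schwarz_ineq2) auto
  also have "\<dots> = (24 * (m * (norm z)^2) + 6 * (m * m)) * norm h" by (simp add: power2_eq_square algebra_simps)
  also have "\<dots> \<le> (24 * (ep^2 * ep^2) + 6 * (ep^2 * ep^2)) * norm h"
  proof -
   have "m * m \<le> ep^2 * ep^2" using m0 m1 by (intro mult_mono) auto
   then have "24 * (m * (norm z)^2) + 6 * (m * m) \<le> 24 * (ep^2 * ep^2) + 6 * (ep^2 * ep^2)"
    using mz by linarith
   then show ?thesis by (intro mult_right_mono) auto
  qed
  also have "\<dots> = 30 * ep ^ 4 * norm h" by (simp add: power_add[symmetric])
  finally show ?thesis .
 qed
 have Lip: "norm (dbump ep a - dbump ep b) \<le> 30 * ep ^ 4 * norm (a - b)" for a b :: 'a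
 proof (rule differentiable_bound[where S = UNIV and f' = "Hbump ep"])
  show "(dbump ep has_derivative Hbump ep z) (at z within UNIV)" for z :: 'a using bump_derivs(2)[of ep z] by simp
  show "onorm (Hbump ep z) \<le> 30 * ep ^ 4" for z :: 'a
   by (rule onorm_bound) (use Hb in auto)
 qed auto
 define g where "g t = bump ep (x + t *R h) + bump ep (x - t *R h)" for t
 have dg: "(g has_real_derivative (dbump ep (x + t *R h) - dbump ep (x - t *R h)) \<bullet> h) (at t)" for t
 proof -
  have "((\<lambda>t. x + t *R h) has_derivative (\<lambda>s. s *R h)) (at t)" "((\<lambda>t. x - t *R h) has_derivative (\<lambda>s. - (s *R h))) (at t)"
   by (auto intro!: derivative_eq_intros)
  from has_derivative_add[OF has_derivative_compose[OF this(1) bump_derivs(1)] has_derivative_compose[OF this(2) bump_derivs(1)]]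
  show ?thesis unfolding g_def[abs_def] has_field_derivative_def
   by (rule has_derivative_eq_rhs) (simp add: fun_eq_iff inner_diff_left algebra_simps)
 qed
 obtain \<xi> where xi: "0 < \<xi>" "\<xi> < 1" "g 1 - g 0 = (1 - 0) * ((dbump ep (x + \<xi> *R h) - dbump ep (x - \<xi> *R h)) \<bullet> h)"
  using MVT2[of 0 1 g, OF _ dg] by auto
 have "\<bar>g 1 - g 0\<bar> \<le> norm (dbump ep (x + \<xi> *R h) - dbump ep (x - \<xi> *R h)) * norm h"
  unfolding xi(3) by (simp add: Cauchy_Schwarz_ineq2)
 also have "\<dots> \<le> (30 * ep ^ 4 * norm ((x + \<xi> *R h) - (x - \<xi> *R h))) * norm h"
  by (intro mult_right_mono Lip) auto
 also have "(x + \<xi> *R h) - (x - \<xi> *R h) = (2 * \<xi>) *R h" by (simp add: scaleR_2[symmetric] flip: scaleR_scaleR)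
 also have "(30 * ep ^ 4 * norm ((2 * \<xi>) *R h)) * norm h = \<xi> * (60 * ep ^ 4 * (norm h)^2)"
  using xi by (simp add: power2_eq_square)
 also have "\<dots> \<le> 1 * (60 * ep ^ 4 * (norm h)^2)" using xi by (intro mult_right_mono) auto
 finally show ?thesis by (simp add: g_def abs_le_iff)
qed

text \<open>Semiconcavity makes \<open>s n\<close> nonnegative. Tested with a bump, the second
  difference moves onto the bump, where it is of order n^(-2); so the integral of \<open>s n\<close>
  is of order 1 / n and the infimum over n vanishes almost everywhere. The result expresses that the
  one-sided derivatives in direction e agree.\<close>

lemma AE_second_difference:
 fixes u :: "'a::euclidean_space => real"
 assumes u: "superclass La C u" and R: "R > 0" and e: "norm e = 1"
 shows "AE x in lborel. norm x < R --> (\<forall>\<eta>>0. \<exists>n>0. real n * (2 * u x - u (x + (1 / n) *R e) - u (x - (1 / n) *R e)) + C / n < \<eta>)"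
proof -
 define s where "s n x = real (Suc n) * (2 * u x - u (x + (1 / Suc n) *R e) - u (x - (1 / Suc n) *R e)) + C / Suc n" for n x
 have cu: "continuous_on UNIV u" by (rule superclass_continuous[OF u])
 have cs: "continuous_on UNIV (s n)" for n
  unfolding s_def[abs_def] by (intro continuous_intros cu continuous_on_compose2[OF cu]) auto
 have s0: "s n x \<ge> 0" for n x
 proof -
  have "u (x + (1 / Suc n) *R e) + u (x - (1 / Suc n) *R e) - 2 * u x \<le> C * (norm ((1 / Suc n) *R e))^2"
   by (rule semiconcave_second_difference[OF superclassD(4)[OF u]])
  then have "- (C * (1 / Suc n)^2) \<le> 2 * u x - u (x + (1 / Suc n) *R e) - u (x - (1 / Suc n) *R e)" using e by simp
  then have "real (Suc n) * (- (C * (1 / Suc n)^2)) \<le> real (Suc n) * (2 * u x - u (x + (1 / Suc n) *R e) - u (x - (1 / Suc n) *R e))"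
   by (intro mult_left_mono) auto
  moreover have "real (Suc n) * (- (C * (1 / Suc n)^2)) = - (C / Suc n)" by (simp add: power2_eq_square)
  ultimately show ?thesis by (simp add: s_def)
 qed
 have bint: "integrable lborel (\<lambda>x. f x * bump R (x + k))" if "continuous_on UNIV f" for f :: "'a => real" and k
 proof (rule integrable_continuous_compact_support[of _ "R + norm k"])
  show "continuous_on UNIV (\<lambda>x. f x * bump R (x + k))" by (intro continuous_intros that continuous_on_compose2[OF bump_cont(1)]) auto
  fix x :: 'a assume "R + norm k \<le> norm x"
  then have "R \<le> norm (x + k)" using norm_diff_ineq[of x k] by simp
  then show "f x * bump R (x + k) = 0" using bump_supp(1)[of R "x + k", OF _ R] by simp
 qed
 have shift: "(LBINT x. u (x + k) * bump R x) = (LBINT x. u x * bump R (x - k))" for k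
 proof -
  have c: "continuous_on UNIV (\<lambda>x. u x * bump R (x - k))" by (intro continuous_intros cu continuous_on_compose2[OF bump_cont(1)]) auto
  show ?thesis using lborel_integral_translate[OF borel_measurable_continuous_onI[OF c], of k] by simp
 qed
 define A where "A = (LBINT x. \<bar>u x\<bar> * indicator (ball 0 (R + 1)) x)"
 have iA: "integrable lborel (\<lambda>x. \<bar>u x\<bar> * indicator (ball 0 (R + 1)) x)"
  using integrable_continuous_bounded_set[of "\<lambda>x. \<bar>u x\<bar>" "ball 0 (R + 1)"] cu by (auto simp: mult.commute intro!: continuous_intros)
 define b where "b = (\<integral>x. bump R x \<partial>(lborel :: 'a measure))"
 have int_s: "(LBINT x. s n x * bump R x) \<le> (60 * R ^ 4 * A + C * b) / Suc n" for n
 proof -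
  define k where "k = (1 / Suc n) *R e"
  have nk: "norm k = 1 / Suc n" using e by (simp add: k_def)
  have i0: "integrable lborel (\<lambda>x. u x * bump R x)" using bint[OF cu, of 0] by simp
  have ip: "integrable lborel (\<lambda>x. u (x + k) * bump R x)" "integrable lborel (\<lambda>x. u (x - k) * bump R x)"
  proof -
   have "continuous_on UNIV (\<lambda>x. u (x + k))" "continuous_on UNIV (\<lambda>x. u (x - k))"
    by (intro continuous_on_compose2[OF cu] continuous_intros; simp)+
   from bint[OF this(1), of 0] bint[OF this(2), of 0]
   show "integrable lborel (\<lambda>x. u (x + k) * bump R x)" "integrable lborel (\<lambda>x. u (x - k) * bump R x)" by simp_all
  qed
  have iq: "integrable lborel (\<lambda>x. u x * bump R (x - k))" "integrable lborel (\<lambda>x. u x * bump R (x + k))"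
   using bint[OF cu, of "- k"] bint[OF cu, of k] by simp_all
  have ib: "integrable lborel (bump R :: 'a => real)" by (rule bump_integrable[OF R])
  have "(LBINT x. s n x * bump R x) = (LBINT x. Suc n * (2 * (u x * bump R x) - u (x + k) * bump R x - u (x - k) * bump R x) + C / Suc n * bump R x)"
   unfolding s_def k_def by (intro Bochner_Integration.integral_cong) (auto simp: algebra_simps)
  also have "\<dots> = Suc n * (2 * (LBINT x. u x * bump R x) - (LBINT x. u (x + k) * bump R x) - (LBINT x. u (x - k) * bump R x)) + C / Suc n * b"
   unfolding b_def using i0 ip ib by simp
  also have "(LBINT x. u (x - k) * bump R x) = (LBINT x. u x * bump R (x + k))" using shift[of "- k"] by simp
  also have "(LBINT x. u (x + k) * bump R x) = (LBINT x. u x * bump R (x - k))" by (rule shift)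
  also have "2 * (LBINT x. u x * bump R x) - (LBINT x. u x * bump R (x - k)) - (LBINT x. u x * bump R (x + k))
    = (LBINT x. u x * (2 * bump R x - bump R (x + k) - bump R (x - k)))"
   unfolding right_diff_distrib using i0 iq by (simp add: mult.left_commute[of _ 2])
  also have "\<dots> \<le> (LBINT x. (60 * R ^ 4 * (1 / Suc n)^2) * (\<bar>u x\<bar> * indicator (ball 0 (R + 1)) x))"
  proof (rule integral_mono)
   show "integrable lborel (\<lambda>x. u x * (2 * bump R x - bump R (x + k) - bump R (x - k)))"
    unfolding right_diff_distrib using i0 iq by (simp add: mult.left_commute[of _ 2])
   show "integrable lborel (\<lambda>x. (60 * R ^ 4 * (1 / Suc n)^2) * (\<bar>u x\<bar> * indicator (ball 0 (R + 1)) x))"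
    using iA by simp
   fix x :: 'a
   show "u x * (2 * bump R x - bump R (x + k) - bump R (x - k)) \<le> (60 * R ^ 4 * (1 / Suc n)^2) * (\<bar>u x\<bar> * indicator (ball 0 (R + 1)) x)"
   proof (cases "norm x < R + 1")
    case True
    have "u x * (2 * bump R x - bump R (x + k) - bump R (x - k)) \<le> \<bar>u x\<bar> * \<bar>2 * bump R x - bump R (x + k) - bump R (x - k)\<bar>"
     by (metis abs_ge_self abs_mult)
    also have "\<dots> \<le> \<bar>u x\<bar> * (60 * R ^ 4 * (norm k)^2)" by (intro mult_left_mono second_difference_bump) auto
    finally show ?thesis using True unfolding nk by (simp add: mult_ac)
   next
    case False
    have k1: "norm k \<le> 1" unfolding nk by simp
    then have "R \<le> norm x" "R \<le> norm (x + k)" "R \<le> norm (x - k)"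
     using False norm_diff_ineq[of x k] norm_triangle_ineq2[of x k] by auto
    then show ?thesis using False by (simp add: bump_supp(1)[OF _ R])
   qed
  qed
  also have "\<dots> = 60 * R ^ 4 * (1 / Suc n)^2 * A" by (simp add: A_def)
  finally have "(LBINT x. s n x * bump R x) \<le> Suc n * (60 * R ^ 4 * (1 / Suc n)^2 * A) + C / Suc n * b"
   by (simp add: mult_left_mono)
  also have "\<dots> = (60 * R ^ 4 * A + C * b) / Suc n" by (simp add: power2_eq_square add_divide_distrib)
  finally show ?thesis .
 qed
 \<comment> \<open>The infimum is measurable and bounded by each \<open>s n\<close>, so its integral
   is 0; convergence of \<open>s n\<close> plays no part in the argument.\<close>
 define F where "F x = (INF n. ennreal (s n x * bump R x))" for x
 have Fm: "F \<in> borel_measurable lborel"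
 proof -
  have [measurable]: "s n \<in> borel_measurable borel" "(bump R :: 'a => real) \<in> borel_measurable borel" for n
   using cs bump_cont(1)[of R] by (auto intro!: borel_measurable_continuous_onI)
  show ?thesis unfolding F_def[abs_def] by measurable
 qed
 have "(\<integral>\<^sup>+x. F x \<partial>lborel) \<le> ennreal ((60 * R ^ 4 * A + C * b) / Suc n)" for n
 proof -
  have "(\<integral>\<^sup>+x. F x \<partial>lborel) \<le> (\<integral>\<^sup>+x. ennreal (s n x * bump R x) \<partial>lborel)"
   unfolding F_def by (intro nn_integral_mono INF_lower) auto
  also have "\<dots> = ennreal (LBINT x. s n x * bump R x)"
   by (rule nn_integral_eq_integral) (use bint[OF cs, of n 0] in \<open>simp, intro AE_I2 mult_nonneg_nonneg s0 bump_nonneg\<close>)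
  also have "\<dots> \<le> ennreal ((60 * R ^ 4 * A + C * b) / Suc n)" by (intro ennreal_leI int_s)
  finally show ?thesis .
 qed
 moreover have "(\<lambda>n. ennreal ((60 * R ^ 4 * A + C * b) / Suc n)) \<longlonglongrightarrow> ennreal 0"
  by (intro tendsto_ennrealI tendsto_divide_0[OF tendsto_const] filterlim_at_top_imp_at_infinity filterlim_compose[OF filterlim_real_sequentially filterlim_Suc])
 ultimately have "(\<integral>\<^sup>+x. F x \<partial>lborel) \<le> 0" by (intro tendsto_lowerbound[where F = sequentially]) auto
 then have "AE x in lborel. F x = 0" using nn_integral_0_iff_AE[OF Fm] by simp
 then show ?thesis
 proof eventually_elim
  case (elim x)
  show ?case
  proof (intro impI allI)
   fix \<eta> :: real assume x: "norm x < R" and eta: "\<eta> > 0"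
   have bp: "bump R x > 0" by (rule bump_pos[OF x])
   have "F x < ennreal (\<eta> * bump R x)" using elim eta bp by simp
   then obtain n where "ennreal (s n x * bump R x) < ennreal (\<eta> * bump R x)" unfolding F_def INF_less_iff by auto
   then have "s n x * bump R x < \<eta> * bump R x" using mult_nonneg_nonneg[OF s0[of n x] bump_nonneg[of R x]] by (simp add: ennreal_less_iff)
   then have "s n x < \<eta>" using bp by simp
   then show "\<exists>n>0. real n * (2 * u x - u (x + (1 / n) *R e) - u (x - (1 / n) *R e)) + C / n < \<eta>"
    unfolding s_def by blast
  qed
 qed
qed

text \<open>Two supergradients bound 2 u x - u (x + h) - u (x - h) from below by (q - q') \<bullet>
  h - C |h|^2. With h = e / n the preceding lemma forces (q - q') \<bullet> e \<le> 0 for every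
  signed basis vector e.\<close>

lemma AE_unique_supergrad:
 fixes u :: "'a::euclidean_space => real"
 assumes u: "superclass La C u"
 shows "AE x in lborel. \<forall>q q'. supergrad C u x q --> supergrad C u x q' --> q = q'"
proof -
 have "AE x in lborel. \<forall>R. \<forall>e\<in>Basis. norm x < Suc R --> (\<forall>\<eta>>0. \<exists>n>0. real n * (2 * u x - u (x + (1 / n) *R e) - u (x - (1 / n) *R e)) + C / n < \<eta>)"
  unfolding AE_all_countable
 proof
  fix R :: nat
  show "AE x in lborel. \<forall>e\<in>Basis. norm x < Suc R --> (\<forall>\<eta>>0. \<exists>n>0. real n * (2 * u x - u (x + (1 / n) *R e) - u (x - (1 / n) *R e)) + C / n < \<eta>)"
   by (rule AE_finite_allI) (auto intro!: AE_second_difference[OF u])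
 qed
 then show ?thesis
 proof eventually_elim
  case (elim x)
  show ?case
  proof (intro allI impI)
   fix q q' assume q: "supergrad C u x q" "supergrad C u x q'"
   obtain R where R: "norm x < real (Suc R)" using reals_Archimedean2[of "norm x"] by (metis less_SucI of_nat_less_iff order_less_trans lessI)
   have *: "(q - q') \<bullet> e \<le> 0" if e: "e \<in> Basis \<or> - e \<in> Basis" and q: "supergrad C u x q" "supergrad C u x q'" for e q q'
   proof (rule field_le_epsilon)
    fix \<eta> :: real assume "\<eta> > 0"
    obtain b where b: "b \<in> Basis" "e = b \<or> e = - b" using e by (metis minus_minus)
    then obtain n where n: "n > 0" "real n * (2 * u x - u (x + (1 / n) *R b) - u (x - (1 / n) *R b)) + C / n < \<eta>"
     using elim R \<open>\<eta> > 0\<close> by blast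
    have ne: "norm e = 1" using b by auto
    have "real n * (2 * u x - u (x + (1 / n) *R e) - u (x - (1 / n) *R e)) + C / n < \<eta>"
     using n(2) b(2) by (auto simp: algebra_simps)
    moreover have "u (x - (1 / n) *R e) \<le> u x + q \<bullet> (- ((1 / n) *R e)) + C / 2 * (norm (- ((1 / n) *R e)))^2"
     using q(1)[unfolded supergrad_def, rule_format, of "- ((1 / n) *R e)"] by simp
    moreover have "u (x + (1 / n) *R e) \<le> u x + q' \<bullet> ((1 / n) *R e) + C / 2 * (norm ((1 / n) *R e))^2"
     using q(2)[unfolded supergrad_def, rule_format] by blast
    ultimately have A: "(1 / n) * ((q - q') \<bullet> e) - C * (1 / n)^2 \<le> 2 * u x - u (x + (1 / n) *R e) - u (x - (1 / n) *R e)"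
     using ne by (simp add: inner_diff_left diff_divide_distrib)
    have "(q - q') \<bullet> e - C / n = real n * ((1 / n) * ((q - q') \<bullet> e) - C * (1 / n)^2)"
     using n(1) by (simp add: power2_eq_square field_simps)
    also have "\<dots> \<le> real n * (2 * u x - u (x + (1 / n) *R e) - u (x - (1 / n) *R e))"
     by (intro mult_left_mono A) auto
    finally show "(q - q') \<bullet> e \<le> 0 + \<eta>"
     using \<open>real n * (2 * u x - u (x + (1 / n) *R e) - u (x - (1 / n) *R e)) + C / n < \<eta>\<close> by simp
   qed
   show "q = q'"
   proof (rule euclidean_eqI)
    fix b :: 'a assume "b \<in> Basis"
    then show "q \<bullet> b = q' \<bullet> b" using *[of b q q'] *[of b q' q] q by (simp add: inner_diff_left)
   qed
  qed
 qed
qed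

text \<open>Where the supergradient p is unique, supergradients at nearby points are close to p.
  Hence jets near x satisfy the inequality with slope p up to a small error, mollification at frozen
  p preserves this, and a second perturbation replaces p by the gradient of the
  mollification.\<close>

lemma mollified_mcurv_limsup:
 fixes u :: "'a::euclidean_space => real"
 assumes u: "superclass La C u" and uniq: "\<And>q q'. supergrad C u x q ==> supergrad C u x q' ==> q = q'"
  and eta: "\<eta> > 0"
 shows "\<forall>\<^sub>F n in sequentially. mcurv (dmoll (1 / Suc n) u x) (Hmoll (1 / Suc n) u x) \<le> \<eta>"
proof -
 note Lam = superclassD(1)[OF u] and C = superclassD(2)[OF u] and sc = superclassD(4)[OF u]
 have cu: "continuous_on UNIV u" by (rule superclass_continuous[OF u])
 have e0: "(\<lambda>n. La * (1 / real (Suc n))) \<longlonglongrightarrow> 0"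
  using tendsto_mult_right_zero[OF LIMSEQ_inverse_real_of_nat, of La] by (simp add: inverse_eq_divide)
 have pos: "1 / real (Suc n) > 0" for n by simp
 note sg = dmoll_supergrad[OF u pos] and nr = moll_near[OF u pos] and nl = dmoll_norm_le[OF u pos]
 obtain r p where p: "supergrad C u x p"
  by (rule supergrad_subsequence[where w = "\<lambda>n. moll (1 / Suc n) u" and y = "\<lambda>_. x" and q = "\<lambda>n. dmoll (1 / Suc n) u x" and u = u
     and e = "\<lambda>n. La * (1 / real (Suc n))" and x = x and C = C and La = La, OF sg nr e0 tendsto_const nl cu])
 have up: "q = p" if "supergrad C u x q" for q using uniq that p by blast
 have conv: "(\<lambda>n. dmoll (1 / Suc n) u x) \<longlonglongrightarrow> p"
  by (rule unique_supergrad_convergence[where w = "\<lambda>n. moll (1 / Suc n) u" and y = "\<lambda>_. x", OF up sg nr e0 tendsto_const nl cu])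
 \<comment> \<open>A sequence of counterexamples would consist of bounded supergradients at points
   tending to x, and these converge to the unique p.\<close>
 have near: "\<exists>de>0. \<forall>y q. norm (y - x) < de --> supergrad C u y q --> norm (q - p) < \<omega>" if om: "\<omega> > 0" for \<omega>
 proof (rule ccontr)
  assume neg: "\<not> ?thesis"
  have "\<exists>y q. norm (y - x) < 1 / real (Suc n) \<and> supergrad C u y q \<and> norm (q - p) \<ge> \<omega>" for n
   using neg pos[of n] by (meson not_less)
  then obtain y q where yq: "\<And>n. norm (y n - x) < 1 / real (Suc n)" "\<And>n. supergrad C u (y n) (q n)" "\<And>n. norm (q n - p) \<ge> \<omega>"
   by metis
  have "(\<lambda>n. norm (y n - x)) \<longlonglongrightarrow> 0"
   by (rule tendsto_sandwich[OF _ _ tendsto_const LIMSEQ_inverse_real_of_nat])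
    (use yq(1) in \<open>auto simp: inverse_eq_divide intro!: always_eventually less_imp_le\<close>)
  then have y: "y \<longlonglongrightarrow> x" by (simp add: tendsto_norm_zero_iff LIM_zero_iff)
  have "q \<longlonglongrightarrow> p"
   by (rule unique_supergrad_convergence[where w = "\<lambda>_. u" and y = y and e = "\<lambda>_. 0", OF up yq(2) _ tendsto_const y
      supergrad_norm_le[OF superclassD(3)[OF u] yq(2)] cu]) auto
  then have "\<forall>\<^sub>F n in sequentially. dist (q n) p < \<omega>" using om by (auto simp: tendsto_iff)
  then show False using yq(3) by (auto simp: eventually_sequentially dist_norm not_less[symmetric])
 qed
 define N :: real where "N = DIM('a) + 1"
 \<comment> \<open>Each of the two perturbations then costs at most \<eta> / 2.\<close>
 define ka where "ka = min 1 (\<eta> / (2 * (C * N + 1)))"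
 have N: "N > 0" by (simp add: N_def)
 have k: "0 < ka" "ka \<le> 1" using eta C N by (auto simp: ka_def add_nonneg_pos)
 have kC: "C * ka * N \<le> \<eta> / 2"
 proof -
  have pos: "2 * (C * N + 1) > 0" using C N by (simp add: add_nonneg_pos)
  have "ka \<le> \<eta> / (2 * (C * N + 1))" by (simp add: ka_def)
  then have "ka * (2 * (C * N + 1)) \<le> \<eta>" using pos by (simp add: pos_le_divide_eq)
  then have "2 * (C * ka * N) + 2 * ka \<le> \<eta>" by (simp add: algebra_simps)
  then show ?thesis using k by simp
 qed
 define \<omega> where "\<omega> = ka / (2 * (1 + La^2))"
 have om: "\<omega> > 0" using k by (simp add: \<omega>_def add_pos_nonneg)
 have pert: "2 * (1 + La^2) * norm (a - b) \<le> ka" if "norm (a - b) < \<omega>" for a b :: 'a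
 proof -
  have "0 < 2 * (1 + La^2)" by (simp add: add_pos_nonneg)
  then have "2 * (1 + La^2) * norm (a - b) \<le> 2 * (1 + La^2) * \<omega>" using that by (intro mult_left_mono) auto
  also have "\<dots> = ka" using \<open>0 < 2 * (1 + La^2)\<close> by (simp add: \<omega>_def)
  finally show ?thesis .
 qed
 obtain de where d: "de > 0" "\<And>y q. norm (y - x) < de ==> supergrad C u y q ==> norm (q - p) < \<omega>"
  using near[OF om] by blast
 have "\<forall>\<^sub>F n in sequentially. dist (dmoll (1 / Suc n) u x) p < \<omega>" using conv om by (auto simp: tendsto_iff)
 moreover have "\<forall>\<^sub>F n in sequentially. inverse (real (Suc n)) < de / 2"
  using order_tendstoD(2)[OF LIMSEQ_inverse_real_of_nat, of "de / 2"] d(1) by simp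
 ultimately show ?thesis
 proof eventually_elim
  case (elim n)
  define ep where "ep = 1 / real (Suc n)"
  have eps: "ep > 0" "2 * ep < de" using elim(2) by (auto simp: ep_def inverse_eq_divide)
  have "mcurv p (Hmoll ep u x) \<le> C * ka * N"
  proof (rule mcurv_Hmoll_le[OF u eps(1)])
   fix y q B assume y: "y \<in> ball x (2 * ep)" and j: "subjet u y q B"
   have q: "supergrad C u y q" by (rule subjet_imp_supergrad[OF sc j])
   have "norm (y - x) < de" using y eps by (simp add: dist_norm norm_minus_commute)
   from d(2)[OF this q] have qp: "2 * (1 + La^2) * norm (q - p) \<le> ka" by (rule pert)
   have "selfadjoint B" using j by (simp add: subjet_def)
   from mcurv_perturb[OF this subjet_hessian_le[OF sc j] C supergrad_norm_le[OF superclassD(3)[OF u] q] qp k(2) superclassD(5)[OF u j] order_refl]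
   show "mcurv p B \<le> C * ka * N" by (simp add: N_def add.commute)
  qed (use C k N in auto)
  moreover have "0 \<le> C * ka * N" using C k N by simp
  moreover have "2 * (1 + La^2) * norm (p - dmoll ep u x) \<le> ka"
   using elim(1) by (intro pert) (simp add: dist_norm norm_minus_commute ep_def)
  ultimately have "mcurv (dmoll ep u x) (Hmoll ep u x) \<le> C * ka * N + C * ka * (DIM('a) + 1)"
   by (intro mcurv_perturb[OF moll_derivs(3)[OF u eps(1)] Hmoll_le[OF u eps(1)] C supergrad_norm_le[OF superclassD(3)[OF u] p] _ k(2)])
  also have "\<dots> \<le> \<eta>" using kC by (simp add: N_def add.commute)
  finally show ?case by (simp add: ep_def)
 qed
qed

text \<open>The amount by which the mollification fails to be a supersolution; it becomes the error
  density \<open>e\<close> of \<open>supersol_approx\<close>.\<close>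

definition excess :: "real => ('a::euclidean_space => real) => 'a => real" where
 "excess ep u x = max 0 (mcurv (dmoll ep u x) (Hmoll ep u x))"

lemma continuous_excess:
 assumes u: "superclass La C u" and eps: "ep > 0"
 shows "continuous_on UNIV (excess ep u)"
proof -
 have n: "1 + p \<bullet> p \<noteq> 0" for p :: 'a using one_plus_inner_pos(1)[of p] by simp
 have rep: "Hmoll ep u x h = (\<Sum>j\<in>Basis. (h \<bullet> j) *R Hmoll ep u x j)" for x h
 proof -
  have lin: "linear (Hmoll ep u x)" by (rule selfadjointD(1)[OF moll_derivs(3)[OF u eps]])
  show ?thesis by (subst euclidean_representation[symmetric, of h]) (simp add: linear_sum[OF lin] linear_scale[OF lin])
 qed
 have "continuous_on UNIV (\<lambda>x. Hmoll ep u x (dmoll ep u x))"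
  by (subst rep) (intro continuous_intros moll_derivs(5,6)[OF u eps])
 then show ?thesis
  unfolding excess_def[abs_def] mcurv_def trace_map_def
  by (intro continuous_intros moll_derivs(5,6)[OF u eps]) (auto simp: n)
qed

text \<open>Dominated convergence: semiconcavity bounds the excess by C times the dimension, and it
  tends to 0 wherever the supergradient is unique.\<close>

lemma excess_integral_tendsto:
 fixes u :: "'a::euclidean_space => real"
 assumes u: "superclass La C u"
 shows "(\<lambda>n. (LBINT x. indicator (ball 0 r) x * excess (1 / Suc n) u x)) \<longlonglongrightarrow> 0"
proof -
 have "(\<lambda>n. (LBINT x. indicator (ball 0 r) x * excess (1 / Suc n) u x)) \<longlonglongrightarrow> (\<integral>x. 0 \<partial>(lborel :: 'a measure))"
 proof (rule integral_dominated_convergence[where w = "\<lambda>x. C * DIM('a) * indicator (ball 0 r) x"])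
  have m: "excess (1 / Suc n) u \<in> borel_measurable borel" for n
   by (intro borel_measurable_continuous_onI continuous_excess[OF u]) auto
  show "(\<lambda>x. indicator (ball 0 r) x * excess (1 / Suc n) u x) \<in> borel_measurable lborel" for n
   using borel_measurable_times[OF borel_measurable_indicator m[of n], of "ball 0 r"] by simp
  show "integrable lborel (\<lambda>x::'a. C * DIM('a) * indicator (ball 0 r) x)" by (intro integrable_mult_right integrable_indicator_ball)
  show "AE x in lborel. norm (indicator (ball 0 r) x * excess (1 / Suc n) u x) \<le> C * DIM('a) * indicator (ball 0 r) x" for n
  proof (intro AE_I2)
   fix x :: 'a
   have "mcurv (dmoll (1 / Suc n) u x) (Hmoll (1 / Suc n) u x) \<le> C * DIM('a)"
    by (rule mcurv_le_bound[OF moll_derivs(3)[OF u] Hmoll_le[OF u] superclassD(2)[OF u]]) auto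
   then show "norm (indicator (ball 0 r) x * excess (1 / Suc n) u x) \<le> C * DIM('a) * indicator (ball 0 r) x"
    using superclassD(2)[OF u] by (auto simp: indicator_def excess_def)
  qed
  show "AE x in lborel. (\<lambda>n. indicator (ball 0 r) x * excess (1 / Suc n) u x) \<longlonglongrightarrow> 0"
   using AE_unique_supergrad[OF u]
  proof eventually_elim
   case (elim x)
   have "(\<lambda>n. excess (1 / Suc n) u x) \<longlonglongrightarrow> 0"
   proof (rule order_tendstoI)
    fix a :: real assume "a < 0"
    then show "\<forall>\<^sub>F n in sequentially. a < excess (1 / Suc n) u x" by (auto simp: excess_def less_max_iff_disj)
   next
    fix a :: real assume a: "0 < a"
    have "\<forall>\<^sub>F n in sequentially. mcurv (dmoll (1 / Suc n) u x) (Hmoll (1 / Suc n) u x) \<le> a / 2"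
     by (rule mollified_mcurv_limsup[OF u]) (use elim a in auto)
    then show "\<forall>\<^sub>F n in sequentially. excess (1 / Suc n) u x < a"
     by eventually_elim (use a in \<open>auto simp: excess_def\<close>)
   qed
   then show ?case using tendsto_mult_right_zero by blast
  qed
 qed simp
 then show ?thesis by simp
qed

section \<open>Divergence of the flux, and sums of supersolutions\<close>

definition dslope :: "'a::euclidean_space => 'a => 'a" where
 "dslope p h = (1 / sqrt (1 + p \<bullet> p)) *R h - ((p \<bullet> h) / (sqrt (1 + p \<bullet> p)) ^ 3) *R p"

lemma unit_slope_derivative: "(unit_slope has_derivative dslope p) (at p)"
proof -
 define W where "W p = sqrt (1 + p \<bullet> p)" for p :: 'a
 have W: "W p > 0" for p using sqrt_one_plus_inner(1)[of p] unfolding W_def by linarith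
 have s: "0 < 1 + p \<bullet> p" by (rule one_plus_inner_pos)
 have "((\<lambda>p. 1 + p \<bullet> p) has_derivative (\<lambda>h. 2 * (p \<bullet> h))) (at p)"
  by (auto intro!: derivative_eq_intros simp: inner_commute)
 from has_derivative_compose[OF this DERIV_real_sqrt[OF s, unfolded has_field_derivative_def]]
 have dW: "(W has_derivative (\<lambda>h. (p \<bullet> h) / W p)) (at p)"
  unfolding W_def[abs_def] by (rule has_derivative_eq_rhs) (simp add: fun_eq_iff W_def inverse_eq_divide)
 have "((\<lambda>s. inverse s) has_real_derivative - (inverse (W p) ^ Suc (Suc 0))) (at (W p))"
  by (rule DERIV_inverse) (use W[of p] in simp)
 from has_derivative_scaleR[OF has_derivative_compose[OF dW this[unfolded has_field_derivative_def]] has_derivative_ident]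
 have "((\<lambda>p. inverse (W p) *R p) has_derivative dslope p) (at p)"
  by (rule has_derivative_eq_rhs) (simp add: fun_eq_iff dslope_def W_def[symmetric] divide_inverse power3_eq_cube)
 moreover have "unit_slope = (\<lambda>p. inverse (W p) *R p)" by (simp add: fun_eq_iff unit_slope_def W_def divide_inverse)
 ultimately show ?thesis by simp
qed

text \<open>\<open>dslope p\<close> is 1 / W times the inverse of the first fundamental form, so its
  trace against \<open>B\<close> is \<open>mcurv p B\<close> divided by W.\<close>

lemma trace_dslope:
 assumes B: "linear B"
 shows "(\<Sum>i\<in>Basis. dslope p (B i) \<bullet> i) = mcurv p B / sqrt (1 + p \<bullet> p)"
proof -
 define W where "W = sqrt (1 + p \<bullet> p)"
 have W: "W > 0" "W * W = 1 + p \<bullet> p" using sqrt_one_plus_inner[of p] unfolding W_def by linarith+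
 have "(\<Sum>i\<in>Basis. (p \<bullet> B i) * (p \<bullet> i)) = p \<bullet> B (\<Sum>i\<in>Basis. (p \<bullet> i) *R i)"
  by (simp add: linear_sum[OF B] linear_scale[OF B] inner_sum_right mult.commute)
 also have "\<dots> = p \<bullet> B p" by (simp add: euclidean_representation)
 finally have pB: "(\<Sum>i\<in>Basis. (p \<bullet> B i) * (p \<bullet> i)) = p \<bullet> B p" .
 have "(\<Sum>i\<in>Basis. dslope p (B i) \<bullet> i) = (\<Sum>i\<in>Basis. (1 / W) * (B i \<bullet> i) - (1 / W ^ 3) * ((p \<bullet> B i) * (p \<bullet> i)))"
  by (simp add: dslope_def W_def inner_diff_left)
 also have "\<dots> = (1 / W) * trace_map B - (1 / W ^ 3) * (p \<bullet> B p)"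
  unfolding sum_subtractf sum_distrib_left[symmetric] pB trace_map_def ..
 also have "\<dots> = mcurv p B / W"
 proof -
  have "1 / W ^ 3 = 1 / (W * W) / W" by (simp add: power3_eq_cube)
  then show ?thesis unfolding mcurv_def W(2)[symmetric] by (simp add: diff_divide_distrib)
 qed
 finally show ?thesis by (simp add: W_def)
qed

text \<open>The field \<beta> is the sum of the two fluxes. Since \<open>unit_slope\<close> is odd,
  it equals \<open>unit_slope\<close> p - \<open>unit_slope\<close> (- q) for the gradients p and q,
  hence is bounded by p + q and coercive against it although the equation is nonlinear. The
  Lipschitz bound \<open>La\<close> on the gradients determines the coercivity constant.\<close>

lemma supersol_approx_superclass_sum:
 fixes u1 u2 :: "'a::euclidean_space => real"
 assumes u1: "superclass La C1 u1" and u2: "superclass La C2 u2"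
 shows "supersol_approx (1 / (1 + La^2)^2) (\<lambda>x. u1 x + u2 x)"
 unfolding supersol_approx_def
proof (intro allI impI)
 fix r ep :: real assume r: "r > 0" and eps: "ep > 0"
 have "(\<lambda>n. (LBINT x. indicator (ball 0 r) x * excess (1 / Suc n) u1 x) + (LBINT x. indicator (ball 0 r) x * excess (1 / Suc n) u2 x)) \<longlonglongrightarrow> 0 + 0"
  by (intro tendsto_add excess_integral_tendsto[OF u1] excess_integral_tendsto[OF u2])
 then have "\<forall>\<^sub>F n in sequentially. (LBINT x. indicator (ball 0 r) x * excess (1 / Suc n) u1 x) + (LBINT x. indicator (ball 0 r) x * excess (1 / Suc n) u2 x) < ep"
  using eps order_tendstoD(2) by fastforce
 moreover have "(\<lambda>n. 2 * La * inverse (real (Suc n))) \<longlonglongrightarrow> 0"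
  by (rule tendsto_mult_right_zero[OF LIMSEQ_inverse_real_of_nat])
 then have "\<forall>\<^sub>F n in sequentially. 2 * La * inverse (real (Suc n)) < ep" using order_tendstoD(2) eps by fastforce
 ultimately have "\<forall>\<^sub>F n in sequentially. (LBINT x. indicator (ball 0 r) x * excess (1 / Suc n) u1 x) + (LBINT x. indicator (ball 0 r) x * excess (1 / Suc n) u2 x) < ep
   \<and> 2 * La * inverse (real (Suc n)) < ep" by (rule eventually_conj)
 then obtain n where n: "(LBINT x. indicator (ball 0 r) x * excess (1 / Suc n) u1 x) + (LBINT x. indicator (ball 0 r) x * excess (1 / Suc n) u2 x) < ep"
   "2 * La * inverse (real (Suc n)) < ep"
  using eventually_happens'[OF sequentially_bot] by blast
 define h where "h = 1 / real (Suc n)"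
 have h: "h > 0" by (simp add: h_def)
 note D1 = moll_derivs[OF u1 h] and D2 = moll_derivs[OF u2 h]
 define g where "g x = dmoll h u1 x + dmoll h u2 x" for x
 define \<beta> where "\<beta> x = unit_slope (dmoll h u1 x) + unit_slope (dmoll h u2 x)" for x
 define \<beta>' where "\<beta>' x k = dslope (dmoll h u1 x) (Hmoll h u1 x k) + dslope (dmoll h u2 x) (Hmoll h u2 x k)" for x k
 define e where "e x = excess h u1 x + excess h u2 x" for x
 have neg: "unit_slope (- p) = - unit_slope p" for p :: 'a by (simp add: unit_slope_def)
 have cd: "continuous_on UNIV (\<lambda>x. dslope (dmoll h u x) (Hmoll h u x i))" if "superclass La C u" for u C i
  unfolding dslope_def
  by (intro continuous_intros moll_derivs(5,6)[OF that h]) (metis less_irrefl one_plus_inner_pos(1) real_sqrt_gt_zero power_not_zero)+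
 have ce: "continuous_on UNIV e"
  unfolding e_def by (intro continuous_intros continuous_excess[OF u1 h] continuous_excess[OF u2 h])
 show "\<exists>w g \<beta> \<beta>' e. (\<forall>x. (w has_derivative (\<lambda>h. g x \<bullet> h)) (at x)) \<and> continuous_on UNIV g \<and>
  (\<forall>x. (\<beta> has_derivative \<beta>' x) (at x)) \<and> (\<forall>i\<in>Basis. continuous_on UNIV (\<lambda>x. \<beta>' x i)) \<and>
  (\<forall>x. norm (\<beta> x) \<le> norm (g x)) \<and> (\<forall>x. 1 / (1 + La^2)^2 * (norm (g x))^2 \<le> \<beta> x \<bullet> g x) \<and>
  (\<forall>x. (\<Sum>i\<in>Basis. \<beta>' x i \<bullet> i) \<le> e x) \<and> continuous_on UNIV e \<and> (\<forall>x. 0 \<le> e x) \<and>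
  (\<forall>x. \<bar>w x - (u1 x + u2 x)\<bar> \<le> ep) \<and> (LBINT x. indicator (ball 0 r) x * e x) \<le> ep"
 proof (intro exI conjI allI ballI)
  fix x
  show "((\<lambda>x. moll h u1 x + moll h u2 x) has_derivative (\<lambda>h. g x \<bullet> h)) (at x)"
   by (rule has_derivative_eq_rhs[OF has_derivative_add[OF D1(1) D2(1)]]) (simp add: g_def inner_add_left)
  show "(\<beta> has_derivative \<beta>' x) (at x)"
   unfolding \<beta>_def[abs_def] \<beta>'_def
   by (intro has_derivative_add has_derivative_compose[OF D1(2) unit_slope_derivative] has_derivative_compose[OF D2(2) unit_slope_derivative])
  show "norm (\<beta> x) \<le> norm (g x)"
   using unit_slope_dist(1)[of "dmoll h u1 x" "- dmoll h u2 x"] by (simp add: \<beta>_def g_def neg)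
  show "1 / (1 + La^2)^2 * (norm (g x))^2 \<le> \<beta> x \<bullet> g x"
   using unit_slope_dist(2)[of "dmoll h u1 x" La "- dmoll h u2 x"] dmoll_norm_le[OF u1 h, of x] dmoll_norm_le[OF u2 h, of x]
   by (simp add: \<beta>_def g_def neg)
  have H: "mcurv (dmoll h u x) (Hmoll h u x) / sqrt (1 + dmoll h u x \<bullet> dmoll h u x) \<le> excess h u x" for u
  proof -
   define W where "W = sqrt (1 + dmoll h u x \<bullet> dmoll h u x)"
   have W: "W \<ge> 1" unfolding W_def by (rule sqrt_one_plus_inner)
   have "mcurv (dmoll h u x) (Hmoll h u x) / W \<le> excess h u x / W"
    unfolding excess_def using W by (intro divide_right_mono) auto
   also have "\<dots> \<le> excess h u x / 1" using W by (intro divide_left_mono) (auto simp: excess_def)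
   finally show ?thesis by (simp add: W_def)
  qed
  show "(\<Sum>i\<in>Basis. \<beta>' x i \<bullet> i) \<le> e x"
   unfolding \<beta>'_def inner_add_left sum.distrib trace_dslope[OF selfadjointD(1)[OF D1(3)]] trace_dslope[OF selfadjointD(1)[OF D2(3)]] e_def
   by (intro add_mono H)
  show "0 \<le> e x" by (simp add: e_def excess_def)
  show "\<bar>(moll h u1 x + moll h u2 x) - (u1 x + u2 x)\<bar> \<le> ep"
   using moll_near[OF u1 h, of x] moll_near[OF u2 h, of x] n(2) by (simp add: h_def inverse_eq_divide abs_le_iff)
 next
  show "continuous_on UNIV g" unfolding g_def by (intro continuous_intros D1 D2)
  show "continuous_on UNIV (\<lambda>x. \<beta>' x i)" for i
   unfolding \<beta>'_def by (intro continuous_intros cd[OF u1] cd[OF u2])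
  show "continuous_on UNIV e" by (rule ce)
  have i: "integrable lborel (\<lambda>x. indicator (ball 0 r) x * excess h u x)" if "superclass La C u" for u :: "'a => real" and C
   by (intro integrable_continuous_bounded_set continuous_excess[OF that h]) auto
  show "(LBINT x. indicator (ball 0 r) x * e x) \<le> ep"
   using n(1) i[OF u1] i[OF u2] by (simp add: e_def distrib_left h_def)
 qed
qed

theorem superclass_sum_measure:
 fixes u1 u2 :: "'a::euclidean_space => real"
 assumes u1: "superclass La C1 u1" and u2: "superclass La C2 u2" and pos: "\<And>x. 0 \<le> u1 x + u2 x"
  and inf0: "\<And>m. m > 0 ==> \<exists>x. u1 x + u2 x < m" and eta: "\<eta> > 0" and theta: "\<theta> > 0"
 obtains r0 where "r0 > 0"
  "\<And>r. r \<ge> r0 ==> measure lborel {x \<in> ball 0 r. u1 x + u2 x > \<eta>} < \<theta> * measure lborel (ball (0::'a) r)"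
proof -
 have "1 + La^2 > 0" by (simp add: add_pos_nonneg)
 then have c: "1 / (1 + La^2)^2 > 0" by simp
 have "continuous_on UNIV (\<lambda>x. u1 x + u2 x)"
  by (intro continuous_intros superclass_continuous[OF u1] superclass_continuous[OF u2])
 from weak_harnack[OF supersol_approx_superclass_sum[OF u1 u2] c this pos inf0 eta theta] that show ?thesis by blast
qed

section \<open>Principal curvatures of graphs\<close>

lemma tilt_ge: "(norm z)^2 \<le> z \<bullet> tilt p z"
 using tilt_simps(3)[of p z] by (simp add: inner_commute power2_norm_eq_inner)

lemma tilt_sym: "x \<bullet> tilt p y = y \<bullet> tilt p x"
 using tilt_simps(2)[of p x y] by (simp add: inner_commute)

lemma tilt_linear_simps [simp]:
 "tilt p (x + y) = tilt p x + tilt p y" "tilt p (x - y) = tilt p x - tilt p y" "tilt p (c *R x) = c *R tilt p x"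
 "tilt p (- x) = - tilt p x" "tilt p 0 = 0"
 using tilt_simps(1)[of p] by (auto simp: linear_add linear_diff linear_scale linear_neg linear_0)

text \<open>Induction on the dimension of V: e maximises the form of \<open>B\<close> on the unit
  sphere of the form \<open>tilt p\<close> in V. Being critical, e satisfies e \<bullet> B v = lam
  (e \<bullet> \<open>tilt p\<close> v) on V, so the \<open>tilt p\<close>-orthogonal complement of
  e is orthogonal to it for \<open>B\<close> as well.\<close>

lemma simultaneous_diagonalization:
 fixes B :: "'a::euclidean_space => 'a"
 assumes B: "selfadjoint B" and V: "subspace V"
 shows "\<exists>E. finite E \<and> E \<subseteq> V \<and> span E = V \<and> (\<forall>e\<in>E. e \<bullet> tilt p e = 1) \<and>
  (\<forall>e\<in>E. \<forall>e'\<in>E. e \<noteq> e' --> e \<bullet> tilt p e' = 0 \<and> e \<bullet> B e' = 0)"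
 using V
proof (induction "dim V" arbitrary: V rule: less_induct)
 case less
 have linB: "linear B" by (rule selfadjointD(1)[OF B])
 have symB: "x \<bullet> B y = y \<bullet> B x" for x y using selfadjointD(2)[OF B, of x y] by (simp add: inner_commute)
 show ?case
 proof (cases "V \<subseteq> {0}")
  case True
  then have "V = {0}" using less(2) subspace_0 by auto
  then show ?thesis by (intro exI[of _ "{}"]) auto
 next
  case False
  then obtain v0 where v0: "v0 \<in> V" "v0 \<noteq> 0" by auto
  define K where "K = {x \<in> V. x \<bullet> tilt p x = 1}"
  have q0: "x \<bullet> tilt p x > 0" if "x \<noteq> 0" for x using tilt_ge[of x p] that by (smt (verit) zero_less_power2 norm_eq_zero)
  have "closed K"
  proof -
   have "K = V \<inter> {x. x \<bullet> tilt p x = 1}" by (auto simp: K_def)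
   moreover have "closed V" using less(2) by (rule closed_subspace)
   moreover have "closed {x::'a. x \<bullet> tilt p x = 1}" by (intro closed_Collect_eq continuous_intros)
   ultimately show ?thesis by (simp add: closed_Int)
  qed
  moreover have "bounded K"
  proof (rule boundedI)
   fix x assume "x \<in> K"
   then have "(norm x)^2 \<le> 1^2" using tilt_ge[of x p] by (simp add: K_def)
   then show "norm x \<le> 1" by (rule power2_le_imp_le) simp
  qed
  ultimately have cK: "compact K" by (simp add: compact_eq_bounded_closed)
  have neK: "(1 / sqrt (v0 \<bullet> tilt p v0)) *R v0 \<in> K"
   using v0 q0[OF v0(2)] less(2) by (auto simp: K_def subspace_scale)
  have "continuous_on K (\<lambda>x. x \<bullet> B x)"
   by (intro continuous_intros linear_continuous_on linear_conv_bounded_linear[THEN iffD1] linB)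
  then obtain e where e: "e \<in> K" "\<And>x. x \<in> K ==> x \<bullet> B x \<le> e \<bullet> B e"
   using continuous_attains_sup[OF cK, of "\<lambda>x. x \<bullet> B x"] neK by blast
  define lam where "lam = e \<bullet> B e"
  have eV: "e \<in> V" and e1: "e \<bullet> tilt p e = 1" using e(1) by (auto simp: K_def)
  have max: "x \<bullet> B x \<le> lam * (x \<bullet> tilt p x)" if "x \<in> V" for x
  proof (cases "x = 0")
   case False
   define s where "s = x \<bullet> tilt p x"
   have s: "s > 0" unfolding s_def by (rule q0[OF False])
   have "(1 / sqrt s) *R x \<in> K" using that s less(2) by (auto simp: K_def subspace_scale s_def[symmetric])
   from e(2)[OF this] have "(x \<bullet> B x) / s \<le> lam" using s by (simp add: linear_scale[OF linB] lam_def)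
   then show ?thesis using s by (simp add: pos_divide_le_eq s_def)
  qed (simp add: linear_0[OF linB])
  \<comment> \<open>The form lam \<open>tilt p\<close> - \<open>B\<close> is nonnegative on V and
    vanishes at e, so its discriminant inequality makes the polar form with e vanish.\<close>
  have crit: "e \<bullet> B v = lam * (e \<bullet> tilt p v)" if v: "v \<in> V" for v
  proof -
   have "(lam * (e \<bullet> tilt p v) - e \<bullet> B v)^2 \<le> (lam * (e \<bullet> tilt p e) - e \<bullet> B e) * (lam * (v \<bullet> tilt p v) - v \<bullet> B v)"
   proof (rule quadratic_nonneg_discriminant)
    fix t
    have "e + t *R v \<in> V" using eV v less(2) by (simp add: subspace_add subspace_scale)
    from max[OF this]
    show "0 \<le> (lam * (e \<bullet> tilt p e) - e \<bullet> B e) + 2 * (lam * (e \<bullet> tilt p v) - e \<bullet> B v) * t + (lam * (v \<bullet> tilt p v) - v \<bullet> B v) * t^2"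
     by (simp add: linear_add[OF linB] linear_scale[OF linB] inner_add_left inner_add_right symB[of v e] tilt_sym[of v p e]
       power2_eq_square algebra_simps)
   qed
   then show ?thesis using e1 by (simp add: lam_def)
  qed
  define V' where "V' = {v \<in> V. e \<bullet> tilt p v = 0}"
  have sub': "subspace V'" using less(2) by (auto simp: V'_def subspace_def inner_add_right)
  have "e \<notin> V'" "V' \<subseteq> V" using e1 by (auto simp: V'_def)
  then have "V' \<subset> V" using eV by blast
  then have "dim V' < dim V" using sub' less(2) by (intro dim_psubset) (simp add: span_eq_iff[THEN iffD2])
  from less(1)[OF this sub'] obtain E where E: "finite E" "E \<subseteq> V'" "span E = V'" "\<forall>e\<in>E. e \<bullet> tilt p e = 1"
   "\<forall>e\<in>E. \<forall>e'\<in>E. e \<noteq> e' --> e \<bullet> tilt p e' = 0 \<and> e \<bullet> B e' = 0" by blast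
  have eE: "e \<bullet> tilt p e' = 0 \<and> e \<bullet> B e' = 0" if "e' \<in> E" for e'
  proof -
   have "e' \<in> V'" using E(2) that by auto
   then show ?thesis using crit[of e'] by (auto simp: V'_def)
  qed
  have "span (insert e E) = V"
  proof (rule antisym)
   show "span (insert e E) \<subseteq> V" using E(2) eV less(2) by (intro span_minimal) (auto simp: V'_def)
   show "V \<subseteq> span (insert e E)"
   proof
    fix v assume v: "v \<in> V"
    have "v - (e \<bullet> tilt p v) *R e \<in> V'" using v eV less(2) e1
     by (auto simp: V'_def subspace_diff subspace_scale inner_diff_right)
    then show "v \<in> span (insert e E)" unfolding E(3)[symmetric] span_insert by blast
   qed
  qed
  moreover have "e' \<bullet> tilt p e = 0 \<and> e' \<bullet> B e = 0" if "e' \<in> E" for e'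
   using eE[OF that] symB[of e' e] tilt_sym[of e' p e] by simp
  moreover have "insert e E \<subseteq> V" using E(2) eV by (auto simp: V'_def)
  ultimately show ?thesis
   using E(1,4,5) e1 eE by (intro exI[of _ "insert e E"]) auto
 qed
qed

text \<open>A frame orthonormal for the first fundamental form in which \<open>B\<close> is
  diagonal; the numbers \<open>l\<close> are the principal curvatures times sqrt (1 + p \<bullet>
  p).\<close>

definition diag_frame :: "real^'n => (real^'n => real^'n) => ('n => real^'n) => ('n => real) => bool" where
 "diag_frame p B e l \<longleftrightarrow> (\<forall>i j. e i \<bullet> tilt p (e j) = (if i = j then 1 else 0)) \<and>
  (\<forall>i j. e i \<bullet> B (e j) = (if i = j then l i else 0))"

lemma diag_frame_exists:
 fixes B :: "real^'n => real^'n"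
 assumes B: "selfadjoint B"
 obtains e l where "diag_frame p B e l"
proof -
 obtain E where E: "finite E" "span E = (UNIV :: (real^'n) set)" "\<forall>e\<in>E. e \<bullet> tilt p e = 1"
  "\<forall>e\<in>E. \<forall>e'\<in>E. e \<noteq> e' --> e \<bullet> tilt p e' = 0 \<and> e \<bullet> B e' = 0"
  using simultaneous_diagonalization[OF B subspace_UNIV, of p] by blast
 have "independent E"
  unfolding independent_explicit
 proof (intro conjI allI impI ballI E(1))
  fix u :: "real^'n => real" and e assume z: "(\<Sum>v\<in>E. u v *R v) = 0" and e: "e \<in> E"
  have "0 = (\<Sum>v\<in>E. u v *R v) \<bullet> tilt p e" using z by simp
  also have "\<dots> = (\<Sum>v\<in>E. if v = e then u e else 0)"
   unfolding inner_sum_left using E(3,4) e by (intro sum.cong) auto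
  finally show "u e = 0" using E(1) e by simp
 qed
 then have "card E = DIM(real^'n)" using E(2) dim_eq_card[of E UNIV] by simp
 then have "card (UNIV :: 'n set) = card E" by simp
 then obtain e where e: "bij_betw e (UNIV :: 'n set) E"
  using finite_same_card_bij[OF finite_class.finite_UNIV E(1)] by blast
 have eE: "e i \<in> E" for i using e by (auto simp: bij_betw_def)
 have inj: "e i = e j \<longleftrightarrow> i = j" for i j using e by (auto simp: bij_betw_def inj_on_def)
 show ?thesis
  by (rule that[of e "\<lambda>i. e i \<bullet> B (e i)"]) (use E(3,4) eE inj in \<open>auto simp: diag_frame_def\<close>)
qed

lemma diag_frame_expand:
 fixes B :: "real^'n => real^'n"
 assumes "diag_frame p B e l"
 shows "v = (\<Sum>i\<in>UNIV. (v \<bullet> tilt p (e i)) *R e i)"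
proof -
 have d: "e i \<bullet> tilt p (e j) = (if i = j then 1 else 0)" for i j using assms by (auto simp: diag_frame_def)
 have inj: "inj e"
 proof (rule injI)
  fix i j assume "e i = e j"
  then show "i = j" using d[of i j] d[of j j] by (auto split: if_splits)
 qed
 have ind: "independent (range e)"
  unfolding independent_explicit
 proof (intro conjI allI impI ballI)
  fix u :: "real^'n => real" and w assume z: "(\<Sum>v\<in>range e. u v *R v) = 0" and w: "w \<in> range e"
  then obtain j where j: "w = e j" by auto
  have "0 = (\<Sum>i\<in>UNIV. u (e i) *R e i) \<bullet> tilt p (e j)" using z by (simp add: sum.reindex[OF inj] o_def)
  also have "\<dots> = u (e j)" by (simp add: inner_sum_left d if_distrib[of "(*) _"] cong: if_cong)
  finally show "u w = 0" using j by simp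
 qed simp
 have "UNIV \<subseteq> span (range e)"
  using card_eq_dim[of "range e" UNIV] ind card_image[OF inj] by simp
 then have "v \<in> span (range e)" by blast
 then obtain u where u: "v = (\<Sum>w\<in>range e. u w *R w)" unfolding span_finite[OF finite_imageI[OF finite_class.finite_UNIV]] by auto
 then have v: "v = (\<Sum>i\<in>UNIV. u (e i) *R e i)" by (simp add: sum.reindex[OF inj] o_def)
 have "v \<bullet> tilt p (e j) = u (e j)" for j
  by (subst v) (simp add: inner_sum_left d if_distrib[of "(*) _"] cong: if_cong)
 then show ?thesis using v by simp
qed

section \<open>Paraboloids as test functions and their principal curvatures\<close>

definition quad :: "real^'n => real => real^'n => (real^'n => real^'n) => real^'n => real" where
 "quad x0 c p B x = c + p \<bullet> (x - x0) + ((x - x0) \<bullet> B (x - x0)) / 2"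

lemma quad_partial:
 assumes B: "selfadjoint B"
 shows "(quad x0 c p B has_derivative (\<lambda>h. (p + B (x - x0)) \<bullet> h)) (at x)"
  "partial_deriv i (quad x0 c p B) x = (p + B (x - x0)) $ i"
  "partial_deriv j (partial_deriv i (quad x0 c p B)) x = B (axis j 1) $ i"
  "C2_near x0 (quad x0 c p B)"
proof -
 have lin: "linear B" by (rule selfadjointD(1)[OF B])
 have dB: "((\<lambda>x. B (x - x0)) has_derivative B) (at x)" for x
 proof -
  have "((\<lambda>x. x - x0) has_derivative (\<lambda>h. h)) (at x)" by (auto intro!: derivative_eq_intros)
  from has_derivative_compose[OF this linear_imp_has_derivative[OF lin]] show ?thesis .
 qed
 show D: "(quad x0 c p B has_derivative (\<lambda>h. (p + B (x - x0)) \<bullet> h)) (at x)" for x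
 proof -
  have "((\<lambda>x. x - x0) has_derivative (\<lambda>h. h)) (at x)" by (auto intro!: derivative_eq_intros)
  then have "((\<lambda>x. c + p \<bullet> (x - x0) + (1/2) * ((x - x0) \<bullet> B (x - x0))) has_derivative
   (\<lambda>h. 0 + p \<bullet> h + (1/2) * ((x - x0) \<bullet> B h + h \<bullet> B (x - x0)))) (at x)"
   by (intro has_derivative_add has_derivative_const has_derivative_inner_right has_derivative_mult_right has_derivative_inner dB)
  then show ?thesis
   unfolding quad_def[abs_def]
   by (simp, elim has_derivative_eq_rhs) (use selfadjointD(2)[OF B, of "x - x0"] in \<open>auto simp: fun_eq_iff inner_add_left inner_commute[of _ "B (x - x0)"]\<close>)
 qed
 have P: "partial_deriv i (quad x0 c p B) = (\<lambda>x. (p + B (x - x0)) $ i)" for i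
  unfolding partial_deriv_def by (rule ext) (simp add: frechet_derivative_at[OF D, symmetric] inner_axis)
 show "partial_deriv i (quad x0 c p B) x = (p + B (x - x0)) $ i" by (simp only: P)
 have D2: "((\<lambda>x. (p + B (x - x0)) $ i) has_derivative (\<lambda>h. B h $ i)) (at x)" for i x
 proof -
  have "((\<lambda>x. p + B (x - x0)) has_derivative B) (at x)"
   by (rule has_derivative_eq_rhs[OF has_derivative_add[OF has_derivative_const dB]]) simp
  then show ?thesis by (rule bounded_linear.has_derivative[OF bounded_linear_vec_nth])
 qed
 show PP: "partial_deriv j (partial_deriv i (quad x0 c p B)) x = B (axis j 1) $ i" for i j x
  unfolding P unfolding partial_deriv_def frechet_derivative_at[OF D2, symmetric] ..
 have cB: "continuous_on UNIV B" by (intro linear_continuous_on linear_conv_bounded_linear[THEN iffD1] lin)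
 have "C1_on UNIV (quad x0 c p B)"
  unfolding C1_on_def P differentiable_def using D
  by (auto intro!: continuous_intros continuous_on_compose2[OF cB])
 moreover have "C1_on UNIV (partial_deriv i (quad x0 c p B))" for i
 proof -
  have "partial_deriv j (partial_deriv i (quad x0 c p B)) = (\<lambda>_. B (axis j 1) $ i)" for j by (rule ext) (rule PP)
  then have c: "continuous_on UNIV (partial_deriv j (partial_deriv i (quad x0 c p B)))" for j by simp
  have "partial_deriv i (quad x0 c p B) differentiable (at x)" for x
   unfolding P differentiable_def using D2 by blast
  with c show ?thesis unfolding C1_on_def by blast
 qed
 ultimately show "C2_near x0 (quad x0 c p B)" unfolding C2_near_def C2_on_def by (intro exI[of _ UNIV]) auto
qed

lemma norm_axis_1: "axis i (1::real) \<bullet> v = v $ i"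
 by (simp add: inner_axis' )

text \<open>With the frame as columns of \<open>P\<close>, the first fundamental form T satisfies
  P^T T P = I, and the shape operator S satisfies P^T T (t - S) P = diag (t - l_i / W).
  Determinants, with det P^2 det T = 1, give the characteristic polynomial.\<close>

lemma frame_principal_curvatures:
 fixes p :: "real^'n" and B :: "real^'n => real^'n"
 assumes B: "selfadjoint B" and fr: "diag_frame p B e l"
 defines "W \<equiv> sqrt (1 + p \<bullet> p)"
 shows "principal_curvatures (quad x0 c p B) x0 (\<chi> i. l i / W)" "mcurv p B = (\<Sum>i\<in>UNIV. l i)"
proof -
 have lin: "linear B" by (rule selfadjointD(1)[OF B])
 have W: "W > 0" "W * W = 1 + p \<bullet> p" using sqrt_one_plus_inner[of p] unfolding W_def by linarith+
 define P where "P = (\<chi> r i. e i $ r)"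
 define Tm where "Tm = matrix (tilt p)"
 define Bm where "Bm = matrix B"
 have Tv: "Tm *v v = tilt p v" for v unfolding Tm_def by (simp add: tilt_simps(1))
 have Bv: "Bm *v v = B v" for v unfolding Bm_def by (simp add: lin)
 have PMP: "(transpose P ** (M ** P)) $ i $ j = e i \<bullet> (M *v e j)" for M i j
  by (simp add: matrix_matrix_mult_def transpose_def P_def inner_vec_def matrix_vector_mult_def)
 have I1: "transpose P ** (Tm ** P) = mat 1"
  using fr by (simp add: vec_eq_iff PMP Tv mat_def diag_frame_def)
 have I2: "transpose P ** (Bm ** P) = (\<chi> i j. if i = j then l i else 0)"
  using fr by (simp add: vec_eq_iff PMP Bv diag_frame_def)
 have pd: "partial_deriv i (quad x0 c p B) x0 = p $ i" for i
  using quad_partial(2)[OF B, of i x0 c p x0] linear_0[OF lin] by simp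
 have pv: "(\<chi> i. partial_deriv i (quad x0 c p B) x0) = p" by (simp add: vec_eq_iff pd)
 have Taxis: "axis i 1 \<bullet> tilt p (axis j 1) = (axis i 1 \<bullet> (axis j (1::real) :: real^'n)) + p $ i * p $ j" for i j
  by (simp add: tilt_def inner_add_right inner_axis inner_commute norm_axis_1)
 have ff: "first_fundamental_form (quad x0 c p B) x0 = Tm"
 proof -
  have "Tm $ i $ j = axis i 1 \<bullet> tilt p (axis j 1)" for i j
   by (simp add: Tm_def matrix_def norm_axis_1)
  then show ?thesis
   by (simp add: first_fundamental_form_def graph_tangent_def pd vec_eq_iff Taxis)
 qed
 have symB: "B (axis i 1) $ j = B (axis j 1) $ i" for i j
  using selfadjointD(2)[OF B, of "axis i 1" "axis j 1"] by (simp add: norm_axis_1 inner_axis)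
 have sf: "second_fundamental_form (quad x0 c p B) x0 = (1 / W) *R Bm"
 proof -
  have "upward_unit_normal (quad x0 c p B) x0 = (1 / W) *R (- p, 1)"
   unfolding upward_unit_normal_def pv Let_def W_def by (simp add: power2_norm_eq_inner)
  then show ?thesis
   by (simp add: second_fundamental_form_def quad_partial(3)[OF B] vec_eq_iff Bm_def matrix_def symB)
 qed
 have detP: "det P * (det Tm * det P) = 1"
  using arg_cong[OF I1, of det] by (simp add: det_mul)
 have invT: "invertible Tm" using detP by (auto simp: invertible_det_nz)
 define S where "S = shape_operator (quad x0 c p B) x0"
 have TS: "Tm ** S = (1 / W) *R Bm"
 proof -
  have "Tm ** matrix_inv Tm = mat 1"
   using someI_ex[OF invT[unfolded invertible_def]] by (simp add: matrix_inv_def)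
  then show ?thesis unfolding S_def shape_operator_def ff sf by (simp add: matrix_mul_assoc)
 qed
 show "principal_curvatures (quad x0 c p B) x0 (\<chi> i. l i / W)"
  unfolding principal_curvatures_def S_def[symmetric]
 proof
  fix t
  have "transpose P ** (Tm ** (mat t - S) ** P) = (\<chi> i j. if i = j then t - l i / W else 0)"
  proof -
   have a: "Tm ** mat t = t *R Tm" by (simp add: vec_eq_iff matrix_matrix_mult_def mat_def if_distrib[of "(*) _"] cong: if_cong)
   have "Tm ** (mat t - S) = Tm ** mat t - Tm ** S"
    by (simp add: vec_eq_iff matrix_matrix_mult_def right_diff_distrib sum_subtractf)
   then have M: "Tm ** (mat t - S) = t *R Tm - (1 / W) *R Bm" unfolding a TS .
   have Mv: "(Tm ** (mat t - S)) *v v = t *R tilt p v - (1 / W) *R B v" for v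
    unfolding M by (simp add: matrix_vector_mult_diff_rdistrib scaleR_matrix_vector_assoc[symmetric] Tv Bv)
   have "transpose P ** (Tm ** (mat t - S) ** P) = (\<chi> i j. e i \<bullet> ((Tm ** (mat t - S)) *v e j))"
    by (simp only: vec_eq_iff PMP vec_lambda_beta) simp
   also have "\<dots> = (\<chi> i j. if i = j then t - l i / W else 0)"
    unfolding Mv using fr by (simp add: vec_eq_iff inner_diff_right diag_frame_def)
   finally show ?thesis .
  qed
  then have "det P * (det Tm * det (mat t - S)) * det P = det (\<chi> i j. if i = j then t - l i / W else 0)"
   by (metis (no_types) det_mul det_transpose mult.assoc)
  also have "\<dots> = (\<Prod>i\<in>UNIV. t - l i / W)" by (subst det_diagonal) auto
  finally have "(det P * (det Tm * det P)) * det (mat t - S) = (\<Prod>i\<in>UNIV. t - l i / W)" by (simp add: mult_ac)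
  then show "det (mat t - S) = (\<Prod>i\<in>UNIV. t - (\<chi> i. l i / W) $ i)" unfolding detP by simp
 qed
 have d: "e i \<bullet> B (e j) = (if i = j then l i else 0)" for i j using fr by (auto simp: diag_frame_def)
 \<comment> \<open>The trace with respect to the frame: \<open>\<Sum>\<^sub>i e\<^sub>i e\<^sub>i\<^sup>T\<close> inverts the first fundamental form.\<close>
 define Q where "Q v = v - ((p \<bullet> v) / (1 + p \<bullet> p)) *R p" for v
 have TQ: "tilt p (Q v) = v" for v
  using one_plus_inner_pos(1)[of p] by (simp add: Q_def tilt_def inner_diff_right field_simps scaleR_add_left[symmetric] flip: scaleR_diff_left)
 have Q: "Q v = (\<Sum>i\<in>UNIV. (v \<bullet> e i) *R e i)" for v
  using diag_frame_expand[OF fr, of "Q v"] tilt_simps(2)[of p "Q v"] by (simp add: TQ)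
 have "mcurv p B = (\<Sum>b\<in>Basis. Q (B b) \<bullet> b)"
 proof -
  have "(\<Sum>i\<in>Basis. (p \<bullet> B i) * (p \<bullet> i)) = p \<bullet> B (\<Sum>i\<in>Basis. (p \<bullet> i) *R i)"
   by (simp add: linear_sum[OF lin] linear_scale[OF lin] inner_sum_right mult.commute)
  also have "\<dots> = p \<bullet> B p" by (simp add: euclidean_representation)
  finally show ?thesis
   by (simp add: Q_def inner_diff_left sum_subtractf mcurv_def trace_map_def sum_divide_distrib[symmetric])
 qed
 also have "\<dots> = (\<Sum>b\<in>Basis. \<Sum>i\<in>UNIV. (B b \<bullet> e i) * (e i \<bullet> b))" by (simp add: Q inner_sum_left)
 also have "\<dots> = (\<Sum>i\<in>UNIV. \<Sum>b\<in>Basis. (B b \<bullet> e i) * (e i \<bullet> b))" by (rule sum.swap)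
 also have "\<dots> = (\<Sum>i\<in>UNIV. e i \<bullet> B (e i))"
 proof (rule sum.cong[OF refl])
  fix i
  have "B b \<bullet> e i = B (e i) \<bullet> b" for b using selfadjointD(2)[OF B, of b "e i"] by (simp add: inner_commute[of b])
  then have "(\<Sum>b\<in>Basis. (B b \<bullet> e i) * (e i \<bullet> b)) = (\<Sum>b\<in>Basis. (B (e i) \<bullet> b) * (e i \<bullet> b))" by (simp only:)
  also have "\<dots> = B (e i) \<bullet> e i" by (rule euclidean_inner[symmetric])
  also have "\<dots> = e i \<bullet> B (e i)" by (rule inner_commute)
  finally show "(\<Sum>b\<in>Basis. (B b \<bullet> e i) * (e i \<bullet> b)) = e i \<bullet> B (e i)" .
 qed
 finally show "mcurv p B = (\<Sum>i\<in>UNIV. l i)" by (simp add: d)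
qed

lemma frame_quadratic:
 assumes B: "linear B" and fr: "diag_frame p B e l"
 shows "(\<Sum>i\<in>UNIV. a i *R e i) \<bullet> B (\<Sum>i\<in>UNIV. a i *R e i) = (\<Sum>i\<in>UNIV. l i * (a i)^2)"
proof -
 have d: "e i \<bullet> B (e j) = (if i = j then l i else 0)" for i j using fr by (auto simp: diag_frame_def)
 have "(\<Sum>i\<in>UNIV. a i *R e i) \<bullet> B (\<Sum>i\<in>UNIV. a i *R e i) = (\<Sum>j\<in>UNIV. \<Sum>i\<in>UNIV. a j * (a i * (e i \<bullet> B (e j))))"
  by (simp add: linear_sum[OF B] linear_scale[OF B] inner_sum_left inner_sum_right sum_distrib_left)
 also have "\<dots> = (\<Sum>j\<in>UNIV. \<Sum>i\<in>UNIV. if i = j then l j * (a j)^2 else 0)"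
  by (intro sum.cong refl) (auto simp: d power2_eq_square)
 finally show ?thesis by simp
qed

lemma frame_tilt: "diag_frame p B e l ==> diag_frame p (tilt p) e (\<lambda>_. 1)"
 by (auto simp: diag_frame_def)

lemma frame_norm_le_1: "diag_frame p B e l ==> (norm (e i))^2 \<le> 1"
 using tilt_ge[of "e i" p] by (auto simp: diag_frame_def)

section \<open>The upper envelope and its spherical caps\<close>

lemma upper_envelope_ge:
 assumes f: "continuous_on UNIV f" and y: "norm (x - y) \<le> R"
 shows "f y + sqrt (R^2 - (norm (x - y))\<^sup>2) \<le> upper_envelope R f x"
  "\<exists>z. norm (x - z) \<le> R \<and> upper_envelope R f x = f z + sqrt (R^2 - (norm (x - z))\<^sup>2)"
proof -
 define S where "S = {y. norm (x - y) \<le> R}"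
 define h where "h y = f y + sqrt (R^2 - (norm (x - y))\<^sup>2)" for y
 have S: "S = cball x R" by (auto simp: S_def dist_norm)
 have "continuous_on S h" unfolding h_def by (intro continuous_intros continuous_on_subset[OF f]) auto
 moreover have "compact S" by (simp add: S)
 moreover have "S \<noteq> {}" using y by (auto simp: S_def)
 ultimately obtain z where z: "z \<in> S" "\<And>w. w \<in> S ==> h w \<le> h z" using continuous_attains_sup by metis
 have "Sup (h ` S) = h z" using z by (intro cSup_eq_maximum) auto
 then have U: "upper_envelope R f x = h z" by (simp add: upper_envelope_def S_def h_def)
 show "f y + sqrt (R^2 - (norm (x - y))\<^sup>2) \<le> upper_envelope R f x"
  unfolding U using z(2)[of y] y by (simp add: S_def h_def)
 show "\<exists>z. norm (x - z) \<le> R \<and> upper_envelope R f x = f z + sqrt (R^2 - (norm (x - z))\<^sup>2)"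
  using z(1) U by (auto simp: S_def h_def)
qed

lemma divide_double_cancel:
 fixes d n :: real
 shows "0 \<le> n ==> d / (2 * (n + 1)) * (2 * (n + 1)) = d"
 by auto

text \<open>To second order the hemisphere of radius R bends down with coefficient W / R in the form
  \<open>tilt p\<close>; a paraboloid with the larger coefficient W / R' stays below it near the
  tangency. Squares are compared: R^2 - |w0 + \<eta>|^2 minus the square of the paraboloid is
  \<open>E\<close> times a factor close to R / R' - 1 > 0.\<close>

lemma spherical_cap_lower_bound:
 fixes w0 :: "'a::euclidean_space"
 assumes w0: "norm w0 < R" and R': "0 < R'" "R' < R"
 defines "s0 \<equiv> sqrt (R^2 - (norm w0)\<^sup>2)"
 defines "p \<equiv> (- 1 / s0) *R w0"
 defines "W \<equiv> sqrt (1 + p \<bullet> p)"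
 obtains d where "d > 0" "\<And>\<eta>. norm \<eta> < d ==> norm (w0 + \<eta>) \<le> R \<and>
  s0 + p \<bullet> \<eta> - W / R' / 2 * (\<eta> \<bullet> tilt p \<eta>) \<le> sqrt (R^2 - (norm (w0 + \<eta>))\<^sup>2)"
proof -
 have R: "R > 0" using R' by simp
 have "(norm w0)^2 < R\<^sup>2" using w0 by (intro power_strict_mono) auto
 then have s0: "s0 > 0" "s0^2 = R^2 - (norm w0)\<^sup>2" by (auto simp: s0_def)
 have w: "w0 = - (s0 *R p)" using s0 by (simp add: p_def)
 have "(norm w0)^2 = s0^2 * (p \<bullet> p)" unfolding power2_norm_eq_inner by (subst (1 2) w) (simp add: power2_eq_square)
 then have "s0^2 * (1 + p \<bullet> p) = R^2" using s0(2) by (simp only: distrib_left mult_1_right)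
 then have "sqrt (s0^2 * (1 + p \<bullet> p)) = sqrt (R^2)" by simp
 then have "sqrt (s0^2) * sqrt (1 + p \<bullet> p) = sqrt (R^2)" by (simp only: real_sqrt_mult)
 moreover have "sqrt (s0^2) = s0" "sqrt (R^2) = R" using s0(1) R by (simp_all only: real_sqrt_unique less_imp_le refl real_sqrt_abs abs_of_pos)
 ultimately have sW: "s0 * W = R" unfolding W_def by (simp only:)
 have W1: "W \<ge> 1" "W * W = 1 + p \<bullet> p" unfolding W_def by (rule sqrt_one_plus_inner)+
 define a where "a = W / R'"
 have a: "a > 0" using W1 R' by (simp add: a_def)
 have as: "a * s0 = R / R'" using sW by (simp add: a_def mult.commute)
 define r0 where "r0 = R / R' - 1"
 have r0: "r0 > 0" using R' by (simp add: r0_def)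
 define C where "C = a * norm p + a^2 * W^2 + 1"
 have C: "C > 0" unfolding C_def using a by (intro add_nonneg_pos) auto
 show ?thesis
 proof (rule that[of "min 1 (r0 / C)"])
  show "min 1 (r0 / C) > 0" using r0 C by simp
  fix \<eta> :: 'a assume eta: "norm \<eta> < min 1 (r0 / C)"
  define E where "E = \<eta> \<bullet> tilt p \<eta>"
  have E: "E = (norm \<eta>)^2 + (p \<bullet> \<eta>)^2"
   using tilt_simps(3)[of p \<eta>] by (simp add: E_def inner_commute power2_norm_eq_inner)
  have E0: "E \<ge> 0" by (simp add: E)
  have EW: "E \<le> W^2 * (norm \<eta>)^2"
  proof -
   have "(p \<bullet> \<eta>)^2 \<le> (p \<bullet> p) * (norm \<eta>)^2" using Cauchy_Schwarz_ineq[of p \<eta>] by (simp add: power2_norm_eq_inner)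
   then show ?thesis using W1(2) by (simp add: E power2_eq_square[of W] algebra_simps)
  qed
  have small: "0 \<le> r0 + a * (p \<bullet> \<eta>) - a\<^sup>2 * E / 4"
  proof -
   have "\<bar>p \<bullet> \<eta>\<bar> \<le> norm p * norm \<eta>" by (rule Cauchy_Schwarz_ineq2)
   then have "a * \<bar>p \<bullet> \<eta>\<bar> \<le> a * (norm p * norm \<eta>)" using a by (intro mult_left_mono) auto
   moreover have "a * (p \<bullet> \<eta>) \<ge> - (a * \<bar>p \<bullet> \<eta>\<bar>)" using a by (simp add: abs_mult_pos' flip: mult_minus_right)
   moreover have "a^2 * E / 4 \<le> a^2 * W^2 * norm \<eta>"
   proof -
    have "(norm \<eta>)^2 \<le> norm \<eta>" using eta by (simp add: power2_eq_square mult_left_le)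
    then have "W^2 * (norm \<eta>)^2 \<le> W^2 * norm \<eta>" by (intro mult_left_mono) auto
    then have "a^2 * E \<le> a^2 * (W^2 * norm \<eta>)" using EW by (intro mult_left_mono) auto
    moreover have "a^2 * E \<ge> 0" using E0 by simp
    ultimately show ?thesis by (simp add: mult.assoc)
   qed
   moreover have "C * norm \<eta> \<le> r0" using eta C by (simp add: pos_less_divide_eq mult.commute)
   moreover have "C * norm \<eta> = a * (norm p * norm \<eta>) + a^2 * W^2 * norm \<eta> + norm \<eta>" by (simp add: C_def algebra_simps)
   ultimately show ?thesis using norm_ge_zero[of \<eta>] by linarith
  qed
  define q where "q = s0 + p \<bullet> \<eta> - a / 2 * E"
  have nw: "(norm (w0 + \<eta>))^2 = (norm w0)^2 - 2 * s0 * (p \<bullet> \<eta>) + (norm \<eta>)^2"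
  proof -
   have "(norm (w0 + \<eta>))^2 = (norm w0)^2 + 2 * (w0 \<bullet> \<eta>) + (norm \<eta>)^2"
    by (simp add: power2_norm_eq_inner inner_add_left inner_add_right inner_commute)
   also have "w0 \<bullet> \<eta> = - (s0 * (p \<bullet> \<eta>))" by (subst w) simp
   finally show ?thesis by simp
  qed
  have "R^2 - (norm (w0 + \<eta>))\<^sup>2 - q\<^sup>2 = E * (r0 + a * (p \<bullet> \<eta>) - a\<^sup>2 * E / 4)"
  proof -
   define P where "P = p \<bullet> \<eta>"
   define n where "n = (norm \<eta>)^2"
   have 1: "R^2 - (norm (w0 + \<eta>))\<^sup>2 = s0^2 + 2 * s0 * P - n" using nw s0(2) by (simp add: P_def n_def)
   have 2: "q^2 = s0^2 + 2 * s0 * P + P^2 - (a * s0) * E - a * P * E + a^2 * E^2 / 4"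
    unfolding q_def P_def[symmetric] by (simp add: power2_eq_square field_simps)
   have 3: "E = n + P^2" by (simp add: E n_def P_def)
   have "R^2 - (norm (w0 + \<eta>))\<^sup>2 - q\<^sup>2 = (a * s0) * E + a * P * E - a\<^sup>2 * E^2 / 4 - E"
    unfolding 1 2 using 3 by simp
   also have "\<dots> = E * (r0 + a * P - a\<^sup>2 * E / 4)"
    unfolding as r0_def by (simp add: power2_eq_square algebra_simps)
   finally show ?thesis by (simp add: P_def)
  qed
  then have q2: "q^2 \<le> R^2 - (norm (w0 + \<eta>))\<^sup>2" using mult_nonneg_nonneg[OF E0 small] by simp
  then have "(norm (w0 + \<eta>))^2 \<le> R^2" using zero_le_power2[of q] by linarith
  then have "norm (w0 + \<eta>) \<le> R" using R by (rule power2_le_imp_le[OF _ less_imp_le])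
  moreover have "q \<le> sqrt (R^2 - (norm (w0 + \<eta>))\<^sup>2)" using q2 by (rule real_le_rsqrt)
  ultimately show "norm (w0 + \<eta>) \<le> R \<and> s0 + p \<bullet> \<eta> - W / R' / 2 * (\<eta> \<bullet> tilt p \<eta>) \<le> sqrt (R^2 - (norm (w0 + \<eta>))\<^sup>2)"
   by (simp add: q_def a_def E_def)
 qed
qed

text \<open>At a rim contact the cap has infinite slope, which a paraboloid above the envelope
  excludes. At an interior contact the cap lies below the envelope and touches it, so its slope is p
  and its second-order term bounds \<open>B\<close> from below; the bound is obtained for R' < R and
  passes to the limit.\<close>

lemma envelope_contact_slope:
 fixes f :: "real^'n => real"
 assumes f: "continuous_on UNIV f" and R: "R > 0" and B: "selfadjoint B"
  and jet: "de0 > 0" "\<And>h. norm h < de0 ==> upper_envelope R f (y0 + h) \<le> upper_envelope R f y0 + p \<bullet> h + (h \<bullet> B h) / 2"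
  and z0: "norm (y0 - z0) \<le> R" "upper_envelope R f y0 = f z0 + sqrt (R^2 - (norm (y0 - z0))\<^sup>2)"
 shows "norm (y0 - z0) < R" "p = (- 1 / sqrt (R^2 - (norm (y0 - z0))\<^sup>2)) *R (y0 - z0)"
  "- (sqrt (1 + p \<bullet> p) / R) * (h \<bullet> tilt p h) \<le> h \<bullet> B h"
proof -
 define g where "g = upper_envelope R f"
 define w0 where "w0 = y0 - z0"
 have lin: "linear B" by (rule selfadjointD(1)[OF B])
 obtain b where b: "\<And>x. norm (B x) \<le> b * norm x" using linear_bounded[OF lin] by blast
 have gge: "norm (w0 + h) \<le> R ==> f z0 + sqrt (R^2 - (norm (w0 + h))\<^sup>2) \<le> g (y0 + h)" for h
  using upper_envelope_ge(1)[OF f, of "y0 + h" z0 R] by (simp add: g_def w0_def algebra_simps)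
 have jetg: "norm h < de0 ==> g (y0 + h) \<le> g y0 + p \<bullet> h + (h \<bullet> B h) / 2" for h using jet(2) by (simp add: g_def)
 show lt: "norm (y0 - z0) < R"
 proof (rule ccontr)
  assume "\<not> ?thesis"
  then have nw: "norm w0 = R" using z0(1) by (simp add: w0_def)
  define \<nu> where "\<nu> = (1 / R) *R w0"
  have nn: "norm \<nu> = 1" using nw R by (simp add: \<nu>_def)
  have w0n: "w0 = R *R \<nu>" using R by (simp add: \<nu>_def)
  have g0: "g y0 = f z0" using z0(2) nw by (simp add: g_def w0_def)
  define M where "M = \<bar>p \<bullet> \<nu>\<bar> + R * \<bar>\<nu> \<bullet> B \<nu>\<bar>"
  have M: "M \<ge> 0" using R by (simp add: M_def)
  \<comment> \<open>Small enough that the height sqrt (R^2 - (R - t)^2) of the cap, of order sqrt t,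
    exceeds the linear bound t M.\<close>
  define t where "t = min (de0 / 2) (R / (2 * (M^2 + 1)))"
  have M1: "2 * (M^2 + 1) \<ge> 1" by (simp add: add_increasing)
  have M10: "2 * (M^2 + 1) > 0" using M1 by linarith
  have t: "t > 0" "t < de0" "t * (2 * (M^2 + 1)) \<le> R"
  proof -
   show "t > 0" using jet(1) R M10 by (simp add: t_def)
   show "t < de0" using jet(1) by (simp add: t_def)
   have "t \<le> R / (2 * (M^2 + 1))" by (simp add: t_def)
   then show "t * (2 * (M^2 + 1)) \<le> R" using M10 by (simp add: pos_le_divide_eq)
  qed
  have tR: "t \<le> R"
  proof -
   have "t * 1 \<le> t * (2 * (M^2 + 1))" using t(1) M1 by (intro mult_left_mono) auto
   then show ?thesis using t(3) by simp
  qed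
  have "w0 + (- t) *R \<nu> = (R - t) *R \<nu>" by (subst w0n) (simp add: scaleR_diff_left)
  then have n: "norm (w0 + (- t) *R \<nu>) = R - t" using nn tR by simp
  have "f z0 + sqrt (R^2 - (R - t)\<^sup>2) \<le> g y0 + p \<bullet> ((- t) *R \<nu>) + (((- t) *R \<nu>) \<bullet> B ((- t) *R \<nu>)) / 2"
   using gge[of "(- t) *R \<nu>"] jetg[of "(- t) *R \<nu>"] n nn t tR by simp
  then have "sqrt (R^2 - (R - t)\<^sup>2) \<le> - t * (p \<bullet> \<nu>) + t * t * (\<nu> \<bullet> B \<nu>) / 2"
   using g0 by (simp add: linear_scale[OF lin] linear_neg[OF lin])
  also have "\<dots> \<le> t * M"
  proof -
   have 1: "t * (- (p \<bullet> \<nu>)) \<le> t * \<bar>p \<bullet> \<nu>\<bar>" using t(1) by (intro mult_left_mono) auto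
   have "t * (\<nu> \<bullet> B \<nu>) / 2 \<le> R * \<bar>\<nu> \<bullet> B \<nu>\<bar>"
   proof -
    have "t * (\<nu> \<bullet> B \<nu>) \<le> t * \<bar>\<nu> \<bullet> B \<nu>\<bar>" using t(1) by (intro mult_left_mono) auto
    also have "\<dots> \<le> R * \<bar>\<nu> \<bullet> B \<nu>\<bar>" using tR by (intro mult_right_mono) auto
    finally show ?thesis using mult_nonneg_nonneg[OF less_imp_le[OF R], of "\<bar>\<nu> \<bullet> B \<nu>\<bar>"] by linarith
   qed
   then have "t * (t * (\<nu> \<bullet> B \<nu>) / 2) \<le> t * (R * \<bar>\<nu> \<bullet> B \<nu>\<bar>)" using t(1) by (intro mult_left_mono) auto
   then show ?thesis using 1 by (simp add: M_def distrib_left mult.assoc)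
  qed
  finally have "R^2 - (R - t)\<^sup>2 \<le> (t * M)^2" by (rule sqrt_le_D)
  moreover have "R^2 - (R - t)\<^sup>2 = t * (2 * R - t)" by (simp add: power2_eq_square algebra_simps)
  ultimately have "t * (2 * R - t) \<le> t * (t * M^2)" by (simp add: power2_eq_square mult_ac)
  then have "2 * R - t \<le> t * M^2" using t(1) by simp
  moreover have "t * (2 * (M^2 + 1)) = 2 * (t * M^2) + 2 * t" by (simp add: algebra_simps)
  moreover have "t * M^2 \<ge> 0" using t(1) by simp
  ultimately show False using t tR R by linarith
 qed
 have w0: "norm w0 < R" using lt by (simp add: w0_def)
 define s0 where "s0 = sqrt (R^2 - (norm w0)\<^sup>2)"
 define p0 where "p0 = (- 1 / s0) *R w0"
 have g0: "g y0 = f z0 + s0" using z0(2) by (simp add: g_def w0_def s0_def)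
 have below: "\<exists>d>0. \<forall>h. norm h < d --> (p0 - p) \<bullet> h - sqrt (1 + p0 \<bullet> p0) / R' / 2 * (h \<bullet> tilt p0 h) \<le> (h \<bullet> B h) / 2"
  if R': "0 < R'" "R' < R" for R'
 proof -
  obtain d where d: "d > 0" "\<And>\<eta>. norm \<eta> < d ==> norm (w0 + \<eta>) \<le> R \<and>
   s0 + p0 \<bullet> \<eta> - sqrt (1 + p0 \<bullet> p0) / R' / 2 * (\<eta> \<bullet> tilt p0 \<eta>) \<le> sqrt (R^2 - (norm (w0 + \<eta>))\<^sup>2)"
   using spherical_cap_lower_bound[OF w0 R'] unfolding s0_def[symmetric] p0_def[symmetric] by blast
  show ?thesis
  proof (intro exI[of _ "min d de0"] conjI allI impI)
   show "min d de0 > 0" using d(1) jet(1) by simp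
   fix h :: "real^'n" assume h: "norm h < min d de0"
   then have "norm (w0 + h) \<le> R" "s0 + p0 \<bullet> h - sqrt (1 + p0 \<bullet> p0) / R' / 2 * (h \<bullet> tilt p0 h) \<le> sqrt (R^2 - (norm (w0 + h))\<^sup>2)"
    using d(2)[of h] by auto
   then show "(p0 - p) \<bullet> h - sqrt (1 + p0 \<bullet> p0) / R' / 2 * (h \<bullet> tilt p0 h) \<le> (h \<bullet> B h) / 2"
    using gge[of h] jetg[of h] h g0 unfolding inner_diff_left by linarith
  qed
 qed
 \<comment> \<open>A nonzero difference of slopes would dominate the quadratic terms along the ray
   in its own direction.\<close>
 have "p = p0"
 proof (rule ccontr)
  assume ne: "p \<noteq> p0"
  obtain d where d: "d > 0" "\<And>h. norm h < d ==> (p0 - p) \<bullet> h - sqrt (1 + p0 \<bullet> p0) / (R / 2) / 2 * (h \<bullet> tilt p0 h) \<le> (h \<bullet> B h) / 2"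
   using below[of "R / 2"] R by auto
  define h where "h = p0 - p"
  define Q where "Q = sqrt (1 + p0 \<bullet> p0) / (R / 2) / 2 * (h \<bullet> tilt p0 h) + \<bar>h \<bullet> B h\<bar>"
  have h0: "h \<bullet> h > 0" using ne by (simp add: h_def)
  define t where "t = min (d / (2 * (norm h + 1))) ((h \<bullet> h) / (2 * (\<bar>Q\<bar> + 1)))"
  have tpos: "t > 0" using d(1) h0 by (simp add: t_def add_nonneg_pos)
  have "t * (2 * (norm h + 1)) \<le> d"
  proof -
   have "t \<le> d / (2 * (norm h + 1))" by (simp add: t_def)
   then show ?thesis by (simp add: pos_le_divide_eq add_nonneg_pos)
  qed
  moreover have "t * (2 * (norm h + 1)) = 2 * (t * norm h) + 2 * t" by (simp add: algebra_simps)
  moreover have "t * norm h \<ge> 0" using tpos by simp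
  moreover have "norm (t *R h) = t * norm h" using tpos by simp
  ultimately have "norm (t *R h) < d" using tpos by linarith
  from d(2)[OF this] have "t * (h \<bullet> h) - t * t * (sqrt (1 + p0 \<bullet> p0) / (R / 2) / 2 * (h \<bullet> tilt p0 h)) \<le> t * t * (h \<bullet> B h) / 2"
   by (simp add: h_def[symmetric] linear_scale[OF lin] mult_ac)
  also have "\<dots> \<le> t * t * \<bar>h \<bullet> B h\<bar>"
  proof -
   have "t * t * (h \<bullet> B h) \<le> t * t * \<bar>h \<bullet> B h\<bar>" by (intro mult_left_mono) auto
   moreover have "0 \<le> t * t * \<bar>h \<bullet> B h\<bar>" by simp
   ultimately show ?thesis by linarith
  qed
  finally have "t * (h \<bullet> h) \<le> t * (t * Q)" by (simp add: Q_def algebra_simps)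
  then have "h \<bullet> h \<le> t * Q" using tpos by simp
  also have "\<dots> \<le> t * \<bar>Q\<bar>" using tpos by (intro mult_left_mono) auto
  finally have 1: "h \<bullet> h \<le> t * \<bar>Q\<bar>" .
  have "t * (2 * (\<bar>Q\<bar> + 1)) \<le> h \<bullet> h"
  proof -
   have "t \<le> (h \<bullet> h) / (2 * (\<bar>Q\<bar> + 1))" by (simp add: t_def)
   then show ?thesis by (simp add: pos_le_divide_eq add_nonneg_pos)
  qed
  moreover have "t * (2 * (\<bar>Q\<bar> + 1)) = 2 * (t * \<bar>Q\<bar>) + 2 * t" by (simp add: algebra_simps)
  moreover have "t * \<bar>Q\<bar> \<ge> 0" using tpos by simp
  ultimately show False using 1 tpos by linarith
 qed
 then show pe: "p = (- 1 / sqrt (R^2 - (norm (y0 - z0))\<^sup>2)) *R (y0 - z0)" by (simp add: p0_def s0_def w0_def)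
 have "- (sqrt (1 + p \<bullet> p) / R') * (h \<bullet> tilt p h) \<le> h \<bullet> B h" if R': "0 < R'" "R' < R" for R'
 proof -
  obtain d where d: "d > 0" "\<And>h. norm h < d ==> (p0 - p) \<bullet> h - sqrt (1 + p0 \<bullet> p0) / R' / 2 * (h \<bullet> tilt p0 h) \<le> (h \<bullet> B h) / 2"
   using below[OF R'] by auto
  define t where "t = d / (2 * (norm h + 1))"
  have tpos: "t > 0" using d(1) by (simp add: t_def add_nonneg_pos)
  have "t * (2 * (norm h + 1)) = d" unfolding t_def by (rule divide_double_cancel) simp
  moreover have "t * (2 * (norm h + 1)) = 2 * (t * norm h) + 2 * t" by (simp add: algebra_simps)
  moreover have "t * norm h \<ge> 0" using tpos by simp
  moreover have "norm (t *R h) = t * norm h" using tpos by simp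
  ultimately have "norm (t *R h) < d" using tpos by linarith
  from d(2)[OF this] have "(t * t) * (- (sqrt (1 + p \<bullet> p) / R') * (h \<bullet> tilt p h)) \<le> (t * t) * (h \<bullet> B h)"
   unfolding \<open>p = p0\<close>[symmetric] by (simp add: linear_scale[OF lin] mult_ac)
  then show ?thesis by (rule mult_left_le_imp_le) (intro mult_pos_pos tpos)
 qed
 then have "\<forall>\<^sub>F R' in at_left R. - (sqrt (1 + p \<bullet> p) / R') * (h \<bullet> tilt p h) \<le> h \<bullet> B h"
  using eventually_at_left_real[OF R] by (auto elim!: eventually_mono)
 moreover have "((\<lambda>R'. - (sqrt (1 + p \<bullet> p) / R') * (h \<bullet> tilt p h)) \<longlongrightarrow> - (sqrt (1 + p \<bullet> p) / R) * (h \<bullet> tilt p h)) (at_left R)"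
  using R by (intro tendsto_intros) auto
 ultimately show "- (sqrt (1 + p \<bullet> p) / R) * (h \<bullet> tilt p h) \<le> h \<bullet> B h"
  by (intro tendsto_upperbound) auto
qed

section \<open>Viscosity inequalities for the mean curvature\<close>

abbreviation (input) ones :: "real^'n" where "ones \<equiv> (\<chi> i. 1)"

lemma open_positive_cone: "open (positive_cone :: (real^'n) set)"
proof -
 have "open (\<Inter>j\<in>UNIV. {s :: real^'n. 0 < s $ j})" by (intro open_INT ballI open_Collect_less continuous_intros) auto
 moreover have "(positive_cone :: (real^'n) set) = (\<Inter>j\<in>UNIV. {s. 0 < s $ j})" by (auto simp: positive_cone_def)
 ultimately show ?thesis by (simp only:)
qed

lemma vec_expand_axis: "v = (\<Sum>i\<in>UNIV. (v $ i) *R axis i (1::real))"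
 by (simp add: vec_eq_iff axis_def if_distrib[of "(*) _"] cong: if_cong)

lemma norm_const_vec_le:
 fixes v :: "real^'n" and r :: real
 assumes "\<And>i. \<bar>v $ i\<bar> \<le> r"
 shows "norm v \<le> CARD('n) * r"
proof -
 have "norm v \<le> (\<Sum>i\<in>UNIV. \<bar>v $ i\<bar>)" by (rule norm_le_l1_cart)
 also have "\<dots> \<le> (\<Sum>i\<in>(UNIV::'n set). r)" by (intro sum_mono assms)
 finally show ?thesis by simp
qed

text \<open>The segment is cut into at most 1 + |x - y| steps of length at most 1.\<close>

lemma increment_bound:
 fixes f :: "'a::real_normed_vector => real"
 assumes K: "\<And>x y. norm (x - y) \<le> 1 ==> \<bar>f x - f y\<bar> \<le> K"
 shows "\<bar>f x - f y\<bar> \<le> K * (1 + norm (x - y))"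
proof -
  have K0: "0 \<le> K" using K[of 0 0] by simp
 have step: "norm (x - y) \<le> real n ==> \<bar>f x - f y\<bar> \<le> K * real n" for n x y
 proof (induction n arbitrary: x)
  case (Suc n)
  define z where "z = y + (real n / real (Suc n)) *R (x - y)"
  have "norm (z - y) = (real n / real (Suc n)) * norm (x - y)" by (simp add: z_def)
  also have "\<dots> \<le> (real n / real (Suc n)) * real (Suc n)" using Suc.prems by (intro mult_left_mono) auto
  finally have "norm (z - y) \<le> real n" by simp
  then have 1: "\<bar>f z - f y\<bar> \<le> K * real n" by (rule Suc.IH)
  have "x - z = (1 - real n / real (Suc n)) *R (x - y)" by (simp add: z_def algebra_simps)
  also have "1 - real n / real (Suc n) = 1 / real (Suc n)" by (simp add: field_simps)
  finally have "norm (x - z) = (1 / real (Suc n)) * norm (x - y)" by simp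
  also have "\<dots> \<le> (1 / real (Suc n)) * real (Suc n)" using Suc.prems by (intro mult_left_mono) auto
  finally have "norm (x - z) \<le> 1" by simp
  then have "\<bar>f x - f z\<bar> \<le> K" by (rule K)
  then show ?case using 1 by (simp add: algebra_simps abs_le_iff)
 qed simp
 have "norm (x - y) \<le> real (nat \<lceil>norm (x - y)\<rceil>)" by linarith
 from step[OF this] have "\<bar>f x - f y\<bar> \<le> K * real (nat \<lceil>norm (x - y)\<rceil>)" .
 also have "\<dots> \<le> K * (1 + norm (x - y))"
 proof (intro mult_left_mono K0)
  show "real (nat \<lceil>norm (x - y)\<rceil>) \<le> 1 + norm (x - y)" using norm_ge_zero[of "x - y"] by linarith
 qed
 finally show ?thesis .
qed

text \<open>One sheet of a hyperboloid: slope at most \<open>La\<close> everywhere and second-order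
  bound La / rh. It outgrows any function of growth rate below \<open>La\<close> and is as flat as
  desired for large \<open>rh\<close>.\<close>

definition hyp :: "real => real => 'a::euclidean_space => real" where
 "hyp La rh z = La * sqrt (rh^2 + z \<bullet> z)"

lemma hyp_facts:
 fixes z :: "'a::euclidean_space"
 assumes L: "La > 0" and r: "rh > 0"
 shows "hyp La rh (z + h) \<le> hyp La rh z + ((La / sqrt (rh^2 + z \<bullet> z)) *R z) \<bullet> h + La / rh / 2 * (norm h)^2"
  "hyp La rh z \<ge> La * norm z" "hyp La rh z \<le> La * (rh + norm z)" "\<bar>hyp La rh z - hyp La rh w\<bar> \<le> La * norm (z - w)"
  "continuous_on S (hyp La rh)" "hyp La rh (- z) = hyp La rh z"
proof -
 define m where "m z = sqrt (rh^2 + z \<bullet> z)" for z :: 'a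
 have r2: "rh^2 > 0" using r by simp
 have mr: "m z \<ge> rh" and m2: "(m z)^2 = rh^2 + z \<bullet> z" and mn: "m z \<ge> norm z" for z
  unfolding m_def using r2 by (auto simp: real_le_rsqrt power2_norm_eq_inner[symmetric] intro: add_nonneg_nonneg less_imp_le)
 have m0: "m z > 0" for z using mr[of z] r by simp
 have "m (z + h) \<le> m z + (z \<bullet> h) / m z + (norm h)^2 / (2 * m z)"
 proof -
  have "(m (z + h))^2 = (m z)^2 + 2 * (z \<bullet> h) + (norm h)^2"
   unfolding m2 by (simp add: inner_add_left inner_add_right inner_commute power2_norm_eq_inner)
  moreover have "0 \<le> (m (z + h) - m z)^2" by simp
  ultimately have "2 * m z * m (z + h) \<le> 2 * (m z)^2 + 2 * (z \<bullet> h) + (norm h)^2" 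
   unfolding power2_diff mult.assoc mult.commute[of "m z" "m (z + h)"] by linarith
  also have "\<dots> = 2 * m z * (m z + (z \<bullet> h) / m z + (norm h)^2 / (2 * m z))"
   using m0[of z] by (simp add: power2_eq_square field_simps)
  finally show ?thesis using m0[of z] by simp
 qed
 also have "(norm h)^2 / (2 * m z) \<le> (norm h)^2 / (2 * rh)" using mr[of z] r m0[of z] by (intro divide_left_mono) auto
 finally have "La * m (z + h) \<le> La * (m z + (z \<bullet> h) / m z + (norm h)^2 / (2 * rh))" using L by simp
 then show "hyp La rh (z + h) \<le> hyp La rh z + ((La / sqrt (rh^2 + z \<bullet> z)) *R z) \<bullet> h + La / rh / 2 * (norm h)^2"
  unfolding hyp_def m_def[symmetric] by (simp add: distrib_left)
 show "hyp La rh z \<ge> La * norm z" unfolding hyp_def m_def[symmetric] using L mn by simp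
 have "m z \<le> rh + norm z"
 proof -
  have "(m z)^2 \<le> (rh + norm z)^2" unfolding m2 using r by (simp add: power2_norm_eq_inner[symmetric] power2_sum)
  then show ?thesis by (rule power2_le_imp_le) (use r in auto)
 qed
 then show "hyp La rh z \<le> La * (rh + norm z)" unfolding hyp_def m_def[symmetric] using L by simp
 have Lip: "m z - m w \<le> norm (z - w)" for z w
 proof -
  have "(m z)^2 \<le> (m w + norm (z - w))^2"
  proof -
   have "z \<bullet> z = w \<bullet> w + 2 * (w \<bullet> (z - w)) + (norm (z - w))^2"
    by (simp add: power2_norm_eq_inner inner_diff_left inner_diff_right inner_commute)
   moreover have "w \<bullet> (z - w) \<le> m w * norm (z - w)"
    using norm_cauchy_schwarz[of w "z - w"] mult_right_mono[OF mn[of w] norm_ge_zero[of "z - w"]] by linarith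
   ultimately show ?thesis using m2[of z] m2[of w] by (simp add: power2_sum)
  qed
  then have "m z \<le> m w + norm (z - w)" by (rule power2_le_imp_le) (simp add: add_nonneg_nonneg less_imp_le m0)
  then show ?thesis by simp
 qed
 have "\<bar>m z - m w\<bar> \<le> norm (z - w)" using Lip[of z w] Lip[of w z] by (simp add: abs_le_iff norm_minus_commute)
 then have "La * \<bar>m z - m w\<bar> \<le> La * norm (z - w)" using L by simp
 then show "\<bar>hyp La rh z - hyp La rh w\<bar> \<le> La * norm (z - w)"
  unfolding hyp_def m_def[symmetric] using L by (simp add: abs_mult right_diff_distrib[symmetric])
 show "continuous_on S (hyp La rh)" unfolding hyp_def[abs_def] by (intro continuous_intros)
 show "hyp La rh (- z) = hyp La rh z" by (simp add: hyp_def)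
qed

lemma inf_attained:
 fixes v :: "'a::euclidean_space => real"
 assumes cv: "continuous_on UNIV v" and k: "k > 0" "\<And>x. v x \<ge> k * norm x - C"
 obtains x0 where "\<And>x. v x0 \<le> v x"
proof -
 define r where "r = (\<bar>v 0\<bar> + \<bar>C\<bar>) / k + 1"
 have r: "r > 0" using k by (simp add: r_def add_nonneg_pos)
 obtain x0 where x0: "x0 \<in> cball 0 r" "\<And>x. x \<in> cball 0 r ==> v x0 \<le> v x"
  using continuous_attains_inf[of "cball 0 r" v] continuous_on_subset[OF cv] r by auto
 have "v x0 \<le> v x" for x
 proof (cases "norm x \<le> r")
  case False
  then have "k * r \<le> k * norm x" using k by simp
  moreover have "k * r = \<bar>v 0\<bar> + \<bar>C\<bar> + k" using k(1) unfolding r_def distrib_left by simp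
  ultimately have "v 0 \<le> v x" using k(1) k(2)[of x] by linarith
  moreover have "v x0 \<le> v 0" using x0(2)[of 0] r by simp
  ultimately show ?thesis by simp
 qed (use x0 in simp)
 then show ?thesis by (rule that)
qed

text \<open>\<open>B0\<close> records the bounded increments of \<open>f\<close> in the form of a
  linear growth bound at all scales.\<close>

locale curvature_problem =
 fixes F :: "real^'n => real" and f :: "real^'n => real" and R c B0 :: real
 assumes C1: "C1_on positive_cone F" and symF: "symmetric_on positive_cone F" and conc: "concave_on positive_cone F"
  and incr: "\<forall>s\<in>positive_cone. \<forall>j. partial_deriv j F s > 0"
  and convG: "convex_on positive_cone (\<lambda>s. F (\<chi> i. 1 / s $ i))"
  and contf: "continuous_on UNIV f" and R: "R > 0" and visc: "viscosity_solution F R c f"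
  and B0: "B0 \<ge> 0" "\<And>x y. \<bar>f x - f y\<bar> \<le> B0 * (1 + norm (x - y))"
begin

lemma ones_in [simp]: "ones \<in> positive_cone" by (simp add: positive_cone_def)

lemma F_diff: "s \<in> positive_cone ==> F differentiable (at s)" using C1 by (simp add: C1_on_def)

lemma F_cont: "s \<in> positive_cone ==> isCont F s"
 using F_diff differentiable_imp_continuous_within by blast

text \<open>Exchanging two coordinates fixes the point (1, ..., 1) and preserves F, so all partial
  derivatives there agree.\<close>

lemma dF_ones: obtains a where "a > 0" "(F has_derivative (\<lambda>v. a * (\<Sum>i\<in>UNIV. v $ i))) (at ones)"
proof -
 define D where "D = frechet_derivative F (at ones)"
 have D: "(F has_derivative D) (at ones)" unfolding D_def using F_diff[OF ones_in] frechet_derivative_works by blast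
 have lin: "linear D" using D by (rule has_derivative_linear)
 have same: "D (axis i 1) = D (axis j 1)" for i j :: 'n
 proof -
  define p where "p = Transposition.transpose i j"
  have p: "p permutes UNIV" unfolding p_def by (intro permutes_swap_id) auto
  define L where "L v = (\<chi> k. v $ p k)" for v :: "real^'n"
  have "linear L" by (auto simp: L_def linear_iff vec_eq_iff)
  then have "(L has_derivative L) (at ones)" by (rule linear_imp_has_derivative)
  moreover have "L ones = ones" by (simp add: L_def vec_eq_iff)
  ultimately have "((\<lambda>v. F (L v)) has_derivative (\<lambda>v. D (L v))) (at ones)"
   using has_derivative_compose[of L L ones UNIV F D] D by simp
  then have "(F has_derivative (\<lambda>v. D (L v))) (at ones)"
  proof (rule has_derivative_transform_within_open[OF _ open_positive_cone ones_in])
   fix v :: "real^'n" assume "v \<in> positive_cone"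
   then show "F (L v) = F v" using symF p by (simp add: symmetric_on_def L_def)
  qed
  then have "D (L (axis i 1)) = D (axis i 1)" using has_derivative_unique[OF D] by metis
  moreover have "L (axis i 1) = axis j 1"
   by (auto simp: L_def vec_eq_iff axis_def p_def Transposition.transpose_def)
  ultimately show ?thesis by simp
 qed
 define a where "a = D (axis undefined 1)"
 have pd: "partial_deriv j F ones = D (axis j 1)" for j by (simp add: partial_deriv_def D_def)
 have "a > 0" using incr ones_in pd[of undefined] unfolding a_def by metis
 moreover have "D v = a * (\<Sum>i\<in>UNIV. v $ i)" for v
 proof -
  have "D v = (\<Sum>i\<in>UNIV. v $ i * D (axis i 1))"
   by (subst vec_expand_axis[of v]) (simp add: linear_sum[OF lin] linear_scale[OF lin])
  also have "\<dots> = (\<Sum>i\<in>UNIV. v $ i * a)" unfolding a_def using same by (intro sum.cong) auto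
  finally show ?thesis by (simp add: sum_distrib_left mult.commute)
 qed
 then have "D = (\<lambda>v. a * (\<Sum>i\<in>UNIV. v $ i))" by auto
 ultimately show ?thesis using D that by blast
qed

lemma tangent_line_limit:
 fixes H :: "real^'n => real"
 assumes H: "(H has_derivative D) (at ones)" and le: "\<And>t. 0 < t ==> t < 1 ==> H (ones + t *R v) - H ones \<le> t * k"
 shows "D v \<le> k"
proof -
 have "((\<lambda>t. ones + t *R v) has_derivative (\<lambda>s. s *R v)) (at 0)" by (auto intro!: derivative_eq_intros)
 from has_derivative_compose[OF this, of H D] H
 have "((\<lambda>t. H (ones + t *R v)) has_derivative (\<lambda>s. D (s *R v))) (at 0)" by simp
 moreover have "D (s *R v) = D v * s" for s using has_derivative_linear[OF H] by (simp add: linear_scale)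
 ultimately have "((\<lambda>t. H (ones + t *R v)) has_real_derivative D v) (at 0)"
  by (simp add: has_field_derivative_def)
 then have "((\<lambda>t. (H (ones + t *R v) - H ones) / t) \<longlongrightarrow> D v) (at_right 0)"
  unfolding DERIV_def by (auto intro: tendsto_mono[OF at_le])
 moreover have "\<forall>\<^sub>F t in at_right 0. (H (ones + t *R v) - H ones) / t \<le> k"
  using eventually_at_right_real[OF zero_less_one]
  by eventually_elim (use le in \<open>auto simp: divide_le_eq mult.commute\<close>)
 ultimately show ?thesis by (intro tendsto_upperbound) auto
qed

text \<open>A concave F lies below its tangent at (1, ..., 1), whose linear part is a positive
  multiple of the sum of the coordinates.\<close>

lemma F_concave_at_ones:
 assumes s: "s \<in> positive_cone" and F: "F s \<ge> F ones"
 shows "(\<Sum>i\<in>UNIV. s $ i - 1) \<ge> 0"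
proof -
 obtain a where a: "a > 0" "(F has_derivative (\<lambda>v. a * (\<Sum>i\<in>UNIV. v $ i))) (at ones)" by (rule dF_ones)
 have "((\<lambda>v. - F v) has_derivative (\<lambda>v. - (a * (\<Sum>i\<in>UNIV. v $ i)))) (at ones)" by (rule has_derivative_minus[OF a(2)])
 then have "- (a * (\<Sum>i\<in>UNIV. (s - ones) $ i)) \<le> 0"
 proof (rule tangent_line_limit)
  fix t :: real assume t: "0 < t" "t < 1"
  have "F ((1 - t) *R ones + t *R s) \<ge> (1 - t) * F ones + t * F s"
   using concave_onD[OF conc, of t ones s] t s by simp
  moreover have "(1 - t) *R ones + t *R s = ones + t *R (s - ones)" by (simp add: algebra_simps)
  moreover have "(1 - t) * F ones + t * F s - F ones = t * (F s - F ones)" by (simp add: algebra_simps)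
  moreover have "t * (F s - F ones) \<ge> 0" using t F by simp
  ultimately show "- F (ones + t *R (s - ones)) - - F ones \<le> t * 0" by simp
 qed
 then show ?thesis using a(1) by (simp add: zero_le_mult_iff)
qed

text \<open>The dual argument: the convex G lies above its tangent at (1, ..., 1), and the inversion
  of the coordinates reverses the sign of the derivative.\<close>

lemma G_convex_at_ones:
 assumes s: "s \<in> positive_cone" and F: "F (\<chi> i. 1 / s $ i) \<le> F ones"
 shows "(\<Sum>i\<in>UNIV. s $ i - 1) \<ge> 0"
proof -
 obtain a where a: "a > 0" "(F has_derivative (\<lambda>v. a * (\<Sum>i\<in>UNIV. v $ i))) (at ones)" by (rule dF_ones)
 define I where "I v = (\<chi> i. 1 / v $ i)" for v :: "real^'n"
 have I1: "I ones = ones" by (simp add: I_def vec_eq_iff)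
 have "(I has_derivative (\<lambda>v. \<chi> i. - v $ i)) (at ones)"
  unfolding has_derivative_componentwise_within[of I]
 proof
  fix b :: "real^'n" assume "b \<in> Basis"
  then obtain i where b: "b = axis i 1" by (auto simp: Basis_vec_def)
  have "((\<lambda>s. 1 / s) has_real_derivative - 1) (at 1)" by (auto intro!: derivative_eq_intros)
  moreover have "((\<lambda>v. v $ i) has_derivative (\<lambda>v. v $ i)) (at (ones :: real^'n))"
   by (rule bounded_linear_imp_has_derivative[OF bounded_linear_vec_nth])
  ultimately have "((\<lambda>v. 1 / v $ i) has_derivative (\<lambda>v. (- 1) * v $ i)) (at (ones :: real^'n))"
   using has_derivative_compose[of "\<lambda>v. v $ i" "\<lambda>v. v $ i" ones UNIV "\<lambda>s. 1 / s" "(*) (- 1)"] by (simp add: has_field_derivative_def)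
  then show "((\<lambda>x. I x \<bullet> b) has_derivative (\<lambda>x. (\<chi> i. - x $ i) \<bullet> b)) (at ones)"
   by (simp add: b I_def inner_axis)
 qed
 moreover have "(F has_derivative (\<lambda>v. a * (\<Sum>i\<in>UNIV. v $ i))) (at (I ones))" using a(2) by (simp only: I1)
 ultimately
 have "((\<lambda>v. F (I v)) has_derivative (\<lambda>v. a * (\<Sum>i\<in>UNIV. (\<chi> i. - v $ i) $ i))) (at ones)" by (rule has_derivative_compose)
 then have "a * (\<Sum>i\<in>UNIV. (\<chi> i. - (s - ones) $ i) $ i) \<le> 0"
 proof (rule tangent_line_limit)
  fix t :: real assume t: "0 < t" "t < 1"
  have "F (I ((1 - t) *R ones + t *R s)) \<le> (1 - t) * F (I ones) + t * F (I s)"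
   using convex_onD[OF convG, of t ones s] t s by (simp add: I_def)
  moreover have "(1 - t) *R ones + t *R s = ones + t *R (s - ones)" by (simp add: algebra_simps)
  moreover have "(1 - t) * F (I ones) + t * F (I s) - F (I ones) = t * (F (I s) - F (I ones))" by (simp add: algebra_simps)
  moreover have "t * (F (I s) - F (I ones)) \<le> 0" using t F unfolding I1 by (simp add: I_def mult_nonneg_nonpos)
  ultimately show "F (I (ones + t *R (s - ones))) - F (I ones) \<le> t * 0" by simp
 qed
 then have "a * - (\<Sum>i\<in>UNIV. s $ i - 1) \<le> 0" by (simp add: sum_negf[symmetric])
 then show ?thesis using a(1) by (simp add: zero_le_mult_iff)
qed

text \<open>The paraboloid of the jet serves as test function, with the curvatures given by
  \<open>frame_principal_curvatures\<close>.\<close>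

lemma visc_super:
 assumes B: "selfadjoint B" and fr: "diag_frame p B e l" and lt: "\<And>i. R * (l i / sqrt (1 + p \<bullet> p)) < 1"
  and j: "de > 0" "\<And>h. norm h < de ==> f x0 + p \<bullet> h + (h \<bullet> B h) / 2 \<le> f (x0 + h)"
 shows "c \<le> F (\<chi> i. 1 - R * (l i / sqrt (1 + p \<bullet> p)))"
proof -
 have "\<forall>\<^sub>F x in nhds x0. f x - quad x0 (f x0) p B x \<ge> f x0 - quad x0 (f x0) p B x0"
  unfolding eventually_nhds_metric
 proof (intro exI[of _ de] conjI j(1) allI impI)
  fix x assume "dist x x0 < de"
  then show "f x0 - quad x0 (f x0) p B x0 \<le> f x - quad x0 (f x0) p B x"
   using j(2)[of "x - x0"] linear_0[OF selfadjointD(1)[OF B]] by (simp add: quad_def dist_norm)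
 qed
 then show ?thesis
  using visc[unfolded viscosity_solution_def, rule_format, OF quad_partial(4)[OF B] frame_principal_curvatures(1)[OF B fr]] lt
  by (auto simp: positive_cone_def)
qed

lemma visc_sub:
 assumes B: "selfadjoint B" and fr: "diag_frame p B e l" and lt: "\<And>i. R * (l i / sqrt (1 + p \<bullet> p)) < 1"
  and j: "de > 0" "\<And>h. norm h < de ==> f (x0 + h) \<le> f x0 + p \<bullet> h + (h \<bullet> B h) / 2"
 shows "F (\<chi> i. 1 - R * (l i / sqrt (1 + p \<bullet> p))) \<le> c"
proof -
 have "\<forall>\<^sub>F x in nhds x0. f x - quad x0 (f x0) p B x \<le> f x0 - quad x0 (f x0) p B x0"
  unfolding eventually_nhds_metric
 proof (intro exI[of _ de] conjI j(1) allI impI)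
  fix x assume "dist x x0 < de"
  then show "f x - quad x0 (f x0) p B x \<le> f x0 - quad x0 (f x0) p B x0"
   using j(2)[of "x - x0"] linear_0[OF selfadjointD(1)[OF B]] by (simp add: quad_def dist_norm)
 qed
 then show ?thesis
  using visc[unfolded viscosity_solution_def, rule_format, OF quad_partial(4)[OF B] frame_principal_curvatures(1)[OF B fr]] lt
  by (auto simp: positive_cone_def)
qed

lemma selfadjoint_scaled_id: "selfadjoint (\<lambda>h. k *R h)"
 by (auto simp: selfadjoint_def linear_iff algebra_simps)

text \<open>Hyperboloids steeper than the growth of \<open>f\<close> touch it from below and from
  above. The tangent paraboloids have curvatures at most La / rh in absolute value, so the argument
  of F is as close to (1, ..., 1) as desired, and continuity of F bounds c from both sides.\<close>

lemma c_eq: "c = F ones"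
proof -
 define N :: real where "N = CARD('n)"
 define La where "La = B0 + 1"
 have L: "La > 0" using B0 by (simp add: La_def)
 have grow: "\<bar>f x\<bar> \<le> B0 * norm x + (\<bar>f 0\<bar> + B0)" for x
  using B0(2)[of x 0] unfolding diff_zero distrib_left mult_1_right by linarith
 have small: "\<bar>l i / sqrt (1 + p \<bullet> p)\<bar> \<le> \<bar>k\<bar>" if "diag_frame p (\<lambda>h. k *R h) e l" for p e l k i
 proof -
  have "l i = k * (norm (e i))^2" using that by (auto simp: diag_frame_def power2_norm_eq_inner)
  then have "\<bar>l i\<bar> \<le> \<bar>k\<bar> * 1" using frame_norm_le_1[OF that, of i] by (simp add: abs_mult mult_left_le)
  then show ?thesis using sqrt_one_plus_inner(1)[of p] frac_le[of "\<bar>k\<bar>" "\<bar>l i\<bar>" 1 "sqrt (1 + p \<bullet> p)"] by (simp add: abs_divide)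
 qed
 have approx: "\<bar>c - F ones\<bar> \<le> \<eta>" if eta: "\<eta> > 0" for \<eta>
 proof -
  obtain d where d: "d > 0" "\<And>s. dist s ones < d ==> dist (F s) (F ones) < \<eta>"
   using F_cont[OF ones_in] eta unfolding continuous_at_eps_delta by blast
  \<comment> \<open>Large enough for R k < 1, which keeps the arguments in the cone, and for N R k <
    d, which keeps F within \<eta> of its value at (1, ..., 1).\<close>
  define rh where "rh = 2 * (La * R * (N + 1)) * (1 + 1 / d)"
  have N: "N > 0" by (simp add: N_def)
  have rho: "rh > 0" using L R N d by (simp add: rh_def add_pos_pos)
  define k where "k = La / rh"
  have k: "k > 0" "R * k < 1" "N * (R * k) < d"
  proof -
   show "k > 0" using L rho by (simp add: k_def)
   have ex: "rh = 2 * (La * R * N) + 2 * (La * R) + 2 * (La * R * N) / d + 2 * (La * R) / d"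
    unfolding rh_def by (simp add: field_simps)
   have "R * La < rh" unfolding ex using L R N d by (simp add: add_pos_pos mult.commute)
   then show "R * k < 1" using rho by (simp add: k_def)
   have "d * rh = 2 * (La * R * N) * d + 2 * (La * R) * d + 2 * (La * R * N) + 2 * (La * R)"
    unfolding ex using d by (simp add: field_simps)
   moreover have "N * R * La > 0" "La * R > 0" "(La * R * N) * d > 0" "(La * R) * d > 0" using L R N d by auto
   ultimately have "N * R * La < d * rh" by (simp add: mult_ac)
   then show "N * (R * k) < d" using rho by (simp add: k_def pos_divide_less_eq)
  qed
  have near: "dist (F (\<chi> i. 1 - R * (l i / sqrt (1 + p \<bullet> p)))) (F ones) < \<eta>" "R * (l i / sqrt (1 + p \<bullet> p)) < 1"
   if fr: "diag_frame p (\<lambda>h. k' *R h) e l" "\<bar>k'\<bar> = k" for k' p e l i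
  proof -
   have s: "\<bar>l i / sqrt (1 + p \<bullet> p)\<bar> \<le> k" for i using small[OF fr(1), of i] fr(2) by simp
   then have s': "R * \<bar>l i / sqrt (1 + p \<bullet> p)\<bar> \<le> R * k" for i using R by (intro mult_left_mono) auto
   have "norm ((\<chi> i. 1 - R * (l i / sqrt (1 + p \<bullet> p))) - ones) \<le> N * (R * k)"
    unfolding N_def by (rule norm_const_vec_le) (use s' R in \<open>simp add: abs_mult\<close>)
   then show "dist (F (\<chi> i. 1 - R * (l i / sqrt (1 + p \<bullet> p)))) (F ones) < \<eta>" using k(3) by (intro d(2)) (simp add: dist_norm)
   have "R * (l i / sqrt (1 + p \<bullet> p)) \<le> R * \<bar>l i / sqrt (1 + p \<bullet> p)\<bar>" using R by (intro mult_left_mono abs_ge_self) auto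
   then show "R * (l i / sqrt (1 + p \<bullet> p)) < 1" using s'[of i] k(2) by linarith
  qed
  note hf = hyp_facts[OF L rho]
  have "c \<le> F ones + \<eta>"
  proof -
   obtain x0 where x0: "\<And>x. f x0 + hyp La rh x0 \<le> f x + hyp La rh x"
   proof (rule inf_attained[of "\<lambda>x. f x + hyp La rh x" 1 "\<bar>f 0\<bar> + B0"])
    show "continuous_on UNIV (\<lambda>x. f x + hyp La rh x)" by (intro continuous_intros contf hf)
    show "1 * norm x - (\<bar>f 0\<bar> + B0) \<le> f x + hyp La rh x" for x
     using grow[of x] hf(2)[of x] by (simp add: La_def distrib_right abs_le_iff)
   qed auto
   define p where "p = - ((La / sqrt (rh^2 + x0 \<bullet> x0)) *R x0)"
   obtain e l where fr: "diag_frame p (\<lambda>h. (- k) *R h) e l" using diag_frame_exists[OF selfadjoint_scaled_id] by blast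
   have "c \<le> F (\<chi> i. 1 - R * (l i / sqrt (1 + p \<bullet> p)))"
   proof (rule visc_super[OF selfadjoint_scaled_id fr _ zero_less_one, of x0])
    show "R * (l i / sqrt (1 + p \<bullet> p)) < 1" for i using near(2)[OF fr] k by simp
    show "f x0 + p \<bullet> h + (h \<bullet> (- k) *R h) / 2 \<le> f (x0 + h)" for h
     using x0[of "x0 + h"] hf(1)[of x0 h] by (simp add: p_def k_def power2_norm_eq_inner)
   qed
   then show ?thesis using near(1)[OF fr] k by (simp add: dist_real_def abs_less_iff)
  qed
  moreover have "F ones - \<eta> \<le> c"
  proof -
   obtain x0 where x0: "\<And>x. - f x0 + hyp La rh x0 \<le> - f x + hyp La rh x"
   proof (rule inf_attained[of "\<lambda>x. - f x + hyp La rh x" 1 "\<bar>f 0\<bar> + B0"])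
    show "continuous_on UNIV (\<lambda>x. - f x + hyp La rh x)" by (intro continuous_intros contf hf)
    show "1 * norm x - (\<bar>f 0\<bar> + B0) \<le> - f x + hyp La rh x" for x
     using grow[of x] hf(2)[of x] by (simp add: La_def distrib_right abs_le_iff)
   qed auto
   define p where "p = (La / sqrt (rh^2 + x0 \<bullet> x0)) *R x0"
   obtain e l where fr: "diag_frame p (\<lambda>h. k *R h) e l" using diag_frame_exists[OF selfadjoint_scaled_id] by blast
   have "F (\<chi> i. 1 - R * (l i / sqrt (1 + p \<bullet> p))) \<le> c"
   proof (rule visc_sub[OF selfadjoint_scaled_id fr _ zero_less_one, of x0])
    show "R * (l i / sqrt (1 + p \<bullet> p)) < 1" for i using near(2)[OF fr] k by simp
    show "f (x0 + h) \<le> f x0 + p \<bullet> h + (h \<bullet> k *R h) / 2" for h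
     using x0[of "x0 + h"] hf(1)[of x0 h] by (simp add: p_def k_def power2_norm_eq_inner)
   qed
   then show ?thesis using near(1)[OF fr] k by (simp add: dist_real_def abs_less_iff)
  qed
  ultimately show ?thesis by (simp add: abs_le_iff)
 qed
 then have "\<bar>c - F ones\<bar> \<le> 0" by (rule field_le_epsilon[of _ 0, simplified])
 then show ?thesis by simp
qed

text \<open>R b < 1 puts the numbers 1 - R \<kappa> into the cone. The viscosity inequality then
  says F \<ge> c = F (1, ..., 1), and concavity turns this into a sign for the sum of the
  curvatures.\<close>

lemma f_jets:
 assumes j: "subjet f x0 p B" and b: "\<And>h. h \<bullet> B h \<le> b * (norm h)^2" "b \<ge> 0" "R * b < 1"
 shows "mcurv p B \<le> 0"
proof -
 have B: "selfadjoint B" using j by (simp add: subjet_def)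
 obtain e l where fr: "diag_frame p B e l" using diag_frame_exists[OF B] by blast
 define W where "W = sqrt (1 + p \<bullet> p)"
 have W: "W \<ge> 1" unfolding W_def by (rule sqrt_one_plus_inner)
 have lb: "l i / W \<le> b" for i
 proof -
  have "l i = e i \<bullet> B (e i)" using fr by (auto simp: diag_frame_def)
  also have "\<dots> \<le> b * (norm (e i))^2" by (rule b)
  also have "\<dots> \<le> b * 1" using b(2) frame_norm_le_1[OF fr] by (intro mult_left_mono) auto
  also have "\<dots> \<le> b * W" using b(2) W by (intro mult_left_mono) auto
  finally show ?thesis using W by (simp add: divide_le_eq)
 qed
 have lt: "R * (l i / W) < 1" for i using mult_left_mono[OF lb[of i], of R] R b(3) by simp
 obtain de where "de > 0" "\<And>h. norm h < de ==> f x0 + p \<bullet> h + (h \<bullet> B h) / 2 \<le> f (x0 + h)"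
  using j by (auto simp: subjet_def)
 from visc_super[OF B fr lt[unfolded W_def] this] have "F (\<chi> i. 1 - R * (l i / W)) \<ge> F ones" by (simp add: c_eq W_def)
 moreover have "(\<chi> i. 1 - R * (l i / W)) \<in> positive_cone" using lt by (simp add: positive_cone_def)
 ultimately have "0 \<le> (\<Sum>i\<in>UNIV. (\<chi> i. 1 - R * (l i / W)) $ i - 1)" by (rule F_concave_at_ones[rotated])
 also have "\<dots> = - (R / W) * (\<Sum>i\<in>UNIV. l i)" by (simp add: sum_negf sum_distrib_left)
 finally have "(R / W) * (\<Sum>i\<in>UNIV. l i) \<le> 0" by simp
 then have "(\<Sum>i\<in>UNIV. l i) \<le> 0" using R W by (simp add: mult_le_0_iff divide_le_0_iff)
 then show ?thesis using frame_principal_curvatures(2)[OF B fr] by simp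
qed

text \<open>A paraboloid above g at y0 is carried to one above \<open>f\<close> at the contact point
  z0 of the cap. Moving z0 by k and y0 by M k, the cap inequality bounds f (z0 + k) by a quadratic
  form in k, and M is chosen to minimise it. The eigenvalues become l_i / (1 + R' \<kappa>_i), the
  law of parallel surfaces. As R' tends to R, the arguments of F tend to 1 / (1 + R \<kappa>_i), and
  convexity of G applies.\<close>

lemma g_jets:
 assumes B: "selfadjoint B"
  and jet: "de0 > 0" "\<And>h. norm h < de0 ==> upper_envelope R f (y0 + h) \<le> upper_envelope R f y0 + p \<bullet> h + (h \<bullet> B h) / 2"
 shows "0 \<le> mcurv p B"
proof -
 define g where "g = upper_envelope R f"
 obtain z0 where z0: "norm (y0 - z0) \<le> R" "g y0 = f z0 + sqrt (R^2 - (norm (y0 - z0))\<^sup>2)"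
  using upper_envelope_ge(2)[OF contf, of y0 y0 R] R by (auto simp: g_def)
 note con = envelope_contact_slope[OF contf R B jet z0(1) z0(2)[unfolded g_def]]
 define w0 where "w0 = y0 - z0"
 define W where "W = sqrt (1 + p \<bullet> p)"
 define s0 where "s0 = sqrt (R^2 - (norm w0)\<^sup>2)"
 have w0: "norm w0 < R" using con(1) by (simp add: w0_def)
 have p: "p = (- 1 / s0) *R w0" using con(2) by (simp add: s0_def w0_def)
 have W: "W \<ge> 1" unfolding W_def by (rule sqrt_one_plus_inner)
 have strict: "0 \<le> mcurv p (\<lambda>h. B h + de *R h)" if del: "de > 0" for de
 proof -
  \<comment> \<open>The summand \<open>de\<close> makes all 1 + R \<kappa>_i strictly positive;
    contact with the cap alone gives only nonnegativity.\<close>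
  define B' where "B' h = B h + de *R h" for h
  have B': "selfadjoint B'"
   using B unfolding B'_def selfadjoint_def by (auto simp: linear_iff inner_add_left inner_add_right algebra_simps)
  have linB': "linear B'" by (rule selfadjointD(1)[OF B'])
  obtain e l where fr: "diag_frame p B' e l" using diag_frame_exists[OF B'] by blast
  define ka where "ka i = l i / W" for i
  have eT: "e i \<bullet> tilt p (e j) = (if i = j then 1 else 0)" for i j using fr by (auto simp: diag_frame_def)
  have kap: "1 + R * ka i > 0" for i
  proof -
   have "e i \<noteq> 0" using eT[of i i] by auto
   have "l i = e i \<bullet> B (e i) + de * (norm (e i))^2"
    using fr by (auto simp: diag_frame_def B'_def inner_add_right power2_norm_eq_inner)
   moreover have "- (W / R) * 1 \<le> e i \<bullet> B (e i)" using con(3)[of "e i"] eT[of i i] by (simp add: W_def)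
   moreover have "de * (norm (e i))^2 > 0" using del \<open>e i \<noteq> 0\<close> by simp
   ultimately have "- (W / R) < l i" by linarith
   then have "- 1 < R * l i / W" using R W by (simp add: field_simps)
   then show ?thesis by (simp add: ka_def)
  qed
  define S where "S R' = (\<chi> i. (1 + (R' - R) * ka i) / (1 + R' * ka i))" for R'
  \<comment> \<open>The paraboloid below the cap is available only for R' < R, so the inequality is
    proved for R' and passed to the limit afterwards.\<close>
  have claim: "F (S R') \<le> c" if R': "0 < R'" "R' < R" and pos: "\<And>i. 1 + R' * ka i > 0" "\<And>i. 1 + (R' - R) * ka i > 0" for R'
  proof -
   define a where "a = W / R'"
   have a: "a > 0" using W R' by (simp add: a_def)
   \<comment> \<open>The minimiser of m^2 l_i + a (m - 1)^2; \<open>\<mu> i\<close> is the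
     minimum.\<close>
   define m where "m i = 1 / (1 + R' * ka i)" for i
   define \<mu> where "\<mu> i = l i / (1 + R' * ka i)" for i
   have mu: "(m i)^2 * l i + a * (m i - 1)^2 = \<mu> i" for i
   proof -
    define q where "q = 1 + R' * ka i"
    have q: "q > 0" using pos(1) by (simp add: q_def)
    have lq: "l i = a * (q - 1)" using W R' by (simp add: q_def ka_def a_def)
    have m1: "m i = 1 / q" "m i - 1 = (1 - q) / q" using q by (auto simp: m_def q_def[symmetric] field_simps)
    have "(m i)^2 * l i + a * (m i - 1)^2 = (a * (q - 1) + a * (1 - q)^2) / q^2"
    proof -
     have "(m i - 1)^2 = (1 - q)^2 / q^2" by (simp only: m1(2) power_divide)
     moreover have "(m i)^2 = 1 / q^2" by (simp only: m1(1) power_divide power_one)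
     ultimately show ?thesis unfolding lq by (simp add: add_divide_distrib)
    qed
    also have "a * (q - 1) + a * (1 - q)^2 = a * (q - 1) * q" by (simp add: power2_eq_square algebra_simps)
    also have "\<dots> / q^2 = \<mu> i" using q by (simp add: \<mu>_def q_def[symmetric] lq power2_eq_square)
    finally show ?thesis .
   qed
   have ident: "1 - R * (\<mu> i / W) = (1 + (R' - R) * ka i) / (1 + R' * ka i)" for i
   proof -
    define q where "q = 1 + R' * ka i"
    have q: "q > 0" using pos(1) by (simp add: q_def)
    have "\<mu> i / W = l i / W / q" unfolding \<mu>_def q_def by (simp only: divide_divide_eq_left mult.commute)
    then have "1 - R * (\<mu> i / W) = (q - R * ka i) / q" using q by (simp add: ka_def diff_divide_distrib)
    then show ?thesis by (simp add: q_def left_diff_distrib)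
   qed
   define co where "co k i = k \<bullet> tilt p (e i)" for k i
   have expand: "k = (\<Sum>i\<in>UNIV. co k i *R e i)" for k unfolding co_def by (rule diag_frame_expand[OF fr])
   define M where "M k = (\<Sum>i\<in>UNIV. (m i * co k i) *R e i)" for k
   define D where "D k = (\<Sum>i\<in>UNIV. (\<mu> i * co k i) *R tilt p (e i))" for k
   have linM: "linear M" unfolding M_def co_def
    by (auto simp: linear_iff inner_add_left distrib_left scaleR_add_left sum.distrib scaleR_sum_right mult.left_commute)
   have D: "selfadjoint D"
    unfolding selfadjoint_def
   proof (intro conjI allI)
    show "linear D" unfolding D_def co_def
     by (auto simp: linear_iff inner_add_left distrib_left scaleR_add_left sum.distrib scaleR_sum_right mult.left_commute)
    show "D h \<bullet> k = h \<bullet> D k" for h k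
     unfolding D_def co_def inner_sum_left inner_sum_right by (intro sum.cong) (auto simp: inner_commute)
   qed
   have frD: "diag_frame p D e \<mu>"
    unfolding diag_frame_def
   proof (intro conjI allI eT)
    fix i j
    have "e i \<bullet> D (e j) = (\<Sum>k\<in>UNIV. if k = j then (if i = j then \<mu> j else 0) else 0)"
     unfolding D_def co_def inner_sum_right by (intro sum.cong) (auto simp: eT)
    then show "e i \<bullet> D (e j) = (if i = j then \<mu> i else 0)" by simp
   qed
   have quadM: "M k \<bullet> B' (M k) + a * ((M k - k) \<bullet> tilt p (M k - k)) = k \<bullet> D k" for k
   proof -
    have "M k - k = (\<Sum>i\<in>UNIV. ((m i - 1) * co k i) *R e i)"
     by (subst (2) expand[of k]) (simp add: M_def sum_subtractf[symmetric] scaleR_diff_left[symmetric] left_diff_distrib)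
    then have 1: "(M k - k) \<bullet> tilt p (M k - k) = (\<Sum>i\<in>UNIV. 1 * ((m i - 1) * co k i)^2)"
     using frame_quadratic[OF tilt_simps(1) frame_tilt[OF fr], of "\<lambda>i. (m i - 1) * co k i"] by simp
    have 2: "M k \<bullet> B' (M k) = (\<Sum>i\<in>UNIV. l i * (m i * co k i)^2)"
     unfolding M_def by (rule frame_quadratic[OF linB' fr])
    have 3: "k \<bullet> D k = (\<Sum>i\<in>UNIV. \<mu> i * (co k i)^2)"
     using frame_quadratic[OF selfadjointD(1)[OF D] frD, of "co k"] expand[of k] by simp
    have "M k \<bullet> B' (M k) + a * ((M k - k) \<bullet> tilt p (M k - k)) = (\<Sum>i\<in>UNIV. ((m i)^2 * l i + a * (m i - 1)^2) * (co k i)^2)"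
     unfolding 1 2 sum_distrib_left sum.distrib[symmetric]
     by (intro sum.cong refl) (simp add: power_mult_distrib distrib_right distrib_left mult_ac)
    then show ?thesis unfolding mu 3 .
   qed
   obtain d where d: "d > 0" "\<And>\<eta>. norm \<eta> < d ==> norm (w0 + \<eta>) \<le> R \<and>
     s0 + p \<bullet> \<eta> - W / R' / 2 * (\<eta> \<bullet> tilt p \<eta>) \<le> sqrt (R^2 - (norm (w0 + \<eta>))\<^sup>2)"
    using spherical_cap_lower_bound[OF w0 R'] unfolding s0_def[symmetric] p[symmetric] W_def[symmetric] by blast
   obtain b where b: "b > 0" "\<And>x. norm (M x) \<le> b * norm x" using linear_bounded_pos[OF linM] by blast
   define dd where "dd = min de0 d / (b + 1)"
   have dd: "dd > 0" using d(1) jet(1) b(1) by (simp add: dd_def)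
   have "F (\<chi> i. 1 - R * (\<mu> i / sqrt (1 + p \<bullet> p))) \<le> c"
   proof (rule visc_sub[OF D frD _ dd, of z0])
    fix i
    have "1 - R * (\<mu> i / W) > 0" unfolding ident using pos[of i] by simp
    then show "R * (\<mu> i / sqrt (1 + p \<bullet> p)) < 1" by (simp add: W_def)
   next
    fix k :: "real^'n" assume k: "norm k < dd"
    have kb: "(b + 1) * norm k < min de0 d" using k b(1) by (simp add: dd_def pos_less_divide_eq mult.commute)
    then have kb: "b * norm k + norm k < de0" "b * norm k + norm k < d" by (auto simp: distrib_right)
    have Mk: "norm (M k) < de0" using kb(1) b(2)[of k] norm_ge_zero[of k] by linarith
    have eta: "norm (M k - k) < d" using kb(2) b(2)[of k] norm_triangle_ineq4[of "M k" k] by linarith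
    have eq: "y0 + M k - (z0 + k) = w0 + (M k - k)" by (simp add: w0_def algebra_simps)
    have "f (z0 + k) + sqrt (R^2 - (norm (w0 + (M k - k)))\<^sup>2) \<le> g (y0 + M k)"
     using upper_envelope_ge(1)[OF contf, of "y0 + M k" "z0 + k" R] d(2)[OF eta] unfolding eq g_def by simp
    moreover have "g (y0 + M k) \<le> g y0 + p \<bullet> M k + (M k \<bullet> B (M k)) / 2" using jet(2)[OF Mk] by (simp add: g_def)
    moreover have "M k \<bullet> B (M k) \<le> M k \<bullet> B' (M k)" using del by (simp add: B'_def inner_add_right)
    moreover have "s0 + p \<bullet> (M k - k) - a / 2 * ((M k - k) \<bullet> tilt p (M k - k)) \<le> sqrt (R^2 - (norm (w0 + (M k - k)))\<^sup>2)"
     using d(2)[OF eta] by (simp add: a_def)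
    moreover have "g y0 = f z0 + s0" using z0(2) by (simp add: s0_def w0_def)
    ultimately show "f (z0 + k) \<le> f z0 + p \<bullet> k + (k \<bullet> D k) / 2"
     using quadM[of k] unfolding inner_diff_right[of p] by linarith
   qed
   moreover have "(\<chi> i. 1 - R * (\<mu> i / sqrt (1 + p \<bullet> p))) = S R'"
    unfolding S_def W_def[symmetric] ident ..
   ultimately show ?thesis by simp
  qed
  have ev: "\<forall>\<^sub>F R' in at_left R. F (S R') \<le> c"
  proof -
   have "\<forall>\<^sub>F R' in at_left R. \<forall>i. 1 + R' * ka i > 0"
   proof (rule eventually_all_finite)
    fix i
    have "((\<lambda>R'. 1 + R' * ka i) \<longlongrightarrow> 1 + R * ka i) (at_left R)" by (intro tendsto_intros)
    then show "\<forall>\<^sub>F R' in at_left R. 1 + R' * ka i > 0" using kap by (rule order_tendstoD)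
   qed
   moreover have "\<forall>\<^sub>F R' in at_left R. \<forall>i. 1 + (R' - R) * ka i > 0"
   proof (rule eventually_all_finite)
    fix i
    have "((\<lambda>R'. 1 + (R' - R) * ka i) \<longlongrightarrow> 1 + (R - R) * ka i) (at_left R)" by (intro tendsto_intros)
    then show "\<forall>\<^sub>F R' in at_left R. 1 + (R' - R) * ka i > 0" by (rule order_tendstoD) simp
   qed
   ultimately show ?thesis using eventually_at_left_real[OF R]
    by eventually_elim (use claim in auto)
  qed
  define T where "T = (\<chi> i. 1 + R * ka i)"
  have T: "T \<in> positive_cone" using kap by (simp add: T_def positive_cone_def)
  have SR: "S R = (\<chi> i. 1 / T $ i)" by (simp add: S_def T_def)
  have inv: "(\<chi> i. 1 / T $ i) \<in> positive_cone" using kap by (simp add: T_def positive_cone_def)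
  have "(S \<longlongrightarrow> S R) (at_left R)"
   unfolding S_def by (intro tendsto_vec_lambda tendsto_intros) (use kap in \<open>auto simp: less_imp_neq[symmetric]\<close>)
  then have "((\<lambda>R'. F (S R')) \<longlongrightarrow> F (S R)) (at_left R)"
   using F_cont[OF inv] unfolding SR[symmetric] by (rule isCont_tendsto_compose[rotated])
  then have "F (S R) \<le> c" using ev by (intro tendsto_upperbound) auto
  then have "F (\<chi> i. 1 / T $ i) \<le> F ones" by (simp add: SR c_eq)
  from G_convex_at_ones[OF T this] have "0 \<le> R / W * (\<Sum>i\<in>UNIV. l i)"
   by (simp add: T_def ka_def sum_distrib_left)
  then have "0 \<le> (\<Sum>i\<in>UNIV. l i)" using R W by (simp add: zero_le_mult_iff zero_le_divide_iff)
  then show ?thesis using frame_principal_curvatures(2)[OF B' fr] by (simp add: B'_def[abs_def])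
 qed
 have "\<forall>\<^sub>F de in at_right 0. 0 \<le> mcurv p B + de * mcurv p (\<lambda>h. h)"
  using eventually_at_right_less[of "0::real"]
  by eventually_elim (use strict mcurv_add[of p B] mcurv_scale[of p _ "\<lambda>h. h"] in simp)
 moreover have "((\<lambda>de. mcurv p B + de * mcurv p (\<lambda>h. h)) \<longlongrightarrow> mcurv p B + 0 * mcurv p (\<lambda>h. h)) (at_right 0)"
  by (intro tendsto_intros)
 ultimately have "0 \<le> mcurv p B + 0 * mcurv p (\<lambda>h. h)" by (intro tendsto_lowerbound) auto
 then show ?thesis by simp
qed

end

section \<open>Inf-convolutions and growth of entire solutions\<close>

lemma superclass_translate:
 assumes u: "superclass La C u"
 shows "superclass La C (\<lambda>x. u (x + \<xi>) + k)"
 unfolding superclass_def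
proof (intro conjI allI impI)
 show "0 \<le> La" "0 \<le> C" using superclassD(1,2)[OF u] .
 show "\<bar>u (x + \<xi>) + k - (u (y + \<xi>) + k)\<bar> \<le> La * norm (x - y)" for x y
  using superclassD(3)[OF u, of "x + \<xi>" "y + \<xi>"] by simp
 show "semiconcave C (\<lambda>x. u (x + \<xi>) + k)"
  unfolding semiconcave_def
 proof (intro allI impI)
  fix x h :: 'a and t :: real assume t: "0 \<le> t" "t \<le> 1"
  have e: "x + h + \<xi> = (x + \<xi>) + h" "x + t *R h + \<xi> = (x + \<xi>) + t *R h" by simp_all
  have "u (x + \<xi>) + t * (u ((x + \<xi>) + h) - u (x + \<xi>)) \<le> u ((x + \<xi>) + t *R h) + C / 2 * t * (1 - t) * (norm h)^2"
   using superclassD(4)[OF u] t unfolding semiconcave_def by blast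
  then show "u (x + \<xi>) + k + t * (u (x + h + \<xi>) + k - (u (x + \<xi>) + k)) \<le> u (x + t *R h + \<xi>) + k + C / 2 * t * (1 - t) * (norm h)^2"
   unfolding e by simp
 qed
 fix x p B assume "subjet (\<lambda>x. u (x + \<xi>) + k) x p B"
 then have "subjet u (x + \<xi>) p B" unfolding subjet_def by (simp add: add.commute add.left_commute)
 then show "mcurv p B \<le> 0" by (rule superclassD(5)[OF u])
qed

lemma superclass_affine:
 fixes a :: "'a::euclidean_space"
 assumes a: "norm a \<le> La"
 shows "superclass La 0 (\<lambda>x. a \<bullet> x + k)"
 unfolding superclass_def
proof (intro conjI allI impI)
 show "0 \<le> La" using a norm_ge_zero[of a] by linarith
 show "\<bar>a \<bullet> x + k - (a \<bullet> y + k)\<bar> \<le> La * norm (x - y)" for x y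
 proof -
  have "a \<bullet> x + k - (a \<bullet> y + k) = a \<bullet> (x - y)" by (simp add: inner_diff_right)
  moreover have "\<bar>a \<bullet> (x - y)\<bar> \<le> norm a * norm (x - y)" by (rule Cauchy_Schwarz_ineq2)
  moreover have "norm a * norm (x - y) \<le> La * norm (x - y)" using a by (intro mult_right_mono) auto
  ultimately show ?thesis by linarith
 qed
 show sc: "semiconcave 0 (\<lambda>x. a \<bullet> x + k)" by (simp add: semiconcave_def inner_add_right)
 fix x p B assume j: "subjet (\<lambda>x. a \<bullet> x + k) x p B"
 then have B: "selfadjoint B" by (simp add: subjet_def)
 show "mcurv p B \<le> 0" using mcurv_le_bound[OF B subjet_hessian_le[OF sc j]] by simp
qed simp

definition infconv :: "real => real => ('a::euclidean_space => real) => 'a => real" where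
 "infconv ka rh v x = (INF y. v y + hyp ka rh (x - y))"

section \<open>Inf-convolution with a hyperboloid\<close>

context
 fixes v :: "'a::euclidean_space => real" and B0 ka rh :: real
 assumes cv: "continuous_on UNIV v" and grow: "\<And>x y. \<bar>v x - v y\<bar> \<le> B0 * (1 + norm (x - y))"
  and B0: "0 \<le> B0" "B0 < ka" and rh: "0 < rh"
begin

lemma kappa_pos: "ka > 0" using B0 by simp

lemma infconv_attained:
 obtains y where "infconv ka rh v x = v y + hyp ka rh (x - y)" "\<And>y. infconv ka rh v x \<le> v y + hyp ka rh (x - y)"
proof -
 have c: "continuous_on UNIV (\<lambda>y. v y + hyp ka rh (x - y))"
  unfolding hyp_def by (intro continuous_intros cv)
 have "(ka - B0) * norm y - (\<bar>v 0\<bar> + B0 + ka * norm x) \<le> v y + hyp ka rh (x - y)" for y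
 proof -
  have "\<bar>v y - v 0\<bar> \<le> B0 * (1 + norm y)" using grow[of y 0] by simp
  moreover have "ka * (norm y - norm x) \<le> ka * norm (x - y)"
   using kappa_pos norm_triangle_ineq2[of y x] by (intro mult_left_mono) (auto simp: norm_minus_commute)
  moreover have "ka * norm (x - y) \<le> hyp ka rh (x - y)" by (rule hyp_facts(2)[OF kappa_pos rh])
  ultimately show ?thesis unfolding left_diff_distrib right_diff_distrib distrib_left by linarith
 qed
 then obtain y where y: "\<And>z. v y + hyp ka rh (x - y) \<le> v z + hyp ka rh (x - z)"
  using inf_attained[OF c, of "ka - B0"] B0 by (metis diff_gt_0_iff_gt)
 have "infconv ka rh v x = v y + hyp ka rh (x - y)"
  unfolding infconv_def by (rule cInf_eq_minimum) (use y in auto)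
 then show ?thesis using that y by simp
qed

lemma infconv_le: "infconv ka rh v x \<le> v y + hyp ka rh (x - y)"
 using infconv_attained[of x] by metis

lemma infconv_close: "\<bar>infconv ka rh v x - v x\<bar> \<le> B0 + ka * rh"
proof -
 obtain y where y: "infconv ka rh v x = v y + hyp ka rh (x - y)" using infconv_attained[of x] by metis
 have "\<bar>v x - v y\<bar> \<le> B0 * (1 + norm (x - y))" by (rule grow)
 moreover have "ka * norm (x - y) \<le> hyp ka rh (x - y)" by (rule hyp_facts(2)[OF kappa_pos rh])
 moreover have "B0 * norm (x - y) \<le> ka * norm (x - y)" using B0 by (intro mult_right_mono) auto
 moreover have "infconv ka rh v x \<le> v x + hyp ka rh (x - x)" by (rule infconv_le)
 moreover have "hyp ka rh (x - x) = ka * rh" using rh by (simp add: hyp_def)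
 moreover have "ka * rh \<ge> 0" using kappa_pos rh by simp
 ultimately show ?thesis using y B0(1) unfolding distrib_left mult_1_right by linarith
qed

lemma hyp_min: "ka * rh \<le> hyp ka rh z"
proof -
 have "rh \<le> sqrt (rh^2 + z \<bullet> z)" by (rule real_le_rsqrt) simp
 then show ?thesis using kappa_pos by (simp add: hyp_def)
qed

text \<open>The hyperboloid is at least ka rh, with equality at 0, so the infimum of v is shifted by
  exactly this amount.\<close>

lemma infconv_infimum:
 assumes "\<And>y. i \<le> v y" "\<And>e. e > 0 ==> \<exists>y. v y < i + e"
 shows "i + ka * rh \<le> infconv ka rh v x" "e > 0 ==> \<exists>y. infconv ka rh v y < i + ka * rh + e"
proof -
 obtain y where "infconv ka rh v x = v y + hyp ka rh (x - y)" using infconv_attained[of x] by metis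
 then show "i + ka * rh \<le> infconv ka rh v x" using assms(1)[of y] hyp_min[of "x - y"] by linarith
next
 assume "e > 0"
 then obtain y where "v y < i + e" using assms(2) by blast
 moreover have "infconv ka rh v y \<le> v y + hyp ka rh (y - y)" by (rule infconv_le)
 moreover have "hyp ka rh (y - y) = ka * rh" using rh by (simp add: hyp_def)
 ultimately show "\<exists>y. infconv ka rh v y < i + ka * rh + e" by (intro exI[of _ y]) linarith
qed

text \<open>A minimising y transplants a subjet at x to a subjet of v at y with the same slope and
  Hessian. Semiconcavity bounds this Hessian by ka / rh, so only such jets have to be tested. The
  supersolution property belongs to v + a \<bullet> x while infima are needed for v; restoring the
  linear function after the convolution serves both.\<close>

lemma infconv_superclass:
 assumes jets: "\<And>x p B. subjet (\<lambda>x. v x + a \<bullet> x) x p B ==> (\<And>h. h \<bullet> B h \<le> ka / rh * (norm h)^2) ==> mcurv p B \<le> 0"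
 shows "superclass (ka + norm a) (ka / rh) (\<lambda>x. infconv ka rh v x + a \<bullet> x)"
 unfolding superclass_def
proof (intro conjI allI impI)
 let ?I = "infconv ka rh v"
 show "0 \<le> ka + norm a" using kappa_pos by (simp add: add_nonneg_nonneg)
 show "0 \<le> ka / rh" using kappa_pos rh by simp
 have le: "?I x - ?I y \<le> ka * norm (x - y)" for x y
 proof -
  obtain z where z: "?I y = v z + hyp ka rh (y - z)" using infconv_attained[of y] by metis
  have "\<bar>hyp ka rh (x - z) - hyp ka rh (y - z)\<bar> \<le> ka * norm ((x - z) - (y - z))" by (rule hyp_facts(4)[OF kappa_pos rh])
  moreover have "(x - z) - (y - z) = x - y" by simp
  ultimately show ?thesis using infconv_le[of x z] z by (simp only:)
 qed
 show "\<bar>?I x + a \<bullet> x - (?I y + a \<bullet> y)\<bar> \<le> (ka + norm a) * norm (x - y)" for x y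
 proof -
  have "\<bar>a \<bullet> (x - y)\<bar> \<le> norm a * norm (x - y)" by (rule Cauchy_Schwarz_ineq2)
  moreover have "a \<bullet> (x - y) = a \<bullet> x - a \<bullet> y" by (rule inner_diff_right)
  ultimately show ?thesis using le[of x y] le[of y x] unfolding distrib_right norm_minus_commute[of y x] by linarith
 qed
 show sc: "semiconcave (ka / rh) (\<lambda>x. ?I x + a \<bullet> x)"
  unfolding semiconcave_def
 proof (intro allI impI)
  fix x h :: 'a and t :: real assume t: "0 \<le> t" "t \<le> 1"
  define Z where "Z = x + t *R h"
  obtain y where y: "?I Z = v y + hyp ka rh (Z - y)" using infconv_attained[of Z] by metis
  define D where "D = (ka / sqrt (rh^2 + (Z - y) \<bullet> (Z - y))) *R (Z - y)"
  have q: "?I (Z + k) \<le> ?I Z + D \<bullet> k + ka / rh / 2 * (norm k)^2" for k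
  proof -
   have e: "Z + k - y = (Z - y) + k" by simp
   show ?thesis using infconv_le[of "Z + k" y, unfolded e] hyp_facts(1)[OF kappa_pos rh, of "Z - y" k, folded D_def] y by linarith
  qed
  have x: "x = Z + (- t) *R h" "x + h = Z + (1 - t) *R h" by (auto simp: Z_def algebra_simps)
  have 1: "?I x \<le> ?I Z - t * (D \<bullet> h) + ka / rh / 2 * (t^2 * (norm h)^2)"
   using q[of "(- t) *R h"] unfolding x(1)[symmetric] by (simp add: power_mult_distrib)
  have 2: "?I (x + h) \<le> ?I Z + (1 - t) * (D \<bullet> h) + ka / rh / 2 * ((1 - t)^2 * (norm h)^2)"
   using q[of "(1 - t) *R h"] unfolding x(2)[symmetric] by (simp add: power_mult_distrib)
  have "?I x + t * (?I (x + h) - ?I x) = (1 - t) * ?I x + t * ?I (x + h)" by (simp add: algebra_simps)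
  also have "\<dots> \<le> (1 - t) * (?I Z - t * (D \<bullet> h) + ka / rh / 2 * (t^2 * (norm h)^2))
    + t * (?I Z + (1 - t) * (D \<bullet> h) + ka / rh / 2 * ((1 - t)^2 * (norm h)^2))"
   using 1 2 t by (intro add_mono mult_left_mono) auto
  also have "\<dots> = ?I Z + ka / rh / 2 * t * (1 - t) * (norm h)^2"
  proof -
   have "(1 - t) * (I - t * E + K * (t^2 * n)) + t * (I + (1 - t) * E + K * ((1 - t)^2 * n)) = I + K * t * (1 - t) * n"
    for I E K n :: real by (simp add: power2_eq_square algebra_simps)
   then show ?thesis .
  qed
  finally show "?I x + a \<bullet> x + t * (?I (x + h) + a \<bullet> (x + h) - (?I x + a \<bullet> x))
    \<le> ?I (x + t *R h) + a \<bullet> (x + t *R h) + ka / rh / 2 * t * (1 - t) * (norm h)^2"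
   unfolding Z_def[symmetric] by (simp add: inner_add_right Z_def algebra_simps)
 qed
 fix x p B assume j: "subjet (\<lambda>x. ?I x + a \<bullet> x) x p B"
 obtain y where y: "?I x = v y + hyp ka rh (x - y)" using infconv_attained[of x] by metis
 have "subjet (\<lambda>x. v x + a \<bullet> x) y p B"
  unfolding subjet_def
 proof (intro conjI)
  show "selfadjoint B" using j by (simp add: subjet_def)
  obtain de where d: "de > 0" "\<And>h. norm h < de ==> ?I x + a \<bullet> x + p \<bullet> h + (h \<bullet> B h) / 2 \<le> ?I (x + h) + a \<bullet> (x + h)"
   using j by (auto simp: subjet_def)
  show "\<exists>de>0. \<forall>h. norm h < de --> v y + a \<bullet> y + p \<bullet> h + (h \<bullet> B h) / 2 \<le> v (y + h) + a \<bullet> (y + h)"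
  proof (intro exI[of _ de] conjI allI impI d(1))
   fix h :: 'a assume "norm h < de"
   from d(2)[OF this] have "?I x + a \<bullet> x + p \<bullet> h + (h \<bullet> B h) / 2 \<le> ?I (x + h) + a \<bullet> (x + h)" .
   moreover have "?I (x + h) \<le> v (y + h) + hyp ka rh (x - y)" using infconv_le[of "x + h" "y + h"] by simp
   ultimately show "v y + a \<bullet> y + p \<bullet> h + (h \<bullet> B h) / 2 \<le> v (y + h) + a \<bullet> (y + h)"
    using y unfolding inner_add_right by linarith
  qed
 qed
 then show "mcurv p B \<le> 0" using subjet_hessian_le[OF sc j] by (rule jets)
qed

end

text \<open>By weak Harnack each condition fails on less than the fraction \<theta> = 1 / (card I +
  1) of a large ball, so the exceptional sets cannot cover the ball.\<close>

lemma common_near_minimum: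
 fixes u v :: "'i => 'a::euclidean_space => real"
 assumes I: "finite I"
  and u: "\<And>i. i \<in> I ==> superclass La (C1 i) (u i)" and v: "\<And>i. i \<in> I ==> superclass La (C2 i) (v i)"
  and lo: "\<And>i x. i \<in> I ==> m i \<le> u i x + v i x"
  and inf: "\<And>i e. i \<in> I ==> e > 0 ==> \<exists>x. u i x + v i x < m i + e" and eta: "\<eta> > 0"
 obtains x where "\<And>i. i \<in> I ==> u i x + v i x \<le> m i + \<eta>"
proof -
 define \<theta> where "\<theta> = 1 / (real (card I) + 1)"
 have theta: "\<theta> > 0" by (simp add: \<theta>_def add_nonneg_pos)
 define E where "E i r = {x \<in> ball 0 r. u i x + (v i x - m i) > \<eta>}" for i r
 have "\<exists>r0>0. \<forall>r\<ge>r0. measure lborel (E i r) < \<theta> * measure lborel (ball (0::'a) r)" if i: "i \<in> I" for i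
 proof -
  have v': "superclass La (C2 i) (\<lambda>x. v i x - m i)" using superclass_translate[OF v[OF i], of 0 "- m i"] by simp
  have pos: "0 \<le> u i x + (v i x - m i)" for x using lo[OF i, of x] by linarith
  have small: "\<exists>x. u i x + (v i x - m i) < e" if "e > 0" for e using inf[OF i that] by (simp add: algebra_simps)
  obtain r0 where "r0 > 0" "\<And>r. r \<ge> r0 ==> measure lborel {x \<in> ball 0 r. u i x + (v i x - m i) > \<eta>} < \<theta> * measure lborel (ball (0::'a) r)"
   using superclass_sum_measure[OF u[OF i] v' pos small eta theta] by blast
  then show ?thesis unfolding E_def by blast
 qed
 then obtain r0 where r0: "\<And>i. i \<in> I ==> r0 i > 0"
   "\<And>i r. i \<in> I ==> r \<ge> r0 i ==> measure lborel (E i r) < \<theta> * measure lborel (ball (0::'a) r)" by metis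
 define r where "r = 1 + (\<Sum>i\<in>I. r0 i)"
 have r: "r \<ge> r0 i" if "i \<in> I" for i
  using member_le_sum[OF that, of r0] I r0(1) unfolding r_def by (simp add: less_imp_le add_increasing)
 have "0 \<le> (\<Sum>i\<in>I. r0 i)" by (intro sum_nonneg less_imp_le r0(1))
 then have rpos: "r > 0" by (simp add: r_def)
 define b where "b = measure lborel (ball (0::'a) r)"
 have b: "b > 0" unfolding b_def using rpos by (simp add: content_ball_pos)
 have op: "E i r \<in> sets lborel" if i: "i \<in> I" for i
 proof -
  have "E i r = ball 0 r \<inter> {x. \<eta> < u i x + (v i x - m i)}" by (auto simp: E_def)
  moreover have "open {x. \<eta> < u i x + (v i x - m i)}"
   by (intro open_Collect_less continuous_intros superclass_continuous[OF u[OF i]] superclass_continuous[OF v[OF i]])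
  ultimately show ?thesis by simp
 qed
 have "\<exists>x. \<forall>i\<in>I. u i x + v i x \<le> m i + \<eta>"
 proof (rule ccontr)
  assume neg: "\<not> ?thesis"
  have "\<exists>i\<in>I. x \<in> E i r" if "x \<in> ball 0 r" for x
  proof -
   obtain i where "i \<in> I" "\<not> u i x + v i x \<le> m i + \<eta>" using neg by blast
   then have "x \<in> E i r" using that unfolding E_def by (simp add: not_le)
   then show ?thesis using \<open>i \<in> I\<close> by blast
  qed
  then have "ball 0 r = (\<Union>i\<in>I. E i r)" by (auto simp: E_def)
  then have "b = measure lborel (\<Union>i\<in>I. E i r)" by (simp add: b_def)
  also have "\<dots> \<le> (\<Sum>i\<in>I. measure lborel (E i r))" by (rule measure_UNION_le[OF I op])
  also have "\<dots> \<le> (\<Sum>i\<in>I. \<theta> * b)" unfolding b_def by (intro sum_mono less_imp_le r0(2) r)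
  also have "\<dots> = (real (card I) * \<theta>) * b" by simp
  also have "\<dots> < 1 * b" using b by (intro mult_strict_right_mono) (auto simp: \<theta>_def divide_less_eq add_nonneg_pos)
  finally show False by simp
 qed
 then show ?thesis using that by blast
qed

text \<open>Let m True and m False be the infima of v (x + \<xi>) + w x and of v x + w (x + \<xi>).
  Both sums are almost minimal at a common point, where adding them and regrouping gives m True + m
  False \<ge> - 2 K. Each increment of v by \<xi> lies between m True - K and K - m False, an
  interval of length at most 4 K.\<close>

lemma translates_almost_additive:
 fixes v w :: "'a::euclidean_space => real"
 assumes v: "superclass La C1 v" and w: "superclass La C2 w" and K: "\<And>x. \<bar>v x + w x\<bar> \<le> K"
 shows "\<bar>(v (x + \<xi>) - v x) - (v (y + \<xi>) - v y)\<bar> \<le> 4 * K"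
proof -
 \<comment> \<open>The Boolean selects which of the two functions is translated.\<close>
 define s where "s b = (if b then \<xi> else 0)" for b
 define U where "U b x = v (x + s b)" for b x
 define V where "V b x = w (x + s (\<not> b))" for b x
 define m where "m b = (INF x. U b x + V b x)" for b
 have below: "- K - La * norm \<xi> \<le> U b x + V b x" for b x
 proof -
  have "\<bar>v (x + s b) - v (x + s (\<not> b))\<bar> \<le> La * norm ((x + s b) - (x + s (\<not> b)))" by (rule superclassD(3)[OF v])
  moreover have "norm ((x + s b) - (x + s (\<not> b))) = norm \<xi>" by (simp add: s_def)
  moreover have "\<bar>v (x + s (\<not> b)) + w (x + s (\<not> b))\<bar> \<le> K" by (rule K)
  ultimately show ?thesis unfolding U_def V_def by (simp only:)
 qed
 have bdd: "bdd_below (range (\<lambda>x. U b x + V b x))" for b using below by (auto simp: bdd_below_def)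
 have lo: "m b \<le> U b x + V b x" for b x unfolding m_def by (rule cINF_lower[OF bdd]) simp
 have inf: "\<exists>x. U b x + V b x < m b + e" if "e > 0" for b e
 proof -
  have "m b < m b + e" using that by simp
  then show ?thesis unfolding m_def using cINF_less_iff[OF _ bdd[of b]] by (metis UNIV_not_empty UNIV_I)
 qed
 have U: "superclass La C1 (U b)" for b unfolding U_def using superclass_translate[OF v, of "s b" 0] by simp
 have V: "superclass La C2 (V b)" for b unfolding V_def using superclass_translate[OF w, of "s (\<not> b)" 0] by simp
 have sum: "- (2 * K) \<le> m True + m False"
 proof (rule field_le_epsilon)
  fix e :: real assume e: "e > 0"
  obtain x where x: "\<And>b. U b x + V b x \<le> m b + e / 2"
   by (rule common_near_minimum[of UNIV La "\<lambda>_. C1" U "\<lambda>_. C2" V m "e / 2"]) (use e U V lo inf in auto)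
  have "v (x + \<xi>) + w x \<le> m True + e / 2" "v x + w (x + \<xi>) \<le> m False + e / 2"
   using x[of True] x[of False] by (auto simp: U_def V_def s_def)
  then show "- (2 * K) \<le> m True + m False + e" using K[of x] K[of "x + \<xi>"] by linarith
 qed
 have up: "v (z + \<xi>) - v z \<le> K - m False" "m True - K \<le> v (z + \<xi>) - v z" for z
 proof -
  have "m True \<le> v (z + \<xi>) + w z" "m False \<le> v z + w (z + \<xi>)" using lo[of True z] lo[of False z] by (auto simp: U_def V_def s_def)
  then show "v (z + \<xi>) - v z \<le> K - m False" "m True - K \<le> v (z + \<xi>) - v z" using K[of z] K[of "z + \<xi>"] by linarith+
 qed
 show ?thesis using up[of x] up[of y] sum by linarith
qed

text \<open>Hyers' argument: the rescalings \<phi> (2^n x) / 2^n form a Cauchy sequence with an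
  additive limit within K of \<phi>. The Lipschitz bound passes to |l x| \<le> La |x| and upgrades
  additivity to linearity.\<close>

lemma almost_additive_near_linear:
 fixes \<phi> :: "'a::euclidean_space => real"
 assumes A: "\<And>x y. \<bar>\<phi> (x + y) - \<phi> x - \<phi> y\<bar> \<le> K" and Lip: "\<And>x y. \<bar>\<phi> x - \<phi> y\<bar> \<le> La * norm (x - y)"
 obtains a where "\<And>x. \<bar>\<phi> x - a \<bullet> x\<bar> \<le> K"
proof -
 define s where "s n x = \<phi> (2 ^ n *R x) / 2 ^ n" for n x
 have K: "K \<ge> 0" using A[of 0 0] by linarith
 have dbl: "\<bar>\<phi> (2 ^ n *R x) - 2 ^ n * \<phi> x\<bar> \<le> (2 ^ n - 1) * K" for n x
 proof (induction n)
  case (Suc n)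
  have e: "(2::real) ^ Suc n *R x = 2 ^ n *R x + 2 ^ n *R x" by (simp add: scaleR_add_left[symmetric])
  have "\<bar>\<phi> (2 ^ Suc n *R x) - \<phi> (2 ^ n *R x) - \<phi> (2 ^ n *R x)\<bar> \<le> K" unfolding e by (rule A)
  then show ?case using Suc unfolding power_Suc left_diff_distrib mult.assoc mult_1_left by linarith
 qed simp
 have near: "\<bar>s (n + k) x - s n x\<bar> \<le> K / 2 ^ n" for n k x
 proof -
  have "\<bar>\<phi> (2 ^ k *R (2 ^ n *R x)) - 2 ^ k * \<phi> (2 ^ n *R x)\<bar> \<le> 2 ^ k * K"
   using dbl[of k "2 ^ n *R x"] K unfolding left_diff_distrib mult_1_left by linarith
  then have "\<bar>\<phi> (2 ^ k *R (2 ^ n *R x)) - 2 ^ k * \<phi> (2 ^ n *R x)\<bar> / 2 ^ (n + k) \<le> 2 ^ k * K / 2 ^ (n + k)"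
   by (rule divide_right_mono) simp
  moreover have "2 ^ k * K / 2 ^ (n + k) = K / 2 ^ n" by (simp add: power_add)
  moreover have "\<bar>\<phi> (2 ^ k *R (2 ^ n *R x)) - 2 ^ k * \<phi> (2 ^ n *R x)\<bar> / 2 ^ (n + k) = \<bar>s (n + k) x - s n x\<bar>"
  proof -
   have "s (n + k) x - s n x = (\<phi> (2 ^ k *R (2 ^ n *R x)) - 2 ^ k * \<phi> (2 ^ n *R x)) / 2 ^ (n + k)"
    by (simp add: s_def power_add diff_divide_distrib mult.commute)
   then show ?thesis by (simp add: abs_divide)
  qed
  ultimately show ?thesis by linarith
 qed
 have Kl: "(\<lambda>n. K / 2 ^ n) \<longlonglongrightarrow> 0" by (rule LIMSEQ_divide_realpow_zero) simp
 have "Cauchy (\<lambda>n. s n x)" for x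
 proof (rule metric_CauchyI)
  fix e :: real assume e: "e > 0"
  have "\<forall>\<^sub>F n in sequentially. K / 2 ^ n < e / 2" using Kl e by (intro order_tendstoD(2)) auto
  then obtain N where N: "K / 2 ^ N < e / 2" by (auto simp: eventually_sequentially)
  have "dist (s m x) (s N x) < e / 2" if "m \<ge> N" for m
  proof -
   have "\<bar>s m x - s N x\<bar> \<le> K / 2 ^ N" using near[of N "m - N" x] that by simp
   then show ?thesis using N unfolding dist_real_def by linarith
  qed
  then show "\<exists>M. \<forall>m\<ge>M. \<forall>n\<ge>M. dist (s m x) (s n x) < e" by (intro exI[of _ N]) (metis dist_triangle_half_l dist_commute)
 qed
 then have "convergent (\<lambda>n. s n x)" for x by (simp add: Cauchy_convergent_iff)
 then obtain l where l: "\<And>x. (\<lambda>n. s n x) \<longlonglongrightarrow> l x" unfolding convergent_def by metis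
 have close: "\<bar>l x - \<phi> x\<bar> \<le> K" for x
 proof -
  have "(\<lambda>n. \<bar>s n x - \<phi> x\<bar>) \<longlonglongrightarrow> \<bar>l x - \<phi> x\<bar>" by (intro tendsto_intros l)
  moreover have "\<bar>s n x - \<phi> x\<bar> \<le> K" for n using near[of 0 n x] by (simp add: s_def)
  ultimately show ?thesis by (intro LIMSEQ_le_const2[of _ _ K]) auto
 qed
 have add: "l (x + y) = l x + l y" for x y
 proof -
  have "\<bar>s n (x + y) - s n x - s n y\<bar> \<le> K / 2 ^ n" for n
  proof -
   have "s n (x + y) - s n x - s n y = (\<phi> (2 ^ n *R x + 2 ^ n *R y) - \<phi> (2 ^ n *R x) - \<phi> (2 ^ n *R y)) / 2 ^ n"
    by (simp add: s_def diff_divide_distrib scaleR_add_right)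
   then show ?thesis using A by (simp add: abs_divide divide_right_mono)
  qed
  moreover have "(\<lambda>n. \<bar>s n (x + y) - s n x - s n y\<bar>) \<longlonglongrightarrow> \<bar>l (x + y) - l x - l y\<bar>" by (intro tendsto_intros l)
  ultimately have "\<bar>l (x + y) - l x - l y\<bar> \<le> 0" by (intro LIMSEQ_le[OF _ Kl]) auto
  then show ?thesis by simp
 qed
 have bound: "\<bar>l x\<bar> \<le> La * norm x" for x
 proof -
  have "\<bar>s n x\<bar> \<le> La * norm x + \<bar>\<phi> 0\<bar> / 2 ^ n" for n
  proof -
   have "\<bar>\<phi> (2 ^ n *R x)\<bar> \<le> 2 ^ n * (La * norm x) + \<bar>\<phi> 0\<bar>" using Lip[of "2 ^ n *R x" 0] by (simp add: mult.left_commute)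
   then have "\<bar>\<phi> (2 ^ n *R x)\<bar> / 2 ^ n \<le> (2 ^ n * (La * norm x) + \<bar>\<phi> 0\<bar>) / 2 ^ n" by (rule divide_right_mono) simp
   then show ?thesis by (simp add: s_def abs_divide add_divide_distrib)
  qed
  moreover have "(\<lambda>n. La * norm x + \<bar>\<phi> 0\<bar> / 2 ^ n) \<longlonglongrightarrow> La * norm x + 0"
   by (intro tendsto_intros LIMSEQ_divide_realpow_zero) simp
  moreover have "(\<lambda>n. \<bar>s n x\<bar>) \<longlonglongrightarrow> \<bar>l x\<bar>" by (intro tendsto_intros l)
  ultimately show ?thesis using LIMSEQ_le[of "\<lambda>n. \<bar>s n x\<bar>" "\<bar>l x\<bar>" "\<lambda>n. La * norm x + \<bar>\<phi> 0\<bar> / 2 ^ n" "La * norm x + 0"] by auto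
 qed
 have l0: "l 0 = 0" using add[of 0 0] by simp
 have neg: "l (- x) = - l x" for x using add[of x "- x"] l0 by simp
 have nat: "l (real n *R x) = real n * l x" for n x
  by (induction n) (auto simp: l0 add scaleR_add_left distrib_right)
 have int: "l (of_int k *R x) = of_int k * l x" for k x
  using nat[of "nat k" x] nat[of "nat (- k)" x] neg[of "real (nat (- k)) *R x"] by (cases "k \<ge> 0") auto
 have scale: "l (t *R x) = t * l x" for t x
 proof -
  have "real n * \<bar>l (t *R x) - t * l x\<bar> \<le> 2 * (La * norm x)" for n
  proof -
   define k where "k = \<lfloor>real n * t\<rfloor>"
   define q where "q = real n * t - of_int k"
   have q: "0 \<le> q" "q \<le> 1" unfolding q_def k_def by linarith+
   have "real n *R (t *R x) = of_int k *R x + q *R x" by (simp add: q_def scaleR_add_left[symmetric])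
   then have "real n * l (t *R x) = of_int k * l x + l (q *R x)" using nat[of n "t *R x"] by (simp only: add int)
   then have "real n * (l (t *R x) - t * l x) = l (q *R x) - q * l x" by (simp add: q_def algebra_simps)
   moreover have "\<bar>l (q *R x)\<bar> \<le> La * norm x"
   proof -
    have "La * norm x \<ge> 0" using bound[of x] by linarith
    then have "q * (La * norm x) \<le> 1 * (La * norm x)" using q by (intro mult_right_mono) auto
    then show ?thesis using bound[of "q *R x"] q by (simp add: mult.left_commute)
   qed
   moreover have "\<bar>q * l x\<bar> \<le> La * norm x"
   proof -
    have "q * \<bar>l x\<bar> \<le> 1 * \<bar>l x\<bar>" using q by (intro mult_right_mono) auto
    then show ?thesis using bound[of x] q by (simp add: abs_mult)
   qed
   ultimately have "\<bar>real n * (l (t *R x) - t * l x)\<bar> \<le> 2 * (La * norm x)" by linarith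
   then show ?thesis by (simp add: abs_mult)
  qed
  then have "\<not> 0 < \<bar>l (t *R x) - t * l x\<bar>" using reals_Archimedean3 by (metis not_le)
  then show ?thesis by simp
 qed
 have lin: "linear l" by (rule linearI) (auto simp: add scale)
 define a where "a = (\<Sum>b\<in>Basis. l b *R b)"
 have "l x = a \<bullet> x" for x
 proof -
  have "l x = l (\<Sum>b\<in>Basis. (x \<bullet> b) *R b)" by (simp add: euclidean_representation)
  also have "\<dots> = (\<Sum>b\<in>Basis. (x \<bullet> b) * l b)" by (simp add: linear_sum[OF lin] scale)
  also have "\<dots> = a \<bullet> x" unfolding a_def inner_sum_left by (intro sum.cong) (auto simp: inner_commute)
  finally show ?thesis .
 qed
 then have "\<bar>\<phi> x - a \<bullet> x\<bar> \<le> K" for x using close[of x] by (simp add: abs_minus_commute)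
 then show ?thesis by (rule that)
qed

section \<open>Rigidity\<close>

text \<open>The function sqrt (R^2 - |w|^2) - a \<bullet> w has its maximum R W at w = - (R / W) a,
  where the cap has slope a. Completing a square bounds the squared distance from this point by the
  deficit.\<close>

lemma cap_gap:
 fixes a w :: "'a::euclidean_space"
 assumes R: "R > 0" and w: "norm w \<le> R"
 defines "W \<equiv> sqrt (1 + a \<bullet> a)"
 shows "(norm (w + (R / W) *R a))^2 \<le> 2 * (R / W) * (R * W + a \<bullet> w - sqrt (R^2 - (norm w)\<^sup>2))"
  "sqrt (R^2 - (norm w)\<^sup>2) - a \<bullet> w \<le> R * W"
proof -
 have W: "W \<ge> 1" "W * W = 1 + a \<bullet> a" unfolding W_def by (rule sqrt_one_plus_inner)+
 define k where "k = R / W"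
 have k: "k > 0" "k * W = R" using R W by (auto simp: k_def)
 define s where "s = sqrt (R^2 - (norm w)\<^sup>2)"
 have "(norm w)^2 \<le> R^2" using w by (intro power_mono) auto
 then have s2: "s^2 = R^2 - w \<bullet> w" by (simp add: s_def power2_norm_eq_inner)
 have kk: "k^2 * (1 + a \<bullet> a) = R^2" using k(2) W(2) by (simp add: power2_eq_square) (metis mult.assoc mult.left_commute)
 have "(norm (w + k *R a))^2 = w \<bullet> w + 2 * k * (a \<bullet> w) + k^2 * (a \<bullet> a)"
  unfolding power2_norm_eq_inner by (simp add: inner_add_left inner_add_right inner_commute power2_eq_square)
 moreover have "(s - k)^2 = s^2 - 2 * (k * s) + k^2" by (simp add: power2_diff)
 moreover have "0 \<le> (s - k)^2" by simp
 moreover have "2 * k * (R * W + a \<bullet> w - s) = 2 * R^2 + 2 * k * (a \<bullet> w) - 2 * (k * s)"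
 proof -
  have "k * (R * W) = R^2" using k(2) by (metis mult.left_commute power2_eq_square)
  then show ?thesis by (simp add: algebra_simps)
 qed
 ultimately have main: "(norm (w + k *R a))^2 \<le> 2 * k * (R * W + a \<bullet> w - s)"
  using s2 kk unfolding distrib_left mult_1_right by linarith
 then show "(norm (w + (R / W) *R a))^2 \<le> 2 * (R / W) * (R * W + a \<bullet> w - sqrt (R^2 - (norm w)\<^sup>2))"
  by (simp only: k_def s_def)
 have "0 \<le> (2 * k) * (R * W + a \<bullet> w - s)" using main zero_le_power2[of "norm (w + k *R a)"] by linarith
 then have "0 \<le> R * W + a \<bullet> w - s" using k(1) by (simp add: zero_le_mult_iff)
 then show "sqrt (R^2 - (norm w)\<^sup>2) - a \<bullet> w \<le> R * W" by (simp add: s_def)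
qed

text \<open>The converse of \<open>cap_gap\<close>, by continuity: near the optimal offset the cap
  loses at most e.\<close>

lemma cap_near_optimum:
 fixes a :: "'a::euclidean_space"
 assumes R: "R > 0" and e: "e > 0"
 defines "W \<equiv> sqrt (1 + a \<bullet> a)"
 obtains d where "d > 0"
  "\<And>w. norm (w + (R / W) *R a) < d ==> norm w \<le> R \<and> R * W - e \<le> sqrt (R^2 - (norm w)\<^sup>2) - a \<bullet> w"
  "norm ((R / W) *R a) < R" "sqrt (R^2 - (norm ((R / W) *R a))\<^sup>2) + a \<bullet> ((R / W) *R a) = R * W"
proof -
 have W: "W \<ge> 1" "W * W = 1 + a \<bullet> a" unfolding W_def by (rule sqrt_one_plus_inner)+
 define k where "k = R / W"
 have k: "k > 0" "k * W = R" using R W by (auto simp: k_def)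
 define z where "z = - (k *R a)"
 have kk: "k^2 + k^2 * (a \<bullet> a) = R^2"
 proof -
  have "R^2 = k * k * (W * W)" unfolding k(2)[symmetric] power2_eq_square by (simp only: mult_ac)
  then show ?thesis unfolding W(2) by (simp add: power2_eq_square distrib_left)
 qed
 have nz: "(norm z)^2 = k^2 * (a \<bullet> a)" by (simp add: z_def power_mult_distrib power2_norm_eq_inner)
 have "sqrt (R^2 - (norm z)\<^sup>2) = sqrt (k^2)" using kk nz by (intro arg_cong[of _ _ sqrt]) linarith
 then have cz: "sqrt (R^2 - (norm z)\<^sup>2) = k" using k by simp
 have "k * (a \<bullet> a) + k = k * (W * W)" unfolding W(2) by (simp add: distrib_left)
 also have "\<dots> = R * W" using k(2) by (simp only: mult.assoc[symmetric])
 finally have opt: "sqrt (R^2 - (norm z)\<^sup>2) - a \<bullet> z = R * W" unfolding cz by (simp add: z_def)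
 have "(norm z)^2 < R\<^sup>2" unfolding nz using kk k(1) zero_less_power[OF k(1), of 2] by linarith
 then have nR: "norm z < R" using R by (rule power2_less_imp_less[OF _ less_imp_le])
 have "((\<lambda>w. sqrt (R^2 - (norm w)\<^sup>2) - a \<bullet> w) \<longlongrightarrow> sqrt (R^2 - (norm z)\<^sup>2) - a \<bullet> z) (nhds z)"
  by (intro tendsto_intros tendsto_ident_at filterlim_ident)
 then have "\<forall>\<^sub>F w in nhds z. R * W - e < sqrt (R^2 - (norm w)\<^sup>2) - a \<bullet> w"
  using e unfolding opt by (intro order_tendstoD(1)) auto
 moreover have "((\<lambda>w. norm w) \<longlongrightarrow> norm z) (nhds z)" by (intro tendsto_intros filterlim_ident)
 then have "\<forall>\<^sub>F w in nhds z. norm w < R" using nR by (rule order_tendstoD(2))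
 ultimately have "\<forall>\<^sub>F w in nhds z. norm w \<le> R \<and> R * W - e \<le> sqrt (R^2 - (norm w)\<^sup>2) - a \<bullet> w"
  by eventually_elim auto
 then obtain d where d: "d > 0" "\<And>w. dist w z < d ==> norm w \<le> R \<and> R * W - e \<le> sqrt (R^2 - (norm w)\<^sup>2) - a \<bullet> w"
  unfolding eventually_nhds_metric by blast
 show ?thesis
 proof (rule that[OF d(1)])
  show "norm w \<le> R \<and> R * W - e \<le> sqrt (R^2 - (norm w)\<^sup>2) - a \<bullet> w" if "norm (w + (R / W) *R a) < d" for w
   using that by (intro d(2)) (simp add: dist_norm z_def k_def)
  show "norm ((R / W) *R a) < R" using nR by (simp only: z_def k_def norm_minus_cancel)
  show "sqrt (R^2 - (norm ((R / W) *R a))\<^sup>2) + a \<bullet> ((R / W) *R a) = R * W"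
   using opt by (simp only: z_def k_def norm_minus_cancel inner_minus_right diff_minus_eq_add)
 qed
qed

text \<open>An excess of at most \<eta> over the minimum ka rh confines z to a ball that shrinks
  with \<eta>. This localises the points that realise an inf-convolution near its infimum.\<close>

lemma hyp_near_minimum:
 fixes z :: "'a::euclidean_space"
 assumes ka: "ka > 0" and rh: "rh > 0" and h: "hyp ka rh z \<le> ka * rh + \<eta>"
 shows "(norm z)^2 \<le> \<eta> / ka * (\<eta> / ka + 2 * rh)"
proof -
 define m where "m = sqrt (rh^2 + z \<bullet> z)"
 have m2: "m^2 = rh^2 + (norm z)^2" unfolding m_def power2_norm_eq_inner by (simp add: add_nonneg_nonneg)
 have "ka * m \<le> ka * rh + \<eta>" using h by (simp add: hyp_def m_def)
 also have "\<dots> = ka * (rh + \<eta> / ka)" using ka by (simp add: distrib_left)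
 finally have "m \<le> rh + \<eta> / ka" using ka by simp
 moreover have "m \<ge> 0" unfolding m_def by (simp add: add_nonneg_nonneg)
 ultimately have "m^2 \<le> (rh + \<eta> / ka)^2" by (intro power_mono)
 also have "\<dots> = rh^2 + \<eta> / ka * (\<eta> / ka + 2 * rh)" by (simp add: power2_eq_square algebra_simps)
 finally show ?thesis using m2 by linarith
qed

section \<open>The envelope g as a second supersolution, and the conclusion\<close>

context curvature_problem
begin

abbreviation g where "g \<equiv> upper_envelope R f"

lemma g_ge: "norm (x - y) \<le> R ==> f y + sqrt (R^2 - (norm (x - y))\<^sup>2) \<le> g x"
 by (rule upper_envelope_ge(1)[OF contf])

lemma g_attained: obtains q where "norm (x - q) \<le> R" "g x = f q + sqrt (R^2 - (norm (x - q))\<^sup>2)"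
 using upper_envelope_ge(2)[OF contf, of x x R] R by auto

text \<open>An optimal contact point translated along with the centre stays admissible, so g
  inherits one-sided comparisons of translates of \<open>f\<close>; its growth and continuity
  follow.\<close>

lemma g_diff_le:
 assumes "\<And>w. norm w \<le> R ==> f (x + w) - f (y + w) \<le> e"
 shows "g x - g y \<le> e"
proof -
 obtain q where q: "norm (x - q) \<le> R" "g x = f q + sqrt (R^2 - (norm (x - q))\<^sup>2)" by (rule g_attained)
 have "norm (q - x) \<le> R" using q(1) by (simp only: norm_minus_commute)
 then have "f (x + (q - x)) - f (y + (q - x)) \<le> e" by (rule assms)
 moreover have "y - (y + (q - x)) = x - q" by simp
 then have "f (y + (q - x)) + sqrt (R^2 - (norm (x - q))\<^sup>2) \<le> g y" using g_ge[of y "y + (q - x)"] q(1) by simp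
 moreover have "x + (q - x) = q" by simp
 ultimately show ?thesis using q(2) by (simp only:)
qed

lemma g_growth: "\<bar>g x - g y\<bar> \<le> B0 * (1 + norm (x - y))"
proof -
 have "g x - g y \<le> B0 * (1 + norm (x - y))" for x y
 proof (rule g_diff_le)
  fix w :: "real^'n" show "f (x + w) - f (y + w) \<le> B0 * (1 + norm (x - y))" using B0(2)[of "x + w" "y + w"] by simp
 qed
 from this[of x y] this[of y x] show ?thesis by (simp add: norm_minus_commute abs_le_iff)
qed

lemma g_cont: "continuous_on UNIV g"
 unfolding continuous_on_iff
proof (intro ballI allI impI)
 fix x :: "real^'n" and e :: real assume e: "e > 0"
 have "uniformly_continuous_on (cball x (R + 1)) f"
  by (intro compact_uniformly_continuous continuous_on_subset[OF contf]) auto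
 then obtain d where d: "d > 0" "\<And>y z. y \<in> cball x (R + 1) ==> z \<in> cball x (R + 1) ==> dist z y < d ==> dist (f z) (f y) < e / 2"
  using e unfolding uniformly_continuous_on_def by (metis half_gt_zero)
 show "\<exists>d>0. \<forall>x'\<in>UNIV. dist x' x < d --> dist (g x') (g x) < e"
 proof (intro exI[of _ "min d 1"] conjI ballI impI)
  show "min d 1 > 0" using d(1) by simp
  fix x' assume x': "dist x' x < min d 1"
  have near: "\<bar>f (x' + w) - f (x + w)\<bar> < e / 2" if w: "norm w \<le> R" for w
  proof -
   have "dist x (x' + w) \<le> dist x' x + norm w"
    using norm_triangle_ineq[of "x' - x" w] by (simp add: dist_norm norm_minus_commute[of x] algebra_simps)
   then have "x' + w \<in> cball x (R + 1)" using x' w by simp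
   moreover have "x + w \<in> cball x (R + 1)" using w by (simp add: dist_norm)
   ultimately show ?thesis using d(2)[of "x + w" "x' + w"] x' by (simp add: dist_norm)
  qed
  have "g x' - g x \<le> e / 2"
  proof (rule g_diff_le)
   fix w :: "real^'n" assume "norm w \<le> R" then show "f (x' + w) - f (x + w) \<le> e / 2" using near[of w] by linarith
  qed
  moreover have "g x - g x' \<le> e / 2"
  proof (rule g_diff_le)
   fix w :: "real^'n" assume "norm w \<le> R" then show "f (x + w) - f (x' + w) \<le> e / 2" using near[of w] by linarith
  qed
  ultimately show "dist (g x') (g x) < e" using e unfolding dist_real_def abs_less_iff by linarith
 qed
qed

lemma g_close: "f x + R \<le> g x" "g x \<le> f x + (B0 * (1 + R) + R)"
proof -
 show "f x + R \<le> g x" using g_ge[of x x] R by simp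
 obtain q where q: "norm (x - q) \<le> R" "g x = f q + sqrt (R^2 - (norm (x - q))\<^sup>2)" by (rule g_attained)
 have "sqrt (R^2 - (norm (x - q))\<^sup>2) \<le> sqrt (R^2)" by (intro real_sqrt_le_mono) simp
 moreover have "sqrt (R^2) = R" using R by simp
 moreover have "\<bar>f x - f q\<bar> \<le> B0 * (1 + norm (x - q))" by (rule B0(2))
 moreover have "B0 * (1 + norm (x - q)) \<le> B0 * (1 + R)" using B0(1) q(1) by (intro mult_left_mono) auto
 ultimately show "g x \<le> f x + (B0 * (1 + R) + R)" using q(2) by linarith
qed

text \<open>\<open>mcurv\<close> is even in the slope and odd in the Hessian, so the subsolution
  property of g becomes the supersolution property of - g.\<close>

lemma neg_g_jets: "subjet (\<lambda>x. - g x) x p B ==> mcurv p B \<le> 0"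
proof -
 assume j: "subjet (\<lambda>x. - g x) x p B"
 then have B: "selfadjoint B" by (simp add: subjet_def)
 have lin: "linear B" by (rule selfadjointD(1)[OF B])
 obtain de where d: "de > 0" "\<And>h. norm h < de ==> - g x + p \<bullet> h + (h \<bullet> B h) / 2 \<le> - g (x + h)"
  using j by (auto simp: subjet_def)
 have "selfadjoint (\<lambda>h. - B h)" using B by (simp add: selfadjoint_def linear_compose_neg)
 then have "0 \<le> mcurv (- p) (\<lambda>h. - B h)"
 proof (rule g_jets[OF _ d(1)])
  fix h :: "real^'n" assume "norm h < de"
  from d(2)[OF this] show "g (x + h) \<le> g x + (- p) \<bullet> h + (h \<bullet> - B h) / 2" by simp
 qed
 moreover have "mcurv (- p) (\<lambda>h. - B h) = - mcurv p B"
  by (simp add: mcurv_def trace_map_def sum_negf linear_neg[OF lin])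
 ultimately show ?thesis by simp
qed

lemma tilted_growth:
 assumes "\<And>x y. \<bar>v x - v y\<bar> \<le> B0 * (1 + norm (x - y))"
 shows "\<bar>(v x - a \<bullet> x) - (v y - a \<bullet> y)\<bar> \<le> (B0 + norm a) * (1 + norm (x - y :: real^'n))"
proof -
 have "\<bar>a \<bullet> (x - y)\<bar> \<le> norm a * norm (x - y)" by (rule Cauchy_Schwarz_ineq2)
 moreover have "a \<bullet> (x - y) = a \<bullet> x - a \<bullet> y" by (rule inner_diff_right)
 ultimately show ?thesis using assms[of x y] norm_ge_zero[of a] unfolding distrib_left distrib_right mult_1_right by linarith
qed

text \<open>The width 2 R ka makes ka / rh equal to 1 / (2 R), half of the curvature bound 1 / R
  below which \<open>f\<close> can be tested.\<close>

lemma penalised: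
 fixes v :: "real^'n => real" and a :: "real^'n"
 assumes cv: "continuous_on UNIV v" and gr: "\<And>x y. \<bar>v x - v y\<bar> \<le> B0 * (1 + norm (x - y))"
  and jets: "\<And>x p B. subjet v x p B ==> (\<And>h. h \<bullet> B h \<le> 1 / (2 * R) * (norm h)^2) ==> mcurv p B \<le> 0"
 defines "ka \<equiv> B0 + norm a + 1"
 shows "superclass (ka + norm a) (1 / (2 * R)) (\<lambda>x. infconv ka (2 * R * ka) (\<lambda>y. v y - a \<bullet> y) x + a \<bullet> x)"
proof -
 have ka: "ka > 0" "B0 + norm a < ka" "0 \<le> B0 + norm a" using B0(1) norm_ge_zero[of a] unfolding ka_def by linarith+
 have C: "ka / (2 * R * ka) = 1 / (2 * R)" using ka(1) by simp
 have "continuous_on UNIV (\<lambda>y. v y - a \<bullet> y)" by (intro continuous_intros cv)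
 from infconv_superclass[OF this tilted_growth[OF gr] ka(3,2), of "2 * R * ka" a, unfolded C]
 show ?thesis using jets R ka(1) by simp
qed

lemma f_jets_half: "subjet f x p B ==> (\<And>h. h \<bullet> B h \<le> 1 / (2 * R) * (norm h)^2) ==> mcurv p B \<le> 0"
 by (rule f_jets[of x p B "1 / (2 * R)"]) (use R in auto)

lemma neg_g_growth: "\<bar>- g x - - g y\<bar> \<le> B0 * (1 + norm (x - y))"
 using g_growth[of x y] by (simp add: abs_minus_commute)

text \<open>Since g - f is bounded, the inf-convolutions of \<open>f\<close> and of - g have bounded
  sum. So the increments of the first are additive up to a constant, and Hyers' argument gives the
  linear part.\<close>

lemma f_near_linear: obtains a C where "\<And>x. \<bar>f x - a \<bullet> x\<bar> \<le> C"
proof -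
 define ka where "ka = B0 + 1"
 define rh where "rh = 2 * R * ka"
 have ka: "ka > 0" "B0 < ka" using B0(1) by (auto simp: ka_def)
 have rh: "rh > 0" using R ka by (simp add: rh_def)
 have ng: "continuous_on UNIV (\<lambda>x. - g x)" by (intro continuous_intros g_cont)
 define v where "v = infconv ka rh f"
 define w where "w = infconv ka rh (\<lambda>x. - g x)"
 have v: "superclass ka (1 / (2 * R)) v"
  using penalised[OF contf B0(2) f_jets_half, where a = 0] by (simp add: v_def ka_def rh_def)
 have w: "superclass ka (1 / (2 * R)) w"
  using penalised[OF ng neg_g_growth neg_g_jets, where a = 0] by (simp add: w_def ka_def rh_def)
 define K1 where "K1 = B0 + ka * rh"
 have vf: "\<bar>v x - f x\<bar> \<le> K1" for x unfolding v_def K1_def by (rule infconv_close[OF contf B0(2) B0(1) ka(2) rh])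
 have wg: "\<bar>w x - - g x\<bar> \<le> K1" for x unfolding w_def K1_def by (rule infconv_close[OF ng neg_g_growth B0(1) ka(2) rh])
 define K where "K = 2 * K1 + (B0 * (1 + R) + R)"
 have vw: "\<bar>v x + w x\<bar> \<le> K" for x
  using vf[of x] wg[of x] g_close[of x] R unfolding K_def by linarith
 define \<phi> where "\<phi> x = v x - v 0" for x
 obtain a where a: "\<And>x. \<bar>\<phi> x - a \<bullet> x\<bar> \<le> 4 * K"
 proof -
  have A: "\<bar>\<phi> (x + y) - \<phi> x - \<phi> y\<bar> \<le> 4 * K" for x y
   using translates_almost_additive[OF v w vw, of x y 0] by (simp add: \<phi>_def)
  have L: "\<bar>\<phi> x - \<phi> y\<bar> \<le> ka * norm (x - y)" for x y using superclassD(3)[OF v, of x y] by (simp add: \<phi>_def)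
  show ?thesis using almost_additive_near_linear[OF A L] that by blast
 qed
 have "\<bar>f x - a \<bullet> x\<bar> \<le> K1 + \<bar>v 0\<bar> + 4 * K" for x using a[of x] vf[of x] unfolding \<phi>_def by linarith
 then show ?thesis by (rule that)
qed

text \<open>S bounds V = f - a \<bullet> x from above. If S exceeded the infimum i of V, there would
  be a point x close to an almost minimal point z of V such that every point of a net around x is
  close to an almost maximal point of g - a \<bullet> x. A sphere from below at z has its centre c0
  near such a point y; the contact q of y with \<open>f\<close> satisfies V q \<ge> S - \<eta> and
  has nearly optimal offset from c0. This forces g c0 up, and with it f z, to almost S + a \<bullet>
  z.\<close>

lemma f_affine:
 assumes env: "\<And>x. f x = lower_envelope R g x"
 shows "\<exists>a b. \<forall>x. f x = a \<bullet> x + b"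
proof -
 obtain a C where aC: "\<And>x. \<bar>f x - a \<bullet> x\<bar> \<le> C" using f_near_linear by blast
 define W where "W = sqrt (1 + a \<bullet> a)"
 have W: "W \<ge> 1" unfolding W_def by (rule sqrt_one_plus_inner)
 define z0 where "z0 = (R / W) *R a"
 define ka where "ka = B0 + norm a + 1"
 define rh where "rh = 2 * R * ka"
 have ka: "ka > 0" "B0 + norm a < ka" "0 \<le> B0 + norm a" using B0(1) norm_ge_zero[of a] unfolding ka_def by linarith+
 have rh: "rh > 0" using R ka by (simp add: rh_def)
 define V where "V y = f y - a \<bullet> y" for y
 define G where "G y = - g y - (- a) \<bullet> y" for y
 have ng: "continuous_on UNIV (\<lambda>x. - g x)" by (intro continuous_intros g_cont)
 have cV: "continuous_on UNIV V" unfolding V_def by (intro continuous_intros contf)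
 have cG: "continuous_on UNIV G" unfolding G_def by (intro continuous_intros g_cont)
 have gV: "\<bar>V x - V y\<bar> \<le> (B0 + norm a) * (1 + norm (x - y))" for x y unfolding V_def by (rule tilted_growth[OF B0(2)])
 have gG: "\<bar>G x - G y\<bar> \<le> (B0 + norm a) * (1 + norm (x - y))" for x y
  using tilted_growth[OF neg_g_growth, of x "- a" y] by (simp only: G_def norm_minus_cancel)
 note infV = infconv_attained[OF cV gV ka(3,2) rh] infconv_infimum[OF cV gV ka(3,2) rh]
 note infG = infconv_attained[OF cG gG ka(3,2) rh] infconv_infimum[OF cG gG ka(3,2) rh]
 have sV: "superclass (ka + norm a) (1 / (2 * R)) (\<lambda>x. infconv ka rh V x + a \<bullet> x)"
  unfolding rh_def ka_def V_def by (rule penalised[OF contf B0(2) f_jets_half])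
 have sG: "superclass (ka + norm a) (1 / (2 * R)) (\<lambda>x. infconv ka rh G x + (- a) \<bullet> x)"
  using penalised[OF ng neg_g_growth neg_g_jets, where a = "- a"] unfolding rh_def ka_def G_def by (simp only: norm_minus_cancel)
 define i where "i = (INF x. V x)"
 define j where "j = (INF x. G x)"
 have bV: "bdd_below (range V)"
 proof -
  have "- C \<le> V x" for x using aC[of x] unfolding V_def by linarith
  then show ?thesis by (auto simp: bdd_below_def)
 qed
 have bG: "bdd_below (range G)"
 proof -
  have "- C - (B0 * (1 + R) + R) \<le> G x" for x using aC[of x] g_close(2)[of x] unfolding G_def inner_minus_left by linarith
  then show ?thesis by (auto simp: bdd_below_def)
 qed
 have iV: "i \<le> V x" and jG: "j \<le> G x" for x unfolding i_def j_def by (auto intro: cINF_lower bV bG)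
 have iV': "\<exists>x. V x < i + e" if "e > 0" for e
  using cINF_less_iff[OF UNIV_not_empty bV, of "i + e"] that unfolding i_def by simp
 have jG': "\<exists>x. G x < j + e" if "e > 0" for e
  using cINF_less_iff[OF UNIV_not_empty bG, of "j + e"] that unfolding j_def by simp
 \<comment> \<open>- j is the supremum of g - a \<bullet> x, and a cap at the optimal offset raises
   g - a \<bullet> x above V by R W.\<close>
 define S where "S = - j - R * W"
 have S: "V q \<le> S" for q
 proof -
  obtain d where d: "norm z0 < R" "sqrt (R^2 - (norm z0)\<^sup>2) + a \<bullet> z0 = R * W"
   using cap_near_optimum[OF R zero_less_one, of a] unfolding W_def[symmetric] z0_def[symmetric] by blast
  have "f q + sqrt (R^2 - (norm z0)\<^sup>2) \<le> g (q - z0)" using g_ge[of "q - z0" q] d(1) by simp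
  then show ?thesis using jG[of "q - z0"] d(2) unfolding G_def S_def V_def inner_diff_right inner_minus_left by linarith
 qed
 have "S \<le> i"
 proof (rule ccontr)
  assume "\<not> S \<le> i"
  \<comment> \<open>The final chain of inequalities loses at most 2 e + 2 \<eta>, with \<eta> <
    e.\<close>
  define e where "e = (S - i) / 4"
  have e: "e > 0" using \<open>\<not> S \<le> i\<close> by (simp add: e_def)
  obtain d where d: "d > 0" "\<And>w. norm (w + z0) < d ==> norm w \<le> R \<and> R * W - e \<le> sqrt (R^2 - (norm w)\<^sup>2) - a \<bullet> w"
   using cap_near_optimum[OF R e, of a] unfolding W_def[symmetric] z0_def[symmetric] by blast
  \<comment> \<open>Three displacements below r have to stay below d together: from c0 to x + \<xi>,
    from x + \<xi> to y, and from y - q to the optimal offset - z0.\<close>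
  define r where "r = d / 3"
  have r: "r > 0" using d(1) by (simp add: r_def)
  have "((\<lambda>\<eta>. 2 * (R / W) * \<eta>) \<longlongrightarrow> 2 * (R / W) * 0) (at_right 0)"
   "((\<lambda>\<eta>. \<eta> / ka * (\<eta> / ka + 2 * rh)) \<longlongrightarrow> 0 / ka * (0 / ka + 2 * rh)) (at_right 0)"
   by (intro tendsto_intros; use ka in simp)+
  then have "\<forall>\<^sub>F \<eta> in at_right 0. 2 * (R / W) * \<eta> < r\<^sup>2" "\<forall>\<^sub>F \<eta> in at_right 0. \<eta> / ka * (\<eta> / ka + 2 * rh) < r\<^sup>2"
   using r by (auto elim!: order_tendstoD(2))
  moreover have "\<forall>\<^sub>F \<eta> in at_right 0. \<eta> \<in> {0<..<e}" using eventually_at_right_real[OF e] .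
  ultimately have "\<forall>\<^sub>F \<eta> in at_right 0. 0 < \<eta> \<and> \<eta> < e \<and> 2 * (R / W) * \<eta> < r\<^sup>2 \<and> \<eta> / ka * (\<eta> / ka + 2 * rh) < r\<^sup>2"
   by eventually_elim auto
  \<comment> \<open>With this \<eta>, being \<eta>-optimal in value means being within r in
    position, both for the cap and for the hyperboloid.\<close>
  then obtain \<eta> where eta: "0 < \<eta>" "\<eta> < e" "2 * (R / W) * \<eta> < r\<^sup>2" "\<eta> / ka * (\<eta> / ka + 2 * rh) < r\<^sup>2"
   using eventually_happens'[OF trivial_limit_at_right_real] by blast
  \<comment> \<open>The centre of a sphere reaching a point within r of x lies within R + r of x, so
    a finite net of this ball suffices.\<close>
  have "\<exists>N. finite N \<and> N \<subseteq> cball (0::real^'n) (R + r) \<and> cball 0 (R + r) \<subseteq> (\<Union>x\<in>N. ball x r)"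
   using r compact_imp_seq_compact[OF compact_cball[of "0::real^'n" "R + r"]] seq_compact_imp_totally_bounded by blast
  then obtain N where N: "finite N" "cball (0::real^'n) (R + r) \<subseteq> (\<Union>x\<in>N. ball x r)" by blast
  \<comment> \<open>\<open>None\<close> encodes near-minimality of V at x, and
    \<open>Some \<xi>\<close> that of G at x + \<xi>. In each case the affine supersolution
    \<open>v k\<close> undoes the tilt of \<open>u k\<close>, so the sum is an
    inf-convolution.\<close>
  define u where "u k = (case k of None => (\<lambda>x. infconv ka rh V x + a \<bullet> x)
    | Some \<xi> => (\<lambda>x. infconv ka rh G (x + \<xi>) + (- a) \<bullet> (x + \<xi>) + 0))" for k
  define v where "v k = (case k of None => (\<lambda>x. (- a) \<bullet> x + 0) | Some \<xi> => (\<lambda>x. a \<bullet> x + a \<bullet> \<xi>))" for k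
  define m where "m k = (case k of None => i + ka * rh | Some (\<xi>::real^'n) => j + ka * rh)" for k
  have uv: "u None x + v None x = infconv ka rh V x" "u (Some \<xi>) x + v (Some \<xi>) x = infconv ka rh G (x + \<xi>)" for x \<xi>
   by (auto simp: u_def v_def inner_add_right)
  obtain x where x: "\<And>k. k \<in> insert None (Some ` N) ==> u k x + v k x \<le> m k + \<eta>"
  proof (rule common_near_minimum[of "insert None (Some ` N)" "ka + norm a" "\<lambda>_. 1 / (2 * R)" u "\<lambda>_. 0" v m \<eta>])
   show "finite (insert None (Some ` N))" using N(1) by simp
   fix k :: "(real^'n) option"
   show "superclass (ka + norm a) (1 / (2 * R)) (u k)"
   proof (cases k)
    case None then show ?thesis using sV by (simp only: u_def option.case)
   next
    case (Some \<xi>) then show ?thesis using superclass_translate[OF sG, of \<xi> 0] by (simp only: u_def option.case)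
   qed
   have "norm a \<le> ka + norm a" "norm (- a) \<le> ka + norm a" using ka(1) by auto
   then show "superclass (ka + norm a) 0 (v k)"
    unfolding v_def by (cases k) (simp_all only: option.case superclass_affine)
   show "m k \<le> u k x + v k x" for x
    using infV(2)[OF iV iV', of x] infG(2)[OF jG jG'] by (cases k) (simp_all only: uv m_def option.case)
   show "\<exists>x. u k x + v k x < m k + e'" if e': "e' > 0" for e'
   proof (cases k)
    case None then show ?thesis using infV(3)[OF iV iV' e'] by (simp only: uv m_def option.case)
   next
    case (Some \<xi>)
    obtain y where "infconv ka rh G y < j + ka * rh + e'" using infG(3)[OF jG jG' e'] by blast
    then show ?thesis using Some by (intro exI[of _ "y - \<xi>"]) (simp only: uv m_def option.case diff_add_cancel)
   qed
  qed (use eta in auto)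
  have xV: "infconv ka rh V x \<le> i + ka * rh + \<eta>" using x[of None] unfolding uv m_def by simp
  have xG: "infconv ka rh G (x + \<xi>) \<le> j + ka * rh + \<eta>" if "\<xi> \<in> N" for \<xi> using x[of "Some \<xi>"] that unfolding uv m_def by simp
  have small: "norm y < r" if "hyp ka rh y \<le> ka * rh + \<eta>" for y :: "real^'n"
  proof -
   have "(norm y)^2 < r\<^sup>2" using hyp_near_minimum[OF ka(1) rh that] eta(4) by linarith
   then show ?thesis using r by (rule power2_less_imp_less[OF _ less_imp_le])
  qed
  have hmin: "ka * rh \<le> hyp ka rh y" for y :: "real^'n" by (rule hyp_min[OF cV gV ka(3,2) rh])
  obtain z where z: "infconv ka rh V x = V z + hyp ka rh (x - z)" using infV(1)[of x] by metis
  have zV: "V z \<le> i + \<eta>" using z xV hmin[of "x - z"] by linarith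
  have zx: "norm (x - z) < r" by (rule small) (use z xV iV[of z] in linarith)
  \<comment> \<open>Here the double envelope enters: the lower hemisphere of radius R about the
    point of the graph of g over c0 passes less than e above the graph of \<open>f\<close> at
    z.\<close>
  obtain c0 where c0: "norm (z - c0) \<le> R" "g c0 - sqrt (R^2 - (norm (z - c0))\<^sup>2) < f z + e"
  proof -
   let ?A = "(\<lambda>y. g y - sqrt (R^2 - (norm (z - y))\<^sup>2)) ` {y. norm (z - y) \<le> R}"
   have ne: "?A \<noteq> {}" using R by (auto intro!: exI[of _ z])
   have "Inf ?A < f z + e" using env[of z] e unfolding lower_envelope_def by linarith
   from cInf_lessD[OF ne this] show ?thesis using that by auto
  qed
  have "norm (c0 - x) \<le> norm (c0 - z) + norm (z - x)" using norm_triangle_ineq[of "c0 - z" "z - x"] by simp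
  then have "c0 - x \<in> cball 0 (R + r)" using c0(1) zx by (simp add: norm_minus_commute)
  then have "c0 - x \<in> (\<Union>x\<in>N. ball x r)" using N(2) by blast
  then obtain \<xi> where "\<xi> \<in> N" "c0 - x \<in> ball \<xi> r" by blast
  then have xi: "\<xi> \<in> N" "norm (\<xi> - (c0 - x)) < r" by (simp_all only: mem_ball dist_norm)
  obtain y where y: "infconv ka rh G (x + \<xi>) = G y + hyp ka rh (x + \<xi> - y)" using infG(1)[of "x + \<xi>"] by metis
  have yG: "G y \<le> j + \<eta>" using y xG[OF xi(1)] hmin[of "x + \<xi> - y"] by linarith
  have yx: "norm (x + \<xi> - y) < r" by (rule small) (use y xG[OF xi(1)] jG[of y] in linarith)
  obtain q where q: "norm (y - q) \<le> R" "g y = f q + sqrt (R^2 - (norm (y - q))\<^sup>2)" by (rule g_attained)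
  note cap = cap_gap[OF R q(1), of a, folded W_def z0_def]
  have sum: "V q + (sqrt (R^2 - (norm (y - q))\<^sup>2) - a \<bullet> (y - q)) = - G y"
   using q(2) unfolding V_def G_def inner_diff_right inner_minus_left by linarith
  have qV: "S - \<eta> \<le> V q" using sum yG cap(2) unfolding S_def by linarith
  have "R * W + a \<bullet> (y - q) - sqrt (R^2 - (norm (y - q))\<^sup>2) \<le> \<eta>" using sum yG S[of q] unfolding S_def by linarith
  then have "2 * (R / W) * (R * W + a \<bullet> (y - q) - sqrt (R^2 - (norm (y - q))\<^sup>2)) \<le> 2 * (R / W) * \<eta>"
   using R W by (intro mult_left_mono) auto
  then have "(norm (y - q + z0))^2 < r\<^sup>2" using cap(1) eta(3) by linarith
  then have yq: "norm (y - q + z0) < r" using r by (rule power2_less_imp_less[OF _ less_imp_le])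
  have "c0 - q + z0 = - (\<xi> - (c0 - x)) + ((x + \<xi> - y) + (y - q + z0))" by simp
  then have "norm (c0 - q + z0) \<le> norm (\<xi> - (c0 - x)) + (norm (x + \<xi> - y) + norm (y - q + z0))"
   by (metis norm_minus_cancel norm_triangle_le add_left_mono norm_triangle_ineq)
  then have "norm (c0 - q + z0) < d" using xi(2) yx yq unfolding r_def by linarith
  from d(2)[OF this] have cq: "norm (c0 - q) \<le> R" "R * W - e \<le> sqrt (R^2 - (norm (c0 - q))\<^sup>2) - a \<bullet> (c0 - q)" by auto
  have "norm (c0 - z) \<le> R" using c0(1) by (simp only: norm_minus_commute)
  from cap_gap(2)[OF R this, of a]
  have "sqrt (R^2 - (norm (z - c0))\<^sup>2) - a \<bullet> (c0 - z) \<le> R * W" by (simp only: W_def norm_minus_commute)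
  with c0(2) g_ge[OF cq(1)] cq(2) qV zV eta(2) have "S - i < 4 * e"
   unfolding V_def inner_diff_right by linarith
  then show False by (simp add: e_def)
 qed
 then have "f x = a \<bullet> x + i" for x using S[of x] iV[of x] unfolding V_def by linarith
 then show ?thesis by blast
qed

end

theorem theorem5:
  fixes F :: "real^'n \<Rightarrow> real" and f :: "real^'n \<Rightarrow> real" and R c :: real
  assumes "C1_on positive_cone F"
    and "symmetric_on positive_cone F"
    and "concave_on positive_cone F"
    and "\<forall>s\<in>positive_cone. \<forall>j. partial_deriv j F s > 0"
    and "convex_on positive_cone (\<lambda>s. F (\<chi> i. 1 / s $ i))"
    and "continuous_on UNIV f"
    and "R > 0"
    and "viscosity_solution F R c f"
    and "\<forall>x. f x = lower_envelope R (upper_envelope R f) x"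
    and "bounded {\<bar>f x - f y\<bar> | x y. norm (x - y) \<le> 1}"
  shows "c = F (\<chi> i. 1) \<and>
    (\<exists>a b. \<forall>x. f x = a \<bullet> x + b) \<and>
    (\<exists>\<nu> d. \<nu> \<noteq> 0 \<and> frontier (strict_epigraph f) = {z. \<nu> \<bullet> z = d})"
proof -
  obtain K where K: "\<And>x y. norm (x - y) \<le> 1 \<Longrightarrow> \<bar>f x - f y\<bar> \<le> K"
    using assms(10) unfolding bounded_real by fastforce
  have K0: "0 \<le> K" using K[of 0 0] by simp
  interpret curvature_problem F f R c K
    by unfold_locales (use assms K0 increment_bound[of f K] K in auto)
  obtain a b where ab: "\<And>x. f x = a \<bullet> x + b" using f_affine assms(9) by blast
  have "strict_epigraph f = {z. (- a, 1) \<bullet> z > b}" by (auto simp: strict_epigraph_def ab)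
  moreover have "frontier {z. (- a, 1::real) \<bullet> z > b} = {z. (- a, 1) \<bullet> z = b}"
    by (rule frontier_halfspace_gt) (simp add: zero_prod_def)
  moreover have "(- a, 1::real) \<noteq> 0" by (simp add: zero_prod_def)
  ultimately have "\<exists>\<nu> d. \<nu> \<noteq> 0 \<and> frontier (strict_epigraph f) = {z. \<nu> \<bullet> z = d}" by metis
  then show ?thesis using c_eq ab by blast
qed

end
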